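(* Let $r\ge 1$. If $\Gamma\subset\mathbf{P}^r_k$ is a nondegenerate finite scheme of degree $2r+2$ over an algebraically closed field $k$, then the homogeneous coordinate ring $S_\Gamma$ is Gorenstein if and only if $\Gamma$ is self-associated and fails by $1$ to impose independent conditions on quadrics.
   Context: $\Gamma\subset\mathbf{P}^r=\mathbf{P}(V)$ (with $V$ the space of linear forms) is nondegenerate if it lies in no hyperplane. A finite $k$-scheme is Gorenstein if all of its local rings are. For a finite Gorenstein scheme $\Gamma$ with dualizing line bundle $K_\Gamma$, Serre duality gives a trace map $\mathrm{H}^0(K_\Gamma)\to k$ and, via multiplication, a perfect pairing $\mathrm{H}^0(\mathcal{O}_\Gamma(1))\otimes\mathrm{H}^0(K_\Gamma(-1))\to k$; let $V^\perp\subset\mathrm{H}^0(K_\Gamma(-1))$ be the annihilator of $V\subset\mathrm{H}^0(\mathcal{O}_\Gamma(1))$. $\Gamma$ is self-associated if it is Gorenstein and there is an isomorphism of $\mathcal{O}_\Gamma$-modules $\mathcal{O}_\Gamma(1)\to K_\Gamma(-1)$ carrying $V$ onto $V^\perp$. $\Gamma$ fails by $1$ to impose independent conditions on quadrics if the image of the restriction map from quadratic forms on $\mathbf{P}^r$ to $\mathrm{H}^0(\mathcal{O}_\Gamma(2))$ has codimension exactly $1$, i.e. dimension $2r+1$. *)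

theory Defs
  imports
    "HOL-Algebra.Algebraic_Closure_Type"
    "HOL-Algebra.Embedded_Algebras"
    "HOL-Algebra.QuotRing"
    "HOL-Algebra.Ring_Divisibility"
    "HOL-Algebra.Module"
    "HOL-Library.Poly_Mapping"
    "HOL-Library.Cardinality"
    "HOL-Library.FuncSet"
begin

section \<open>Modules, localization, products\<close>

text \<open>Only the additive group and the scalar multiplication of a module record matter; the
  \<open>mult\<close> and \<open>one\<close> fields, inherited from the ring record, are junk in what follows.\<close>

definition as_module :: "('a, 'b) ring_scheme \<Rightarrow> 'a set \<Rightarrow> ('a, 'a) module" where
  "as_module R E = \<lparr>carrier = E, monoid.mult = monoid.mult R, one = \<one>\<^bsub>R\<^esub>,
     ring.zero = \<zero>\<^bsub>R\<^esub>, add = add R, module.smult = monoid.mult R\<rparr>"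

definition module_hom ::
    "('a, 'r) ring_scheme \<Rightarrow> ('a, 'b, 'm) module_scheme \<Rightarrow> ('a, 'c, 'n) module_scheme \<Rightarrow> ('b \<Rightarrow> 'c) set"
  where
  "module_hom R M N = {f \<in> carrier M \<rightarrow>\<^sub>E carrier N.
     (\<forall>x\<in>carrier M. \<forall>y\<in>carrier M. f (x \<oplus>\<^bsub>M\<^esub> y) = f x \<oplus>\<^bsub>N\<^esub> f y) \<and>
     (\<forall>a\<in>carrier R. \<forall>x\<in>carrier M. f (a \<odot>\<^bsub>M\<^esub> x) = a \<odot>\<^bsub>N\<^esub> f x)}"

definition module_iso ::
    "('a, 'r) ring_scheme \<Rightarrow> ('a, 'b, 'm) module_scheme \<Rightarrow> ('a, 'c, 'n) module_scheme \<Rightarrow> ('b \<Rightarrow> 'c) set"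
  where
  "module_iso R M N = {f \<in> module_hom R M N. bij_betw f (carrier M) (carrier N)}"

definition Hom_module ::
    "('a, 'r) ring_scheme \<Rightarrow> ('a, 'b, 'm) module_scheme \<Rightarrow> ('a, 'c, 'n) module_scheme
      \<Rightarrow> ('a, 'b \<Rightarrow> 'c) module"
  where
  "Hom_module R M N = \<lparr>carrier = module_hom R M N, monoid.mult = undefined, one = undefined,
     ring.zero = (\<lambda>x\<in>carrier M. \<zero>\<^bsub>N\<^esub>), add = (\<lambda>f g. \<lambda>x\<in>carrier M. f x \<oplus>\<^bsub>N\<^esub> g x),
     module.smult = (\<lambda>a f. \<lambda>x\<in>carrier M. a \<odot>\<^bsub>N\<^esub> f x)\<rparr>"

definition loc_rel :: "('a, 'b) ring_scheme \<Rightarrow> 'a set \<Rightarrow> (('a \<times> 'a) \<times> ('a \<times> 'a)) set" where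
  "loc_rel R T = {((a, s), (b, t)). a \<in> carrier R \<and> b \<in> carrier R \<and> s \<in> T \<and> t \<in> T \<and>
     (\<exists>u\<in>T. u \<otimes>\<^bsub>R\<^esub> (a \<otimes>\<^bsub>R\<^esub> t) = u \<otimes>\<^bsub>R\<^esub> (b \<otimes>\<^bsub>R\<^esub> s))}"

definition fraction :: "('a, 'b) ring_scheme \<Rightarrow> 'a set \<Rightarrow> 'a \<Rightarrow> 'a \<Rightarrow> ('a \<times> 'a) set" where
  "fraction R T a s = loc_rel R T `` {(a, s)}"

definition localization :: "('a, 'b) ring_scheme \<Rightarrow> 'a set \<Rightarrow> (('a \<times> 'a) set) ring" where
  "localization R T = \<lparr>carrier = {fraction R T a s |a s. a \<in> carrier R \<and> s \<in> T},
     monoid.mult = (\<lambda>x y. \<Union>(a, s)\<in>x. \<Union>(b, t)\<in>y. fraction R T (a \<otimes>\<^bsub>R\<^esub> b) (s \<otimes>\<^bsub>R\<^esub> t)),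
     one = fraction R T \<one>\<^bsub>R\<^esub> \<one>\<^bsub>R\<^esub>,
     ring.zero = fraction R T \<zero>\<^bsub>R\<^esub> \<one>\<^bsub>R\<^esub>,
     add = (\<lambda>x y. \<Union>(a, s)\<in>x. \<Union>(b, t)\<in>y.
       fraction R T (a \<otimes>\<^bsub>R\<^esub> t \<oplus>\<^bsub>R\<^esub> b \<otimes>\<^bsub>R\<^esub> s) (s \<otimes>\<^bsub>R\<^esub> t))\<rparr>"

definition ring_product :: "'i set \<Rightarrow> ('i \<Rightarrow> ('a, 'b) ring_scheme) \<Rightarrow> ('i \<Rightarrow> 'a) ring" where
  "ring_product D R = \<lparr>carrier = (\<Pi>\<^sub>E i\<in>D. carrier (R i)),
     monoid.mult = (\<lambda>f g. \<lambda>i\<in>D. f i \<otimes>\<^bsub>R i\<^esub> g i), one = (\<lambda>i\<in>D. \<one>\<^bsub>R i\<^esub>),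
     ring.zero = (\<lambda>i\<in>D. \<zero>\<^bsub>R i\<^esub>), add = (\<lambda>f g. \<lambda>i\<in>D. f i \<oplus>\<^bsub>R i\<^esub> g i)\<rparr>"


section \<open>Gorenstein rings\<close>

text \<open>A Noetherian local ring is Gorenstein if it is Cohen--Macaulay and is its own canonical
  module: modulo some regular sequence in the maximal ideal it becomes a zero-dimensional ring that
  is injective as a module over itself (Eisenbud, Commutative Algebra, Chapter 21).\<close>

text \<open>Injectivity is tested on inclusions of ideals (Baer); HOL cannot quantify over modules on
  all types.\<close>

definition injective_module :: "('a, 'r) ring_scheme \<Rightarrow> ('a, 'b, 'm) module_scheme \<Rightarrow> bool" where
  "injective_module R M \<longleftrightarrow>
     (\<forall>J. ideal J R \<longrightarrow> (\<forall>f\<in>module_hom R (as_module R J) M.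
        \<exists>g\<in>module_hom R (as_module R (carrier R)) M. \<forall>x\<in>J. g x = f x))"

definition regular_sequence :: "('a, 'r) ring_scheme \<Rightarrow> 'a list \<Rightarrow> bool" where
  "regular_sequence R xs \<longleftrightarrow> set xs \<subseteq> carrier R \<and> genideal R (set xs) \<noteq> carrier R \<and>
     (\<forall>i<length xs. \<forall>a\<in>carrier R.
        xs ! i \<otimes>\<^bsub>R\<^esub> a \<in> genideal R (set (take i xs)) \<longrightarrow> a \<in> genideal R (set (take i xs)))"

definition local_cring :: "('a, 'r) ring_scheme \<Rightarrow> bool" where
  "local_cring R \<longleftrightarrow> cring R \<and> (\<exists>!M. maximalideal M R)"

definition gorenstein_local :: "('a, 'r) ring_scheme \<Rightarrow> bool" where
  "gorenstein_local R \<longleftrightarrow> local_cring R \<and> noetherian_ring R \<and>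
     (\<exists>xs. regular_sequence R xs \<and>
       (let Q = R Quot (genideal R (set xs)) in
          (\<forall>P. primeideal P Q \<longrightarrow> maximalideal P Q) \<and>
          injective_module Q (as_module Q (carrier Q))))"

definition gorenstein_ring :: "('a, 'r) ring_scheme \<Rightarrow> bool" where
  "gorenstein_ring R \<longleftrightarrow> cring R \<and> noetherian_ring R \<and>
     (\<forall>M. maximalideal M R \<longrightarrow> gorenstein_local (localization R (carrier R - M)))"


section \<open>Proj of a graded ring\<close>

text \<open>\<open>G n\<close> is the homogeneous part of degree \<open>n\<close> of \<open>R\<close>.\<close>

definition homogeneous_ideal :: "('a, 'r) ring_scheme \<Rightarrow> (nat \<Rightarrow> 'a set) \<Rightarrow> 'a set \<Rightarrow> bool" where
  "homogeneous_ideal R G J \<longleftrightarrow> ideal J R \<and> genideal R (J \<inter> (\<Union>n. G n)) = J"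

definition Proj :: "('a, 'r) ring_scheme \<Rightarrow> (nat \<Rightarrow> 'a set) \<Rightarrow> 'a set set" where
  "Proj R G = {P. primeideal P R \<and> homogeneous_ideal R G P \<and> \<not> (\<Union>n\<in>{1..}. G n) \<subseteq> P}"

definition homog_away :: "(nat \<Rightarrow> 'a set) \<Rightarrow> 'a set \<Rightarrow> 'a set" where
  "homog_away G P = (\<Union>n. G n) - P"

definition homog_loc :: "('a, 'r) ring_scheme \<Rightarrow> (nat \<Rightarrow> 'a set) \<Rightarrow> 'a set \<Rightarrow> (('a \<times> 'a) set) ring" where
  "homog_loc R G P = localization R (homog_away G P)"

text \<open>The stalk at \<open>P\<close> of \<open>\<O>(n)\<close>: the elements of degree \<open>n\<close> of the homogeneous localization.\<close>

definition twist_stalk ::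
    "('a, 'r) ring_scheme \<Rightarrow> (nat \<Rightarrow> 'a set) \<Rightarrow> int \<Rightarrow> 'a set \<Rightarrow> ('a \<times> 'a) set set" where
  "twist_stalk R G n P = {fraction R (homog_away G P) a f |a f d e.
     a \<in> G d \<and> f \<in> G e \<and> f \<notin> P \<and> int d - int e = n}"

definition local_ring_at ::
    "('a, 'r) ring_scheme \<Rightarrow> (nat \<Rightarrow> 'a set) \<Rightarrow> 'a set \<Rightarrow> (('a \<times> 'a) set) ring" where
  "local_ring_at R G P = (homog_loc R G P)\<lparr>carrier := twist_stalk R G 0 P\<rparr>"

text \<open>Global sections of \<open>\<O>(n)\<close>, as functions into the stalks that are, on a basic open
  neighbourhood \<open>D(g)\<close> of each point, given by a single fraction. They all live in one ring, the
  product of the homogeneous localizations; their multiplication is that of this ring.\<close>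

definition Proj_sections ::
    "('a, 'r) ring_scheme \<Rightarrow> (nat \<Rightarrow> 'a set) \<Rightarrow> int \<Rightarrow> ('a set \<Rightarrow> ('a \<times> 'a) set) set" where
  "Proj_sections R G n = {s \<in> (\<Pi>\<^sub>E P\<in>Proj R G. twist_stalk R G n P).
     \<forall>P\<in>Proj R G. \<exists>g\<in>homog_away G P. \<exists>d e. \<exists>a\<in>G d. \<exists>f\<in>G e. int d - int e = n \<and>
       (\<forall>Q\<in>Proj R G. g \<notin> Q \<longrightarrow> f \<notin> Q \<and> s Q = fraction R (homog_away G Q) a f)}"

definition stalk_product ::
    "('a, 'r) ring_scheme \<Rightarrow> (nat \<Rightarrow> 'a set) \<Rightarrow> ('a set \<Rightarrow> ('a \<times> 'a) set) ring" where
  "stalk_product R G = ring_product (Proj R G) (homog_loc R G)"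


section \<open>Closed subschemes of projective space\<close>

text \<open>Homogeneous coordinates are indexed by a finite type \<open>'n\<close> with \<open>r + 1\<close> elements. A closed
  subscheme is given by its saturated homogeneous ideal \<open>I\<close>; it is \<open>Proj\<close> of its
  homogeneous coordinate ring. The empty subscheme (\<open>I = UNIV\<close>) is included.\<close>

type_synonym ('n, 'k) mpoly = "('n \<Rightarrow>\<^sub>0 nat) \<Rightarrow>\<^sub>0 'k"
type_synonym ('n, 'k) coord = "('n, 'k) mpoly set"
type_synonym ('n, 'k) sect = "('n, 'k) coord set \<Rightarrow> (('n, 'k) coord \<times> ('n, 'k) coord) set"

abbreviation poly_ring :: "('n::finite, 'k::field) mpoly ring" where
  "poly_ring \<equiv> ring_of_type_algebra"

definition forms :: "nat \<Rightarrow> ('n::finite, 'k::field) mpoly set" where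
  "forms n = {F. \<forall>m\<in>Poly_Mapping.keys F. (\<Sum>i\<in>UNIV. Poly_Mapping.lookup m i) = n}"

definition saturated :: "('n::finite, 'k::field) mpoly set \<Rightarrow> bool" where
  "saturated I \<longleftrightarrow> (\<forall>F. (\<exists>N. \<forall>H\<in>forms N. H * F \<in> I) \<longrightarrow> F \<in> I)"

definition closed_subscheme :: "('n::finite, 'k::field) mpoly set \<Rightarrow> bool" where
  "closed_subscheme I \<longleftrightarrow> homogeneous_ideal poly_ring forms I \<and> saturated I"

definition coord_ring :: "('n::finite, 'k::field) mpoly set \<Rightarrow> ('n, 'k) coord ring" where
  "coord_ring I = poly_ring Quot I"

definition coord_grading :: "('n::finite, 'k::field) mpoly set \<Rightarrow> nat \<Rightarrow> ('n, 'k) coord set" where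
  "coord_grading I n = (\<lambda>F. I +>\<^bsub>poly_ring\<^esub> F) ` forms n"

definition points :: "('n::finite, 'k::field) mpoly set \<Rightarrow> ('n, 'k) coord set set" where
  "points I = Proj (coord_ring I) (coord_grading I)"

definition section_ambient :: "('n::finite, 'k::field) mpoly set \<Rightarrow> ('n, 'k) sect ring" where
  "section_ambient I = stalk_product (coord_ring I) (coord_grading I)"

definition H0 :: "('n::finite, 'k::field) mpoly set \<Rightarrow> int \<Rightarrow> ('n, 'k) sect set" where
  "H0 I n = Proj_sections (coord_ring I) (coord_grading I) n"

text \<open>The section of \<open>\<O>(n)\<close> on the subscheme defined by a form \<open>F\<close> of degree \<open>n\<close>.\<close>

definition restrict_form :: "('n::finite, 'k::field) mpoly set \<Rightarrow> ('n, 'k) mpoly \<Rightarrow> ('n, 'k) sect" where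
  "restrict_form I F = (\<lambda>P\<in>points I. fraction (coord_ring I) (homog_away (coord_grading I) P)
     (I +>\<^bsub>poly_ring\<^esub> F) \<one>\<^bsub>coord_ring I\<^esub>)"

definition const_section :: "('n::finite, 'k::field) mpoly set \<Rightarrow> 'k \<Rightarrow> ('n, 'k) sect" where
  "const_section I c = restrict_form I (Poly_Mapping.single 0 c)"

definition H0_dim :: "('n::finite, 'k::field) mpoly set \<Rightarrow> nat \<Rightarrow> ('n, 'k) sect set \<Rightarrow> bool" where
  "H0_dim I d E \<longleftrightarrow> ring.dimension (section_ambient I) d (range (const_section I)) E"

text \<open>For a scheme of finite type over a field, being finite over the field is the same as
  having finitely many points.\<close>

definition finite_scheme :: "('n::finite, 'k::field) mpoly set \<Rightarrow> bool" where
  "finite_scheme I \<longleftrightarrow> closed_subscheme I \<and> finite (points I)"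

definition has_degree :: "('n::finite, 'k::field) mpoly set \<Rightarrow> nat \<Rightarrow> bool" where
  "has_degree I d \<longleftrightarrow> H0_dim I d (H0 I 0)"

definition nondegenerate :: "('n::finite, 'k::field) mpoly set \<Rightarrow> bool" where
  "nondegenerate I \<longleftrightarrow> (\<forall>l\<in>forms 1. l \<noteq> 0 \<longrightarrow> l \<notin> I)"

definition gorenstein_scheme :: "('n::finite, 'k::field) mpoly set \<Rightarrow> bool" where
  "gorenstein_scheme I \<longleftrightarrow>
     (\<forall>P\<in>points I. gorenstein_local (local_ring_at (coord_ring I) (coord_grading I) P))"


section \<open>Duality and self-association\<close>

text \<open>A finite scheme is affine, so its quasi-coherent sheaves are treated as modules over
  \<open>A = H\<^sup>0(\<O>)\<close>. The dualizing module is \<open>H\<^sup>0(K) = Hom\<^sub>k(A, k)\<close>, with trace map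
  \<open>\<phi> \<mapsto> \<phi>(1)\<close>, and \<open>H\<^sup>0(K(-1)) = Hom\<^sub>A(H\<^sup>0(\<O>(1)), H\<^sup>0(K))\<close>.\<close>

definition structure_algebra :: "('n::finite, 'k::field) mpoly set \<Rightarrow> ('n, 'k) sect ring" where
  "structure_algebra I = (section_ambient I)\<lparr>carrier := H0 I 0\<rparr>"

definition twist_module ::
    "('n::finite, 'k::field) mpoly set \<Rightarrow> int \<Rightarrow> (('n, 'k) sect, ('n, 'k) sect) module" where
  "twist_module I n = as_module (section_ambient I) (H0 I n)"

definition dualizing_module ::
    "('n::finite, 'k::field) mpoly set \<Rightarrow> (('n, 'k) sect, ('n, 'k) sect \<Rightarrow> 'k) module" where
  "dualizing_module I = (let A = structure_algebra I in
     \<lparr>carrier = {\<phi> \<in> extensional (carrier A).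
        (\<forall>a\<in>carrier A. \<forall>b\<in>carrier A. \<phi> (a \<oplus>\<^bsub>A\<^esub> b) = \<phi> a + \<phi> b) \<and>
        (\<forall>c. \<forall>a\<in>carrier A. \<phi> (const_section I c \<otimes>\<^bsub>A\<^esub> a) = c * \<phi> a)},
      monoid.mult = undefined, one = undefined,
      ring.zero = (\<lambda>a\<in>carrier A. 0),
      add = (\<lambda>\<phi> \<psi>. \<lambda>a\<in>carrier A. \<phi> a + \<psi> a),
      module.smult = (\<lambda>b \<phi>. \<lambda>a\<in>carrier A. \<phi> (b \<otimes>\<^bsub>A\<^esub> a))\<rparr>)"

definition trace :: "('n::finite, 'k::field) mpoly set \<Rightarrow> (('n, 'k) sect \<Rightarrow> 'k) \<Rightarrow> 'k" where
  "trace I \<phi> = \<phi> \<one>\<^bsub>structure_algebra I\<^esub>"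

definition K_twist_minus_1 ::
    "('n::finite, 'k::field) mpoly set \<Rightarrow>
      (('n, 'k) sect, ('n, 'k) sect \<Rightarrow> ('n, 'k) sect \<Rightarrow> 'k) module" where
  "K_twist_minus_1 I = Hom_module (structure_algebra I) (twist_module I 1) (dualizing_module I)"

definition linear_sections :: "('n::finite, 'k::field) mpoly set \<Rightarrow> ('n, 'k) sect set" where
  "linear_sections I = restrict_form I ` forms 1"

definition linear_sections_perp ::
    "('n::finite, 'k::field) mpoly set \<Rightarrow> (('n, 'k) sect \<Rightarrow> ('n, 'k) sect \<Rightarrow> 'k) set" where
  "linear_sections_perp I =
     {\<psi> \<in> carrier (K_twist_minus_1 I). \<forall>v\<in>linear_sections I. trace I (\<psi> v) = 0}"

definition self_associated :: "('n::finite, 'k::field) mpoly set \<Rightarrow> bool" where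
  "self_associated I \<longleftrightarrow> gorenstein_scheme I \<and>
     (\<exists>h\<in>module_iso (structure_algebra I) (twist_module I 1) (K_twist_minus_1 I).
        h ` linear_sections I = linear_sections_perp I)"

definition fails_by_one_on_quadrics :: "('n::finite, 'k::field) mpoly set \<Rightarrow> bool" where
  "fails_by_one_on_quadrics I \<longleftrightarrow>
     (\<exists>d. H0_dim I (Suc d) (H0 I 2) \<and> H0_dim I d (restrict_form I ` forms 2))"

end

theory Submission
  imports Defs "HOL-Computational_Algebra.Polynomial"
begin

text \<open>Let \<open>S\<close> be the polynomial ring, \<open>R = S / I\<close> the homogeneous coordinate ring and \<open>A\<close> the ring of
functions on the finite scheme. As \<open>k\<close> is infinite, some linear form \<open>l\<close> vanishes at no point. It
trivializes all the sheaves \<open>\<O>(n)\<close>, and so identifies every \<open>H\<^sup>0(\<O>(n))\<close> with \<open>A = S / J\<close>, where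
\<open>J = I + (l - 1)\<close>. Dividing by powers of \<open>l\<close> turns the forms of degree \<open>n\<close> into a subspace \<open>W n\<close> of
\<open>A\<close>. These subspaces increase, satisfy \<open>W m W n \<subseteq> W (m + n)\<close> and exhaust \<open>A\<close>, and \<open>R\<close> is the Rees ring
\<open>\<Oplus> (W n) t\<^sup>n\<close> in which \<open>l\<close> is the variable \<open>t\<close>. Hence \<open>l\<close> is a nonzerodivisor on \<open>R\<close>, and \<open>R / (l)\<close> is the
Artinian graded ring \<open>\<Oplus> W n / W (n - 1)\<close>, while \<open>R / (l - c)\<close> is \<open>A\<close> for every nonzero constant \<open>c\<close>.

The hinge of the proof is a linear functional \<open>\<Phi>\<close> on \<open>A\<close> whose kernel contains no nonzero ideal and
which vanishes on \<open>W 2\<close>. After trivialization, an isomorphism from \<open>\<O>(1)\<close> to \<open>K(-1)\<close> is a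
generator \<open>\<Phi>\<close> of the dual of \<open>A\<close>, and the condition on \<open>V\<close> says that \<open>W 1\<close>, whose dimension is half
of that of \<open>A\<close>, is orthogonal to itself under \<open>\<Phi>(a b)\<close>; see \<open>dual_form_if_self_associated\<close> and
\<open>self_associated_if_dual_form\<close>. Functionals of this kind are also what makes Artinian quotients
Gorenstein: a finite-dimensional algebra with a functional whose kernel contains no nonzero ideal is
injective over itself (\<open>self_injective_if_functional\<close>). All the Artinian rings that occur are images
of \<open>S\<close>, so that the criterion is applied to functionals on \<open>S\<close> throughout.

If \<open>R\<close> is Gorenstein, then \<open>R / (l)\<close> has a one-dimensional socle, because the size of the socle
modulo a nonzerodivisor does not depend on the nonzerodivisor (\<open>gorenstein_socle_cyclic\<close>,
\<open>socle_one_dim\<close>). Let \<open>s\<close> be the first index with \<open>W s = A\<close>. The socle is then the top degree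
\<open>W s / W (s - 1)\<close>; let \<open>\<Phi>\<close> have kernel \<open>W (s - 1)\<close>. As lower degrees contain no socle, the orthogonal
of \<open>W n\<close> is \<open>W (s - 1 - n)\<close>. For \<open>n = 1\<close> this gives \<open>dim W (s - 2) = r + 1 = dim W 1\<close>, and since the
filtration grows strictly until it reaches \<open>A\<close>, only \<open>s = 3\<close> is possible. So \<open>\<Phi>\<close> vanishes on \<open>W 2\<close>,
which has codimension one (\<open>dual_form_if_gorenstein\<close>).

Conversely, if \<open>\<Phi>\<close> exists and \<open>W 2\<close> has codimension one, then \<open>W 2\<close> is the kernel of \<open>\<Phi>\<close>, its
orthogonal consists of the constants, \<open>W 1\<close> is its own orthogonal, and \<open>W 3 = A\<close>. Therefore no nonzero
ideal of \<open>R / (l)\<close> lies in the kernel of the functional that applies \<open>\<Phi>\<close> to the component of degree 3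
(\<open>irrelevant_functional\<close>), and \<open>R\<close> is Gorenstein at the irrelevant ideal. Every other maximal ideal
contains \<open>l - c\<close> for some nonzero \<open>c\<close> (\<open>maximal_ideals\<close>); rescaling \<open>l\<close> makes \<open>c = 1\<close>, and there
\<open>R / (l - 1) = A\<close> is Gorenstein by \<open>\<Phi>\<close> itself.\<close>

section \<open>Subspaces of finite codimension and functionals\<close>

locale linear_space = vector_space scale for scale :: "'k::field \<Rightarrow> 'b::ab_group_add \<Rightarrow> 'b"
begin

definition fin_codim :: "'b set \<Rightarrow> bool" where
  "fin_codim N \<longleftrightarrow> subspace N \<and> (\<exists>B. finite B \<and> span (N \<union> B) = UNIV)"

text \<open>A subspace \<open>N\<close> of finite codimension stands for the quotient by it. A complement \<open>C\<close> is kept explicitly: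
for a subspace \<open>U\<close> containing \<open>N\<close>, the dimension of the quotient of \<open>U\<close> by \<open>N\<close> is \<open>dim (U \<inter> C)\<close>.\<close>

definition fin_complement :: "'b set \<Rightarrow> 'b set \<Rightarrow> bool" where
  "fin_complement N C \<longleftrightarrow> subspace N \<and> (\<exists>B. finite B \<and> C = span B) \<and> N \<inter> C = {0} \<and>
     (\<forall>x. \<exists>c\<in>C. x - c \<in> N)"

definition functional :: "('b \<Rightarrow> 'k) \<Rightarrow> bool" where
  "functional f \<longleftrightarrow> (\<forall>x y. f (x + y) = f x + f y) \<and> (\<forall>c x. f (scale c x) = c * f x)"

lemma fin_codim_imp_complement:
  assumes "fin_codim N"
  shows "\<exists>C. fin_complement N C"
proof -
  have N: "subspace N" using assms by (simp add: fin_codim_def)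
  obtain B where B: "finite B" "span (N \<union> B) = UNIV" using assms by (auto simp: fin_codim_def)
  have "finite B \<Longrightarrow> \<exists>B0. finite B0 \<and> N \<inter> span B0 = {0} \<and> span (N \<union> B0) = span (N \<union> B)" for B
  proof (induction B rule: finite_induct)
    case empty
    show ?case using N by (intro exI[of _ "{}"]) (auto simp: subspace_0)
  next
    case (insert b B)
    then obtain B0 where B0: "finite B0" "N \<inter> span B0 = {0}" "span (N \<union> B0) = span (N \<union> B)" by blast
    have eq: "span (N \<union> insert b B0) = span (N \<union> insert b B)"
      by (simp add: span_insert B0(3))
    show ?case
    proof (cases "b \<in> span (N \<union> B0)")
      case True
      then have "span (N \<union> insert b B0) = span (N \<union> B0)" by (simp add: span_redundant)
      then show ?thesis using B0 eq by metis
    next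
      case False
      have "x = 0" if x: "x \<in> N" "x \<in> span (insert b B0)" for x
      proof -
        obtain k where k: "x - scale k b \<in> span B0" using x(2) by (auto simp: span_breakdown_eq)
        have "k = 0"
        proof (rule ccontr)
          assume "k \<noteq> 0"
          have "x \<in> span (N \<union> B0)" using x(1) by (simp add: span_base)
          moreover have "x - scale k b \<in> span (N \<union> B0)" using k span_mono[of B0 "N \<union> B0"] by blast
          ultimately have "x - (x - scale k b) \<in> span (N \<union> B0)" by (rule span_diff)
          then have "scale (inverse k) (scale k b) \<in> span (N \<union> B0)" using span_scale by force
          then show False using False \<open>k \<noteq> 0\<close> by simp
        qed
        then show "x = 0" using k x B0(2) by auto
      qed
      then show ?thesis using B0 eq N
        by (intro exI[of _ "insert b B0"]) (auto simp: subspace_0 span_zero)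
    qed
  qed
  from this[OF B(1)] obtain B0 where B0: "finite B0" "N \<inter> span B0 = {0}" "span (N \<union> B0) = UNIV"
    using B by blast
  have "\<exists>c\<in>span B0. x - c \<in> N" for x
  proof -
    have "x \<in> span (N \<union> B0)" using B0 by simp
    then obtain n c where "x = n + c" "n \<in> span N" "c \<in> span B0" by (auto simp: span_Un)
    then show ?thesis using N by (metis add_diff_cancel_right' span_eq_iff)
  qed
  then show ?thesis using B0 N unfolding fin_complement_def by blast
qed

lemma fin_complement_imp_codim:
  assumes "fin_complement N C" shows "fin_codim N"
proof -
  obtain B where B: "finite B" "C = span B" using assms by (auto simp: fin_complement_def)
  have "x \<in> span (N \<union> B)" for x
  proof -
    obtain c where "c \<in> C" "x - c \<in> N" using assms by (auto simp: fin_complement_def)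
    then have "(x - c) + c \<in> span (N \<union> B)"
      using B span_mono[of B "N \<union> B"] by (intro span_add) (auto intro: span_base)
    then show ?thesis by simp
  qed
  then show ?thesis using assms B unfolding fin_codim_def fin_complement_def by blast
qed

lemma dim_insert_finite:
  assumes B: "finite B" "U \<subseteq> span B" and v: "v \<notin> span U"
  shows "dim (span (insert v U)) = Suc (dim U)"
proof -
  obtain b where b: "b \<subseteq> U" "independent b" "U \<subseteq> span b" "card b = dim U" by (rule basis_exists)
  have fb: "finite b" using independent_span_bound[OF B(1) b(2)] b(1) B(2) by blast
  have sp: "span b = span U" using b by (metis span_eq span_mono span_base subset_antisym span_span)
  have "independent (insert v b)" using v b(2) sp by (intro independent_insertI) auto
  moreover have "span (insert v b) = span (insert v U)" using sp by (simp add: span_insert)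
  moreover have "v \<notin> b" using v b(1) by (auto simp: span_base)
  ultimately show ?thesis using dim_span_eq_card_independent[of "insert v b"] fb b(4) by simp
qed

lemma dim_mono_finite:
  assumes "finite B" "U \<subseteq> V" "V \<subseteq> span B"
  shows "dim U \<le> dim V"
proof -
  obtain b where b: "b \<subseteq> U" "independent b" "U \<subseteq> span b" "card b = dim U" by (rule basis_exists)
  obtain c where c: "c \<subseteq> V" "independent c" "V \<subseteq> span c" "card c = dim V" by (rule basis_exists)
  have "finite c" using independent_span_bound[OF assms(1) c(2)] c(1) assms by blast
  then show ?thesis using independent_span_bound[of c b] b c assms by auto
qed

context
  fixes N C
  assumes NC: "fin_complement N C"
begin

lemma complement_subspace: "subspace C"
  using NC by (auto simp: fin_complement_def)

lemma complement_int_subspace: "subspace U \<Longrightarrow> subspace (U \<inter> C)"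
  by (simp add: complement_subspace subspace_inter)

lemma rdim_zero: "dim (N \<inter> C) = 0"
  using NC by (metis fin_complement_def dim_span_eq_card_independent card.empty independent_empty span_empty)

lemma rdim_mono: "U \<subseteq> V \<Longrightarrow> dim (U \<inter> C) \<le> dim (V \<inter> C)"
proof -
  assume "U \<subseteq> V"
  obtain B where "finite B" "C = span B" using NC by (auto simp: fin_complement_def)
  then show ?thesis using dim_mono_finite[of B "U \<inter> C" "V \<inter> C"] \<open>U \<subseteq> V\<close> by blast
qed

text \<open>The component of \<open>v\<close> in \<open>C\<close> enlarges \<open>U \<inter> C\<close> exactly as \<open>v\<close> enlarges \<open>U\<close>. All dimension counts modulo \<open>N\<close>
reduce to this step.\<close>

lemma rdim_insert:
  assumes U: "subspace U" "N \<subseteq> U" and v: "v \<notin> U"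
  shows "dim (span (insert v U) \<inter> C) = Suc (dim (U \<inter> C))"
proof -
  obtain c where c: "c \<in> C" "v - c \<in> N" using NC by (auto simp: fin_complement_def)
  have cX: "c \<notin> U"
  proof
    assume "c \<in> U"
    then have "(v - c) + c \<in> U" using c U by (intro subspace_add) auto
    then show False using v by simp
  qed
  have "span (insert v U) \<inter> C = span (insert c (U \<inter> C))"
  proof (intro equalityI subsetI)
    fix x assume x: "x \<in> span (insert v U) \<inter> C"
    then obtain k where "x - scale k v \<in> span U" by (auto simp: span_breakdown_eq)
    then have "x - scale k v \<in> U" using U span_eq_iff by metis
    moreover have "scale k (v - c) \<in> U" using U c by (auto intro: subspace_scale)
    ultimately have "(x - scale k v) + scale k (v - c) \<in> U" using U by (auto intro: subspace_add)
    then have "x - scale k c \<in> U" by (simp add: scale_right_diff_distrib)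
    moreover have "x - scale k c \<in> C"
      using x c complement_subspace by (auto intro: subspace_diff subspace_scale)
    ultimately have "x - scale k c \<in> span (U \<inter> C)" by (auto intro: span_base)
    then show "x \<in> span (insert c (U \<inter> C))" by (auto simp: span_breakdown_eq)
  next
    fix x assume x: "x \<in> span (insert c (U \<inter> C))"
    then obtain k where "x - scale k c \<in> span (U \<inter> C)" by (auto simp: span_breakdown_eq)
    then have k: "x - scale k c \<in> U \<inter> C" using complement_int_subspace[OF U(1)] span_eq_iff by metis
    moreover have "scale k (v - c) \<in> U" using U c by (auto intro: subspace_scale)
    ultimately have "(x - scale k c) - scale k (v - c) \<in> U" using k U(1) subspace_diff by blast
    then have "x - scale k v \<in> span U" by (simp add: scale_right_diff_distrib span_base)
    then have "x \<in> span (insert v U)" by (auto simp: span_breakdown_eq)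
    moreover have "(x - scale k c) + scale k c \<in> C" using k c complement_subspace by (intro subspace_add subspace_scale) auto
    ultimately show "x \<in> span (insert v U) \<inter> C" by simp
  qed
  moreover have "c \<notin> span (U \<inter> C)" using cX complement_int_subspace[OF U(1)] span_eq_iff by (metis IntD1)
  moreover obtain B where "finite B" "C = span B" using NC by (auto simp: fin_complement_def)
  ultimately show ?thesis using dim_insert_finite[of B "U \<inter> C" c] by auto
qed

lemma rdim_strict:
  assumes "subspace U" "subspace V" "N \<subseteq> U" "U \<subset> V"
  shows "dim (U \<inter> C) < dim (V \<inter> C)"
proof -
  obtain v where v: "v \<in> V" "v \<notin> U" using assms by auto
  have "span (insert v U) \<subseteq> V" using assms v by (intro span_minimal) auto
  from rdim_mono[OF this] rdim_insert[OF assms(1,3) v(2)] show ?thesis by simp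
qed

lemma rdim_eq:
  assumes "subspace U" "subspace V" "N \<subseteq> U" "U \<subseteq> V" "dim (V \<inter> C) \<le> dim (U \<inter> C)"
  shows "U = V"
  using rdim_strict[of U V] assms by fastforce

lemma rdim_eq_zeroD:
  assumes "subspace U" "N \<subseteq> U" "dim (U \<inter> C) = 0" shows "U = N"
  using rdim_eq[of N U] assms NC rdim_zero by (auto simp: fin_complement_def)

end

lemma functional_add: "functional f \<Longrightarrow> f (x + y) = f x + f y"
  and functional_scale: "functional f \<Longrightarrow> f (scale c x) = c * f x"
  by (auto simp: functional_def)

lemma functional_zero: "functional f \<Longrightarrow> f 0 = 0"
  using functional_scale[of f 0 0] by simp

lemma functional_diff: "functional f \<Longrightarrow> f (x - y) = f x - f y"
  using functional_add[of f "x - y" y] by simp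

lemma functional_sum: "functional f \<Longrightarrow> f (sum g A) = (\<Sum>a\<in>A. f (g a))"
  by (induction A rule: infinite_finite_induct) (auto simp: functional_zero functional_add)

text \<open>Induction on the number of functionals: where \<open>u a\<close> does not already vanish on the common kernel of
the others, subtracting a multiple of it from \<open>\<psi>\<close> brings \<open>\<psi>\<close> to the induction hypothesis.\<close>

lemma functional_in_span_if_kernel:
  assumes "finite A" "\<And>i. i \<in> A \<Longrightarrow> functional (u i)" "functional \<psi>"
    and "\<And>x. (\<And>i. i \<in> A \<Longrightarrow> u i x = 0) \<Longrightarrow> \<psi> x = 0"
  shows "\<exists>c. \<forall>x. \<psi> x = (\<Sum>i\<in>A. c i * u i x)"
  using assms
proof (induction A arbitrary: \<psi> rule: finite_induct)
  case empty
  then show ?case by auto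
next
  case (insert a A)
  show ?case
  proof (cases "\<forall>x. (\<forall>i\<in>A. u i x = 0) \<longrightarrow> u a x = 0")
    case True
    then have "\<exists>c. \<forall>x. \<psi> x = (\<Sum>i\<in>A. c i * u i x)" using insert.prems by (intro insert.IH) auto
    then obtain c where c: "\<And>x. \<psi> x = (\<Sum>i\<in>A. c i * u i x)" by blast
    have "\<psi> x = (\<Sum>i\<in>insert a A. (c(a := 0)) i * u i x)" for x
      using insert.hyps by (simp add: c) (rule sum.cong, auto)
    then show ?thesis by blast
  next
    case False
    then obtain x0 where x0: "\<And>i. i \<in> A \<Longrightarrow> u i x0 = 0" "u a x0 \<noteq> 0" by blast
    define d where "d = \<psi> x0 / u a x0"
    define \<psi>' where "\<psi>' x = \<psi> x - d * u a x" for x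
    have "\<exists>c. \<forall>x. \<psi>' x = (\<Sum>i\<in>A. c i * u i x)"
    proof (rule insert.IH)
      show "functional \<psi>'" using insert.prems(1,2)
        by (auto simp: functional_def \<psi>'_def algebra_simps)
      show "\<psi>' x = 0" if x: "\<And>i. i \<in> A \<Longrightarrow> u i x = 0" for x
      proof -
        define y where "y = x - scale (u a x / u a x0) x0"
        have "\<psi> y = 0"
          using x x0 insert.prems(1) by (intro insert.prems(3)) (auto simp: y_def functional_diff functional_scale)
        then show ?thesis using insert.prems(2)
          by (simp add: y_def \<psi>'_def d_def functional_diff functional_scale)
      qed
    qed (use insert.prems in auto)
    then obtain c where c: "\<And>x. \<psi>' x = (\<Sum>i\<in>A. c i * u i x)" by blast
    have "\<psi> x = (\<Sum>i\<in>insert a A. (c(a := d)) i * u i x)" for x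
    proof -
      have "(\<Sum>i\<in>A. (c(a := d)) i * u i x) = (\<Sum>i\<in>A. c i * u i x)"
        using insert.hyps by (intro sum.cong) auto
      then show ?thesis using insert.hyps c[of x] by (simp add: \<psi>'_def diff_eq_eq add.commute)
    qed
    then show ?thesis by blast
  qed
qed

lemma functional_extend:
  assumes U: "subspace U" and add: "\<And>x y. x \<in> U \<Longrightarrow> y \<in> U \<Longrightarrow> f (x + y) = f x + f y"
    and scl: "\<And>c x. x \<in> U \<Longrightarrow> f (scale c x) = c * f x"
  shows "\<exists>g. functional g \<and> (\<forall>x\<in>U. g x = f x)"
proof -
  interpret vp: vector_space_pair scale "(*) :: 'k \<Rightarrow> 'k \<Rightarrow> 'k"
    by unfold_locales (auto simp: algebra_simps)
  obtain B where B: "B \<subseteq> U" "independent B" "U \<subseteq> span B" by (meson maximal_independent_subset)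
  obtain g where g: "Vector_Spaces.linear scale (*) g" "\<And>x. x \<in> B \<Longrightarrow> g x = f x"
    using vp.linear_independent_extend[OF B(2)] by blast
  have fg: "functional g" unfolding functional_def using g(1)
    by (simp add: vp.linear_add vp.linear_scale)
  have f0: "f 0 = 0" using scl[of 0 0] U by (simp add: subspace_0)
  have "x \<in> U \<and> g x = f x" if "x \<in> span B" for x
    using that
  proof (induction rule: span_induct_alt)
    case base
    then show ?case using U f0 fg by (simp add: functional_zero subspace_0)
  next
    case (step c x y)
    then show ?case using B U g(2) fg
      by (auto simp: functional_add functional_scale add scl subspace_add subspace_scale subsetD)
  qed
  then show ?thesis using fg B(3) by blast
qed

lemma functional_separating:
  assumes U: "subspace U" and v: "v \<notin> U"
  shows "\<exists>g. functional g \<and> (\<forall>x\<in>U. g x = 0) \<and> g v = 1"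
proof -
  interpret vp: vector_space_pair scale "(*) :: 'k \<Rightarrow> 'k \<Rightarrow> 'k"
    by unfold_locales (auto simp: algebra_simps)
  obtain B where B: "B \<subseteq> U" "independent B" "U \<subseteq> span B" by (meson maximal_independent_subset)
  have vB: "v \<notin> span B" using v B U by (metis span_minimal subsetD)
  then have ind: "independent (insert v B)" using B by (simp add: independent_insertI)
  obtain g where g: "Vector_Spaces.linear scale (*) g" "\<And>x. x \<in> insert v B \<Longrightarrow> g x = (if x = v then 1 else 0)"
    using vp.linear_independent_extend[OF ind, of "\<lambda>x. if x = v then 1 else 0"] by blast
  have fg: "functional g" unfolding functional_def using g(1)
    by (simp add: vp.linear_add vp.linear_scale)
  have "g x = 0" if "x \<in> span B" for x
    using that
  proof (induction rule: span_induct_alt)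
    case base
    then show ?case using fg by (simp add: functional_zero)
  next
    case (step c x y)
    then have "g x = 0" using g(2)[of x] vB by (auto simp: span_base)
    then show ?case using step fg by (simp add: functional_add functional_scale)
  qed
  then show ?thesis using fg B g(2)[of v] by auto
qed

end

section \<open>Ideals and functionals in a commutative algebra\<close>

text \<open>Ideals of a ring that is a whole type. Polynomial arithmetic stays in the type, and the ring records
only appear where the statement mentions them.\<close>

definition ideal_set :: "'a::comm_ring_1 set \<Rightarrow> bool" where
  "ideal_set K \<longleftrightarrow> 0 \<in> K \<and> (\<forall>a\<in>K. \<forall>b\<in>K. a + b \<in> K) \<and> (\<forall>a\<in>K. \<forall>x. x * a \<in> K)"

lemma ideal_set_zero: "ideal_set K \<Longrightarrow> 0 \<in> K"
  and ideal_set_add: "ideal_set K \<Longrightarrow> a \<in> K \<Longrightarrow> b \<in> K \<Longrightarrow> a + b \<in> K"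
  and ideal_set_mult: "ideal_set K \<Longrightarrow> a \<in> K \<Longrightarrow> x * a \<in> K"
  by (auto simp: ideal_set_def)

lemma ideal_set_mult2: "ideal_set K \<Longrightarrow> a \<in> K \<Longrightarrow> a * x \<in> K"
  using ideal_set_mult[of K a x] by (simp add: mult.commute)

lemma ideal_set_uminus: "ideal_set K \<Longrightarrow> a \<in> K \<Longrightarrow> - a \<in> K"
  using ideal_set_mult[of K a "-1"] by simp

lemma ideal_set_diff: "ideal_set K \<Longrightarrow> a \<in> K \<Longrightarrow> b \<in> K \<Longrightarrow> a - b \<in> K"
  using ideal_set_add[of K a "- b"] ideal_set_uminus[of K b] by simp

lemma ideal_set_sum: "ideal_set K \<Longrightarrow> (\<And>i. i \<in> A \<Longrightarrow> f i \<in> K) \<Longrightarrow> sum f A \<in> K"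
  by (induction A rule: infinite_finite_induct) (auto simp: ideal_set_zero ideal_set_add)

lemma ideal_set_add_mem_iff: "ideal_set K \<Longrightarrow> a - b \<in> K \<Longrightarrow> a \<in> K \<longleftrightarrow> b \<in> K"
  using ideal_set_diff[of K a "a - b"] ideal_set_add[of K "a - b" b] by auto

lemma ideal_set_colon: "ideal_set K \<Longrightarrow> ideal_set {a. a * b \<in> K}"
  by (auto simp: ideal_set_def algebra_simps)

lemma ideal_set_plus_principal:
  assumes "ideal_set K" shows "ideal_set {a. \<exists>x. a - x * b \<in> K}"
  unfolding ideal_set_def
proof (intro conjI ballI allI)
  show "0 \<in> {a. \<exists>x. a - x * b \<in> K}" using assms by (auto intro: exI[of _ 0] simp: ideal_set_zero)
next
  fix a a' assume "a \<in> {a. \<exists>x. a - x * b \<in> K}" "a' \<in> {a. \<exists>x. a - x * b \<in> K}"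
  then obtain x x' where "a - x * b \<in> K" "a' - x' * b \<in> K" by blast
  then have "(a - x * b) + (a' - x' * b) \<in> K" by (rule ideal_set_add[OF assms])
  then have "(a + a') - (x + x') * b \<in> K" by (simp add: algebra_simps)
  then show "a + a' \<in> {a. \<exists>x. a - x * b \<in> K}" by blast
next
  fix a y assume "a \<in> {a. \<exists>x. a - x * b \<in> K}"
  then obtain x where "a - x * b \<in> K" by blast
  then have "y * (a - x * b) \<in> K" by (rule ideal_set_mult[OF assms])
  then have "y * a - (y * x) * b \<in> K" by (simp add: algebra_simps)
  then show "y * a \<in> {a. \<exists>x. a - x * b \<in> K}" by blast
qed

abbreviation type_ring :: "'a::comm_ring_1 ring" where
  "type_ring \<equiv> ring_of_type_algebra"

lemma type_ring_simps [simp]: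
  "carrier type_ring = UNIV" "a \<otimes>\<^bsub>type_ring\<^esub> b = a * b" "a \<oplus>\<^bsub>type_ring\<^esub> b = a + b"
  "\<one>\<^bsub>type_ring\<^esub> = 1" "\<zero>\<^bsub>type_ring\<^esub> = 0"
  by (auto simp: ring_of_type_algebra_def)

lemma type_ring_cring: "cring type_ring"
  by (rule cring_from_type_algebra)

lemma type_ring_uminus [simp]: "\<ominus>\<^bsub>type_ring\<^esub> a = - (a :: 'a::comm_ring_1)"
proof -
  interpret cring "type_ring :: 'a ring" by (rule type_ring_cring)
  show ?thesis using minus_equality[of "- a" a] by simp
qed

lemma ideal_type_ring_iff: "ideal K type_ring \<longleftrightarrow> ideal_set K"
proof
  assume "ideal K type_ring"
  then interpret ideal K type_ring .
  show "ideal_set K" unfolding ideal_set_def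
    using additive_subgroup.zero_closed[OF is_additive_subgroup]
      additive_subgroup.a_closed[OF is_additive_subgroup] I_l_closed by simp
next
  assume K: "ideal_set K"
  interpret cring "type_ring :: 'a ring" by (rule type_ring_cring)
  have neg: "inv\<^bsub>add_monoid type_ring\<^esub> a = - a" for a :: 'a
    using type_ring_uminus[of a] by (simp add: a_inv_def)
  show "ideal K type_ring"
  proof (rule idealI)
    show "ring (type_ring :: 'a ring)" by (rule ring_axioms)
    show "subgroup K (add_monoid type_ring)"
      by (rule group.subgroupI[OF a_group])
         (use K ideal_set_zero[OF K] in \<open>auto simp: neg[simplified] ideal_set_add ideal_set_uminus\<close>)
  qed (use K in \<open>auto simp: ideal_set_mult ideal_set_mult2\<close>)
qed

locale comm_algebra = linear_space scale
  for scale :: "'k::field \<Rightarrow> 'a::comm_ring_1 \<Rightarrow> 'a" +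
  assumes scale_mult: "scale c x * y = scale c (x * y)"
begin

lemma mult_scale: "x * scale c y = scale c (x * y)"
  using scale_mult[of c y x] by (simp add: mult.commute)

lemma ideal_set_subspace: "ideal_set K \<Longrightarrow> subspace K"
proof (rule subspaceI)
  fix c x assume "ideal_set K" "x \<in> K"
  then have "scale c 1 * x \<in> K" by (rule ideal_set_mult)
  then show "scale c x \<in> K" by (simp add: scale_mult)
qed (auto simp: ideal_set_zero ideal_set_add)

lemma ideal_set_scale: "ideal_set K \<Longrightarrow> x \<in> K \<Longrightarrow> scale c x \<in> K"
  using ideal_set_subspace subspace_scale by blast

text \<open>The orthogonal of \<open>U\<close> under the symmetric bilinear form \<open>\<Phi>(x y)\<close>. In particular \<open>perp \<Phi> UNIV\<close> is the
largest ideal in the kernel of \<open>\<Phi>\<close>: the form is nondegenerate on the quotient by it.\<close>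

definition perp :: "('a \<Rightarrow> 'k) \<Rightarrow> 'a set \<Rightarrow> 'a set" where
  "perp \<Phi> U = {x. \<forall>y\<in>U. \<Phi> (x * y) = 0}"

lemma perp_subspace:
  assumes "functional \<Phi>" shows "subspace (perp \<Phi> U)"
  by (rule subspaceI)
     (use assms in \<open>auto simp: perp_def functional_zero distrib_right functional_add scale_mult functional_scale\<close>)

lemma perp_UNIV_ideal:
  assumes "functional \<Phi>" shows "ideal_set (perp \<Phi> UNIV)"
proof -
  have "\<Phi> (x * a * y) = 0" if "\<And>y. \<Phi> (a * y) = 0" for x a y
    using that[of "x * y"] by (simp add: ac_simps)
  then show ?thesis unfolding ideal_set_def perp_def using assms
    by (auto simp: functional_zero distrib_right functional_add)
qed

lemma functional_perp_UNIV: "x \<in> perp \<Phi> UNIV \<Longrightarrow> \<Phi> x = 0"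
  unfolding perp_def by (auto dest: spec[of _ 1])

lemma perp_anti: "U \<subseteq> V \<Longrightarrow> perp \<Phi> V \<subseteq> perp \<Phi> U"
  by (auto simp: perp_def)

text \<open>The functionals \<open>\<Phi>(b x)\<close>, for \<open>b\<close> in a finite set spanning modulo the radical of the form, have the
radical as their common kernel, so they span all functionals that vanish on it.\<close>

lemma functional_represented:
  assumes \<Phi>: "functional \<Phi>" and N: "fin_codim (perp \<Phi> UNIV)"
    and \<psi>: "functional \<psi>" "\<And>x. x \<in> perp \<Phi> UNIV \<Longrightarrow> \<psi> x = 0"
  shows "\<exists>g. \<forall>x. \<psi> x = \<Phi> (g * x)"
proof -
  obtain B where B: "finite B" "span (perp \<Phi> UNIV \<union> B) = UNIV" using N by (auto simp: fin_codim_def)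
  have "\<exists>c. \<forall>x. \<psi> x = (\<Sum>b\<in>B. c b * \<Phi> (b * x))"
  proof (rule functional_in_span_if_kernel[OF B(1) _ \<psi>(1)])
    show "functional (\<lambda>x. \<Phi> (b * x))" for b
      using \<Phi> by (auto simp: functional_def distrib_left mult_scale)
    fix x assume x: "\<And>b. b \<in> B \<Longrightarrow> \<Phi> (b * x) = 0"
    have "perp \<Phi> UNIV \<union> B \<subseteq> {y. \<Phi> (y * x) = 0}" using x by (auto simp: perp_def)
    moreover have "subspace {y. \<Phi> (y * x) = 0}"
      by (rule subspaceI) (use \<Phi> in \<open>auto simp: functional_zero distrib_right functional_add scale_mult functional_scale\<close>)
    ultimately have "span (perp \<Phi> UNIV \<union> B) \<subseteq> {y. \<Phi> (y * x) = 0}" by (rule span_minimal)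
    then have "x \<in> perp \<Phi> UNIV" using B(2) by (auto simp: perp_def mult.commute)
    then show "\<psi> x = 0" by (rule \<psi>(2))
  qed
  then obtain c where c: "\<And>x. \<psi> x = (\<Sum>b\<in>B. c b * \<Phi> (b * x))" by blast
  have "\<psi> x = \<Phi> ((\<Sum>b\<in>B. scale (c b) b) * x)" for x
    using \<Phi> by (simp add: c sum_distrib_right functional_sum scale_mult functional_scale)
  then show ?thesis by blast
qed

lemma perp_separating:
  assumes \<Phi>: "functional \<Phi>" and N: "fin_codim (perp \<Phi> UNIV)"
    and U: "subspace U" "perp \<Phi> UNIV \<subseteq> U" "v \<notin> U"
  shows "\<exists>g\<in>perp \<Phi> U. \<Phi> (g * v) = 1"
proof -
  obtain \<psi> where \<psi>: "functional \<psi>" "\<forall>x\<in>U. \<psi> x = 0" "\<psi> v = 1"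
    using functional_separating[OF U(1,3)] by blast
  obtain g where g: "\<And>x. \<psi> x = \<Phi> (g * x)"
    using functional_represented[OF \<Phi> N \<psi>(1)] \<psi>(2) U(2) by blast
  show ?thesis using g \<psi> by (intro bexI[of _ g]) (auto simp: perp_def)
qed

lemma perp_perp:
  assumes \<Phi>: "functional \<Phi>" and N: "fin_codim (perp \<Phi> UNIV)"
    and U: "subspace U" "perp \<Phi> UNIV \<subseteq> U"
  shows "perp \<Phi> (perp \<Phi> U) = U"
proof
  show "U \<subseteq> perp \<Phi> (perp \<Phi> U)" by (auto simp: perp_def mult.commute)
  show "perp \<Phi> (perp \<Phi> U) \<subseteq> U"
  proof
    fix v assume v: "v \<in> perp \<Phi> (perp \<Phi> U)"
    show "v \<in> U"
    proof (rule ccontr)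
      assume "v \<notin> U"
      then obtain g where "g \<in> perp \<Phi> U" "\<Phi> (g * v) = 1" using perp_separating[OF \<Phi> N U] by blast
      then show False using v by (auto simp: perp_def mult.commute)
    qed
  qed
qed

text \<open>Adding one vector \<open>v\<close> to \<open>U\<close> cuts the orthogonal down by the single condition \<open>\<Phi>(x v) = 0\<close>, and this is
a proper condition because \<open>v\<close> can be separated from \<open>U\<close> by an element.\<close>

lemma perp_dim:
  assumes \<Phi>: "functional \<Phi>" and C: "fin_complement (perp \<Phi> UNIV) C"
    and U: "subspace U" "perp \<Phi> UNIV \<subseteq> U"
  shows "dim (U \<inter> C) + dim (perp \<Phi> U \<inter> C) = dim C"
  using U
proof (induction "dim (U \<inter> C)" arbitrary: U)
  case 0
  then have "U = perp \<Phi> UNIV" using rdim_eq_zeroD[OF C] by simp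
  moreover have "perp \<Phi> (perp \<Phi> UNIV) = UNIV"
    using perp_perp[OF \<Phi> fin_complement_imp_codim[OF C], of UNIV] by simp
  ultimately show ?case using rdim_zero[OF C] by simp
next
  case (Suc n)
  let ?N = "perp \<Phi> UNIV"
  note N = fin_complement_imp_codim[OF C]
  have NI: "ideal_set ?N" by (rule perp_UNIV_ideal[OF \<Phi>])
  have "subspace (U \<inter> C)" by (rule complement_int_subspace[OF C Suc.prems(1)])
  obtain b where b: "b \<subseteq> U \<inter> C" "independent b" "U \<inter> C \<subseteq> span b" "card b = dim (U \<inter> C)"
    by (rule basis_exists)
  have "b \<noteq> {}" using b(4) Suc.hyps(2) by auto
  then obtain v where v: "v \<in> b" by blast
  define U' where "U' = {x. \<exists>y\<in>span (b - {v}). x - y \<in> ?N}"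
  have U': "subspace U'" unfolding U'_def
  proof (rule subspaceI)
    show "0 \<in> {x. \<exists>y\<in>span (b - {v}). x - y \<in> ?N}"
      using NI by (auto intro!: bexI[of _ 0] simp: span_zero ideal_set_zero)
    fix x y assume "x \<in> {x. \<exists>y\<in>span (b - {v}). x - y \<in> ?N}" "y \<in> {x. \<exists>y\<in>span (b - {v}). x - y \<in> ?N}"
    then obtain x' y' where "x' \<in> span (b - {v})" "y' \<in> span (b - {v})" "x - x' \<in> ?N" "y - y' \<in> ?N" by blast
    then have "x' + y' \<in> span (b - {v}) \<and> (x + y) - (x' + y') \<in> ?N"
      using ideal_set_add[OF NI, of "x - x'" "y - y'"] by (auto simp: span_add algebra_simps)
    then show "x + y \<in> {x. \<exists>y\<in>span (b - {v}). x - y \<in> ?N}" by blast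
  next
    fix x c assume "x \<in> {x. \<exists>y\<in>span (b - {v}). x - y \<in> ?N}"
    then obtain x' where "x' \<in> span (b - {v})" "x - x' \<in> ?N" by blast
    then have "scale c x' \<in> span (b - {v}) \<and> scale c x - scale c x' \<in> ?N"
      using ideal_set_scale[OF NI, of "x - x'" c] by (auto simp: span_scale scale_right_diff_distrib)
    then show "scale c x \<in> {x. \<exists>y\<in>span (b - {v}). x - y \<in> ?N}" by blast
  qed
  have NU': "?N \<subseteq> U'" by (auto simp: U'_def intro!: bexI[of _ 0] span_zero)
  have vb: "v \<notin> span (b - {v})" using b(2) v by (auto simp: dependent_def)
  have spC: "span b \<subseteq> U \<inter> C" using b(1) \<open>subspace (U \<inter> C)\<close> by (rule span_minimal)
  have vU': "v \<notin> U'"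
  proof
    assume "v \<in> U'"
    then obtain y where y: "y \<in> span (b - {v})" "v - y \<in> ?N" by (auto simp: U'_def)
    have "y \<in> span b" using y(1) span_mono[of "b - {v}" b] by blast
    then have "v - y \<in> span b" using v span_diff[OF span_base] by blast
    then have "v - y \<in> ?N \<inter> C" using y(2) spC by blast
    then have "v - y \<in> {0}" using C unfolding fin_complement_def by blast
    then have "v = y" by simp
    then show False using y(1) vb by simp
  qed
  have Ueq: "span (insert v U') = U"
  proof
    have "U' \<subseteq> U"
    proof
      fix x assume "x \<in> U'"
      then obtain y where y: "y \<in> span (b - {v})" "x - y \<in> ?N" by (auto simp: U'_def)
      have "y \<in> U" using y(1) span_mono[of "b - {v}" b] spC by blast
      then have "(x - y) + y \<in> U" using y(2) Suc.prems by (intro subspace_add) auto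
      then show "x \<in> U" by simp
    qed
    then show "span (insert v U') \<subseteq> U" using v b(1) Suc.prems(1) by (intro span_minimal) auto
    show "U \<subseteq> span (insert v U')"
    proof
      fix x assume x: "x \<in> U"
      obtain c where c: "c \<in> C" "x - c \<in> ?N" using C by (auto simp: fin_complement_def)
      have "x - (x - c) \<in> U" using x c(2) Suc.prems subspace_diff by blast
      then have "c \<in> span (insert v (b - {v}))" using c(1) b(3) v by (auto simp: insert_absorb)
      then obtain k where k: "c - scale k v \<in> span (b - {v})" unfolding span_breakdown_eq by blast
      have "x - scale k v \<in> U'" unfolding U'_def using k c(2) by (auto intro!: bexI[OF _ k])
      then have "x - scale k v \<in> span U'" by (rule span_base)
      then show "x \<in> span (insert v U')" unfolding span_breakdown_eq by blast
    qed
  qed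
  have d: "dim (U \<inter> C) = Suc (dim (U' \<inter> C))" using rdim_insert[OF C U' NU' vU'] Ueq by simp
  then have IH: "dim (U' \<inter> C) + dim (perp \<Phi> U' \<inter> C) = dim C"
    using Suc.hyps U' NU' by simp
  obtain g where g: "g \<in> perp \<Phi> U'" "\<Phi> (g * v) = 1" using perp_separating[OF \<Phi> N U' NU' vU'] by blast
  have "v \<in> U" using v b(1) by blast
  then have gU: "g \<notin> perp \<Phi> U" using g(2) by (auto simp: perp_def intro!: bexI[of _ v])
  have "span (insert g (perp \<Phi> U)) = perp \<Phi> U'"
  proof
    have "perp \<Phi> U \<subseteq> perp \<Phi> U'" using Ueq by (intro perp_anti) (auto intro: span_base)
    then show "span (insert g (perp \<Phi> U)) \<subseteq> perp \<Phi> U'"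
      using g(1) perp_subspace[OF \<Phi>] by (intro span_minimal) auto
    show "perp \<Phi> U' \<subseteq> span (insert g (perp \<Phi> U))"
    proof
      fix x assume x: "x \<in> perp \<Phi> U'"
      define z where "z = x - scale (\<Phi> (x * v)) g"
      have zU': "z \<in> perp \<Phi> U'" unfolding z_def
        using x g(1) perp_subspace[OF \<Phi>] by (auto intro!: subspace_diff subspace_scale)
      have "\<Phi> (z * v) = 0" unfolding z_def using \<Phi> g(2)
        by (simp add: left_diff_distrib functional_diff scale_mult functional_scale)
      have "\<Phi> (z * y) = 0" if "y \<in> U" for y
      proof -
        have "y \<in> span (insert v U')" using that Ueq by simp
        then obtain k where "y - scale k v \<in> span U'" by (auto simp: span_breakdown_eq)
        then have k: "y - scale k v \<in> U'" using U' span_eq_iff by blast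
        then have "\<Phi> (z * (y - scale k v)) = 0" using zU' by (auto simp: perp_def)
        then show ?thesis using \<Phi> \<open>\<Phi> (z * v) = 0\<close>
          by (simp add: right_diff_distrib functional_diff mult_scale functional_scale)
      qed
      then have "z \<in> span (perp \<Phi> U)" by (auto simp: perp_def intro: span_base)
      then show "x \<in> span (insert g (perp \<Phi> U))"
        unfolding z_def span_breakdown_eq by blast
    qed
  qed
  then have "dim (perp \<Phi> U' \<inter> C) = Suc (dim (perp \<Phi> U \<inter> C))"
    using rdim_insert[OF C perp_subspace[OF \<Phi>] _ gU] perp_anti[of U UNIV \<Phi>] by simp
  then show ?case using IH d by simp
qed

text \<open>In the localization of an Artinian ring at the prime \<open>p\<close>, the element \<open>E\<close> plays the role of the
idempotent of the local factor: everything outside \<open>p\<close> is invertible on its multiples. It exists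
because the ideals generated by elements outside \<open>p\<close> have one of minimal dimension.\<close>

lemma prime_stable_multiple:
  assumes J: "ideal_set J" "fin_codim J" and p: "ideal_set p" "1 \<notin> p" "J \<subseteq> p"
    and prime: "\<And>a b. a * b \<in> p \<Longrightarrow> a \<in> p \<or> b \<in> p"
  shows "\<exists>E. E \<notin> p \<and> (\<forall>x. x \<notin> p \<longrightarrow> (\<exists>y. E - E * x * y \<in> J))"
proof -
  obtain C where C: "fin_complement J C" using fin_codim_imp_complement[OF J(2)] by blast
  define K where "K E = {a. \<exists>x. a - x * E \<in> J}" for E
  have K: "subspace (K E)" "J \<subseteq> K E" for E
  proof -
    show "subspace (K E)" unfolding K_def by (intro ideal_set_subspace ideal_set_plus_principal J)
    show "J \<subseteq> K E" unfolding K_def by (auto intro: exI[of _ 0])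
  qed
  obtain E where E: "E \<notin> p" "\<And>F. F \<notin> p \<Longrightarrow> dim (K E \<inter> C) \<le> dim (K F \<inter> C)"
    using ex_has_least_nat[of "\<lambda>E. E \<notin> p" 1 "\<lambda>E. dim (K E \<inter> C)"] p(2) by blast
  have "\<exists>y. E - E * x * y \<in> J" if x: "x \<notin> p" for x
  proof -
    have "E * x \<notin> p" using E(1) x prime by blast
    moreover have "K (E * x) \<subseteq> K E"
    proof
      fix a assume "a \<in> K (E * x)"
      then obtain z where "a - z * (E * x) \<in> J" by (auto simp: K_def)
      then have "a - (z * x) * E \<in> J" by (simp add: algebra_simps)
      then show "a \<in> K E" by (auto simp: K_def)
    qed
    ultimately have "K (E * x) = K E" using rdim_eq[OF C K(1) K(1) K(2)] E(2) by blast
    moreover have "E - 1 * E \<in> J" using J by (simp add: ideal_set_zero)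
    then have "E \<in> K E" unfolding K_def by blast
    ultimately have "E \<in> K (E * x)" by simp
    then obtain z where "E - z * (E * x) \<in> J" by (auto simp: K_def)
    then have "E - E * x * z \<in> J" by (simp add: algebra_simps)
    then show ?thesis ..
  qed
  then show ?thesis using E(1) by blast
qed

definition poly_eval :: "'k poly \<Rightarrow> 'a \<Rightarrow> 'a" where
  "poly_eval p x = poly (map_poly (\<lambda>c. scale c 1) p) x"

lemma poly_eval_0 [simp]: "poly_eval 0 x = 0"
  by (simp add: poly_eval_def)

lemma poly_eval_pCons [simp]: "poly_eval (pCons c p) x = scale c 1 + x * poly_eval p x"
  by (simp add: poly_eval_def map_poly_pCons)

lemma poly_eval_add: "poly_eval (p + q) x = poly_eval p x + poly_eval q x"
proof (induction p arbitrary: q)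
  case (pCons a p)
  obtain b q' where "q = pCons b q'" by (cases q) auto
  then show ?case using pCons.IH[of q'] by (simp add: scale_left_distrib algebra_simps)
qed simp

lemma poly_eval_smult: "poly_eval (smult c p) x = scale c (poly_eval p x)"
  by (induction p) (auto simp: scale_right_distrib mult_scale)

lemma poly_eval_mult: "poly_eval (p * q) x = poly_eval p x * poly_eval q x"
  by (induction p) (auto simp: poly_eval_add poly_eval_smult scale_mult algebra_simps)

lemma poly_eval_monom: "poly_eval (monom c n) x = scale c (x ^ n)"
  by (induction n) (auto simp: monom_0 monom_Suc mult_scale)

lemma poly_eval_diff: "poly_eval (p - q) x = poly_eval p x - poly_eval q x"
  using poly_eval_add[of "p - q" q x] by simp

lemma poly_eval_prod_mset: "poly_eval (\<Prod>c\<in>#A. [:- c, 1:]) x = (\<Prod>c\<in>#A. x - scale c 1)"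
  by (induction A) (auto simp: poly_eval_mult one_pCons simp del: mult_pCons_left mult_pCons_right)

text \<open>If no power of \<open>x\<close> were a combination of the lower ones modulo \<open>N\<close>, the powers would span spaces of
unbounded dimension modulo \<open>N\<close>.\<close>

lemma algebraic_mod_fin_codim:
  assumes N: "ideal_set N" "fin_codim N"
  shows "\<exists>p. p \<noteq> 0 \<and> poly_eval p x \<in> N"
proof -
  obtain C where C: "fin_complement N C" using fin_codim_imp_complement[OF N(2)] by blast
  define U where "U n = {y. \<exists>p. (p = 0 \<or> degree p < n) \<and> y - poly_eval p x \<in> N}" for n
  have U: "subspace (U n)" "N \<subseteq> U n" for n
  proof -
    show "N \<subseteq> U n" by (auto simp: U_def intro!: exI[of _ 0])
    show "subspace (U n)"
    proof (rule subspaceI)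
      show "0 \<in> U n" using N by (auto simp: U_def ideal_set_zero intro!: exI[of _ 0])
      fix y z assume "y \<in> U n" "z \<in> U n"
      then obtain p q where pq: "p = 0 \<or> degree p < n" "q = 0 \<or> degree q < n" "y - poly_eval p x \<in> N" "z - poly_eval q x \<in> N"
        by (auto simp: U_def)
      have "(y - poly_eval p x) + (z - poly_eval q x) \<in> N" using pq N by (intro ideal_set_add)
      then have "(y + z) - poly_eval (p + q) x \<in> N" by (simp add: poly_eval_add algebra_simps)
      moreover have "p + q = 0 \<or> degree (p + q) < n"
        using pq(1,2) by (cases "p = 0"; cases "q = 0") (auto intro: degree_add_less)
      ultimately show "y + z \<in> U n" by (auto simp: U_def)
    next
      fix c y assume "y \<in> U n"
      then obtain p where p: "p = 0 \<or> degree p < n" "y - poly_eval p x \<in> N" by (auto simp: U_def)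
      have "scale c y - poly_eval (smult c p) x \<in> N"
        using ideal_set_scale[OF N(1) p(2), of c] by (simp add: poly_eval_smult scale_right_diff_distrib)
      moreover have "smult c p = 0 \<or> degree (smult c p) < n" using p(1) by auto
      ultimately show "scale c y \<in> U n" unfolding U_def by blast
    qed
  qed
  have mono: "U n \<subseteq> U (Suc n)" for n using less_SucI unfolding U_def by blast
  show ?thesis
  proof (cases "\<exists>n. x ^ n \<in> U n")
    case True
    then obtain n p where p: "p = 0 \<or> degree p < n" "x ^ n - poly_eval p x \<in> N" by (auto simp: U_def)
    have "poly_eval (monom 1 n - p) x \<in> N" using p(2) by (simp add: poly_eval_diff poly_eval_monom)
    moreover have "monom 1 n - p \<noteq> 0"
    proof
      assume "monom 1 n - p = 0"
      then have "p = monom 1 n" by simp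
      then show False using p(1) by (auto simp: degree_monom_eq monom_eq_0_iff)
    qed
    ultimately show ?thesis by blast
  next
    case False
    have "x ^ n \<in> U (Suc n)" for n
      using N by (auto simp: U_def poly_eval_monom ideal_set_zero degree_monom_eq intro!: exI[of _ "monom 1 n"])
    then have "U n \<subset> U (Suc n)" for n using mono False by blast
    then have st: "dim (U n \<inter> C) < dim (U (Suc n) \<inter> C)" for n by (intro rdim_strict[OF C] U)
    have "n \<le> dim (U n \<inter> C)" for n
    proof (induction n)
      case (Suc n)
      then show ?case using st[of n] by linarith
    qed simp
    from this[of "Suc (dim C)"] have "Suc (dim C) \<le> dim C"
      using rdim_mono[OF C, of "U (Suc (dim C))" UNIV] by simp
    then show ?thesis by simp
  qed
qed

end

locale comm_algebra_closed = comm_algebra scale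
  for scale :: "'k::alg_closed_field \<Rightarrow> 'a::comm_ring_1 \<Rightarrow> 'a"
begin

lemma split_mod_fin_codim:
  assumes N: "ideal_set N" "fin_codim N"
  shows "\<exists>A. (\<Prod>c\<in>#A. x - scale c 1) \<in> N"
proof -
  obtain p where p: "p \<noteq> 0" "poly_eval p x \<in> N" using algebraic_mod_fin_codim[OF N] by blast
  obtain A where "p = smult (lead_coeff p) (\<Prod>c\<in>#A. [:- c, 1:])"
    using alg_closed_imp_factorization[OF p(1)] by blast
  then have "poly_eval p x = scale (lead_coeff p) (\<Prod>c\<in>#A. x - scale c 1)"
    using poly_eval_smult[of "lead_coeff p" "\<Prod>c\<in>#A. [:- c, 1:]" x] by (simp add: poly_eval_prod_mset)
  then have "scale (inverse (lead_coeff p)) (poly_eval p x) = (\<Prod>c\<in>#A. x - scale c 1)"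
    using p(1) by simp
  then show ?thesis using ideal_set_scale[OF N(1) p(2), of "inverse (lead_coeff p)"] by auto
qed

lemma prime_prod_mset:
  assumes "1 \<notin> p" "\<And>a b. a * b \<in> p \<Longrightarrow> a \<in> p \<or> b \<in> (p :: 'a set)" "(\<Prod>c\<in>#A. f c) \<in> p"
  shows "\<exists>c. f c \<in> p"
  using assms(3) by (induction A) (use assms(1,2) in auto)

lemma residue_field_const:
  assumes N: "ideal_set N" "fin_codim N"
    and p: "1 \<notin> p" "N \<subseteq> p" "\<And>a b. a * b \<in> p \<Longrightarrow> a \<in> p \<or> b \<in> p"
  shows "\<exists>c. x - scale c 1 \<in> p"
  using split_mod_fin_codim[OF N] prime_prod_mset[OF p(1,3)] p(2) by blast

end

section \<open>Self-injective quotients and socles\<close>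

lemma as_module_simps [simp]:
  "carrier (as_module R E) = E" "add (as_module R E) = add R" "module.smult (as_module R E) = monoid.mult R"
  "\<zero>\<^bsub>as_module R E\<^esub> = \<zero>\<^bsub>R\<^esub>"
  by (auto simp: as_module_def)

lemma local_cringI:
  assumes "cring Q" "ideal N Q" "N \<noteq> carrier Q"
    and unit: "\<And>x. x \<in> carrier Q \<Longrightarrow> x \<notin> N \<Longrightarrow> \<exists>y\<in>carrier Q. x \<otimes>\<^bsub>Q\<^esub> y = \<one>\<^bsub>Q\<^esub>"
  shows "local_cring Q"
proof -
  interpret Q: cring Q by fact
  interpret N: ideal N Q by fact
  have sub: "J \<subseteq> N" if J: "ideal J Q" "J \<noteq> carrier Q" for J
  proof
    interpret J: ideal J Q by fact
    fix x assume x: "x \<in> J"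
    show "x \<in> N"
    proof (rule ccontr)
      assume "x \<notin> N"
      then obtain y where "y \<in> carrier Q" "x \<otimes>\<^bsub>Q\<^esub> y = \<one>\<^bsub>Q\<^esub>" using unit J.Icarr[OF x] by blast
      then have "\<one>\<^bsub>Q\<^esub> \<in> J" using J.I_r_closed[OF x] by metis
      then show False using J.one_imp_carrier J(2) by blast
    qed
  qed
  have "maximalideal N Q"
  proof (rule maximalidealI)
    fix J assume "ideal J Q" "N \<subseteq> J" "J \<subseteq> carrier Q"
    then show "J = N \<or> J = carrier Q" using sub[of J] by blast
  qed (use assms in auto)
  moreover have "M = N" if "maximalideal M Q" for M
  proof -
    interpret M: maximalideal M Q by fact
    have "M \<subseteq> N" using sub[OF M.ideal_axioms] M.I_notcarr by blast
    then show ?thesis using M.I_maximal[OF assms(2)] assms(3) N.a_subset by blast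
  qed
  ultimately show ?thesis unfolding local_cring_def using assms(1) by blast
qed

text \<open>The map from the ideal of \<open>a\<close> that sends \<open>a\<close> to \<open>a'\<close> is well defined by the inclusion of annihilators.
Its extension to the whole ring is multiplication by an element.\<close>

lemma principal_annihilator_extension:
  assumes "cring Q" and inj: "injective_module Q (as_module Q (carrier Q))"
    and a: "a \<in> carrier Q" "a' \<in> carrier Q"
    and ann: "\<And>q. q \<in> carrier Q \<Longrightarrow> q \<otimes>\<^bsub>Q\<^esub> a = \<zero>\<^bsub>Q\<^esub> \<Longrightarrow> q \<otimes>\<^bsub>Q\<^esub> a' = \<zero>\<^bsub>Q\<^esub>"
  shows "\<exists>g\<in>carrier Q. a' = g \<otimes>\<^bsub>Q\<^esub> a"
proof -
  interpret Q: cring Q by fact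
  let ?J = "PIdl\<^bsub>Q\<^esub> a"
  define f where "f = (\<lambda>y\<in>?J. (SOME x. x \<in> carrier Q \<and> y = x \<otimes>\<^bsub>Q\<^esub> a) \<otimes>\<^bsub>Q\<^esub> a')"
  have J: "ideal ?J Q" by (rule Q.cgenideal_ideal[OF a(1)])
  have Jmem: "x \<otimes>\<^bsub>Q\<^esub> a \<in> ?J" if "x \<in> carrier Q" for x using that by (auto simp: cgenideal_def)
  have JmemE: "\<exists>x\<in>carrier Q. y = x \<otimes>\<^bsub>Q\<^esub> a" if "y \<in> ?J" for y using that by (auto simp: cgenideal_def)
  have f: "f (x \<otimes>\<^bsub>Q\<^esub> a) = x \<otimes>\<^bsub>Q\<^esub> a'" if x: "x \<in> carrier Q" for x
  proof -
    define z where "z = (SOME z. z \<in> carrier Q \<and> x \<otimes>\<^bsub>Q\<^esub> a = z \<otimes>\<^bsub>Q\<^esub> a)"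
    have z: "z \<in> carrier Q" "x \<otimes>\<^bsub>Q\<^esub> a = z \<otimes>\<^bsub>Q\<^esub> a"
      using someI[of "\<lambda>z. z \<in> carrier Q \<and> x \<otimes>\<^bsub>Q\<^esub> a = z \<otimes>\<^bsub>Q\<^esub> a" x] x unfolding z_def by auto
    have "(z \<ominus>\<^bsub>Q\<^esub> x) \<otimes>\<^bsub>Q\<^esub> a = \<zero>\<^bsub>Q\<^esub>" using x z a
      by (simp add: Q.minus_eq Q.l_distr Q.l_minus Q.r_neg)
    then have "(z \<ominus>\<^bsub>Q\<^esub> x) \<otimes>\<^bsub>Q\<^esub> a' = \<zero>\<^bsub>Q\<^esub>" using ann x z by simp
    then have "z \<otimes>\<^bsub>Q\<^esub> a' \<ominus>\<^bsub>Q\<^esub> x \<otimes>\<^bsub>Q\<^esub> a' = \<zero>\<^bsub>Q\<^esub>" using x z a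
      by (simp add: Q.minus_eq Q.l_distr Q.l_minus)
    then have "z \<otimes>\<^bsub>Q\<^esub> a' = x \<otimes>\<^bsub>Q\<^esub> a'" using x z a by (simp add: Q.r_right_minus_eq)
    then show ?thesis using Jmem[OF x] by (simp add: f_def z_def)
  qed
  have "f \<in> module_hom Q (as_module Q ?J) (as_module Q (carrier Q))"
    unfolding module_hom_def
  proof (intro CollectI conjI ballI)
    show "f \<in> carrier (as_module Q ?J) \<rightarrow>\<^sub>E carrier (as_module Q (carrier Q))"
    proof
      fix y assume "y \<in> carrier (as_module Q ?J)"
      then obtain x where "x \<in> carrier Q" "y = x \<otimes>\<^bsub>Q\<^esub> a" using JmemE by auto
      then show "f y \<in> carrier (as_module Q (carrier Q))" using f a by simp
    qed (auto simp: f_def)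
    fix y z assume "y \<in> carrier (as_module Q ?J)" "z \<in> carrier (as_module Q ?J)"
    then have "y \<in> ?J" "z \<in> ?J" by auto
    then obtain x w where xw: "x \<in> carrier Q" "y = x \<otimes>\<^bsub>Q\<^esub> a" "w \<in> carrier Q" "z = w \<otimes>\<^bsub>Q\<^esub> a"
      using JmemE by blast
    have "y \<oplus>\<^bsub>Q\<^esub> z = (x \<oplus>\<^bsub>Q\<^esub> w) \<otimes>\<^bsub>Q\<^esub> a" using xw a by (simp add: Q.l_distr)
    then show "f (y \<oplus>\<^bsub>as_module Q ?J\<^esub> z) = f y \<oplus>\<^bsub>as_module Q (carrier Q)\<^esub> f z"
      using xw a f[of "x \<oplus>\<^bsub>Q\<^esub> w"] f[of x] f[of w] by (simp add: Q.l_distr)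
  next
    fix c y assume c: "c \<in> carrier Q" and "y \<in> carrier (as_module Q ?J)"
    then obtain x where x: "x \<in> carrier Q" "y = x \<otimes>\<^bsub>Q\<^esub> a" using JmemE by auto
    have "c \<otimes>\<^bsub>Q\<^esub> y = (c \<otimes>\<^bsub>Q\<^esub> x) \<otimes>\<^bsub>Q\<^esub> a" using x a c by (simp add: Q.m_assoc)
    then show "f (c \<odot>\<^bsub>as_module Q ?J\<^esub> y) = c \<odot>\<^bsub>as_module Q (carrier Q)\<^esub> f y"
      using x a c f[of "c \<otimes>\<^bsub>Q\<^esub> x"] f[of x] by (simp add: Q.m_assoc)
  qed
  then obtain g where g: "g \<in> module_hom Q (as_module Q (carrier Q)) (as_module Q (carrier Q))" "\<forall>x\<in>?J. g x = f x"
    using inj J unfolding injective_module_def by blast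
  have g1: "g \<one>\<^bsub>Q\<^esub> \<in> carrier Q" using g(1) by (auto simp: module_hom_def)
  have "g (a \<otimes>\<^bsub>Q\<^esub> \<one>\<^bsub>Q\<^esub>) = a \<otimes>\<^bsub>Q\<^esub> g \<one>\<^bsub>Q\<^esub>" using g(1) a(1) Q.one_closed
    unfolding module_hom_def as_module_simps by blast
  moreover have "g (\<one>\<^bsub>Q\<^esub> \<otimes>\<^bsub>Q\<^esub> a) = \<one>\<^bsub>Q\<^esub> \<otimes>\<^bsub>Q\<^esub> a'" using g(2) Jmem[of "\<one>\<^bsub>Q\<^esub>"] f[of "\<one>\<^bsub>Q\<^esub>"] by auto
  ultimately have "a' = g \<one>\<^bsub>Q\<^esub> \<otimes>\<^bsub>Q\<^esub> a" using a g1 by (simp add: Q.m_comm)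
  then show ?thesis using g1 by blast
qed

lemma quotient_annihilator_extension:
  assumes "cring B" and K: "ideal K B" and inj: "injective_module (B Quot K) (as_module (B Quot K) (carrier (B Quot K)))"
    and a: "a \<in> carrier B" "a' \<in> carrier B"
    and ann: "\<And>q. q \<in> carrier B \<Longrightarrow> q \<otimes>\<^bsub>B\<^esub> a \<in> K \<Longrightarrow> q \<otimes>\<^bsub>B\<^esub> a' \<in> K"
  shows "\<exists>g\<in>carrier B. a' \<ominus>\<^bsub>B\<^esub> g \<otimes>\<^bsub>B\<^esub> a \<in> K"
proof -
  interpret B: cring B by fact
  interpret K: ideal K B by fact
  let ?Q = "B Quot K" and ?c = "(+>\<^bsub>B\<^esub>) K"
  interpret Q: cring ?Q by (rule K.quotient_is_cring[OF assms(1)])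
  have c: "?c \<in> ring_hom B ?Q" by (rule K.rcos_ring_hom)
  have zero: "?c q = \<zero>\<^bsub>?Q\<^esub> \<longleftrightarrow> q \<in> K" if "q \<in> carrier B" for q
    using that K.rcos_const_imp_mem[of q] K.a_rcos_const[of q] by (auto simp: FactRing_def)
  have surj: "\<exists>q\<in>carrier B. y = ?c q" if "y \<in> carrier ?Q" for y
    using that by (auto simp: FactRing_def A_RCOSETS_def')
  have "\<exists>g\<in>carrier ?Q. ?c a' = g \<otimes>\<^bsub>?Q\<^esub> ?c a"
  proof (rule principal_annihilator_extension[OF Q.cring_axioms inj])
    show "?c a \<in> carrier ?Q" "?c a' \<in> carrier ?Q" using a ring_hom_closed[OF c] by auto
    fix q assume "q \<in> carrier ?Q" "q \<otimes>\<^bsub>?Q\<^esub> ?c a = \<zero>\<^bsub>?Q\<^esub>"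
    moreover obtain r where r: "r \<in> carrier B" "q = ?c r" using surj calculation(1) by blast
    ultimately have "?c (r \<otimes>\<^bsub>B\<^esub> a) = \<zero>\<^bsub>?Q\<^esub>" using a ring_hom_mult[OF c] by simp
    then have "?c (r \<otimes>\<^bsub>B\<^esub> a') = \<zero>\<^bsub>?Q\<^esub>" using zero ann r a by simp
    then show "q \<otimes>\<^bsub>?Q\<^esub> ?c a' = \<zero>\<^bsub>?Q\<^esub>" using r a ring_hom_mult[OF c] by simp
  qed
  then obtain g where g: "g \<in> carrier B" "?c a' = ?c g \<otimes>\<^bsub>?Q\<^esub> ?c a" using surj by blast
  then have "?c a' = ?c (g \<otimes>\<^bsub>B\<^esub> a)" using a ring_hom_mult[OF c] by simp
  then have "a' \<ominus>\<^bsub>B\<^esub> g \<otimes>\<^bsub>B\<^esub> a \<in> K"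
    using B.quotient_eq_iff_same_a_r_cos[OF K] a g(1) by simp
  then show ?thesis using g(1) by blast
qed

lemma genideal_singleton_mem:
  assumes "cring B" "x \<in> carrier B"
  shows "y \<in> genideal B {x} \<longleftrightarrow> (\<exists>z\<in>carrier B. y = x \<otimes>\<^bsub>B\<^esub> z)"
proof -
  interpret B: cring B by fact
  have "genideal B {x} = {z \<otimes>\<^bsub>B\<^esub> x | z. z \<in> carrier B}"
    using B.cgenideal_eq_genideal[OF assms(2)] by (simp add: cgenideal_def)
  then show ?thesis using assms(2) by (auto simp: B.m_comm)
qed

lemma genideal_empty: "ring B \<Longrightarrow> genideal B {} = {\<zero>\<^bsub>B\<^esub>}"
proof -
  assume "ring B"
  then interpret B: ring B .
  have "genideal B {} \<subseteq> genideal B {\<zero>\<^bsub>B\<^esub>}" by (rule B.genideal_minimal[OF B.genideal_ideal]) auto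
  moreover have "\<zero>\<^bsub>B\<^esub> \<in> genideal B {}"
    using additive_subgroup.zero_closed[OF ideal.axioms(1)[OF B.genideal_ideal[of "{}"]]] by simp
  ultimately show ?thesis using B.genideal_zero by auto
qed

lemma cring_diff_zeroD:
  assumes "cring B" "a \<in> carrier B" "b \<in> carrier B" "a \<ominus>\<^bsub>B\<^esub> b = \<zero>\<^bsub>B\<^esub>" shows "a = b"
proof -
  interpret B: cring B by fact
  show ?thesis using assms by (simp add: B.r_right_minus_eq)
qed

lemma nonzerodivisor_cancel:
  assumes "cring B" "x \<in> carrier B" "a \<in> carrier B" "b \<in> carrier B"
    and "\<And>a. a \<in> carrier B \<Longrightarrow> x \<otimes>\<^bsub>B\<^esub> a = \<zero>\<^bsub>B\<^esub> \<Longrightarrow> a = \<zero>\<^bsub>B\<^esub>"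
    and eq: "x \<otimes>\<^bsub>B\<^esub> a = x \<otimes>\<^bsub>B\<^esub> b"
  shows "a = b"
proof -
  interpret B: cring B by fact
  have "x \<otimes>\<^bsub>B\<^esub> (a \<ominus>\<^bsub>B\<^esub> b) = \<zero>\<^bsub>B\<^esub>" using assms(2-4) eq
    by (simp add: B.minus_eq B.r_distr B.r_minus B.r_neg)
  then have "a \<ominus>\<^bsub>B\<^esub> b = \<zero>\<^bsub>B\<^esub>" using assms by simp
  then show ?thesis by (rule cring_diff_zeroD[OF assms(1,3,4)])
qed

text \<open>The socle modulo a nonzerodivisor, that is, the elements killed by the maximal ideal \<open>N\<close>, is cyclic in
a Gorenstein ring. Over the given regular sequence this is self-injectivity: two socle elements
have the same annihilator. The sequence cannot be empty, since a nonzerodivisor of a self-injective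
ring is a unit, and it cannot have length two, since a socle element is a zero divisor. So it is a
single \<open>x\<close>, and the socle modulo \<open>x\<close> is compared with the socle modulo \<open>\<tau>\<close>: if \<open>x b = \<tau> a\<close>, then \<open>b\<close> is a
socle element modulo \<open>\<tau>\<close> just when \<open>a\<close> is one modulo \<open>x\<close>.\<close>

theorem gorenstein_socle_cyclic:
  assumes "cring B" and N: "ideal N B" "N \<noteq> carrier B"
    and unit: "\<And>x. x \<in> carrier B \<Longrightarrow> x \<notin> N \<Longrightarrow> \<exists>y\<in>carrier B. x \<otimes>\<^bsub>B\<^esub> y = \<one>\<^bsub>B\<^esub>"
    and \<tau>: "\<tau> \<in> N" and \<tau>_reg: "\<And>a. a \<in> carrier B \<Longrightarrow> \<tau> \<otimes>\<^bsub>B\<^esub> a = \<zero>\<^bsub>B\<^esub> \<Longrightarrow> a = \<zero>\<^bsub>B\<^esub>"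
    and xs: "regular_sequence B xs"
    and inj: "injective_module (B Quot (genideal B (set xs)))
                (as_module (B Quot (genideal B (set xs))) (carrier (B Quot (genideal B (set xs)))))"
    and b: "b \<in> carrier B" "b \<notin> genideal B {\<tau>}" "\<And>z. z \<in> N \<Longrightarrow> z \<otimes>\<^bsub>B\<^esub> b \<in> genideal B {\<tau>}"
    and b': "b' \<in> carrier B" "\<And>z. z \<in> N \<Longrightarrow> z \<otimes>\<^bsub>B\<^esub> b' \<in> genideal B {\<tau>}"
  shows "\<exists>g\<in>carrier B. b' \<ominus>\<^bsub>B\<^esub> g \<otimes>\<^bsub>B\<^esub> b \<in> genideal B {\<tau>}"
proof -
  interpret B: cring B by fact
  interpret N: ideal N B by fact
  note carr = N.Icarr
  have \<tau>c: "\<tau> \<in> carrier B" using \<tau> by (rule carr)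
  note gm = genideal_singleton_mem[OF assms(1)]
  have proper: "K \<subseteq> N" if K: "ideal K B" "K \<noteq> carrier B" for K
  proof
    interpret K: ideal K B by fact
    fix x assume x: "x \<in> K"
    show "x \<in> N"
    proof (rule ccontr)
      assume "x \<notin> N"
      then obtain y where "y \<in> carrier B" "x \<otimes>\<^bsub>B\<^esub> y = \<one>\<^bsub>B\<^esub>" using unit K.Icarr[OF x] by blast
      then have "\<one>\<^bsub>B\<^esub> \<in> K" using K.I_r_closed[OF x] by metis
      then show False using K.one_imp_carrier K(2) by blast
    qed
  qed
  have xsc: "set xs \<subseteq> carrier B" using xs by (simp add: regular_sequence_def)
  have idl: "ideal (genideal B (set xs)) B" by (rule B.genideal_ideal[OF xsc])
  have "genideal B (set xs) \<subseteq> N" using proper[OF idl] xs by (simp add: regular_sequence_def)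
  then have xsN: "set xs \<subseteq> N" using B.genideal_self[OF xsc] by blast
  have reg: "\<And>i a. i < length xs \<Longrightarrow> a \<in> carrier B \<Longrightarrow>
      xs ! i \<otimes>\<^bsub>B\<^esub> a \<in> genideal B (set (take i xs)) \<Longrightarrow> a \<in> genideal B (set (take i xs))"
    using xs by (simp add: regular_sequence_def)
  show ?thesis
  proof (cases xs)
    case Nil
    have "\<exists>g\<in>carrier B. \<one>\<^bsub>B\<^esub> \<ominus>\<^bsub>B\<^esub> g \<otimes>\<^bsub>B\<^esub> \<tau> \<in> genideal B (set xs)"
      by (rule quotient_annihilator_extension[OF assms(1) idl inj])
         (use \<tau>c \<tau>_reg in \<open>auto simp: Nil genideal_empty[OF B.ring_axioms] B.m_comm\<close>)
    then obtain g where g: "g \<in> carrier B" "\<one>\<^bsub>B\<^esub> \<ominus>\<^bsub>B\<^esub> g \<otimes>\<^bsub>B\<^esub> \<tau> = \<zero>\<^bsub>B\<^esub>"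
      by (auto simp: Nil genideal_empty[OF B.ring_axioms])
    have "\<one>\<^bsub>B\<^esub> = g \<otimes>\<^bsub>B\<^esub> \<tau>" by (rule cring_diff_zeroD[OF assms(1)]) (use g \<tau>c in simp_all)
    then have "\<one>\<^bsub>B\<^esub> \<in> N" using N.I_l_closed[OF \<tau> g(1)] by simp
    then have False using N.one_imp_carrier N(2) by blast
    then show ?thesis ..
  next
    case (Cons x ys)
    have x: "x \<in> N" "x \<in> carrier B" using xsN xsc Cons by auto
    have x_reg: "a = \<zero>\<^bsub>B\<^esub>" if "a \<in> carrier B" "x \<otimes>\<^bsub>B\<^esub> a = \<zero>\<^bsub>B\<^esub>" for a
      using reg[of 0 a] that Cons by (simp add: genideal_empty[OF B.ring_axioms])
    \<comment> \<open>Multiplying by \<open>x\<close> and dividing by \<open>\<tau>\<close> carries the socle modulo \<open>\<tau>\<close> into the socle modulo \<open>x\<close>.\<close>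
    have move: "\<exists>a\<in>carrier B. x \<otimes>\<^bsub>B\<^esub> c = \<tau> \<otimes>\<^bsub>B\<^esub> a \<and> (\<forall>z\<in>N. z \<otimes>\<^bsub>B\<^esub> a \<in> genideal B {x}) \<and>
        (c \<notin> genideal B {\<tau>} \<longrightarrow> a \<notin> genideal B {x})"
      if c: "c \<in> carrier B" "\<And>z. z \<in> N \<Longrightarrow> z \<otimes>\<^bsub>B\<^esub> c \<in> genideal B {\<tau>}" for c
    proof -
      obtain a where a: "a \<in> carrier B" "x \<otimes>\<^bsub>B\<^esub> c = \<tau> \<otimes>\<^bsub>B\<^esub> a" using c(2)[OF x(1)] gm[OF \<tau>c] by blast
      have "z \<otimes>\<^bsub>B\<^esub> a \<in> genideal B {x}" if z: "z \<in> N" for z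
      proof -
        obtain d where d: "d \<in> carrier B" "z \<otimes>\<^bsub>B\<^esub> c = \<tau> \<otimes>\<^bsub>B\<^esub> d" using c(2)[OF z] gm[OF \<tau>c] by blast
        have "\<tau> \<otimes>\<^bsub>B\<^esub> (z \<otimes>\<^bsub>B\<^esub> a) = z \<otimes>\<^bsub>B\<^esub> (x \<otimes>\<^bsub>B\<^esub> c)" using a carr[OF z] \<tau>c by (simp add: B.m_lcomm)
        also have "\<dots> = x \<otimes>\<^bsub>B\<^esub> (z \<otimes>\<^bsub>B\<^esub> c)" using carr[OF z] x c(1) by (simp add: B.m_lcomm)
        also have "\<dots> = \<tau> \<otimes>\<^bsub>B\<^esub> (x \<otimes>\<^bsub>B\<^esub> d)" using d x \<tau>c by (simp add: B.m_lcomm)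
        finally have "z \<otimes>\<^bsub>B\<^esub> a = x \<otimes>\<^bsub>B\<^esub> d"
          using nonzerodivisor_cancel[OF assms(1) \<tau>c _ _ \<tau>_reg] a d x carr[OF z] by simp
        then show ?thesis using gm[OF x(2)] d(1) by blast
      qed
      moreover have "a \<notin> genideal B {x}" if "c \<notin> genideal B {\<tau>}"
      proof
        assume "a \<in> genideal B {x}"
        then obtain d where d: "d \<in> carrier B" "a = x \<otimes>\<^bsub>B\<^esub> d" using gm[OF x(2)] by blast
        then have "x \<otimes>\<^bsub>B\<^esub> c = x \<otimes>\<^bsub>B\<^esub> (\<tau> \<otimes>\<^bsub>B\<^esub> d)" using a \<tau>c x by (simp add: B.m_lcomm)
        then have "c = \<tau> \<otimes>\<^bsub>B\<^esub> d" using nonzerodivisor_cancel[OF assms(1) x(2) _ _ x_reg] c d \<tau>c by simp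
        then show False using that gm[OF \<tau>c] d(1) by blast
      qed
      ultimately show ?thesis using a by blast
    qed
    obtain a where a: "a \<in> carrier B" "x \<otimes>\<^bsub>B\<^esub> b = \<tau> \<otimes>\<^bsub>B\<^esub> a" "\<forall>z\<in>N. z \<otimes>\<^bsub>B\<^esub> a \<in> genideal B {x}"
        "a \<notin> genideal B {x}"
      using move[OF b(1,3)] b(2) by blast
    obtain a' where a': "a' \<in> carrier B" "x \<otimes>\<^bsub>B\<^esub> b' = \<tau> \<otimes>\<^bsub>B\<^esub> a'" "\<forall>z\<in>N. z \<otimes>\<^bsub>B\<^esub> a' \<in> genideal B {x}"
      using move[OF b'] by blast
    have ys: "ys = []"
    proof (cases ys)
      case (Cons y zs)
      have "y \<in> N" using xsN \<open>xs = x # ys\<close> Cons by auto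
      then have "y \<otimes>\<^bsub>B\<^esub> a \<in> genideal B {x}" using a(3) by blast
      then have "a \<in> genideal B {x}" using reg[of 1 a] a(1) \<open>xs = x # ys\<close> Cons by simp
      then show ?thesis using a(4) by blast
    qed
    then have set_xs: "set xs = {x}" using Cons by simp
    have "\<exists>g\<in>carrier B. a' \<ominus>\<^bsub>B\<^esub> g \<otimes>\<^bsub>B\<^esub> a \<in> genideal B (set xs)"
    proof (rule quotient_annihilator_extension[OF assms(1) idl inj a(1) a'(1)])
      fix q assume q: "q \<in> carrier B" "q \<otimes>\<^bsub>B\<^esub> a \<in> genideal B (set xs)"
      have "q \<in> N"
      proof (rule ccontr)
        assume "q \<notin> N"
        then obtain u where u: "u \<in> carrier B" "q \<otimes>\<^bsub>B\<^esub> u = \<one>\<^bsub>B\<^esub>" using unit q by blast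
        have "u \<otimes>\<^bsub>B\<^esub> (q \<otimes>\<^bsub>B\<^esub> a) \<in> genideal B (set xs)" using ideal.I_l_closed[OF idl q(2) u(1)] .
        moreover have "u \<otimes>\<^bsub>B\<^esub> (q \<otimes>\<^bsub>B\<^esub> a) = a"
          using u q(1) a(1) by (simp add: B.m_assoc[symmetric] B.m_comm[of u q])
        ultimately show False using a(4) set_xs by simp
      qed
      then show "q \<otimes>\<^bsub>B\<^esub> a' \<in> genideal B (set xs)" using a'(3) set_xs by simp
    qed
    then obtain g h where g: "g \<in> carrier B" and h: "h \<in> carrier B" "a' \<ominus>\<^bsub>B\<^esub> g \<otimes>\<^bsub>B\<^esub> a = x \<otimes>\<^bsub>B\<^esub> h"
      using gm[OF x(2)] set_xs by auto
    have "x \<otimes>\<^bsub>B\<^esub> (b' \<ominus>\<^bsub>B\<^esub> g \<otimes>\<^bsub>B\<^esub> b) = x \<otimes>\<^bsub>B\<^esub> b' \<ominus>\<^bsub>B\<^esub> g \<otimes>\<^bsub>B\<^esub> (x \<otimes>\<^bsub>B\<^esub> b)"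
      using x b(1) b'(1) g by (simp add: B.minus_eq B.r_distr B.r_minus B.m_lcomm)
    also have "\<dots> = \<tau> \<otimes>\<^bsub>B\<^esub> (a' \<ominus>\<^bsub>B\<^esub> g \<otimes>\<^bsub>B\<^esub> a)"
      using \<tau>c a(1,2) a'(1,2) g by (simp add: B.minus_eq B.r_distr B.r_minus B.m_lcomm)
    also have "\<dots> = x \<otimes>\<^bsub>B\<^esub> (\<tau> \<otimes>\<^bsub>B\<^esub> h)" using h x \<tau>c by (simp add: B.m_lcomm)
    finally have "b' \<ominus>\<^bsub>B\<^esub> g \<otimes>\<^bsub>B\<^esub> b = \<tau> \<otimes>\<^bsub>B\<^esub> h"
      using nonzerodivisor_cancel[OF assms(1) x(2) _ _ x_reg] b(1) b'(1) g h(1) \<tau>c by simp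
    then show ?thesis using gm[OF \<tau>c] h(1) g by blast
  qed
qed

section \<open>Rings covered by a quotient of an algebra\<close>

text \<open>The ascending chain condition for the quotient by \<open>I\<close>, in terms of the ideals above \<open>I\<close>.\<close>

definition noetherian_above :: "'a::comm_ring_1 set \<Rightarrow> bool" where
  "noetherian_above I \<longleftrightarrow> (\<forall>U. ideal_set U \<longrightarrow> I \<subseteq> U \<longrightarrow>
     (\<exists>G. finite G \<and> G \<subseteq> U \<and> (\<forall>K. ideal_set K \<longrightarrow> I \<subseteq> K \<longrightarrow> G \<subseteq> K \<longrightarrow> U \<subseteq> K)))"

lemma type_ring_hom:
  assumes "\<theta> \<in> ring_hom type_ring Q" "cring Q"
  shows "\<theta> (a + b) = \<theta> a \<oplus>\<^bsub>Q\<^esub> \<theta> b" "\<theta> (a * b) = \<theta> a \<otimes>\<^bsub>Q\<^esub> \<theta> b" "\<theta> 1 = \<one>\<^bsub>Q\<^esub>" "\<theta> a \<in> carrier Q"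
    "\<theta> 0 = \<zero>\<^bsub>Q\<^esub>"
proof -
  interpret T: cring type_ring by (rule type_ring_cring)
  interpret Q: cring Q by fact
  show "\<theta> (a + b) = \<theta> a \<oplus>\<^bsub>Q\<^esub> \<theta> b" using ring_hom_add[OF assms(1), of a b] by simp
  show "\<theta> (a * b) = \<theta> a \<otimes>\<^bsub>Q\<^esub> \<theta> b" using ring_hom_mult[OF assms(1), of a b] by simp
  show "\<theta> 1 = \<one>\<^bsub>Q\<^esub>" using ring_hom_one[OF assms(1)] by simp
  show "\<theta> a \<in> carrier Q" using ring_hom_closed[OF assms(1), of a] by simp
  show "\<theta> 0 = \<zero>\<^bsub>Q\<^esub>" using ring_hom_zero[OF assms(1) T.ring_axioms Q.ring_axioms] by simp
qed

lemma ideal_set_preimage: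
  assumes "\<theta> \<in> ring_hom type_ring Q" "cring Q" "ideal K Q"
  shows "ideal_set {a. \<theta> a \<in> K}"
proof -
  interpret K: ideal K Q by fact
  show ?thesis unfolding ideal_set_def
    using type_ring_hom[OF assms(1,2)] K.I_l_closed additive_subgroup.zero_closed[OF K.is_additive_subgroup]
      additive_subgroup.a_closed[OF K.is_additive_subgroup] by simp
qed

lemma ideal_image:
  assumes \<theta>: "\<theta> \<in> ring_hom type_ring Q" and Q: "cring Q" and surj: "\<theta> ` UNIV = carrier Q"
    and p: "ideal_set p"
  shows "ideal (\<theta> ` p) Q"
proof (rule idealI)
  interpret Q: cring Q by (rule Q)
  note h = type_ring_hom[OF \<theta> Q]
  show "ring Q" by (rule Q.ring_axioms)
  show "subgroup (\<theta> ` p) (add_monoid Q)"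
  proof (rule group.subgroupI[OF Q.a_group])
    show "\<theta> ` p \<subseteq> carrier (add_monoid Q)" using h(4) by auto
    show "\<theta> ` p \<noteq> {}" using ideal_set_zero[OF p] by blast
    fix x assume "x \<in> \<theta> ` p"
    then obtain a where a: "x = \<theta> a" "a \<in> p" by blast
    have "\<theta> (- a) \<oplus>\<^bsub>Q\<^esub> x = \<zero>\<^bsub>Q\<^esub>" using h(1)[of "- a" a] h(5) a(1) by simp
    then have "\<ominus>\<^bsub>Q\<^esub> x = \<theta> (- a)" using Q.minus_equality[of "\<theta> (- a)" x] h(4) a(1) by simp
    then show "inv\<^bsub>add_monoid Q\<^esub> x \<in> \<theta> ` p"
      using ideal_set_uminus[OF p a(2)] unfolding a_inv_def[symmetric] by auto
    fix y assume "y \<in> \<theta> ` p"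
    then obtain b where b: "y = \<theta> b" "b \<in> p" by blast
    have "x \<oplus>\<^bsub>Q\<^esub> y = \<theta> (a + b)" using h(1) a b by simp
    then show "x \<otimes>\<^bsub>add_monoid Q\<^esub> y \<in> \<theta> ` p" using ideal_set_add[OF p a(2) b(2)] by auto
  qed
  fix x y assume "x \<in> \<theta> ` p" "y \<in> carrier Q"
  then obtain a b where ab: "x = \<theta> a" "a \<in> p" "y = \<theta> b" unfolding surj[symmetric] by blast
  then have "y \<otimes>\<^bsub>Q\<^esub> x = \<theta> (b * a)" "x \<otimes>\<^bsub>Q\<^esub> y = \<theta> (a * b)" by (simp_all add: h(2))
  then show "y \<otimes>\<^bsub>Q\<^esub> x \<in> \<theta> ` p" "x \<otimes>\<^bsub>Q\<^esub> y \<in> \<theta> ` p"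
    using ideal_set_mult[OF p ab(2), of b] ideal_set_mult2[OF p ab(2), of b] by auto
qed

text \<open>Covers quotients and localizations at once: up to associates, every element of \<open>Q\<close> comes from the
type, so that an ideal of \<open>Q\<close> is generated by the image of its preimage.\<close>

lemma noetherian_ring_if_above:
  assumes \<theta>: "\<theta> \<in> ring_hom type_ring Q" and Q: "cring Q" and I: "noetherian_above I"
    and ker: "\<And>a. a \<in> I \<Longrightarrow> \<theta> a = \<zero>\<^bsub>Q\<^esub>"
    and assoc: "\<And>y. y \<in> carrier Q \<Longrightarrow>
      \<exists>a. \<exists>v\<in>carrier Q. \<exists>w\<in>carrier Q. y = \<theta> a \<otimes>\<^bsub>Q\<^esub> v \<and> \<theta> a = y \<otimes>\<^bsub>Q\<^esub> w"
  shows "noetherian_ring Q"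
proof -
  interpret Q: cring Q by fact
  show ?thesis
  proof (rule Q.noetherian_ringI)
    fix K assume K: "ideal K Q"
    interpret K: ideal K Q by fact
    let ?U = "{a. \<theta> a \<in> K}"
    have U: "ideal_set ?U" by (rule ideal_set_preimage[OF \<theta> Q K])
    have IU: "I \<subseteq> ?U" using ker additive_subgroup.zero_closed[OF K.is_additive_subgroup] by auto
    obtain G where "finite G \<and> G \<subseteq> ?U \<and> (\<forall>L. ideal_set L \<longrightarrow> I \<subseteq> L \<longrightarrow> G \<subseteq> L \<longrightarrow> ?U \<subseteq> L)"
      using I[unfolded noetherian_above_def, rule_format, OF U IU] by (rule exE)
    then have G: "finite G" "G \<subseteq> ?U" "\<And>L. ideal_set L \<Longrightarrow> I \<subseteq> L \<Longrightarrow> G \<subseteq> L \<Longrightarrow> ?U \<subseteq> L"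
      by simp_all
    have Gc: "\<theta> ` G \<subseteq> carrier Q" using type_ring_hom(4)[OF \<theta> Q] by auto
    interpret L: ideal "Idl\<^bsub>Q\<^esub> (\<theta> ` G)" Q by (rule Q.genideal_ideal[OF Gc])
    have "?U \<subseteq> {a. \<theta> a \<in> Idl\<^bsub>Q\<^esub> (\<theta> ` G)}"
    proof (rule G(3))
      show "ideal_set {a. \<theta> a \<in> Idl\<^bsub>Q\<^esub> (\<theta> ` G)}" by (rule ideal_set_preimage[OF \<theta> Q L.ideal_axioms])
      show "I \<subseteq> {a. \<theta> a \<in> Idl\<^bsub>Q\<^esub> (\<theta> ` G)}"
        using ker additive_subgroup.zero_closed[OF L.is_additive_subgroup] by auto
      show "G \<subseteq> {a. \<theta> a \<in> Idl\<^bsub>Q\<^esub> (\<theta> ` G)}" using Q.genideal_self[OF Gc] by auto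
    qed
    moreover have "y \<in> Idl\<^bsub>Q\<^esub> (\<theta> ` G)" if y: "y \<in> K" and sub: "?U \<subseteq> {a. \<theta> a \<in> Idl\<^bsub>Q\<^esub> (\<theta> ` G)}" for y
    proof -
      obtain a v w where a: "v \<in> carrier Q" "w \<in> carrier Q" "y = \<theta> a \<otimes>\<^bsub>Q\<^esub> v" "\<theta> a = y \<otimes>\<^bsub>Q\<^esub> w"
        using assoc[OF K.Icarr[OF y]] by blast
      have "\<theta> a \<in> K" using a K.I_r_closed[OF y] by simp
      then have "\<theta> a \<in> Idl\<^bsub>Q\<^esub> (\<theta> ` G)" using sub by blast
      then show ?thesis using a(3) L.I_r_closed a(1) by simp
    qed
    moreover have "Idl\<^bsub>Q\<^esub> (\<theta> ` G) \<subseteq> K" using G(2) by (intro Q.genideal_minimal[OF K]) auto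
    ultimately show "\<exists>A\<subseteq>carrier Q. finite A \<and> K = Idl\<^bsub>Q\<^esub> A" using G(1) Gc by (intro exI[of _ "\<theta> ` G"]) auto
  qed
qed

lemma (in comm_algebra) fin_codim_noetherian_above:
  assumes N: "fin_codim N" shows "noetherian_above N"
  unfolding noetherian_above_def
proof (intro allI impI)
  fix U assume U: "ideal_set U" "N \<subseteq> U"
  obtain C where C: "fin_complement N C" using fin_codim_imp_complement[OF N] by blast
  obtain B where B: "finite B" "C = span B" using C by (auto simp: fin_complement_def)
  obtain b where b: "b \<subseteq> U \<inter> C" "independent b" "U \<inter> C \<subseteq> span b" "card b = dim (U \<inter> C)"
    by (rule basis_exists)
  have "finite b" using independent_span_bound[OF B(1) b(2)] b(1) B(2) by blast
  moreover have "U \<subseteq> K" if K: "ideal_set K" "N \<subseteq> K" "b \<subseteq> K" for K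
  proof
    fix x assume x: "x \<in> U"
    obtain c where c: "c \<in> C" "x - c \<in> N" using C by (auto simp: fin_complement_def)
    have "x - (x - c) \<in> U" using ideal_set_diff[OF U(1) x] c(2) U(2) by blast
    then have "c \<in> span b" using b(3) c(1) by auto
    then have "c \<in> K" using span_minimal[OF K(3) ideal_set_subspace[OF K(1)]] by blast
    then show "x \<in> K" using ideal_set_add[OF K(1), of "x - c" c] c(2) K(2) by auto
  qed
  ultimately show "\<exists>G. finite G \<and> G \<subseteq> U \<and> (\<forall>K. ideal_set K \<longrightarrow> N \<subseteq> K \<longrightarrow> G \<subseteq> K \<longrightarrow> U \<subseteq> K)"
    using b(1) by blast
qed

context comm_algebra
begin

text \<open>Composing a homomorphism \<open>f\<close> on an ideal with the nondegenerate functional gives a functional on that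
ideal. Its extension to the whole algebra is \<open>\<Phi>(c x)\<close> for some \<open>c\<close>, and nondegeneracy recovers \<open>f\<close> from its
composite with \<open>\<Phi>\<close> as multiplication by \<open>c\<close>.\<close>

lemma self_injective_if_functional:
  assumes \<theta>: "\<theta> \<in> ring_hom type_ring Q" and Q: "cring Q" and surj: "\<theta> ` UNIV = carrier Q"
    and \<Phi>: "functional \<Phi>" and N: "fin_codim (perp \<Phi> UNIV)"
    and ker: "\<And>a. \<theta> a = \<zero>\<^bsub>Q\<^esub> \<longleftrightarrow> a \<in> perp \<Phi> UNIV"
  shows "injective_module Q (as_module Q (carrier Q))"
  unfolding injective_module_def
proof (intro allI impI ballI)
  fix K f assume K: "ideal K Q" and f: "f \<in> module_hom Q (as_module Q K) (as_module Q (carrier Q))"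
  interpret Q: cring Q by fact
  interpret K: ideal K Q by fact
  note h = type_ring_hom[OF \<theta> Q]
  have NI: "ideal_set (perp \<Phi> UNIV)" by (rule perp_UNIV_ideal[OF \<Phi>])
  have eqI: "a - b \<in> perp \<Phi> UNIV" if "\<theta> a = \<theta> b" for a b
  proof -
    have "\<theta> (a - b) \<oplus>\<^bsub>Q\<^esub> \<theta> b = \<theta> b" using h(1)[of "a - b" b] that by simp
    then have "\<theta> (a - b) = \<zero>\<^bsub>Q\<^esub>" using h(4) Q.add.r_cancel_one' by metis
    then show ?thesis by (simp add: ker)
  qed
  have eqD: "\<theta> a = \<theta> b" if "a - b \<in> perp \<Phi> UNIV" for a b
    using h(1)[of "a - b" b] that h(4) by (simp add: ker[symmetric])
  define \<phi> where "\<phi> y = \<Phi> (SOME a. \<theta> a = y)" for y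
  have \<phi>: "\<phi> (\<theta> a) = \<Phi> a" for a
  proof -
    have "\<theta> (SOME b. \<theta> b = \<theta> a) = \<theta> a" by (rule someI) simp
    then have "(SOME b. \<theta> b = \<theta> a) - a \<in> perp \<Phi> UNIV" by (rule eqI)
    then have "\<Phi> ((SOME b. \<theta> b = \<theta> a) - a) = 0" by (rule functional_perp_UNIV)
    then show ?thesis using \<Phi> by (simp add: \<phi>_def functional_diff)
  qed
  let ?U = "{a. \<theta> a \<in> K}"
  have U: "ideal_set ?U" by (rule ideal_set_preimage[OF \<theta> Q K])
  have f_closed: "f x \<in> carrier Q" if "x \<in> K" for x using f that by (auto simp: module_hom_def)
  have f_add: "f (x \<oplus>\<^bsub>Q\<^esub> y) = f x \<oplus>\<^bsub>Q\<^esub> f y" if "x \<in> K" "y \<in> K" for x y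
    using f that unfolding module_hom_def as_module_simps by blast
  have f_mult: "f (c \<otimes>\<^bsub>Q\<^esub> x) = c \<otimes>\<^bsub>Q\<^esub> f x" if "c \<in> carrier Q" "x \<in> K" for c x
    using f that unfolding module_hom_def as_module_simps by blast
  have lift: "\<exists>b. y = \<theta> b" if "y \<in> carrier Q" for y using that unfolding surj[symmetric] by blast
  define \<chi> where "\<chi> a = \<phi> (f (\<theta> a))" for a
  have "\<exists>g. functional g \<and> (\<forall>a\<in>?U. g a = \<chi> a)"
  proof (rule functional_extend[OF ideal_set_subspace[OF U]])
    fix a b assume ab: "a \<in> ?U" "b \<in> ?U"
    obtain a' where a': "f (\<theta> a) = \<theta> a'" using lift[OF f_closed] ab by blast
    obtain b' where b': "f (\<theta> b) = \<theta> b'" using lift[OF f_closed] ab by blast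
    have "f (\<theta> (a + b)) = \<theta> (a' + b')" using ab f_add a' b' by (simp add: h(1))
    then show "\<chi> (a + b) = \<chi> a + \<chi> b"
      using a' b' \<Phi> by (simp add: \<chi>_def \<phi> functional_add)
  next
    fix c a assume a: "a \<in> ?U"
    obtain a' where a': "f (\<theta> a) = \<theta> a'" using lift[OF f_closed] a by blast
    have sc: "\<theta> (scale c x) = \<theta> (scale c 1) \<otimes>\<^bsub>Q\<^esub> \<theta> x" for x
      using h(2)[of "scale c 1" x] by (simp add: scale_mult)
    have "f (\<theta> (scale c a)) = \<theta> (scale c a')"
      using f_mult[OF h(4)[of "scale c 1"], of "\<theta> a"] a a' by (simp add: sc[of a] sc[of a'])
    then show "\<chi> (scale c a) = c * \<chi> a" using a' \<Phi> by (simp add: \<chi>_def \<phi> functional_scale)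
  qed
  then obtain g where g: "functional g" "\<And>a. \<theta> a \<in> K \<Longrightarrow> g a = \<chi> a" by blast
  have "\<exists>c. \<forall>a. g a = \<Phi> (c * a)"
  proof (rule functional_represented[OF \<Phi> N g(1)])
    fix a assume "a \<in> perp \<Phi> UNIV"
    then have a0: "\<theta> a = \<zero>\<^bsub>Q\<^esub>" by (simp add: ker)
    then have aK: "\<theta> a \<in> K" using additive_subgroup.zero_closed[OF K.is_additive_subgroup] by simp
    have "f (\<zero>\<^bsub>Q\<^esub> \<otimes>\<^bsub>Q\<^esub> \<theta> a) = \<zero>\<^bsub>Q\<^esub> \<otimes>\<^bsub>Q\<^esub> f (\<theta> a)" by (rule f_mult) (use aK in auto)
    then have "f (\<theta> a) = \<theta> 0" using f_closed[OF aK] h(5) a0 by simp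
    then show "g a = 0" using g(2)[OF aK] \<Phi> by (simp add: \<chi>_def \<phi> functional_zero)
  qed
  then obtain c where c: "\<And>a. g a = \<Phi> (c * a)" by blast
  have fx: "f x = \<theta> c \<otimes>\<^bsub>Q\<^esub> x" if x: "x \<in> K" for x
  proof -
    obtain a where a: "x = \<theta> a" using lift[OF K.Icarr[OF x]] by blast
    obtain b where b: "f x = \<theta> b" using lift[OF f_closed[OF x]] by blast
    have "\<Phi> ((b - c * a) * e) = 0" for e
    proof -
      have K': "\<theta> (a * e) \<in> K" using x a K.I_r_closed h(2,4) by simp
      have "f (\<theta> (e * a)) = \<theta> (e * b)" using f_mult[OF h(4)[of e] x] a b by (simp add: h(2))
      then have "f (\<theta> (a * e)) = \<theta> (e * b)" by (simp only: mult.commute)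
      then have "\<Phi> (e * b) = \<Phi> (c * (a * e))" using g(2)[OF K'] c[of "a * e"] by (simp add: \<chi>_def \<phi>)
      moreover have "(b - c * a) * e = e * b - c * (a * e)" by (simp add: algebra_simps)
      ultimately show ?thesis using \<Phi> by (simp add: functional_diff)
    qed
    then have "b - c * a \<in> perp \<Phi> UNIV" by (simp add: perp_def)
    then show ?thesis using eqD[of b "c * a"] a b h(2) by simp
  qed
  let ?g = "\<lambda>x\<in>carrier Q. \<theta> c \<otimes>\<^bsub>Q\<^esub> x"
  have "?g \<in> module_hom Q (as_module Q (carrier Q)) (as_module Q (carrier Q))"
    using h(4)[of c] by (auto simp: module_hom_def Q.r_distr Q.m_lcomm)
  moreover have "\<forall>x\<in>K. ?g x = f x" using fx K.Icarr by simp
  ultimately show "\<exists>g\<in>module_hom Q (as_module Q (carrier Q)) (as_module Q (carrier Q)). \<forall>x\<in>K. g x = f x" by blast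
qed

end

lemma (in comm_algebra_closed) fin_codim_prime_maximal:
  assumes \<theta>: "\<theta> \<in> ring_hom type_ring Q" and Q: "cring Q" and surj: "\<theta> ` UNIV = carrier Q"
    and N: "ideal_set N" "fin_codim N" "\<And>a. a \<in> N \<Longrightarrow> \<theta> a = \<zero>\<^bsub>Q\<^esub>" and P: "primeideal P Q"
  shows "maximalideal P Q"
proof -
  interpret Q: cring Q by fact
  interpret P: primeideal P Q by fact
  note h = type_ring_hom[OF \<theta> Q]
  have Pid: "ideal_set {a. \<theta> a \<in> P}" by (rule ideal_set_preimage[OF \<theta> Q P.ideal_axioms])
  have zP: "\<zero>\<^bsub>Q\<^esub> \<in> P" using additive_subgroup.zero_closed[OF P.is_additive_subgroup] .
  have const: "\<exists>c. x - scale c 1 \<in> {a. \<theta> a \<in> P}" for x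
  proof (rule residue_field_const[OF N(1,2)])
    show "1 \<notin> {a. \<theta> a \<in> P}" using h(3) P.one_imp_carrier P.I_notcarr by auto
    show "N \<subseteq> {a. \<theta> a \<in> P}" using N(3) zP by auto
    fix a b assume "a * b \<in> {a. \<theta> a \<in> P}"
    then show "a \<in> {a. \<theta> a \<in> P} \<or> b \<in> {a. \<theta> a \<in> P}" using P.I_prime h by auto
  qed
  show ?thesis
  proof (rule maximalidealI)
    show "ideal P Q" by (rule P.ideal_axioms)
    show "carrier Q \<noteq> P" by (rule P.I_notcarr)
    fix K assume K: "ideal K Q" "P \<subseteq> K" "K \<subseteq> carrier Q"
    interpret K: ideal K Q by fact
    have "K = carrier Q" if "K \<noteq> P"
    proof -
      have "\<exists>y. y \<in> K \<and> y \<notin> P" using that K(2) by auto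
      then obtain y where y: "y \<in> K" "y \<notin> P" by blast
      obtain x where x: "y = \<theta> x" using y(1) K(3) unfolding surj[symmetric] by blast
      obtain c where c: "\<theta> (x - scale c 1) \<in> P" using const by blast
      have Kid: "ideal_set {a. \<theta> a \<in> K}" by (rule ideal_set_preimage[OF \<theta> Q K(1)])
      have "c \<noteq> 0" using c x y(2) by auto
      have "x - (x - scale c 1) \<in> {a. \<theta> a \<in> K}"
        by (rule ideal_set_diff[OF Kid]) (use x y(1) c K(2) in auto)
      then have "scale c 1 \<in> {a. \<theta> a \<in> K}" by simp
      then have "scale (inverse c) (scale c 1) \<in> {a. \<theta> a \<in> K}" by (rule ideal_set_scale[OF Kid])
      then have "\<one>\<^bsub>Q\<^esub> \<in> K" using \<open>c \<noteq> 0\<close> h(3) by simp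
      then show ?thesis by (rule K.one_imp_carrier)
    qed
    then show "K = P \<or> K = carrier Q" by blast
  qed
qed

section \<open>Localizations of a quotient ring\<close>

lemma ideal_set_lin: "ideal_set K \<Longrightarrow> a \<in> K \<Longrightarrow> b \<in> K \<Longrightarrow> x * a + y * b \<in> K"
  by (intro ideal_set_add ideal_set_mult)

text \<open>Fractions are indexed by representatives \<open>a\<close> and \<open>s\<close> in the type, with \<open>s\<close> in the multiplicative set \<open>M\<close>.
An equality of fractions becomes membership of an explicit element in the ideal \<open>I\<close>.\<close>

locale quotient_localization =
  fixes I M :: "'a::comm_ring_1 set"
  assumes I: "ideal_set I" and one_M: "1 \<in> M" and mult_M: "\<And>s t. s \<in> M \<Longrightarrow> t \<in> M \<Longrightarrow> s * t \<in> M"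
begin

abbreviation cl :: "'a \<Rightarrow> 'a set" where "cl a \<equiv> I +>\<^bsub>type_ring\<^esub> a"
abbreviation "R \<equiv> type_ring Quot I"
abbreviation "L \<equiv> localization R (cl ` M)"

definition frac :: "'a \<Rightarrow> 'a \<Rightarrow> ('a set \<times> 'a set) set" where
  "frac a s = fraction R (cl ` M) (cl a) (cl s)"

lemma I_ideal: "ideal I type_ring"
  using I by (simp add: ideal_type_ring_iff)

lemma R_cring: "cring R"
  by (rule ideal.quotient_is_cring[OF I_ideal type_ring_cring])

lemma cl_hom: "cl \<in> ring_hom type_ring R"
  by (rule ideal.rcos_ring_hom[OF I_ideal])

lemma cl_eq_iff: "cl a = cl b \<longleftrightarrow> a - b \<in> I"
proof -
  interpret cring "type_ring :: 'a ring" by (rule type_ring_cring)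
  show ?thesis using quotient_eq_iff_same_a_r_cos[OF I_ideal, of a b] by (simp add: a_minus_def)
qed

lemma carrier_R: "carrier R = range cl"
  by (auto simp: FactRing_def A_RCOSETS_def')

lemmas cl_simps = type_ring_hom[OF cl_hom R_cring]

lemma cl_mult: "cl a \<otimes>\<^bsub>R\<^esub> cl b = cl (a * b)" and cl_add: "cl a \<oplus>\<^bsub>R\<^esub> cl b = cl (a + b)"
  by (simp_all add: cl_simps)

lemma cl_one: "\<one>\<^bsub>R\<^esub> = cl 1" and cl_zero: "\<zero>\<^bsub>R\<^esub> = cl 0"
  by (simp_all add: cl_simps(3,5))

lemma cl_zero_iff: "cl a = \<zero>\<^bsub>R\<^esub> \<longleftrightarrow> a \<in> I"
  by (simp add: cl_zero cl_eq_iff)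

lemma loc_rel_iff:
  assumes "s \<in> M" "t \<in> M"
  shows "((cl a, cl s), (cl b, cl t)) \<in> loc_rel R (cl ` M) \<longleftrightarrow> (\<exists>u\<in>M. u * (a * t - b * s) \<in> I)"
proof -
  have "((cl a, cl s), (cl b, cl t)) \<in> loc_rel R (cl ` M) \<longleftrightarrow>
     (\<exists>u\<in>M. cl u \<otimes>\<^bsub>R\<^esub> (cl a \<otimes>\<^bsub>R\<^esub> cl t) = cl u \<otimes>\<^bsub>R\<^esub> (cl b \<otimes>\<^bsub>R\<^esub> cl s))"
    unfolding loc_rel_def using assms by (simp add: carrier_R)
  also have "\<dots> \<longleftrightarrow> (\<exists>u\<in>M. u * (a * t - b * s) \<in> I)"
    by (simp add: cl_mult cl_eq_iff right_diff_distrib)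
  finally show ?thesis .
qed

lemma rel_trans:
  assumes "u * (a * t - b * s) \<in> I" "v * (b * w - c * t) \<in> I"
  shows "(u * v * t) * (a * w - c * s) \<in> I"
proof -
  have "(v * w) * (u * (a * t - b * s)) + (u * s) * (v * (b * w - c * t)) \<in> I"
    by (rule ideal_set_lin[OF I assms])
  then show ?thesis by (simp add: algebra_simps)
qed

lemma equiv_loc_rel: "equiv (range cl \<times> cl ` M) (loc_rel R (cl ` M))"
proof (rule equivI)
  show "loc_rel R (cl ` M) \<subseteq> (range cl \<times> cl ` M) \<times> range cl \<times> cl ` M"
    by (auto simp: loc_rel_def carrier_R)
  show "refl_on (range cl \<times> cl ` M) (loc_rel R (cl ` M))"
  proof (rule refl_onI)
    fix x assume "x \<in> range cl \<times> cl ` M"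
    then obtain a s where "x = (cl a, cl s)" "s \<in> M" by auto
    then show "(x, x) \<in> loc_rel R (cl ` M)"
      using loc_rel_iff[of s s a a] one_M I by (auto simp: ideal_set_zero)
  qed
  show "sym (loc_rel R (cl ` M))"
    unfolding sym_def loc_rel_def by fastforce
  show "trans (loc_rel R (cl ` M))"
  proof (rule transI)
    fix x y z assume xy: "(x, y) \<in> loc_rel R (cl ` M)" and yz: "(y, z) \<in> loc_rel R (cl ` M)"
    obtain a s b t c w where e: "x = (cl a, cl s)" "y = (cl b, cl t)" "z = (cl c, cl w)"
      and M: "s \<in> M" "t \<in> M" "w \<in> M"
      using xy yz unfolding loc_rel_def carrier_R by auto
    obtain u where u: "u \<in> M" "u * (a * t - b * s) \<in> I" using xy e M loc_rel_iff by auto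
    obtain v where v: "v \<in> M" "v * (b * w - c * t) \<in> I" using yz e M loc_rel_iff by auto
    have "u * v * t \<in> M" using u v M by (simp add: mult_M)
    then show "(x, z) \<in> loc_rel R (cl ` M)"
      using rel_trans[OF u(2) v(2)] e M loc_rel_iff[OF M(1,3), of a c] by auto
  qed
qed

lemma frac_eq_iff:
  assumes "s \<in> M" "t \<in> M"
  shows "frac a s = frac b t \<longleftrightarrow> (\<exists>u\<in>M. u * (a * t - b * s) \<in> I)"
proof -
  have "frac a s = frac b t \<longleftrightarrow> ((cl a, cl s), (cl b, cl t)) \<in> loc_rel R (cl ` M)"
    unfolding frac_def fraction_def using eq_equiv_class_iff[OF equiv_loc_rel] assms by simp
  then show ?thesis using loc_rel_iff[OF assms] by simp
qed

lemma frac_eqI: "s \<in> M \<Longrightarrow> t \<in> M \<Longrightarrow> a * t - b * s \<in> I \<Longrightarrow> frac a s = frac b t"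
  using frac_eq_iff[of s t a b] one_M by (metis mult_1)

lemma frac_mem:
  assumes "p \<in> frac a s" "s \<in> M"
  shows "\<exists>b t. p = (cl b, cl t) \<and> t \<in> M \<and> frac b t = frac a s"
proof -
  have p: "((cl a, cl s), p) \<in> loc_rel R (cl ` M)" using assms(1) by (simp add: frac_def fraction_def)
  then obtain b t where bt: "p = (cl b, cl t)" "t \<in> M" unfolding loc_rel_def carrier_R by auto
  then have "frac b t = frac a s" unfolding frac_def fraction_def
    using equiv_class_eq[OF equiv_loc_rel p] by simp
  then show ?thesis using bt by blast
qed

lemma frac_self: "s \<in> M \<Longrightarrow> (cl a, cl s) \<in> frac a s"
  unfolding frac_def fraction_def using loc_rel_iff[of s s a a] one_M I by (auto simp: ideal_set_zero)

lemma carrier_L: "carrier L = {frac a s |a s. s \<in> M}"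
  unfolding localization_def carrier_R frac_def by auto

lemma UN_const: "A \<noteq> {} \<Longrightarrow> (\<And>x. x \<in> A \<Longrightarrow> f x = c) \<Longrightarrow> (\<Union>x\<in>A. f x) = c"
  by auto

lemma frac_mult_wd:
  assumes "s \<in> M" "t \<in> M" "s' \<in> M" "t' \<in> M" "frac a s = frac a' s'" "frac b t = frac b' t'"
  shows "frac (a * b) (s * t) = frac (a' * b') (s' * t')"
proof -
  obtain u where u: "u \<in> M" "u * (a * s' - a' * s) \<in> I"
    using frac_eq_iff[OF assms(1,3)] assms(5) by blast
  obtain v where v: "v \<in> M" "v * (b * t' - b' * t) \<in> I"
    using frac_eq_iff[OF assms(2,4)] assms(6) by blast
  have "(v * b * t') * (u * (a * s' - a' * s)) + (u * a' * s) * (v * (b * t' - b' * t)) \<in> I"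
    by (rule ideal_set_lin[OF I u(2) v(2)])
  then have "(u * v) * ((a * b) * (s' * t') - (a' * b') * (s * t)) \<in> I" by (simp add: algebra_simps)
  then show ?thesis using frac_eq_iff[OF mult_M[OF assms(1,2)] mult_M[OF assms(3,4)]] mult_M[OF u(1) v(1)] by blast
qed

lemma frac_add_wd:
  assumes "s \<in> M" "t \<in> M" "s' \<in> M" "t' \<in> M" "frac a s = frac a' s'" "frac b t = frac b' t'"
  shows "frac (a * t + b * s) (s * t) = frac (a' * t' + b' * s') (s' * t')"
proof -
  obtain u where u: "u \<in> M" "u * (a * s' - a' * s) \<in> I"
    using frac_eq_iff[OF assms(1,3)] assms(5) by blast
  obtain v where v: "v \<in> M" "v * (b * t' - b' * t) \<in> I"
    using frac_eq_iff[OF assms(2,4)] assms(6) by blast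
  have "(v * t * t') * (u * (a * s' - a' * s)) + (u * s * s') * (v * (b * t' - b' * t)) \<in> I"
    by (rule ideal_set_lin[OF I u(2) v(2)])
  then have "(u * v) * ((a * t + b * s) * (s' * t') - (a' * t' + b' * s') * (s * t)) \<in> I"
    by (simp add: algebra_simps)
  then show ?thesis using frac_eq_iff[OF mult_M[OF assms(1,2)] mult_M[OF assms(3,4)]] mult_M[OF u(1) v(1)] by blast
qed

lemma frac_mult:
  assumes "s \<in> M" "t \<in> M"
  shows "frac a s \<otimes>\<^bsub>L\<^esub> frac b t = frac (a * b) (s * t)"
proof -
  have "(case q of (b', t') \<Rightarrow> fraction R (cl ` M) (fst p \<otimes>\<^bsub>R\<^esub> b') (snd p \<otimes>\<^bsub>R\<^esub> t')) = frac (a * b) (s * t)"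
    if p: "p \<in> frac a s" and q: "q \<in> frac b t" for p q
  proof -
    obtain a' s' where a': "p = (cl a', cl s')" "s' \<in> M" "frac a' s' = frac a s" using frac_mem[OF p assms(1)] by auto
    obtain b' t' where b': "q = (cl b', cl t')" "t' \<in> M" "frac b' t' = frac b t" using frac_mem[OF q assms(2)] by auto
    have "frac (a' * b') (s' * t') = frac (a * b) (s * t)"
      using frac_mult_wd[OF a'(2) b'(2) assms a'(3) b'(3)] .
    then show ?thesis using a'(1) b'(1) by (simp add: cl_mult frac_def[symmetric])
  qed
  then have "(\<Union>(a', s')\<in>frac a s. \<Union>(b', t')\<in>frac b t.
      fraction R (cl ` M) (a' \<otimes>\<^bsub>R\<^esub> b') (s' \<otimes>\<^bsub>R\<^esub> t')) = frac (a * b) (s * t)"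
    using frac_self[OF assms(1), of a] frac_self[OF assms(2), of b]
    by (intro UN_const) (auto simp: case_prod_beta intro!: UN_const)
  then show ?thesis by (simp add: localization_def)
qed

lemma frac_add:
  assumes "s \<in> M" "t \<in> M"
  shows "frac a s \<oplus>\<^bsub>L\<^esub> frac b t = frac (a * t + b * s) (s * t)"
proof -
  have "(case q of (b', t') \<Rightarrow> fraction R (cl ` M) (fst p \<otimes>\<^bsub>R\<^esub> t' \<oplus>\<^bsub>R\<^esub> b' \<otimes>\<^bsub>R\<^esub> snd p) (snd p \<otimes>\<^bsub>R\<^esub> t'))
      = frac (a * t + b * s) (s * t)"
    if p: "p \<in> frac a s" and q: "q \<in> frac b t" for p q
  proof -
    obtain a' s' where a': "p = (cl a', cl s')" "s' \<in> M" "frac a' s' = frac a s" using frac_mem[OF p assms(1)] by auto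
    obtain b' t' where b': "q = (cl b', cl t')" "t' \<in> M" "frac b' t' = frac b t" using frac_mem[OF q assms(2)] by auto
    have "frac (a' * t' + b' * s') (s' * t') = frac (a * t + b * s) (s * t)"
      using frac_add_wd[OF a'(2) b'(2) assms a'(3) b'(3)] .
    then show ?thesis using a'(1) b'(1) by (simp add: cl_mult cl_add frac_def[symmetric])
  qed
  then have "(\<Union>(a', s')\<in>frac a s. \<Union>(b', t')\<in>frac b t.
      fraction R (cl ` M) (a' \<otimes>\<^bsub>R\<^esub> t' \<oplus>\<^bsub>R\<^esub> b' \<otimes>\<^bsub>R\<^esub> s') (s' \<otimes>\<^bsub>R\<^esub> t')) = frac (a * t + b * s) (s * t)"
    using frac_self[OF assms(1), of a] frac_self[OF assms(2), of b]
    by (intro UN_const) (auto simp: case_prod_beta intro!: UN_const)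
  then show ?thesis by (simp add: localization_def)
qed

lemma frac_one: "\<one>\<^bsub>L\<^esub> = frac 1 1" and frac_zero: "\<zero>\<^bsub>L\<^esub> = frac 0 1"
  by (simp_all add: localization_def frac_def cl_one cl_zero)

lemma L_cring: "cring L"
proof (rule cringI)
  have E: "\<exists>a s. x = frac a s \<and> s \<in> M" if "x \<in> carrier L" for x using that by (auto simp: carrier_L)
  have F: "frac a s \<in> carrier L" if "s \<in> M" for a s using that by (auto simp: carrier_L)
  show "abelian_group L"
  proof (rule abelian_groupI)
    fix x y assume "x \<in> carrier L" "y \<in> carrier L"
    then obtain a s b t where x: "x = frac a s" "s \<in> M" and y: "y = frac b t" "t \<in> M" using E by metis
    show "x \<oplus>\<^bsub>L\<^esub> y \<in> carrier L" using x y by (simp add: frac_add F mult_M)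
    show "x \<oplus>\<^bsub>L\<^esub> y = y \<oplus>\<^bsub>L\<^esub> x" using x y by (simp add: frac_add mult.commute add.commute)
    fix z assume "z \<in> carrier L"
    then obtain c u where z: "z = frac c u" "u \<in> M" using E by metis
    show "x \<oplus>\<^bsub>L\<^esub> y \<oplus>\<^bsub>L\<^esub> z = x \<oplus>\<^bsub>L\<^esub> (y \<oplus>\<^bsub>L\<^esub> z)"
      using x y z by (simp add: frac_add mult_M algebra_simps)
  next
    show "\<zero>\<^bsub>L\<^esub> \<in> carrier L" by (simp add: frac_zero F one_M)
    fix x assume "x \<in> carrier L"
    then obtain a s where x: "x = frac a s" "s \<in> M" using E by metis
    show "\<zero>\<^bsub>L\<^esub> \<oplus>\<^bsub>L\<^esub> x = x" using x one_M by (simp add: frac_zero frac_add)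
    show "\<exists>y\<in>carrier L. y \<oplus>\<^bsub>L\<^esub> x = \<zero>\<^bsub>L\<^esub>"
    proof (rule bexI)
      show "frac (- a) s \<oplus>\<^bsub>L\<^esub> x = \<zero>\<^bsub>L\<^esub>"
        using x one_M mult_M I by (simp add: frac_zero frac_add frac_eqI ideal_set_zero)
    qed (use x F in simp)
  qed
  show "Group.comm_monoid L"
  proof (rule comm_monoidI)
    fix x y assume "x \<in> carrier L" "y \<in> carrier L"
    then obtain a s b t where x: "x = frac a s" "s \<in> M" and y: "y = frac b t" "t \<in> M" using E by metis
    show "x \<otimes>\<^bsub>L\<^esub> y \<in> carrier L" using x y by (simp add: frac_mult F mult_M)
    show "x \<otimes>\<^bsub>L\<^esub> y = y \<otimes>\<^bsub>L\<^esub> x" using x y by (simp add: frac_mult mult.commute)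
    fix z assume "z \<in> carrier L"
    then obtain c u where z: "z = frac c u" "u \<in> M" using E by metis
    show "x \<otimes>\<^bsub>L\<^esub> y \<otimes>\<^bsub>L\<^esub> z = x \<otimes>\<^bsub>L\<^esub> (y \<otimes>\<^bsub>L\<^esub> z)"
      using x y z by (simp add: frac_mult mult_M ac_simps)
  next
    show "\<one>\<^bsub>L\<^esub> \<in> carrier L" by (simp add: frac_one F one_M)
    fix x assume "x \<in> carrier L"
    then obtain a s where x: "x = frac a s" "s \<in> M" using E by metis
    show "\<one>\<^bsub>L\<^esub> \<otimes>\<^bsub>L\<^esub> x = x" using x one_M by (simp add: frac_one frac_mult)
  qed
  fix x y z assume "x \<in> carrier L" "y \<in> carrier L" "z \<in> carrier L"
  then obtain a s b t c u where x: "x = frac a s" "s \<in> M" and y: "y = frac b t" "t \<in> M" and z: "z = frac c u" "u \<in> M"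
    using E by metis
  have "frac ((a * t + b * s) * c) (s * t * u) = frac (a * c * (t * u) + b * c * (s * u)) (s * u * (t * u))"
    using x y z I by (intro frac_eqI) (simp_all add: mult_M algebra_simps ideal_set_zero)
  then show "(x \<oplus>\<^bsub>L\<^esub> y) \<otimes>\<^bsub>L\<^esub> z = x \<otimes>\<^bsub>L\<^esub> z \<oplus>\<^bsub>L\<^esub> y \<otimes>\<^bsub>L\<^esub> z"
    using x y z by (simp add: frac_mult frac_add mult_M)
qed

lemma frac_hom: "(\<lambda>a. frac a 1) \<in> ring_hom type_ring L"
  by (rule ring_hom_memI) (use one_M in \<open>auto simp: frac_mult frac_add frac_one carrier_L\<close>)

lemma frac_decompose:
  assumes "s \<in> M" shows "frac a s = frac a 1 \<otimes>\<^bsub>L\<^esub> frac 1 s" "frac a 1 = frac a s \<otimes>\<^bsub>L\<^esub> frac s 1"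
proof -
  show "frac a s = frac a 1 \<otimes>\<^bsub>L\<^esub> frac 1 s" using assms one_M by (simp add: frac_mult)
  have "frac a 1 = frac (a * s) (s * 1)"
    using assms one_M I by (intro frac_eqI) (auto simp: ideal_set_zero)
  then show "frac a 1 = frac a s \<otimes>\<^bsub>L\<^esub> frac s 1" using assms one_M by (simp add: frac_mult)
qed

lemma L_noetherian:
  assumes n: "noetherian_above I" shows "noetherian_ring L"
proof (rule noetherian_ring_if_above[OF frac_hom L_cring n])
  show "frac a 1 = \<zero>\<^bsub>L\<^esub>" if "a \<in> I" for a using that one_M by (simp add: frac_zero frac_eqI)
  fix y assume "y \<in> carrier L"
  then obtain a s where "y = frac a s" "s \<in> M" by (auto simp: carrier_L)
  show "\<exists>a. \<exists>v\<in>carrier L. \<exists>w\<in>carrier L. y = frac a 1 \<otimes>\<^bsub>L\<^esub> v \<and> frac a 1 = y \<otimes>\<^bsub>L\<^esub> w"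
  proof (rule exI[of _ a], rule bexI[of _ "frac 1 s"], rule bexI[of _ "frac s 1"], rule conjI)
    show "y = frac a 1 \<otimes>\<^bsub>L\<^esub> frac 1 s" "frac a 1 = y \<otimes>\<^bsub>L\<^esub> frac s 1"
      using frac_decompose[OF \<open>s \<in> M\<close>, of a] \<open>y = frac a s\<close> by simp_all
    show "frac 1 s \<in> carrier L" "frac s 1 \<in> carrier L" using \<open>s \<in> M\<close> one_M unfolding carrier_L by blast+
  qed
qed

lemma R_noetherian:
  assumes n: "noetherian_above I" shows "noetherian_ring R"
proof (rule noetherian_ring_if_above[OF cl_hom R_cring n])
  show "cl a = \<zero>\<^bsub>R\<^esub>" if "a \<in> I" for a using that by (simp add: cl_zero_iff)
  interpret R: cring R by (rule R_cring)
  fix y assume y: "y \<in> carrier R"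
  then obtain a where "y = cl a" by (auto simp: carrier_R)
  then show "\<exists>a. \<exists>v\<in>carrier R. \<exists>w\<in>carrier R. y = cl a \<otimes>\<^bsub>R\<^esub> v \<and> cl a = y \<otimes>\<^bsub>R\<^esub> w"
    using y by (intro exI[of _ a] bexI[of _ "\<one>\<^bsub>R\<^esub>"]) auto
qed

lemma frac_mem_prime_iff:
  assumes p: "ideal_set p" "I \<subseteq> p" "M = - p" and s: "s \<in> M"
  shows "frac a s \<in> {frac a s |a s. a \<in> p \<and> s \<in> M} \<longleftrightarrow> a \<in> p"
proof
  assume "frac a s \<in> {frac a s |a s. a \<in> p \<and> s \<in> M}"
  then obtain b t where b: "frac a s = frac b t" "b \<in> p" "t \<in> M" by auto
  then obtain u where u: "u \<in> M" "u * (a * t - b * s) \<in> I" using frac_eq_iff[OF s b(3)] by blast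
  have "1 * (u * (a * t - b * s)) + (u * s) * b \<in> p"
    using u(2) p(2) by (intro ideal_set_lin[OF p(1) _ b(2)]) auto
  then have "(u * t) * a \<in> p" by (simp add: algebra_simps)
  then show "a \<in> p" using mult_M[of "u * t" a] mult_M[OF u(1) b(3)] p(3) by auto
qed (use s in auto)

text \<open>The set \<open>M\<close> is the complement of \<open>p\<close>, so \<open>p\<close> is prime, and the fractions with numerator in \<open>p\<close> form the
ideal of nonunits.\<close>

lemma L_prime_ideal:
  assumes p: "ideal_set p" "I \<subseteq> p" "M = - p"
  shows "ideal {frac a s |a s. a \<in> p \<and> s \<in> M} L" "{frac a s |a s. a \<in> p \<and> s \<in> M} \<noteq> carrier L"
    "\<And>x. x \<in> carrier L \<Longrightarrow> x \<notin> {frac a s |a s. a \<in> p \<and> s \<in> M} \<Longrightarrow> \<exists>y\<in>carrier L. x \<otimes>\<^bsub>L\<^esub> y = \<one>\<^bsub>L\<^esub>"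
proof -
  let ?N = "{frac a s |a s. a \<in> p \<and> s \<in> M}"
  interpret L: cring L by (rule L_cring)
  have NL: "?N \<subseteq> carrier L" by (auto simp: carrier_L)
  show "ideal ?N L"
  proof (rule idealI)
    show "ring L" by (rule L.ring_axioms)
    show "subgroup ?N (add_monoid L)"
    proof (rule group.subgroupI[OF L.a_group])
      show "?N \<subseteq> carrier (add_monoid L)" using NL by simp
      have "0 \<in> p" using p by (simp add: ideal_set_zero)
      then show "?N \<noteq> {}" using one_M by auto
      fix x assume "x \<in> ?N"
      then obtain a s where x: "x = frac a s" "a \<in> p" "s \<in> M" by auto
      have "frac (- a) s \<oplus>\<^bsub>L\<^esub> x = \<zero>\<^bsub>L\<^esub>"
        using x one_M mult_M I by (simp add: frac_zero frac_add frac_eqI ideal_set_zero)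
      then have "\<ominus>\<^bsub>L\<^esub> x = frac (- a) s"
        using x L.minus_equality[of "frac (- a) s" x] by (auto simp: carrier_L)
      then show "inv\<^bsub>add_monoid L\<^esub> x \<in> ?N"
        using x ideal_set_uminus[OF p(1) x(2)] unfolding a_inv_def[symmetric] by auto
      fix y assume "y \<in> ?N"
      then obtain b t where y: "y = frac b t" "b \<in> p" "t \<in> M" by auto
      have "a * t + b * s \<in> p" using x y p(1) by (intro ideal_set_add ideal_set_mult2)
      then show "x \<otimes>\<^bsub>add_monoid L\<^esub> y \<in> ?N" using x y mult_M by (auto simp: frac_add)
    qed
    fix x y assume "x \<in> ?N" "y \<in> carrier L"
    then obtain a s b t where x: "x = frac a s" "a \<in> p" "s \<in> M" and y: "y = frac b t" "t \<in> M"
      by (auto simp: carrier_L)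
    have "b * a \<in> p" "a * b \<in> p" using x p by (auto intro: ideal_set_mult ideal_set_mult2)
    then show "y \<otimes>\<^bsub>L\<^esub> x \<in> ?N" "x \<otimes>\<^bsub>L\<^esub> y \<in> ?N" using x y mult_M by (auto simp: frac_mult)
  qed
  have "frac 1 1 \<notin> ?N" using frac_mem_prime_iff[OF p one_M, of 1] one_M p(3) by blast
  moreover have "frac 1 1 \<in> carrier L" using one_M by (auto simp: carrier_L)
  ultimately show "?N \<noteq> carrier L" by metis
  fix x assume "x \<in> carrier L" "x \<notin> ?N"
  then obtain a s where x: "x = frac a s" "s \<in> M" by (auto simp: carrier_L)
  have aM: "a \<in> M" using \<open>x \<notin> ?N\<close> x p(3) by blast
  have "frac a s \<otimes>\<^bsub>L\<^esub> frac s a = \<one>\<^bsub>L\<^esub>"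
    using x aM one_M I by (simp add: frac_mult frac_one frac_eqI mult_M ideal_set_zero mult.commute)
  moreover have "frac s a \<in> carrier L" using aM unfolding carrier_L by blast
  ultimately show "\<exists>y\<in>carrier L. x \<otimes>\<^bsub>L\<^esub> y = \<one>\<^bsub>L\<^esub>" using x by blast
qed

end

section \<open>Forms and homogeneous ideals\<close>

definition mdeg :: "('n::finite \<Rightarrow>\<^sub>0 nat) \<Rightarrow> nat" where
  "mdeg m = (\<Sum>i\<in>UNIV. Poly_Mapping.lookup m i)"

lemma mdeg_add: "mdeg (a + b) = mdeg a + mdeg b"
  by (simp add: mdeg_def lookup_add sum.distrib)

lemma mdeg_zero [simp]: "mdeg 0 = 0"
  by (simp add: mdeg_def)

lemma mdeg_single [simp]: "mdeg (Poly_Mapping.single i k) = k"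
  by (simp add: mdeg_def lookup_single when_def)

lemma mdeg_eq_0_iff: "mdeg m = 0 \<longleftrightarrow> m = 0"
  by (auto simp: mdeg_def poly_mapping_eq_iff fun_eq_iff)

lemma finite_mdeg_le: "finite {m :: 'n::finite \<Rightarrow>\<^sub>0 nat. mdeg m \<le> d}"
proof (rule finite_imageD)
  show "inj_on Poly_Mapping.lookup {m :: 'n \<Rightarrow>\<^sub>0 nat. mdeg m \<le> d}"
    by (intro inj_onI poly_mapping_eqI) simp
  have "Poly_Mapping.lookup ` {m :: 'n \<Rightarrow>\<^sub>0 nat. mdeg m \<le> d} \<subseteq> PiE UNIV (\<lambda>_. {..d})"
  proof (rule image_subsetI)
    fix m :: "'n \<Rightarrow>\<^sub>0 nat" assume m: "m \<in> {m. mdeg m \<le> d}"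
    have "Poly_Mapping.lookup m i \<le> mdeg m" for i
      unfolding mdeg_def by (rule member_le_sum) auto
    then show "Poly_Mapping.lookup m \<in> PiE UNIV (\<lambda>_. {..d})" using m by (auto intro: order_trans)
  qed
  then show "finite (Poly_Mapping.lookup ` {m :: 'n \<Rightarrow>\<^sub>0 nat. mdeg m \<le> d})"
    by (rule finite_subset) (simp add: finite_PiE)
qed

lemma forms_iff: "F \<in> forms n \<longleftrightarrow> (\<forall>m. Poly_Mapping.lookup F m \<noteq> 0 \<longrightarrow> mdeg m = n)"
  by (auto simp: forms_def mdeg_def in_keys_iff)

definition cst :: "'k::field \<Rightarrow> ('n::finite, 'k) mpoly" where
  "cst c = Poly_Mapping.single 0 c"

definition scl :: "'k::field \<Rightarrow> ('n::finite, 'k) mpoly \<Rightarrow> ('n, 'k) mpoly" where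
  "scl c F = cst c * F"

definition vr :: "'n::finite \<Rightarrow> ('n, 'k::field) mpoly" where
  "vr i = Poly_Mapping.single (Poly_Mapping.single i 1) 1"

lemma cst_add: "cst (a + b) = cst a + cst b"
  and cst_mult: "cst (a * b) = cst a * cst b"
  and cst_one: "cst 1 = 1" and cst_zero: "cst 0 = 0"
  by (simp_all add: cst_def single_add mult_single)

global_interpretation mp: comm_algebra "scl :: 'k::field \<Rightarrow> ('n::finite, 'k) mpoly \<Rightarrow> _"
  by unfold_locales (auto simp: scl_def cst_add cst_mult cst_one algebra_simps)

global_interpretation mpc: comm_algebra_closed "scl :: 'k::alg_closed_field \<Rightarrow> ('n::finite, 'k) mpoly \<Rightarrow> _"
  by unfold_locales

lemma lookup_scl [simp]: "Poly_Mapping.lookup (scl c F) m = c * Poly_Mapping.lookup F m"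
proof -
  have "scl c F = Poly_Mapping.map ((*) c) F"
    by (simp add: scl_def cst_def mult_map_scale_conv_mult)
  then show ?thesis by (simp add: Poly_Mapping.map.rep_eq when_def)
qed

lemma scl_one: "scl c 1 = cst c"
  by (simp add: scl_def)

lemma sum_monomials: "(\<Sum>m\<in>Poly_Mapping.keys F. Poly_Mapping.single m (Poly_Mapping.lookup F m)) = F"
  by (rule poly_mapping_eqI) (auto simp: lookup_sum lookup_single when_def in_keys_iff)

lemma forms_zero: "0 \<in> forms n"
  and forms_add: "F \<in> forms n \<Longrightarrow> G \<in> forms n \<Longrightarrow> F + G \<in> forms n"
  and forms_scl: "F \<in> forms n \<Longrightarrow> scl c F \<in> forms n"
  and forms_uminus: "F \<in> forms n \<Longrightarrow> - F \<in> forms n"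
     apply (simp add: forms_iff)
    apply (auto simp: forms_iff lookup_add)[1]
    apply (metis add.left_neutral)
   apply (auto simp: forms_iff)
  done

lemma forms_subspace: "mp.subspace (forms n)"
  by (rule mp.subspaceI) (auto simp: forms_zero forms_add forms_scl)

lemma forms_diff: "F \<in> forms n \<Longrightarrow> G \<in> forms n \<Longrightarrow> F - G \<in> forms n"
  using forms_add[of F n "- G"] forms_uminus[of G n] by simp

lemma forms_mult: "F \<in> forms m \<Longrightarrow> G \<in> forms n \<Longrightarrow> F * G \<in> forms (m + n)"
  using keys_mult[of F G] by (fastforce simp: forms_def mdeg_def[symmetric] mdeg_add)

lemma cst_forms: "cst c \<in> forms 0"
  by (auto simp: cst_def forms_iff lookup_single when_def)

lemma one_forms: "1 \<in> forms 0"
  using cst_forms[of 1] by (simp add: cst_one)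

lemma forms_0_cst: "F \<in> forms 0 \<Longrightarrow> F = cst (Poly_Mapping.lookup F 0)"
  by (rule poly_mapping_eqI) (auto simp: forms_iff mdeg_eq_0_iff cst_def lookup_single when_def)

lemma forms_power: "F \<in> forms m \<Longrightarrow> F ^ k \<in> forms (m * k)"
  by (induction k) (auto simp: one_forms intro: forms_mult)

lemma forms_power1: "F \<in> forms 1 \<Longrightarrow> F ^ k \<in> forms k"
  using forms_power[of F 1 k] by simp

lemma vr_forms: "vr i \<in> forms 1"
  by (auto simp: vr_def forms_iff lookup_single when_def split: if_splits)

definition hcomp :: "nat \<Rightarrow> ('n::finite, 'k::field) mpoly \<Rightarrow> ('n, 'k) mpoly" where
  "hcomp n F = Abs_poly_mapping (\<lambda>m. Poly_Mapping.lookup F m when mdeg m = n)"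

lemma lookup_hcomp: "Poly_Mapping.lookup (hcomp n F) m = (if mdeg m = n then Poly_Mapping.lookup F m else 0)"
proof -
  have "finite {m. (Poly_Mapping.lookup F m when mdeg m = n) \<noteq> 0}"
    by (rule finite_subset[OF _ finite_lookup[of F]]) auto
  then show ?thesis by (simp add: hcomp_def when_def)
qed

lemma hcomp_forms: "hcomp n F \<in> forms n"
  by (auto simp: forms_iff lookup_hcomp)

lemma hcomp_add: "hcomp n (F + G) = hcomp n F + hcomp n G"
  and hcomp_scl: "hcomp n (scl c F) = scl c (hcomp n F)"
  and hcomp_diff: "hcomp n (F - G) = hcomp n F - hcomp n G"
  and hcomp_zero: "hcomp n 0 = 0"
  by (rule poly_mapping_eqI, simp add: lookup_hcomp lookup_add lookup_minus)+

lemma hcomp_sum: "hcomp n (sum f A) = (\<Sum>i\<in>A. hcomp n (f i))"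
  by (induction A rule: infinite_finite_induct) (auto simp: hcomp_zero hcomp_add)

lemma hcomp_of_form: "F \<in> forms d \<Longrightarrow> hcomp n F = (if n = d then F else 0)"
  by (rule poly_mapping_eqI) (auto simp: lookup_hcomp forms_iff)

lemma hcomp_decomp: "\<exists>D. (\<forall>n>D. hcomp n F = 0) \<and> F = (\<Sum>n\<le>D. hcomp n F)"
proof -
  define D where "D = Max (insert 0 (mdeg ` Poly_Mapping.keys F))"
  have D: "mdeg m \<le> D" if "Poly_Mapping.lookup F m \<noteq> 0" for m
    unfolding D_def using that by (intro Max_ge) (auto simp: in_keys_iff)
  have "hcomp n F = 0" if "n > D" for n
    by (rule poly_mapping_eqI) (use that D in \<open>fastforce simp: lookup_hcomp\<close>)
  moreover have "F = (\<Sum>n\<le>D. hcomp n F)"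
    by (rule poly_mapping_eqI) (use D in \<open>auto simp: lookup_sum lookup_hcomp\<close>)
  ultimately show ?thesis by blast
qed

lemma hcomp_form_mult:
  assumes F: "F \<in> forms d"
  shows "hcomp n (F * G) = (if d \<le> n then F * hcomp (n - d) G else 0)"
proof -
  obtain D where D: "\<forall>n>D. hcomp n G = 0" "G = (\<Sum>j\<le>D. hcomp j G)" using hcomp_decomp by blast
  have "hcomp n (F * G) = (\<Sum>j\<le>D. hcomp n (F * hcomp j G))"
    by (subst D(2)) (simp add: sum_distrib_left hcomp_sum)
  also have "\<dots> = (\<Sum>j\<le>D. if n = d + j then F * hcomp j G else 0)"
    by (intro sum.cong refl hcomp_of_form forms_mult F hcomp_forms)
  also have "\<dots> = (if d \<le> n then F * hcomp (n - d) G else 0)"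
  proof (cases "d \<le> n")
    case True
    then have "(\<Sum>j\<le>D. if n = d + j then F * hcomp j G else 0) = (\<Sum>j\<le>D. if j = n - d then F * hcomp j G else 0)"
      by (intro sum.cong) auto
    then show ?thesis using True D(1) by (cases "n - d \<le> D") auto
  qed auto
  finally show ?thesis .
qed

lemma hcomp_mult: "hcomp n (F * G) = (\<Sum>i\<le>n. hcomp i F * hcomp (n - i) G)"
proof -
  obtain D where D: "\<forall>n>D. hcomp n F = 0" "F = (\<Sum>j\<le>D. hcomp j F)" using hcomp_decomp by blast
  have "hcomp n (F * G) = (\<Sum>i\<le>D. hcomp n (hcomp i F * G))"
    by (subst D(2)) (simp add: sum_distrib_right hcomp_sum)
  also have "\<dots> = (\<Sum>i\<le>D. if i \<le> n then hcomp i F * hcomp (n - i) G else 0)"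
    by (intro sum.cong refl hcomp_form_mult hcomp_forms)
  also have "\<dots> = (\<Sum>i\<in>{..D} \<inter> {..n}. hcomp i F * hcomp (n - i) G)"
    by (subst sum.inter_restrict) auto
  also have "\<dots> = (\<Sum>i\<le>n. hcomp i F * hcomp (n - i) G)"
  proof (rule sum.mono_neutral_left)
    show "\<forall>i\<in>{..n} - {..D} \<inter> {..n}. hcomp i F * hcomp (n - i) G = 0" using D(1) by force
  qed auto
  finally show ?thesis .
qed

lemma single_split:
  assumes "Poly_Mapping.lookup m i > 0"
  shows "\<exists>m'. Poly_Mapping.single m c = vr i * Poly_Mapping.single m' c \<and> mdeg m = Suc (mdeg m')"
proof -
  define m' where "m' = m - Poly_Mapping.single i 1"
  have m: "m = Poly_Mapping.single i 1 + m'"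
    by (rule poly_mapping_eqI) (use assms in \<open>auto simp: m'_def lookup_add lookup_minus lookup_single when_def\<close>)
  have "Poly_Mapping.single m c = vr i * Poly_Mapping.single m' c"
    by (simp add: vr_def mult_single m del: One_nat_def)
  moreover have "mdeg m = Suc (mdeg m')" using mdeg_add[of "Poly_Mapping.single i 1" m'] unfolding m by simp
  ultimately show ?thesis by blast
qed

lemma forms_Suc_induct:
  assumes F: "F \<in> forms (Suc n)" and zero: "0 \<in> K" and add: "\<And>a b. a \<in> K \<Longrightarrow> b \<in> K \<Longrightarrow> a + b \<in> K"
    and var: "\<And>i G. G \<in> forms n \<Longrightarrow> vr i * G \<in> K"
  shows "F \<in> K"
proof -
  have sumK: "sum f A \<in> K" if "\<And>i. i \<in> A \<Longrightarrow> f i \<in> K" for f and A :: "('a \<Rightarrow>\<^sub>0 nat) set"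
    using that by (induction A rule: infinite_finite_induct) (auto simp: zero add)
  have "(\<Sum>m\<in>Poly_Mapping.keys F. Poly_Mapping.single m (Poly_Mapping.lookup F m)) \<in> K"
  proof (rule sumK)
    fix m assume "m \<in> Poly_Mapping.keys F"
    then have "mdeg m = Suc n" using F by (simp add: forms_iff in_keys_iff)
    then have "mdeg m \<noteq> 0" by simp
    then obtain i where "Poly_Mapping.lookup m i > 0" by (auto simp: mdeg_def)
    then obtain m' where m': "Poly_Mapping.single m (Poly_Mapping.lookup F m) = vr i * Poly_Mapping.single m' (Poly_Mapping.lookup F m)"
      "mdeg m = Suc (mdeg m')" using single_split by blast
    then have "Poly_Mapping.single m' (Poly_Mapping.lookup F m) \<in> forms n"
      using \<open>mdeg m = Suc n\<close> by (auto simp: forms_iff lookup_single when_def)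
    then show "Poly_Mapping.single m (Poly_Mapping.lookup F m) \<in> K" using var m'(1) by simp
  qed
  then show ?thesis by (simp add: sum_monomials)
qed

definition hom_ideal :: "('n::finite, 'k::field) mpoly set \<Rightarrow> bool" where
  "hom_ideal K \<longleftrightarrow> ideal_set K \<and> (\<forall>F\<in>K. \<forall>n. hcomp n F \<in> K)"

lemma hom_ideal_memI:
  assumes "ideal_set K" "\<And>n. hcomp n F \<in> K" shows "F \<in> K"
proof -
  obtain D where D: "F = (\<Sum>n\<le>D. hcomp n F)" using hcomp_decomp by blast
  have "(\<Sum>n\<le>D. hcomp n F) \<in> K" using assms by (intro ideal_set_sum)
  then show ?thesis using D by simp
qed

lemma hom_part_ideal:
  assumes "ideal_set K" shows "ideal_set {F. \<forall>n. hcomp n F \<in> K}"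
  unfolding ideal_set_def
  using assms by (auto simp: hcomp_zero hcomp_add hcomp_mult ideal_set_zero ideal_set_add
      intro!: ideal_set_sum ideal_set_mult)

lemma homogeneous_ideal_iff: "homogeneous_ideal poly_ring forms K \<longleftrightarrow> hom_ideal K"
proof
  interpret P: cring "poly_ring :: ('a, 'b) mpoly ring" by (rule type_ring_cring)
  assume "homogeneous_ideal poly_ring forms K"
  then have K: "ideal_set K" "genideal poly_ring (K \<inter> (\<Union>n. forms n)) = K"
    by (auto simp: homogeneous_ideal_def ideal_type_ring_iff)
  have "K \<inter> (\<Union>n. forms n) \<subseteq> {F. \<forall>n. hcomp n F \<in> K}"
    using K(1) by (auto simp: hcomp_of_form ideal_set_zero)
  then have "genideal poly_ring (K \<inter> (\<Union>n. forms n)) \<subseteq> {F. \<forall>n. hcomp n F \<in> K}"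
    using hom_part_ideal[OF K(1)] by (intro P.genideal_minimal) (auto simp: ideal_type_ring_iff)
  then show "hom_ideal K" using K by (auto simp: hom_ideal_def)
next
  interpret P: cring "poly_ring :: ('a, 'b) mpoly ring" by (rule type_ring_cring)
  assume "hom_ideal K"
  then have K: "ideal_set K" "\<And>F n. F \<in> K \<Longrightarrow> hcomp n F \<in> K" by (auto simp: hom_ideal_def)
  let ?G = "genideal poly_ring (K \<inter> (\<Union>n. forms n))"
  have G: "ideal ?G poly_ring" by (rule P.genideal_ideal) simp
  have "?G \<subseteq> K" using K(1) by (intro P.genideal_minimal) (auto simp: ideal_type_ring_iff)
  moreover have "K \<subseteq> ?G"
  proof
    fix F assume "F \<in> K"
    have "hcomp n F \<in> ?G" for n
    proof -
      have "hcomp n F \<in> K \<inter> (\<Union>n. forms n)" using K(2)[OF \<open>F \<in> K\<close>] hcomp_forms[of n F] by blast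
      then show ?thesis using P.genideal_self[of "K \<inter> (\<Union>n. forms n)"] by auto
    qed
    then show "F \<in> ?G" using G hom_ideal_memI by (auto simp: ideal_type_ring_iff)
  qed
  ultimately show "homogeneous_ideal poly_ring forms K"
    using K(1) by (auto simp: homogeneous_ideal_def ideal_type_ring_iff)
qed

lemma hom_ideal_colon:
  assumes K: "hom_ideal K" and F: "F \<in> forms d" shows "hom_ideal {G. G * F \<in> K}"
  unfolding hom_ideal_def
proof (intro conjI ballI allI)
  show "ideal_set {G. G * F \<in> K}" using K by (intro ideal_set_colon) (simp add: hom_ideal_def)
  fix G n assume "G \<in> {G. G * F \<in> K}"
  then have "hcomp (d + n) (F * G) \<in> K" using K by (auto simp: hom_ideal_def mult.commute)
  then show "hcomp n G \<in> {G. G * F \<in> K}" using hcomp_form_mult[OF F, of "d + n" G] by (simp add: mult.commute)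
qed

lemma hom_ideal_plus_principal:
  assumes K: "hom_ideal K" and F: "F \<in> forms d" shows "hom_ideal {G. \<exists>H. G - H * F \<in> K}"
  unfolding hom_ideal_def
proof (intro conjI ballI allI)
  show "ideal_set {G. \<exists>H. G - H * F \<in> K}" using K by (intro ideal_set_plus_principal) (simp add: hom_ideal_def)
  fix G n assume "G \<in> {G. \<exists>H. G - H * F \<in> K}"
  then obtain H where "G - F * H \<in> K" by (auto simp: mult.commute)
  then have "hcomp n (G - F * H) \<in> K" using K by (auto simp: hom_ideal_def)
  then have h: "hcomp n G - (if d \<le> n then F * hcomp (n - d) H else 0) \<in> K"
    by (simp add: hcomp_diff hcomp_form_mult[OF F])
  show "hcomp n G \<in> {G. \<exists>H. G - H * F \<in> K}"
  proof (cases "d \<le> n")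
    case True
    then show ?thesis using h by (auto simp: mult.commute)
  next
    case False
    then show ?thesis using h by (auto intro!: exI[of _ 0])
  qed
qed

text \<open>If \<open>p\<close> and \<open>q\<close> are the highest degrees in which \<open>F\<close> and \<open>G\<close> have a component outside \<open>K\<close>, then the product
of these two components is the only summand in degree \<open>p + q\<close> of \<open>F G\<close> that might be outside \<open>K\<close>.\<close>

lemma hom_ideal_prime:
  assumes K: "hom_ideal K"
    and pr: "\<And>m n F G. F \<in> forms m \<Longrightarrow> G \<in> forms n \<Longrightarrow> F * G \<in> K \<Longrightarrow> F \<in> K \<or> G \<in> K"
    and FG: "F * G \<in> K"
  shows "F \<in> K \<or> G \<in> K"
proof (rule ccontr)
  assume n: "\<not> (F \<in> K \<or> G \<in> K)"
  have KI: "ideal_set K" using K by (simp add: hom_ideal_def)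
  have ex: "\<exists>p. hcomp p F \<notin> K \<and> (\<forall>i>p. hcomp i F \<in> K)" if "F \<notin> K" for F
  proof -
    obtain D where D: "\<forall>n>D. hcomp n F = 0" using hcomp_decomp[of F] by blast
    have "\<not> (\<forall>n. hcomp n F \<in> K)" using hom_ideal_memI[OF KI, of F] that by auto
    then obtain q where q: "hcomp q F \<notin> K" by auto
    have bound: "i \<le> D" if "hcomp i F \<notin> K" for i
    proof (rule ccontr)
      assume "\<not> i \<le> D"
      then have "hcomp i F = 0" using D by simp
      then show False using that KI by (simp add: ideal_set_zero)
    qed
    define p where "p = Greatest (\<lambda>i. hcomp i F \<notin> K)"
    have "hcomp p F \<notin> K" unfolding p_def using GreatestI_nat[of "\<lambda>i. hcomp i F \<notin> K" q D] q bound by blast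
    moreover have "hcomp i F \<in> K" if "i > p" for i
      using Greatest_le_nat[of "\<lambda>i. hcomp i F \<notin> K" i D] bound that unfolding p_def by fastforce
    ultimately show ?thesis by blast
  qed
  obtain p where p: "hcomp p F \<notin> K" "\<And>i. i > p \<Longrightarrow> hcomp i F \<in> K" using ex[of F] n by blast
  obtain q where q: "hcomp q G \<notin> K" "\<And>i. i > q \<Longrightarrow> hcomp i G \<in> K" using ex[of G] n by blast
  have tot: "hcomp (p + q) (F * G) \<in> K" using K FG by (auto simp: hom_ideal_def)
  have "(\<Sum>i\<in>{..p+q}-{p}. hcomp i F * hcomp (p + q - i) G) \<in> K"
  proof (rule ideal_set_sum[OF KI])
    fix i assume i: "i \<in> {..p+q}-{p}"
    show "hcomp i F * hcomp (p + q - i) G \<in> K"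
    proof (cases "i > p")
      case True
      then show ?thesis using p(2) KI by (intro ideal_set_mult2) auto
    next
      case False
      then have "p + q - i > q" using i by auto
      then show ?thesis using q(2) KI by (intro ideal_set_mult) auto
    qed
  qed
  moreover have "hcomp (p + q) (F * G) = hcomp p F * hcomp q G + (\<Sum>i\<in>{..p+q}-{p}. hcomp i F * hcomp (p + q - i) G)"
    unfolding hcomp_mult by (subst sum.remove[of _ p]) auto
  ultimately have "hcomp p F * hcomp q G \<in> K"
    using ideal_set_diff[OF KI tot, of "\<Sum>i\<in>{..p+q}-{p}. hcomp i F * hcomp (p + q - i) G"] by simp
  then show False using pr hcomp_forms p(1) q(1) by blast
qed

text \<open>A homogeneous ideal that is maximal among those without powers of \<open>g\<close> is prime.\<close>

lemma homogeneous_prime_avoiding: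
  assumes K: "hom_ideal K" and g: "g \<in> forms e" and pow: "\<And>m. g ^ m \<notin> K"
  shows "\<exists>P. hom_ideal P \<and> K \<subseteq> P \<and> g \<notin> P \<and> (\<forall>F G. F * G \<in> P \<longrightarrow> F \<in> P \<or> G \<in> P)"
proof -
  define \<A> where "\<A> = {P. hom_ideal P \<and> K \<subseteq> P \<and> (\<forall>m. g ^ m \<notin> P)}"
  have "\<exists>P\<in>\<A>. \<forall>Q\<in>\<A>. P \<subseteq> Q \<longrightarrow> Q = P"
  proof (rule subset_Zorn_nonempty)
    show "\<A> \<noteq> {}" using K pow by (auto simp: \<A>_def)
    fix \<C> assume C: "\<C> \<noteq> {}" "subset.chain \<A> \<C>"
    have sub: "\<C> \<subseteq> \<A>" and tot: "\<And>P Q. P \<in> \<C> \<Longrightarrow> Q \<in> \<C> \<Longrightarrow> P \<subseteq> Q \<or> Q \<subseteq> P"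
      using C(2) unfolding subset_chain_def by blast+
    have mem: "hom_ideal P" "K \<subseteq> P" "\<And>m. g ^ m \<notin> P" if "P \<in> \<C>" for P
      using sub that by (auto simp: \<A>_def)
    have common: "\<exists>P\<in>\<C>. a \<in> P \<and> b \<in> P" if "a \<in> \<Union>\<C>" "b \<in> \<Union>\<C>" for a b
    proof -
      obtain P Q where PQ: "P \<in> \<C>" "Q \<in> \<C>" "a \<in> P" "b \<in> Q" using \<open>a \<in> \<Union>\<C>\<close> \<open>b \<in> \<Union>\<C>\<close> by blast
      then show ?thesis using tot[OF PQ(1,2)] by blast
    qed
    have "ideal_set (\<Union>\<C>)" unfolding ideal_set_def
    proof (intro conjI ballI allI)
      show "0 \<in> \<Union>\<C>" using C(1) mem(1) by (auto simp: hom_ideal_def ideal_set_zero)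
      fix a b assume "a \<in> \<Union>\<C>" "b \<in> \<Union>\<C>"
      then obtain P where "P \<in> \<C>" "a \<in> P" "b \<in> P" using common by blast
      then show "a + b \<in> \<Union>\<C>" using mem(1) by (auto simp: hom_ideal_def intro: ideal_set_add)
    next
      fix a x assume "a \<in> \<Union>\<C>"
      then show "x * a \<in> \<Union>\<C>" using mem(1) by (auto simp: hom_ideal_def intro: ideal_set_mult)
    qed
    then have "hom_ideal (\<Union>\<C>)" using mem(1) by (auto simp: hom_ideal_def)
    moreover have "K \<subseteq> \<Union>\<C>" using C(1) mem(2) by blast
    ultimately show "\<Union>\<C> \<in> \<A>" using mem(3) by (auto simp: \<A>_def)
  qed
  then obtain P where P: "P \<in> \<A>" "\<And>Q. Q \<in> \<A> \<Longrightarrow> P \<subseteq> Q \<Longrightarrow> Q = P" by blast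
  have Ph: "hom_ideal P" "K \<subseteq> P" "\<And>m. g ^ m \<notin> P" and PI: "ideal_set P"
    using P(1) by (auto simp: \<A>_def hom_ideal_def)
  have pw: "\<exists>m H. g ^ m - H * F \<in> P" if F: "F \<in> forms d" "F \<notin> P" for F d
  proof (rule ccontr)
    assume n: "\<not> ?thesis"
    let ?Q = "{G. \<exists>H. G - H * F \<in> P}"
    have sub: "P \<subseteq> ?Q" by (auto intro!: exI[of _ 0])
    have "?Q \<in> \<A>" using n hom_ideal_plus_principal[OF Ph(1) F(1)] Ph(2) sub by (auto simp: \<A>_def)
    then have "?Q = P" using P(2) sub by blast
    moreover have "F \<in> ?Q" using PI by (auto intro!: exI[of _ 1] simp: ideal_set_zero)
    ultimately show False using F(2) by blast
  qed
  have "F \<in> P \<or> G \<in> P" if FG: "F \<in> forms m" "G \<in> forms n" "F * G \<in> P" for F G m n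
  proof (rule ccontr)
    assume n: "\<not> ?thesis"
    obtain a H where a: "g ^ a - H * F \<in> P" using pw[OF FG(1)] n by blast
    obtain b H' where b: "g ^ b - H' * G \<in> P" using pw[OF FG(2)] n by blast
    have "g ^ b * (g ^ a - H * F) + (H * F) * (g ^ b - H' * G) \<in> P" by (rule ideal_set_lin[OF PI a b])
    then have "(g ^ b * (g ^ a - H * F) + (H * F) * (g ^ b - H' * G)) + (H * H') * (F * G) \<in> P"
      by (rule ideal_set_add[OF PI]) (rule ideal_set_mult[OF PI FG(3)])
    then have "g ^ (a + b) \<in> P" by (simp add: algebra_simps power_add)
    then show False using Ph(3) by blast
  qed
  then have "\<forall>F G. F * G \<in> P \<longrightarrow> F \<in> P \<or> G \<in> P" using hom_ideal_prime[OF Ph(1)] by blast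
  moreover have "g \<notin> P" using Ph(3)[of 1] by simp
  ultimately show ?thesis using Ph by blast
qed

lemma forms_subset_if_powers:
  assumes K: "ideal_set K" and pow: "\<And>i. \<exists>m. vr i ^ m \<in> (K :: ('n::finite, 'k::field) mpoly set)"
  shows "\<exists>N. forms N \<subseteq> K"
proof -
  obtain m where m: "\<And>i. vr i ^ m i \<in> K" using pow by metis
  define N where "N = (\<Sum>i\<in>UNIV. m i) + 1"
  have "Poly_Mapping.single p c \<in> K" if p: "mdeg p = N" for p c
  proof -
    have "\<exists>i. Poly_Mapping.lookup p i \<ge> m i"
    proof (rule ccontr)
      assume "\<not> ?thesis"
      then have "mdeg p \<le> (\<Sum>i\<in>UNIV. m i)" unfolding mdeg_def by (intro sum_mono) (meson nat_le_linear)
      then show False using p by (simp add: N_def)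
    qed
    then obtain i where i: "Poly_Mapping.lookup p i \<ge> m i" by blast
    have "\<exists>H. Poly_Mapping.single p c = H * vr i ^ k" if "k \<le> Poly_Mapping.lookup p i" for k p
      using that
    proof (induction k arbitrary: p)
      case (Suc k)
      then have pos: "Poly_Mapping.lookup p i > 0" by simp
      define p' where "p' = p - Poly_Mapping.single i 1"
      have pp: "p = Poly_Mapping.single i 1 + p'"
        by (rule poly_mapping_eqI) (use pos in \<open>auto simp: p'_def lookup_add lookup_minus lookup_single when_def\<close>)
      have "k \<le> Poly_Mapping.lookup p' i" using Suc.prems by (simp add: p'_def lookup_minus)
      then obtain H where "Poly_Mapping.single p' c = H * vr i ^ k" using Suc.IH by blast
      moreover have "Poly_Mapping.single p c = vr i * Poly_Mapping.single p' c"
        by (simp add: vr_def mult_single pp del: One_nat_def)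
      ultimately show ?case by (auto intro!: exI[of _ H] simp: ac_simps)
    qed auto
    then obtain H where "Poly_Mapping.single p c = H * vr i ^ m i" using i by blast
    then show ?thesis using ideal_set_mult[OF K m] by simp
  qed
  then have "F \<in> K" if "F \<in> forms N" for F
  proof -
    have "(\<Sum>p\<in>Poly_Mapping.keys F. Poly_Mapping.single p (Poly_Mapping.lookup F p)) \<in> K"
      using that \<open>\<And>p c. mdeg p = N \<Longrightarrow> Poly_Mapping.single p c \<in> K\<close>
      by (intro ideal_set_sum[OF K]) (simp add: forms_iff in_keys_iff)
    then show ?thesis by (simp add: sum_monomials)
  qed
  then show ?thesis by blast
qed

section \<open>Points of a closed subscheme\<close>

text \<open>Over a finite field, the product of all \<open>x - a\<close> plus one has no root.\<close>

lemma alg_closed_infinite: "infinite (UNIV :: 'k::alg_closed_field set)"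
proof
  assume fin: "finite (UNIV :: 'k set)"
  define q where "q = (\<Prod>a\<in>(UNIV :: 'k set). [:- a, 1:])"
  have dq: "degree q = card (UNIV :: 'k set)" unfolding q_def
    by (subst degree_prod_eq_sum_degree) auto
  have "card (UNIV :: 'k set) > 0" using fin by (simp add: card_gt_0_iff)
  then have "degree (q + 1) > 0" using dq by (subst degree_add_eq_left) auto
  then obtain x where "poly (q + 1) x = 0" using alg_closed_imp_poly_has_root by blast
  moreover have "poly q x = 0" unfolding q_def poly_prod using fin by (intro prod_zero) auto
  ultimately show False by simp
qed

locale closed_scheme =
  fixes I :: "('n::finite, 'k::field) mpoly set"
  assumes closed: "closed_subscheme I"
begin

lemma I_hom: "hom_ideal I" and I_saturated: "saturated I"
  using closed by (auto simp: closed_subscheme_def homogeneous_ideal_iff)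

lemma I_ideal: "ideal_set I"
  using I_hom by (simp add: hom_ideal_def)

abbreviation cl :: "('n, 'k) mpoly \<Rightarrow> ('n, 'k) coord" where "cl F \<equiv> I +>\<^bsub>poly_ring\<^esub> F"

lemma coord_ring_eq: "coord_ring I = type_ring Quot I"
  by (simp add: coord_ring_def)

sublocale triv: quotient_localization I "{1}"
  by unfold_locales (auto simp: I_ideal)

lemma cl_preimage_ideal:
  assumes "ideal P (coord_ring I)"
  shows "ideal_set {F. cl F \<in> P}" "I \<subseteq> {F. cl F \<in> P}" "cl ` {F. cl F \<in> P} = P"
proof -
  show "ideal_set {F. cl F \<in> P}"
    using ideal_set_preimage[OF triv.cl_hom triv.R_cring] assms by (simp add: coord_ring_eq)
  have z: "\<zero>\<^bsub>coord_ring I\<^esub> \<in> P" using additive_subgroup.zero_closed[OF ideal.axioms(1)[OF assms]] .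
  show "I \<subseteq> {F. cl F \<in> P}"
  proof
    fix F assume "F \<in> I"
    then have "cl F = \<zero>\<^bsub>coord_ring I\<^esub>" unfolding coord_ring_eq triv.cl_zero_iff .
    then show "F \<in> {F. cl F \<in> P}" using z by simp
  qed
  show "cl ` {F. cl F \<in> P} = P"
    using additive_subgroup.a_subset[OF ideal.axioms(1)[OF assms]] triv.carrier_R by (auto simp: coord_ring_eq)
qed

lemma cl_mem_image_iff:
  assumes "ideal_set p" "I \<subseteq> p" shows "cl F \<in> cl ` p \<longleftrightarrow> F \<in> p"
proof
  assume "cl F \<in> cl ` p"
  then obtain G where G: "G \<in> p" "cl F = cl G" by blast
  then have "F - G \<in> p" using triv.cl_eq_iff assms(2) by blast
  then show "F \<in> p" using ideal_set_add_mem_iff[OF assms(1)] G(1) by blast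
qed auto

lemma cl_image_ideal:
  assumes "ideal_set p" shows "ideal (cl ` p) (coord_ring I)"
  unfolding coord_ring_eq
  by (rule ideal_image[OF triv.cl_hom triv.R_cring _ assms]) (simp add: triv.carrier_R)

text \<open>A point is a prime of the coordinate ring; this is its preimage in the polynomial ring.\<close>

definition pt :: "('n, 'k) coord set \<Rightarrow> ('n, 'k) mpoly set" where
  "pt P = {F. cl F \<in> P}"

lemma pointD:
  assumes "P \<in> points I"
  shows "ideal_set (pt P)" "I \<subseteq> pt P" "1 \<notin> pt P" "\<And>F G. F * G \<in> pt P \<Longrightarrow> F \<in> pt P \<or> G \<in> pt P"
    "\<exists>i. vr i \<notin> pt P"
proof -
  have P: "primeideal P (coord_ring I)" "\<not> (\<Union>n\<in>{1..}. coord_grading I n) \<subseteq> P"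
    using assms by (auto simp: points_def Proj_def)
  interpret P: primeideal P "coord_ring I" by (rule P(1))
  show 1: "ideal_set (pt P)" and "I \<subseteq> pt P" unfolding pt_def using cl_preimage_ideal[OF P.ideal_axioms] by auto
  show "1 \<notin> pt P"
  proof
    assume "1 \<in> pt P"
    then have "\<one>\<^bsub>coord_ring I\<^esub> \<in> P" unfolding coord_ring_eq by (simp add: triv.cl_one pt_def)
    then show False using P.one_imp_carrier P.I_notcarr by blast
  qed
  show "F \<in> pt P \<or> G \<in> pt P" if "F * G \<in> pt P" for F G
    using P.I_prime[of "cl F" "cl G"] that triv.carrier_R
    by (auto simp: pt_def coord_ring_eq triv.cl_mult)
  show "\<exists>i. vr i \<notin> pt P"
  proof (rule ccontr)
    assume n: "\<not> ?thesis"
    have "F \<in> pt P" if "F \<in> forms (Suc m)" for F m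
      using that by (rule forms_Suc_induct) (use n 1 in \<open>auto intro: ideal_set_zero ideal_set_add ideal_set_mult2\<close>)
    then have "\<And>n F. n \<ge> 1 \<Longrightarrow> F \<in> forms n \<Longrightarrow> cl F \<in> P"
      by (metis Suc_pred' less_eq_Suc_le One_nat_def mem_Collect_eq pt_def)
    then have "(\<Union>n\<in>{1..}. coord_grading I n) \<subseteq> P" by (auto simp: coord_grading_def)
    then show False using P(2) by blast
  qed
qed

lemma point_of_prime:
  assumes p: "hom_ideal p" "I \<subseteq> p" "1 \<notin> p" "\<And>F G. F * G \<in> p \<Longrightarrow> F \<in> p \<or> G \<in> p"
    and g: "g \<in> forms e" "e \<ge> 1" "g \<notin> p"
  shows "cl ` p \<in> points I" "pt (cl ` p) = p"
proof -
  have pI: "ideal_set p" using p(1) by (simp add: hom_ideal_def)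
  note mem = cl_mem_image_iff[OF pI p(2)]
  note id = cl_image_ideal[OF pI]
  interpret R: cring "coord_ring I" unfolding coord_ring_eq by (rule triv.R_cring)
  show "pt (cl ` p) = p" using mem by (auto simp: pt_def)
  have "primeideal (cl ` p) (coord_ring I)"
  proof (rule primeidealI[OF id R.cring_axioms])
    show "carrier (coord_ring I) \<noteq> cl ` p"
    proof
      assume "carrier (coord_ring I) = cl ` p"
      then have "cl 1 \<in> cl ` p" using triv.carrier_R by (auto simp: coord_ring_eq)
      then show False using mem p(3) by simp
    qed
    fix x y assume "x \<in> carrier (coord_ring I)" "y \<in> carrier (coord_ring I)" "x \<otimes>\<^bsub>coord_ring I\<^esub> y \<in> cl ` p"
    then obtain F G where "x = cl F" "y = cl G" "cl (F * G) \<in> cl ` p"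
      unfolding coord_ring_eq triv.carrier_R by (auto simp: triv.cl_mult)
    then show "x \<in> cl ` p \<or> y \<in> cl ` p" using p(4) mem by blast
  qed
  moreover have "homogeneous_ideal (coord_ring I) (coord_grading I) (cl ` p)"
    unfolding homogeneous_ideal_def
  proof (intro conjI id equalityI)
    let ?S = "cl ` p \<inter> (\<Union>n. coord_grading I n)"
    have Sc: "?S \<subseteq> carrier (coord_ring I)" using additive_subgroup.a_subset[OF ideal.axioms(1)[OF id]] by blast
    show "genideal (coord_ring I) ?S \<subseteq> cl ` p" by (rule R.genideal_minimal[OF id]) auto
    have gid: "ideal (genideal (coord_ring I) ?S) (coord_ring I)" by (rule R.genideal_ideal[OF Sc])
    show "cl ` p \<subseteq> genideal (coord_ring I) ?S"
    proof (rule image_subsetI)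
      fix F assume F: "F \<in> p"
      have "hcomp n F \<in> {F. cl F \<in> genideal (coord_ring I) ?S}" for n
      proof -
        have "hcomp n F \<in> p" using F p(1) by (simp add: hom_ideal_def)
        then have "cl (hcomp n F) \<in> ?S" using hcomp_forms[of n F] by (auto simp: coord_grading_def)
        then show ?thesis using R.genideal_self[OF Sc] by auto
      qed
      then have "F \<in> {F. cl F \<in> genideal (coord_ring I) ?S}"
        using hom_ideal_memI[OF cl_preimage_ideal(1)[OF gid]] by blast
      then show "cl F \<in> genideal (coord_ring I) ?S" by simp
    qed
  qed
  moreover have "\<not> (\<Union>n\<in>{1..}. coord_grading I n) \<subseteq> cl ` p"
  proof
    assume "(\<Union>n\<in>{1..}. coord_grading I n) \<subseteq> cl ` p"
    moreover have "cl g \<in> (\<Union>n\<in>{1..}. coord_grading I n)" using g by (auto simp: coord_grading_def)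
    ultimately have "cl g \<in> cl ` p" by (rule subsetD)
    then show False using mem g(3) by simp
  qed
  ultimately show "cl ` p \<in> points I" by (simp add: points_def Proj_def)
qed

text \<open>The homogeneous Nullstellensatz, with prime ideals as points.\<close>

lemma power_mem_if_vanishing:
  assumes K: "hom_ideal K" "I \<subseteq> K" and g: "g \<in> forms e" "e \<ge> 1"
    and van: "\<And>P. P \<in> points I \<Longrightarrow> K \<subseteq> pt P \<Longrightarrow> g \<in> pt P"
  shows "\<exists>m. g ^ m \<in> K"
proof (rule ccontr)
  assume "\<not> ?thesis"
  then obtain p where p: "hom_ideal p" "K \<subseteq> p" "g \<notin> p" "\<forall>F G. F * G \<in> p \<longrightarrow> F \<in> p \<or> G \<in> p"
    using homogeneous_prime_avoiding[OF K(1) g(1)] by blast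
  have "1 \<notin> p" using p(1,3) ideal_set_mult[of p 1 g] by (auto simp: hom_ideal_def)
  have "cl ` p \<in> points I" "pt (cl ` p) = p"
    using point_of_prime[of p g e] p K(2) \<open>1 \<notin> p\<close> g by auto
  then show False using van[of "cl ` p"] p(2,3) by simp
qed

lemma irrelevant_if_no_points:
  assumes K: "hom_ideal K" "I \<subseteq> K" and no: "\<And>P. P \<in> points I \<Longrightarrow> \<not> K \<subseteq> pt P"
  shows "\<exists>N. forms N \<subseteq> K"
proof (rule forms_subset_if_powers)
  show "ideal_set K" using K by (simp add: hom_ideal_def)
  show "\<exists>m. vr i ^ m \<in> K" for i
    using power_mem_if_vanishing[OF K vr_forms] no by auto
qed

text \<open>The annihilator of a locally zero form lies in no point, so it contains all forms of some degree, and
saturation applies.\<close>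

lemma mem_if_locally_zero:
  assumes D: "D \<in> forms d" and loc: "\<And>P. P \<in> points I \<Longrightarrow> \<exists>u. u \<notin> pt P \<and> u * D \<in> I"
  shows "D \<in> I"
proof -
  have "\<exists>N. forms N \<subseteq> {G. G * D \<in> I}"
  proof (rule irrelevant_if_no_points)
    show "hom_ideal {G. G * D \<in> I}" by (rule hom_ideal_colon[OF I_hom D])
    show "I \<subseteq> {G. G * D \<in> I}" using I_ideal by (auto intro: ideal_set_mult2)
    show "\<not> {G. G * D \<in> I} \<subseteq> pt P" if "P \<in> points I" for P using loc[OF that] by blast
  qed
  then show ?thesis using I_saturated unfolding saturated_def by blast
qed

end

text \<open>A form that already avoids some of the points is moved along a variable that avoids the next one;
each point excludes at most one multiple of that variable.\<close>

lemma linear_form_avoiding_points: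
  fixes I :: "('n::finite, 'k::alg_closed_field) mpoly set"
  assumes "closed_scheme I" and "finite A" "A \<subseteq> points I"
  shows "\<exists>l\<in>forms 1. \<forall>P\<in>A. l \<notin> closed_scheme.pt I P"
  using assms(2,3)
proof (induction A rule: finite_induct)
  case empty
  show ?case using forms_zero by blast
next
  case (insert P A)
  interpret closed_scheme I by fact
  obtain l where l: "l \<in> forms 1" "\<And>Q. Q \<in> A \<Longrightarrow> l \<notin> pt Q" using insert by blast
  obtain i where i: "vr i \<notin> pt P" using pointD(5) insert.prems by blast
  have fin: "finite {c. l + scl c (vr i) \<in> pt Q}" if Q: "Q \<in> points I" "l \<notin> pt Q \<or> vr i \<notin> pt Q" for Q
  proof -
    note id = pointD(1)[OF Q(1)]
    have "c = d" if cd: "l + scl c (vr i) \<in> pt Q" "l + scl d (vr i) \<in> pt Q" for c d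
    proof (rule ccontr)
      assume "c \<noteq> d"
      have "(l + scl c (vr i)) - (l + scl d (vr i)) \<in> pt Q" by (rule ideal_set_diff[OF id cd])
      then have "scl (c - d) (vr i) \<in> pt Q" by (simp add: mp.scale_left_diff_distrib)
      then have "scl (inverse (c - d)) (scl (c - d) (vr i)) \<in> pt Q" by (rule mp.ideal_set_scale[OF id])
      then have v: "vr i \<in> pt Q" using \<open>c \<noteq> d\<close> by simp
      then have "(l + scl c (vr i)) - scl c (vr i) \<in> pt Q"
        using cd(1) mp.ideal_set_scale[OF id v] by (intro ideal_set_diff[OF id])
      then show False using v Q(2) by simp
    qed
    then have "\<exists>c. {c. l + scl c (vr i) \<in> pt Q} \<subseteq> {c}" by blast
    then show ?thesis using finite_subset by blast
  qed
  have "finite (\<Union>Q\<in>insert P A. {c. l + scl c (vr i) \<in> pt Q})"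
    using insert.hyps insert.prems l(2) i by (intro finite_UN_I fin) auto
  then obtain c where c: "c \<notin> (\<Union>Q\<in>insert P A. {c. l + scl c (vr i) \<in> pt Q})"
    using ex_new_if_finite[OF alg_closed_infinite] by blast
  have "l + scl c (vr i) \<in> forms 1" using l(1) vr_forms by (intro forms_add forms_scl)
  then show ?case using c by blast
qed

section \<open>Sections on a finite scheme\<close>

locale affine_chart = closed_scheme I for I :: "('n::finite, 'k::field) mpoly set" +
  fixes l :: "('n, 'k) mpoly"
  assumes l_form: "l \<in> forms 1" and l_pt: "\<And>P. P \<in> points I \<Longrightarrow> l \<notin> pt P"
    and fin_points: "finite (points I)"
begin

lemma l_pow_form: "l ^ N \<in> forms N"
  using forms_power1[OF l_form] .

lemma l_pow_pt: "P \<in> points I \<Longrightarrow> l ^ N \<notin> pt P"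
proof (induction N)
  case (Suc N)
  then show ?case using pointD(4)[of P l "l ^ N"] l_pt by auto
qed (use pointD(3) in simp)

lemma l_regular: assumes "l * F \<in> I" shows "F \<in> I"
proof (rule hom_ideal_memI[OF I_ideal])
  fix n
  have "hcomp (Suc n) (l * F) \<in> I" using assms I_hom by (simp add: hom_ideal_def)
  then have "l * hcomp n F \<in> I" by (simp add: hcomp_form_mult[OF l_form])
  then show "hcomp n F \<in> I"
    using mem_if_locally_zero[OF hcomp_forms[of n F]] l_pt by blast
qed

lemma l_pow_regular: "l ^ N * F \<in> I \<Longrightarrow> F \<in> I"
  by (induction N arbitrary: F) (auto simp: mult.assoc intro: l_regular)

text \<open>The ideal of the scheme in the affine chart where \<open>l = 1\<close>. That chart contains all the points.\<close>

definition J :: "('n, 'k) mpoly set" where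
  "J = {F. \<exists>g. F - g * (l - 1) \<in> I}"

lemma J_ideal: "ideal_set J"
  unfolding J_def by (rule ideal_set_plus_principal[OF I_ideal])

lemma I_subset_J: "I \<subseteq> J"
  by (auto simp: J_def intro!: exI[of _ 0])

lemma l_minus_one_J: "l - 1 \<in> J"
  by (auto simp: J_def ideal_set_zero[OF I_ideal] intro!: exI[of _ 1])

lemma l_pow_J: "l ^ k * F - F \<in> J"
proof (induction k)
  case (Suc k)
  have "l * (l ^ k * F - F) + F * (l - 1) \<in> J" by (rule ideal_set_lin[OF J_ideal Suc l_minus_one_J])
  then show ?case by (simp add: algebra_simps)
qed (simp add: ideal_set_zero[OF J_ideal])

lemma l_pow_J': "F * l ^ k - F \<in> J"
  using l_pow_J[of k F] by (simp add: mult.commute)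

text \<open>Comparing components in \<open>F - g (l - 1)\<close> modulo \<open>I\<close> shows that \<open>g\<close> vanishes below the degree of \<open>F\<close> and
equals \<open>- l\<^sup>j F\<close> in \<open>j\<close> degrees above it. As \<open>g\<close> has only finitely many components, some \<open>l\<^sup>j F\<close> is in \<open>I\<close>.\<close>

lemma form_in_J:
  assumes F: "F \<in> forms N" "F \<in> J" shows "F \<in> I"
proof -
  obtain g where g: "F - g * (l - 1) \<in> I" using F(2) by (auto simp: J_def)
  have h: "hcomp d F - (if d = 0 then 0 else l * hcomp (d - 1) g) + hcomp d g \<in> I" for d
  proof -
    have "hcomp d (F - g * (l - 1)) \<in> I" using g I_hom by (simp add: hom_ideal_def)
    moreover have "F - g * (l - 1) = F - l * g + g" by (simp add: algebra_simps)
    ultimately show ?thesis by (cases d) (auto simp: hcomp_add hcomp_diff hcomp_form_mult[OF l_form])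
  qed
  have low: "hcomp d g \<in> I" if "d < N" for d
    using that
  proof (induction d)
    case 0
    then show ?case using h[of 0] by (simp add: hcomp_of_form[OF F(1)])
  next
    case (Suc d)
    have "hcomp (Suc d) g - l * hcomp d g \<in> I"
      using h[of "Suc d"] Suc.prems by (simp add: hcomp_of_form[OF F(1)])
    moreover have "l * hcomp d g \<in> I" using Suc by (simp add: ideal_set_mult[OF I_ideal])
    ultimately show ?case using ideal_set_add_mem_iff[OF I_ideal] by blast
  qed
  have at: "F + hcomp N g \<in> I"
  proof (cases N)
    case 0
    then show ?thesis using h[of N] by (simp add: hcomp_of_form[OF F(1)])
  next
    case (Suc d)
    have "F - l * hcomp d g + hcomp N g \<in> I" using h[of N] Suc by (simp add: hcomp_of_form[OF F(1)])
    moreover have "l * hcomp d g \<in> I" using low[of d] Suc by (simp add: ideal_set_mult[OF I_ideal])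
    ultimately have "(F - l * hcomp d g + hcomp N g) + l * hcomp d g \<in> I" by (rule ideal_set_add[OF I_ideal])
    then show ?thesis by simp
  qed
  have high: "l ^ j * F + hcomp (N + j) g \<in> I" for j
  proof (induction j)
    case 0
    then show ?case using at by simp
  next
    case (Suc j)
    have 1: "hcomp (N + Suc j) g - l * hcomp (N + j) g \<in> I"
      using h[of "N + Suc j"] by (simp add: hcomp_of_form[OF F(1)])
    have "l * (l ^ j * F + hcomp (N + j) g) + 1 * (hcomp (N + Suc j) g - l * hcomp (N + j) g) \<in> I"
      by (rule ideal_set_lin[OF I_ideal Suc 1])
    then show ?case by (simp add: algebra_simps)
  qed
  obtain D where "\<forall>n>D. hcomp n g = 0" using hcomp_decomp by blast
  then have "hcomp (N + Suc D) g = 0" by simp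
  then have "l ^ Suc D * F \<in> I" using high[of "Suc D"] by simp
  then show ?thesis by (rule l_pow_regular)
qed

text \<open>The functions on the scheme that are forms of degree \<open>n\<close> divided by \<open>l\<^sup>n\<close>, as a subspace above \<open>J\<close>.\<close>

definition W :: "nat \<Rightarrow> ('n, 'k) mpoly set" where
  "W n = {F. \<exists>A\<in>forms n. A - F \<in> J}"

lemma J_cong: "A - F \<in> J \<Longrightarrow> B - A \<in> J \<Longrightarrow> B - F \<in> J"
  using ideal_set_add[OF J_ideal, of "A - F" "B - A"] by simp

lemma J_sym: "A - F \<in> J \<Longrightarrow> F - A \<in> J"
  using ideal_set_uminus[OF J_ideal, of "A - F"] by simp

lemma forms_W: "F \<in> forms n \<Longrightarrow> F \<in> W n"
  by (auto simp: W_def ideal_set_zero[OF J_ideal] intro!: bexI[of _ F])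

lemma W_subspace: "mp.subspace (W n)"
proof (rule mp.subspaceI)
  show "0 \<in> W n" by (rule forms_W) (rule forms_zero)
  fix F G assume "F \<in> W n" "G \<in> W n"
  then obtain A B where AB: "A \<in> forms n" "A - F \<in> J" "B \<in> forms n" "B - G \<in> J" by (auto simp: W_def)
  have "(A + B) - (F + G) \<in> J" using ideal_set_add[OF J_ideal AB(2,4)] by (simp add: algebra_simps)
  then show "F + G \<in> W n" using forms_add[OF AB(1,3)] by (auto simp: W_def)
next
  fix c F assume "F \<in> W n"
  then obtain A where A: "A \<in> forms n" "A - F \<in> J" by (auto simp: W_def)
  have "scl c A - scl c F \<in> J" using mp.ideal_set_scale[OF J_ideal A(2), of c] by (simp add: mp.scale_right_diff_distrib)
  then show "scl c F \<in> W n" using forms_scl[OF A(1)] by (auto simp: W_def)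
qed

lemma J_subset_W: "J \<subseteq> W n"
  using ideal_set_uminus[OF J_ideal] by (auto simp: W_def forms_zero intro!: bexI[of _ 0])

lemma W_add: "F \<in> W n \<Longrightarrow> G \<in> W n \<Longrightarrow> F + G \<in> W n"
  by (rule mp.subspace_add[OF W_subspace])

lemma W_diff: "F \<in> W n \<Longrightarrow> G \<in> W n \<Longrightarrow> F - G \<in> W n"
  by (rule mp.subspace_diff[OF W_subspace])

lemma W_scl: "F \<in> W n \<Longrightarrow> scl c F \<in> W n"
  by (rule mp.subspace_scale[OF W_subspace])

lemma W_cong: "A - F \<in> J \<Longrightarrow> A \<in> W n \<longleftrightarrow> F \<in> W n"
  unfolding W_def using J_cong J_sym by blast

lemma W_mono_add: "W n \<subseteq> W (n + k)"
proof
  fix F assume "F \<in> W n"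
  then obtain A where A: "A \<in> forms n" "A - F \<in> J" by (auto simp: W_def)
  have "A * l ^ k \<in> forms (n + k)" by (rule forms_mult[OF A(1) l_pow_form])
  moreover have "A * l ^ k - F \<in> J" by (rule J_cong[OF A(2) l_pow_J'])
  ultimately show "F \<in> W (n + k)" by (auto simp: W_def)
qed

lemma W_mono: "m \<le> n \<Longrightarrow> W m \<subseteq> W n"
  using W_mono_add[of m "n - m"] by simp

lemma W_mult: "F \<in> W m \<Longrightarrow> G \<in> W n \<Longrightarrow> F * G \<in> W (m + n)"
proof -
  assume "F \<in> W m" "G \<in> W n"
  then obtain A B where AB: "A \<in> forms m" "A - F \<in> J" "B \<in> forms n" "B - G \<in> J" by (auto simp: W_def)
  have "B * (A - F) + F * (B - G) \<in> J" by (rule ideal_set_lin[OF J_ideal AB(2,4)])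
  then have "A * B - F * G \<in> J" by (simp add: algebra_simps)
  then show ?thesis using forms_mult[OF AB(1,3)] by (auto simp: W_def)
qed

lemma W_exhaust: "\<exists>n. F \<in> W n"
proof -
  obtain D where D: "F = (\<Sum>n\<le>D. hcomp n F)" using hcomp_decomp by blast
  have "hcomp n F \<in> W D" if "n \<le> D" for n
    using W_mono[OF that] forms_W[OF hcomp_forms] by blast
  then have "(\<Sum>n\<le>D. hcomp n F) \<in> W D" by (intro mp.subspace_sum[OF W_subspace]) auto
  then show ?thesis using D by auto
qed

text \<open>The homogeneous denominators allowed at the point \<open>P\<close>.\<close>

definition M :: "('n, 'k) coord set \<Rightarrow> ('n, 'k) mpoly set" where
  "M P = {F. (\<exists>n. F \<in> forms n) \<and> F \<notin> pt P}"

lemma homog_away_eq: "homog_away (coord_grading I) P = cl ` M P"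
  by (auto simp: homog_away_def coord_grading_def M_def pt_def)

lemma loc_at:
  assumes "P \<in> points I" shows "quotient_localization I (M P)"
proof
  show "ideal_set I" by (rule I_ideal)
  show "1 \<in> M P" using one_forms pointD(3)[OF assms] by (auto simp: M_def)
  show "s * t \<in> M P" if "s \<in> M P" "t \<in> M P" for s t
    using that forms_mult pointD(4)[OF assms] unfolding M_def by blast
qed

abbreviation fr where "fr P \<equiv> quotient_localization.frac I (M P)"

lemma l_pow_M: "P \<in> points I \<Longrightarrow> l ^ N \<in> M P"
  using l_pow_form l_pow_pt by (auto simp: M_def)

lemma fraction_eq_fr:
  assumes "P \<in> points I"
  shows "fraction (coord_ring I) (homog_away (coord_grading I) P) (cl a) (cl s) = fr P a s"
  unfolding homog_away_eq coord_ring_eq quotient_localization.frac_def[OF loc_at[OF assms]] ..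

lemma homog_loc_eq: "homog_loc (coord_ring I) (coord_grading I) P = localization (type_ring Quot I) (cl ` M P)"
  by (simp add: homog_loc_def homog_away_eq coord_ring_eq)

text \<open>The section of \<open>\<O>(n)\<close> that corresponds to the function \<open>F\<close> on the chart, namely \<open>l\<^sup>n F\<close>. To write it as a
quotient of forms, \<open>F\<close> is replaced by a form of high degree congruent to it modulo \<open>J\<close>; which one is
immaterial by the next lemma.\<close>

definition sec :: "nat \<Rightarrow> ('n, 'k) mpoly \<Rightarrow> ('n, 'k) sect" where
  "sec n F = (\<lambda>P\<in>points I. case (SOME (A, N). A \<in> forms (N + n) \<and> A - F \<in> J) of (A, N) \<Rightarrow> fr P A (l ^ N))"

lemma fr_wd:
  assumes "P \<in> points I" "A \<in> forms (N + n)" "B \<in> forms (N' + n)" "A - F \<in> J" "B - F \<in> J"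
  shows "fr P A (l ^ N) = fr P B (l ^ N')"
proof -
  interpret loc: quotient_localization I "M P" by (rule loc_at[OF assms(1)])
  show ?thesis
  proof (rule loc.frac_eqI)
    have "A * l ^ N' \<in> forms (N + n + N')" "B * l ^ N \<in> forms (N' + n + N)"
      using forms_mult assms(2,3) l_pow_form by blast+
    then have f: "A * l ^ N' - B * l ^ N \<in> forms (N + n + N')" by (intro forms_diff) (simp_all add: ac_simps)
    have "(A * l ^ N' - F) - (B * l ^ N - F) \<in> J"
      using ideal_set_diff[OF J_ideal J_cong[OF assms(4) l_pow_J'] J_cong[OF assms(5) l_pow_J']] .
    then have "A * l ^ N' - B * l ^ N \<in> J" by simp
    then show "A * l ^ N' - B * l ^ N \<in> I" by (rule form_in_J[OF f])
  qed (use l_pow_M assms in auto)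
qed

lemma rep_exists: "\<exists>N A. A \<in> forms (N + n) \<and> A - F \<in> J"
proof -
  obtain N where "F \<in> W N" using W_exhaust by blast
  then have "F \<in> W (N + n)" using W_mono_add by blast
  then show ?thesis by (auto simp: W_def)
qed

lemma sec_eq:
  assumes P: "P \<in> points I" and A: "A \<in> forms (N + n)" "A - F \<in> J"
  shows "sec n F P = fr P A (l ^ N)"
proof -
  have "case (SOME (A, N). A \<in> forms (N + n) \<and> A - F \<in> J) of (A, N) \<Rightarrow> A \<in> forms (N + n) \<and> A - F \<in> J"
    using someI[of "\<lambda>(A, N). A \<in> forms (N + n) \<and> A - F \<in> J" "(A, N)"] A by simp
  then obtain B N' where B: "(SOME (A, N). A \<in> forms (N + n) \<and> A - F \<in> J) = (B, N')" "B \<in> forms (N' + n)" "B - F \<in> J"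
    by (auto split: prod.splits)
  have "fr P B (l ^ N') = fr P A (l ^ N)" by (rule fr_wd[OF P B(2) A(1) B(3) A(2)])
  then show ?thesis using P B(1) by (simp add: sec_def)
qed

lemma sec_ext: "sec n F \<in> extensional (points I)"
  by (simp add: sec_def)

lemma sec_eqI: "(\<And>P. P \<in> points I \<Longrightarrow> sec n F P = s P) \<Longrightarrow> s \<in> extensional (points I) \<Longrightarrow> sec n F = s"
  by (rule extensionalityI[OF sec_ext]) auto

lemma sec_eq_iff: "sec n F = sec n G \<longleftrightarrow> F - G \<in> J"
proof
  assume eq: "sec n F = sec n G"
  obtain N where "F \<in> W N" using W_exhaust by blast
  obtain N' where "G \<in> W N'" using W_exhaust by blast
  then have "F \<in> W (N + N' + n)" "G \<in> W (N + N' + n)"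
    using \<open>F \<in> W N\<close> W_mono[of N "N + N' + n"] W_mono[of N' "N + N' + n"] by auto
  then obtain A B where A: "A \<in> forms (N + N' + n)" "A - F \<in> J" and B: "B \<in> forms (N + N' + n)" "B - G \<in> J"
    by (auto simp: W_def)
  have "A - B \<in> I"
  proof (rule mem_if_locally_zero[OF forms_diff[OF A(1) B(1)]])
    fix P assume P: "P \<in> points I"
    interpret loc: quotient_localization I "M P" by (rule loc_at[OF P])
    have "fr P A (l ^ (N + N')) = fr P B (l ^ (N + N'))" using sec_eq[OF P A] sec_eq[OF P B] eq by simp
    then obtain u where u: "u \<in> M P" "u * (A * l ^ (N + N') - B * l ^ (N + N')) \<in> I"
      using loc.frac_eq_iff[OF l_pow_M[OF P] l_pow_M[OF P]] by blast
    have "l ^ (N + N') * (u * (A - B)) \<in> I" using u(2) by (simp add: algebra_simps)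
    then have "u * (A - B) \<in> I" by (rule l_pow_regular)
    then show "\<exists>u. u \<notin> pt P \<and> u * (A - B) \<in> I" using u(1) by (auto simp: M_def)
  qed
  then have AB: "A - B \<in> J" using I_subset_J by blast
  have "(A - B) - (A - F) \<in> J" by (rule ideal_set_diff[OF J_ideal AB A(2)])
  then have "((A - B) - (A - F)) + (B - G) \<in> J" by (rule ideal_set_add[OF J_ideal _ B(2)])
  then show "F - G \<in> J" by simp
next
  assume FG: "F - G \<in> J"
  show "sec n F = sec n G"
  proof (rule sec_eqI[OF _ sec_ext])
    fix P assume P: "P \<in> points I"
    obtain N A where A: "A \<in> forms (N + n)" "A - F \<in> J" using rep_exists by blast
    then have "A - G \<in> J" using J_cong[OF FG] by blast
    then show "sec n F P = sec n G P" using sec_eq[OF P A] sec_eq[OF P A(1)] by simp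
  qed
qed

lemma restrict_form_eq: "F \<in> forms n \<Longrightarrow> restrict_form I F = sec n F"
proof (rule sym, rule sec_eqI)
  assume F: "F \<in> forms n"
  show "restrict_form I F \<in> extensional (points I)" by (simp add: restrict_form_def)
  fix P assume P: "P \<in> points I"
  have "sec n F P = fr P F (l ^ 0)" using F by (intro sec_eq[OF P]) (auto simp: ideal_set_zero[OF J_ideal])
  moreover have "\<one>\<^bsub>coord_ring I\<^esub> = cl 1" by (simp add: coord_ring_eq triv.cl_one)
  ultimately show "sec n F P = restrict_form I F P"
    using P by (simp add: restrict_form_def fraction_eq_fr[OF P])
qed

lemma const_section_eq: "const_section I c = sec 0 (cst c)"
  using restrict_form_eq[OF cst_forms] by (simp add: const_section_def cst_def)

lemma twist_stalk_eq:
  assumes P: "P \<in> points I"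
  shows "twist_stalk (coord_ring I) (coord_grading I) n P =
    {fr P a f |a f d e. a \<in> forms d \<and> f \<in> forms e \<and> f \<notin> pt P \<and> int d - int e = n}"
proof (intro equalityI subsetI)
  fix x assume "x \<in> twist_stalk (coord_ring I) (coord_grading I) n P"
  then obtain a f d e where "x = fraction (coord_ring I) (homog_away (coord_grading I) P) a f"
    "a \<in> coord_grading I d" "f \<in> coord_grading I e" "f \<notin> P" "int d - int e = n"
    unfolding twist_stalk_def by blast
  moreover from this obtain a' f' where "a = cl a'" "f = cl f'" "a' \<in> forms d" "f' \<in> forms e"
    unfolding coord_grading_def by blast
  ultimately show "x \<in> {fr P a f |a f d e. a \<in> forms d \<and> f \<in> forms e \<and> f \<notin> pt P \<and> int d - int e = n}"
    using fraction_eq_fr[OF P] unfolding pt_def by blast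
next
  fix x assume "x \<in> {fr P a f |a f d e. a \<in> forms d \<and> f \<in> forms e \<and> f \<notin> pt P \<and> int d - int e = n}"
  then obtain a f d e where "x = fr P a f" "a \<in> forms d" "f \<in> forms e" "f \<notin> pt P" "int d - int e = n"
    by blast
  moreover from this have "cl a \<in> coord_grading I d" "cl f \<in> coord_grading I e" "cl f \<notin> P"
    unfolding coord_grading_def pt_def by blast+
  ultimately show "x \<in> twist_stalk (coord_ring I) (coord_grading I) n P"
    unfolding twist_stalk_def fraction_eq_fr[OF P, symmetric] by blast
qed

lemma sec_in_H0: "sec n F \<in> H0 I (int n)"
proof -
  obtain N A where A: "A \<in> forms (N + n)" "A - F \<in> J" using rep_exists by blast
  note eq = sec_eq[OF _ A]
  have deg: "int (N + n) - int N = int n" by simp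
  show ?thesis unfolding H0_def Proj_sections_def points_def[symmetric]
  proof (intro CollectI conjI ballI)
    show "sec n F \<in> (\<Pi>\<^sub>E P\<in>points I. twist_stalk (coord_ring I) (coord_grading I) (int n) P)"
    proof
      fix P assume P: "P \<in> points I"
      show "sec n F P \<in> twist_stalk (coord_ring I) (coord_grading I) (int n) P"
        unfolding twist_stalk_eq[OF P] eq[OF P] using A(1) l_pow_form l_pow_pt[OF P] deg by blast
    qed (simp add: sec_def)
    fix P assume P: "P \<in> points I"
    have "cl 1 \<in> homog_away (coord_grading I) P"
      unfolding homog_away_eq using quotient_localization.one_M[OF loc_at[OF P]] by blast
    moreover have "cl A \<in> coord_grading I (N + n)" "cl (l ^ N) \<in> coord_grading I N"
      using A(1) l_pow_form by (auto simp: coord_grading_def)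
    moreover have "cl (l ^ N) \<notin> Q \<and> sec n F Q = fraction (coord_ring I) (homog_away (coord_grading I) Q) (cl A) (cl (l ^ N))"
      if Q: "Q \<in> points I" for Q
      using l_pow_pt[OF Q] eq[OF Q] fraction_eq_fr[OF Q] by (simp add: pt_def)
    ultimately show "\<exists>g\<in>homog_away (coord_grading I) P. \<exists>d e. \<exists>a\<in>coord_grading I d. \<exists>f\<in>coord_grading I e.
       int d - int e = int n \<and> (\<forall>Q\<in>points I. g \<notin> Q \<longrightarrow> f \<notin> Q \<and>
         sec n F Q = fraction (coord_ring I) (homog_away (coord_grading I) Q) a f)"
      using deg by blast
  qed
qed

text \<open>The usual gluing of fractions on basic open sets. After multiplication by powers of the \<open>g P\<close>, the
local fractions \<open>b P / h P\<close> agree on the nose, so that the numerators \<open>B\<close> with \<open>F b = B h\<close> at all points,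
for varying \<open>F\<close>, belong to an ideal of denominators \<open>F\<close>. It contains every \<open>h P\<close> and thus lies in no point.
Hence it contains a power of \<open>l\<close>, which serves as a global denominator.\<close>

lemma H0_subset_sec:
  assumes s: "s \<in> H0 I (int n)" shows "\<exists>F. s = sec n F"
proof -
  have s_ext: "s \<in> extensional (points I)"
    using s by (auto simp: H0_def Proj_sections_def points_def PiE_def)
  have "\<forall>P\<in>points I. \<exists>g a f c d. g \<in> forms (Suc c) \<and> g \<notin> pt P \<and> a \<in> forms (d + n) \<and> f \<in> forms d \<and>
      (\<forall>Q\<in>points I. g \<notin> pt Q \<longrightarrow> f \<notin> pt Q \<and> s Q = fr Q a f)"
  proof
    fix P assume P: "P \<in> points I"
    have "\<exists>g\<in>homog_away (coord_grading I) P. \<exists>d e. \<exists>a\<in>coord_grading I d. \<exists>f\<in>coord_grading I e.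
       int d - int e = int n \<and> (\<forall>Q\<in>points I. g \<notin> Q \<longrightarrow> f \<notin> Q \<and>
         s Q = fraction (coord_ring I) (homog_away (coord_grading I) Q) a f)"
      using s P unfolding H0_def Proj_sections_def points_def by blast
    then obtain g0 d e a0 f0 where g0: "g0 \<in> homog_away (coord_grading I) P"
      and af0: "a0 \<in> coord_grading I d" "f0 \<in> coord_grading I e" and de: "int d - int e = int n"
      and val0: "\<forall>Q\<in>points I. g0 \<notin> Q \<longrightarrow> f0 \<notin> Q \<and>
         s Q = fraction (coord_ring I) (homog_away (coord_grading I) Q) a0 f0"
      by (elim bexE exE conjE) blast
    obtain g where g: "g \<in> M P" "g0 = cl g" using g0 unfolding homog_away_eq by blast
    obtain a f where af: "a \<in> forms d" "f \<in> forms e" "a0 = cl a" "f0 = cl f"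
      using af0 unfolding coord_grading_def by blast
    have val: "\<forall>Q\<in>points I. cl g \<notin> Q \<longrightarrow> cl f \<notin> Q \<and>
         s Q = fraction (coord_ring I) (homog_away (coord_grading I) Q) (cl a) (cl f)"
      using val0 g(2) af(3,4) by simp
    obtain c where c: "g \<in> forms c" using g(1) by (auto simp: M_def)
    have "g * l \<in> forms (Suc c)" using forms_mult[OF c l_form] by simp
    moreover have "g * l \<notin> pt P" using g(1) pointD(4)[OF P, of g l] l_pt[OF P] by (auto simp: M_def)
    moreover have "d = e + n" using de by simp
    moreover have "f \<notin> pt Q \<and> s Q = fr Q a f" if Q: "Q \<in> points I" "g * l \<notin> pt Q" for Q
    proof -
      have "g \<notin> pt Q" using Q(2) ideal_set_mult2[OF pointD(1)[OF Q(1)]] by blast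
      then show ?thesis using val Q(1) fraction_eq_fr[OF Q(1)] by (auto simp: pt_def)
    qed
    ultimately show "\<exists>g a f c d. g \<in> forms (Suc c) \<and> g \<notin> pt P \<and> a \<in> forms (d + n) \<and> f \<in> forms d \<and>
      (\<forall>Q\<in>points I. g \<notin> pt Q \<longrightarrow> f \<notin> pt Q \<and> s Q = fr Q a f)" using af by blast
  qed
  then have "\<exists>g a f c d. \<forall>P\<in>points I. g P \<in> forms (Suc (c P)) \<and> g P \<notin> pt P \<and> a P \<in> forms (d P + n) \<and>
      f P \<in> forms (d P) \<and> (\<forall>Q\<in>points I. g P \<notin> pt Q \<longrightarrow> f P \<notin> pt Q \<and> s Q = fr Q (a P) (f P))"
    unfolding bchoice_iff .
  then obtain g a f c d where all: "\<forall>P\<in>points I. g P \<in> forms (Suc (c P)) \<and> g P \<notin> pt P \<and> a P \<in> forms (d P + n) \<and>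
      f P \<in> forms (d P) \<and> (\<forall>Q\<in>points I. g P \<notin> pt Q \<longrightarrow> f P \<notin> pt Q \<and> s Q = fr Q (a P) (f P))"
    by (elim exE)
  have g: "\<And>P. P \<in> points I \<Longrightarrow> g P \<in> forms (Suc (c P))" "\<And>P. P \<in> points I \<Longrightarrow> g P \<notin> pt P"
    and a: "\<And>P. P \<in> points I \<Longrightarrow> a P \<in> forms (d P + n)" and f: "\<And>P. P \<in> points I \<Longrightarrow> f P \<in> forms (d P)"
    and val: "\<And>P Q. P \<in> points I \<Longrightarrow> Q \<in> points I \<Longrightarrow> g P \<notin> pt Q \<Longrightarrow> f P \<notin> pt Q \<and> s Q = fr Q (a P) (f P)"
    using all by blast+
  have "\<exists>m. (g P * g Q) ^ m * (a P * f Q - a Q * f P) \<in> I" if P: "P \<in> points I" and Q: "Q \<in> points I" for P Q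
  proof -
    let ?D = "a P * f Q - a Q * f P"
    have D: "?D \<in> forms (d P + d Q + n)"
      using forms_mult[OF a[OF P] f[OF Q]] forms_mult[OF a[OF Q] f[OF P]] by (intro forms_diff) (simp_all add: ac_simps)
    have "\<exists>m. (g P * g Q) ^ m \<in> {u. u * ?D \<in> I}"
    proof (rule power_mem_if_vanishing)
      show "hom_ideal {u. u * ?D \<in> I}" by (rule hom_ideal_colon[OF I_hom D])
      show "I \<subseteq> {u. u * ?D \<in> I}" using I_ideal by (auto intro: ideal_set_mult2)
      show "g P * g Q \<in> forms (Suc (c P) + Suc (c Q))" using forms_mult g(1) P Q by blast
      show "g P * g Q \<in> pt Z" if Z: "Z \<in> points I" and sub: "{u. u * ?D \<in> I} \<subseteq> pt Z" for Z
      proof (rule ccontr)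
        assume n: "g P * g Q \<notin> pt Z"
        then have "g P \<notin> pt Z" "g Q \<notin> pt Z" using pointD(1)[OF Z] ideal_set_mult ideal_set_mult2 by blast+
        then have v: "f P \<notin> pt Z" "f Q \<notin> pt Z" "fr Z (a P) (f P) = fr Z (a Q) (f Q)"
          using val[OF P Z] val[OF Q Z] by auto
        interpret loc: quotient_localization I "M Z" by (rule loc_at[OF Z])
        have "f P \<in> M Z" "f Q \<in> M Z" using v f P Q by (auto simp: M_def)
        then obtain u where "u \<in> M Z" "u * ?D \<in> I" using loc.frac_eq_iff v(3) by blast
        then show False using sub by (auto simp: M_def)
      qed
    qed simp
    then show ?thesis by simp
  qed
  then obtain m where m: "\<And>P Q. P \<in> points I \<Longrightarrow> Q \<in> points I \<Longrightarrow> (g P * g Q) ^ m P Q * (a P * f Q - a Q * f P) \<in> I"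
    by metis
  \<comment> \<open>A common exponent for the finitely many pairs of points.\<close>
  define k where "k = (\<Sum>P\<in>points I. \<Sum>Q\<in>points I. m P Q)"
  have mk: "m P Q \<le> k" if "P \<in> points I" "Q \<in> points I" for P Q
  proof -
    have "m P Q \<le> (\<Sum>Q\<in>points I. m P Q)" using that fin_points by (intro member_le_sum) auto
    also have "\<dots> \<le> k" unfolding k_def using that fin_points
      by (intro member_le_sum[where f = "\<lambda>P. \<Sum>Q\<in>points I. m P Q"]) auto
    finally show ?thesis .
  qed
  define h b where "h P = g P ^ k * f P" and "b P = g P ^ k * a P" for P
  have comp: "h P * b Q - b P * h Q \<in> I" if P: "P \<in> points I" and Q: "Q \<in> points I" for P Q
  proof -
    have "(g Q * g P) ^ k = (g Q * g P) ^ (k - m Q P) * (g Q * g P) ^ m Q P"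
      using mk[OF Q P] by (simp add: power_add[symmetric])
    then have "(g Q * g P) ^ k * (a Q * f P - a P * f Q) \<in> I"
      using ideal_set_mult[OF I_ideal m[OF Q P], of "(g Q * g P) ^ (k - m Q P)"] by (simp add: mult.assoc)
    then show ?thesis by (simp add: h_def b_def algebra_simps power_mult_distrib)
  qed
  define e where "e P = Suc (c P) * k + d P" for P
  have h_form: "h P \<in> forms (e P)" and b_form: "b P \<in> forms (e P + n)" if P: "P \<in> points I" for P
    using forms_mult[OF forms_power[OF g(1)[OF P], of k] f[OF P]]
      forms_mult[OF forms_power[OF g(1)[OF P], of k] a[OF P]]
    by (simp_all add: h_def b_def e_def ac_simps)
  have h_pt: "h P \<notin> pt P" if P: "P \<in> points I" for P
  proof -
    have "g P ^ k \<notin> pt P" by (induction k) (use g(2)[OF P] pointD(3,4)[OF P] in auto)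
    then show ?thesis using val[OF P P g(2)[OF P]] pointD(4)[OF P] unfolding h_def by blast
  qed
  let ?K = "{F. \<exists>B. \<forall>Q\<in>points I. F * b Q - B * h Q \<in> I}"
  have K_ideal: "ideal_set ?K" unfolding ideal_set_def
  proof (intro conjI ballI allI)
    show "0 \<in> ?K" by (auto intro!: exI[of _ 0] simp: ideal_set_zero[OF I_ideal])
    fix F G assume "F \<in> ?K" "G \<in> ?K"
    then obtain B B' where B: "\<forall>Q\<in>points I. F * b Q - B * h Q \<in> I" "\<forall>Q\<in>points I. G * b Q - B' * h Q \<in> I" by blast
    have "(F + G) * b Q - (B + B') * h Q \<in> I" if "Q \<in> points I" for Q
      using ideal_set_add[OF I_ideal B(1)[rule_format, OF that] B(2)[rule_format, OF that]] by (simp add: algebra_simps)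
    then show "F + G \<in> ?K" by blast
  next
    fix F G assume "F \<in> ?K"
    then obtain B where B: "\<forall>Q\<in>points I. F * b Q - B * h Q \<in> I" by blast
    have "(G * F) * b Q - (G * B) * h Q \<in> I" if "Q \<in> points I" for Q
      using ideal_set_mult[OF I_ideal B[rule_format, OF that], of G] by (simp add: algebra_simps)
    then show "G * F \<in> ?K" by blast
  qed
  have comps: "hcomp j F * b Q - hcomp (j + n) B * h Q \<in> I"
    if Q: "Q \<in> points I" and F: "F * b Q - B * h Q \<in> I" for j F B Q
  proof -
    have "hcomp (e Q + n + j) (b Q * F - h Q * B) \<in> I"
      using F I_hom by (simp add: hom_ideal_def mult.commute)
    then have "b Q * hcomp j F - h Q * hcomp (n + j) B \<in> I"
      unfolding hcomp_diff hcomp_form_mult[OF b_form[OF Q]] hcomp_form_mult[OF h_form[OF Q]] by simp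
    then show ?thesis by (simp add: mult.commute add.commute)
  qed
  have "\<exists>N. forms N \<subseteq> ?K"
  proof (rule irrelevant_if_no_points)
    show "hom_ideal ?K" unfolding hom_ideal_def
    proof (intro conjI K_ideal ballI allI)
      fix F j assume "F \<in> ?K"
      then obtain B where B: "\<forall>Q\<in>points I. F * b Q - B * h Q \<in> I" by blast
      then have "\<forall>Q\<in>points I. hcomp j F * b Q - hcomp (j + n) B * h Q \<in> I" using comps by blast
      then show "hcomp j F \<in> ?K" by blast
    qed
    show "I \<subseteq> ?K" using I_ideal by (auto intro!: exI[of _ 0] ideal_set_mult2)
    fix P assume P: "P \<in> points I"
    have "h P \<in> ?K" using comp[OF P] by blast
    then show "\<not> ?K \<subseteq> pt P" using h_pt[OF P] by blast
  qed
  then obtain N where "forms N \<subseteq> ?K" by blast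
  then have "l ^ N \<in> ?K" using l_pow_form by blast
  then obtain B where B: "\<forall>Q\<in>points I. l ^ N * b Q - B * h Q \<in> I" by blast
  define A where "A = hcomp (N + n) B"
  have A: "A \<in> forms (N + n)" unfolding A_def by (rule hcomp_forms)
  have AB: "l ^ N * b Q - A * h Q \<in> I" if "Q \<in> points I" for Q
    using comps[OF that B[rule_format, OF that], of N] by (simp add: A_def hcomp_of_form[OF l_pow_form])
  have "s = sec n A"
  proof (rule sym, rule sec_eqI[OF _ s_ext])
    fix Q assume Q: "Q \<in> points I"
    interpret loc: quotient_localization I "M Q" by (rule loc_at[OF Q])
    have v: "f Q \<notin> pt Q" "s Q = fr Q (a Q) (f Q)" using val[OF Q Q g(2)[OF Q]] by auto
    have fM: "f Q \<in> M Q" and hM: "h Q \<in> M Q" using v(1) f[OF Q] h_form[OF Q] h_pt[OF Q] by (auto simp: M_def)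
    have "sec n A Q = fr Q A (l ^ N)" using A by (intro sec_eq[OF Q]) (auto simp: ideal_set_zero[OF J_ideal])
    also have "\<dots> = fr Q (b Q) (h Q)"
      using ideal_set_uminus[OF I_ideal AB[OF Q]] by (intro loc.frac_eqI l_pow_M[OF Q] hM) (simp add: mult.commute)
    also have "\<dots> = fr Q (a Q) (f Q)"
      using fM hM by (intro loc.frac_eqI) (simp_all add: h_def b_def ac_simps ideal_set_zero[OF I_ideal])
    finally show "sec n A Q = s Q" using v(2) by simp
  qed
  then show ?thesis by blast
qed

lemma H0_eq: "H0 I (int n) = range (sec n)"
  using sec_in_H0 H0_subset_sec by blast

end

section \<open>The ring of sections and dimensions\<close>

lemma ring_product_cring:
  assumes "\<And>i. i \<in> D \<Longrightarrow> cring (Q i)"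
  shows "cring (ring_product D Q)"
proof -
  have r: "ring (Q i)" if "i \<in> D" for i using assms[OF that] by (simp add: cring.axioms(1))
  note simps = ring_product_def PiE_def Pi_def extensional_def restrict_def fun_eq_iff
  show ?thesis
  proof (rule cringI)
    show "abelian_group (ring_product D Q)"
    proof (rule abelian_groupI)
      fix x y assume xy: "x \<in> carrier (ring_product D Q)" "y \<in> carrier (ring_product D Q)"
      show "x \<oplus>\<^bsub>ring_product D Q\<^esub> y \<in> carrier (ring_product D Q)"
        using xy by (auto simp: ring_product_def intro!: ring.ring_simprules(1) r)
      show "x \<oplus>\<^bsub>ring_product D Q\<^esub> y = y \<oplus>\<^bsub>ring_product D Q\<^esub> x"
        using xy by (auto simp: ring_product_def fun_eq_iff restrict_def intro!: ring.ring_simprules(10) r)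
      fix z assume z: "z \<in> carrier (ring_product D Q)"
      show "x \<oplus>\<^bsub>ring_product D Q\<^esub> y \<oplus>\<^bsub>ring_product D Q\<^esub> z = x \<oplus>\<^bsub>ring_product D Q\<^esub> (y \<oplus>\<^bsub>ring_product D Q\<^esub> z)"
        using xy z by (auto simp: ring_product_def fun_eq_iff restrict_def intro!: ring.ring_simprules(7) r)
    next
      show "\<zero>\<^bsub>ring_product D Q\<^esub> \<in> carrier (ring_product D Q)"
        by (auto simp: ring_product_def intro!: ring.ring_simprules(2) r)
      fix x assume x: "x \<in> carrier (ring_product D Q)"
      show "\<zero>\<^bsub>ring_product D Q\<^esub> \<oplus>\<^bsub>ring_product D Q\<^esub> x = x"
      proof
        fix i show "(\<zero>\<^bsub>ring_product D Q\<^esub> \<oplus>\<^bsub>ring_product D Q\<^esub> x) i = x i"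
          using x ring.ring_simprules(8)[OF r, of i "x i"] by (cases "i \<in> D") (auto simp: ring_product_def PiE_def extensional_def)
      qed
      show "\<exists>y\<in>carrier (ring_product D Q). y \<oplus>\<^bsub>ring_product D Q\<^esub> x = \<zero>\<^bsub>ring_product D Q\<^esub>"
      proof (rule bexI)
        show "(\<lambda>i\<in>D. \<ominus>\<^bsub>Q i\<^esub> x i) \<oplus>\<^bsub>ring_product D Q\<^esub> x = \<zero>\<^bsub>ring_product D Q\<^esub>"
          using x by (auto simp: ring_product_def fun_eq_iff restrict_def PiE_def intro!: ring.ring_simprules(9) r)
        show "(\<lambda>i\<in>D. \<ominus>\<^bsub>Q i\<^esub> x i) \<in> carrier (ring_product D Q)"
          using x by (auto simp: ring_product_def PiE_def intro!: ring.ring_simprules(3) r)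
      qed
    qed
    have cm: "Group.comm_monoid (Q i)" if "i \<in> D" for i using assms[OF that] by (simp add: cring.axioms(2))
    show "Group.comm_monoid (ring_product D Q)"
    proof (rule comm_monoidI)
      fix x y assume xy: "x \<in> carrier (ring_product D Q)" "y \<in> carrier (ring_product D Q)"
      show "x \<otimes>\<^bsub>ring_product D Q\<^esub> y \<in> carrier (ring_product D Q)"
        using xy by (auto simp: ring_product_def intro!: ring.ring_simprules(5) r)
      show "x \<otimes>\<^bsub>ring_product D Q\<^esub> y = y \<otimes>\<^bsub>ring_product D Q\<^esub> x"
        using xy by (auto simp: ring_product_def fun_eq_iff restrict_def intro!: comm_monoid.m_comm[OF cm])
      fix z assume z: "z \<in> carrier (ring_product D Q)"
      show "x \<otimes>\<^bsub>ring_product D Q\<^esub> y \<otimes>\<^bsub>ring_product D Q\<^esub> z = x \<otimes>\<^bsub>ring_product D Q\<^esub> (y \<otimes>\<^bsub>ring_product D Q\<^esub> z)"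
        using xy z by (auto simp: ring_product_def fun_eq_iff restrict_def intro!: ring.ring_simprules(11) r)
    next
      show "\<one>\<^bsub>ring_product D Q\<^esub> \<in> carrier (ring_product D Q)"
        by (auto simp: ring_product_def intro!: ring.ring_simprules(6) r)
      fix x assume x: "x \<in> carrier (ring_product D Q)"
      show "\<one>\<^bsub>ring_product D Q\<^esub> \<otimes>\<^bsub>ring_product D Q\<^esub> x = x"
      proof
        fix i show "(\<one>\<^bsub>ring_product D Q\<^esub> \<otimes>\<^bsub>ring_product D Q\<^esub> x) i = x i"
          using x ring.ring_simprules(12)[OF r, of i "x i"] by (cases "i \<in> D") (auto simp: ring_product_def PiE_def extensional_def)
      qed
    qed
    fix x y z assume "x \<in> carrier (ring_product D Q)" "y \<in> carrier (ring_product D Q)" "z \<in> carrier (ring_product D Q)"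
    then show "(x \<oplus>\<^bsub>ring_product D Q\<^esub> y) \<otimes>\<^bsub>ring_product D Q\<^esub> z = x \<otimes>\<^bsub>ring_product D Q\<^esub> z \<oplus>\<^bsub>ring_product D Q\<^esub> y \<otimes>\<^bsub>ring_product D Q\<^esub> z"
      by (auto simp: ring_product_def fun_eq_iff restrict_def intro!: ring.ring_simprules(13) r)
  qed
qed

context affine_chart
begin

abbreviation "amb \<equiv> section_ambient I"

lemma amb_eq: "amb = ring_product (points I) (\<lambda>P. localization (type_ring Quot I) (cl ` M P))"
proof -
  have "homog_loc (coord_ring I) (coord_grading I) = (\<lambda>P. localization (type_ring Quot I) (cl ` M P))"
    by (rule ext) (rule homog_loc_eq)
  then show ?thesis by (simp add: section_ambient_def stalk_product_def points_def)
qed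

lemma amb_cring: "cring amb"
  unfolding amb_eq by (rule ring_product_cring) (rule quotient_localization.L_cring[OF loc_at])

lemma amb_ops:
  "P \<in> points I \<Longrightarrow> (s \<oplus>\<^bsub>amb\<^esub> t) P = s P \<oplus>\<^bsub>localization (type_ring Quot I) (cl ` M P)\<^esub> t P"
  "P \<in> points I \<Longrightarrow> (s \<otimes>\<^bsub>amb\<^esub> t) P = s P \<otimes>\<^bsub>localization (type_ring Quot I) (cl ` M P)\<^esub> t P"
  "s \<oplus>\<^bsub>amb\<^esub> t \<in> extensional (points I)" "s \<otimes>\<^bsub>amb\<^esub> t \<in> extensional (points I)"
  by (simp_all add: amb_eq ring_product_def)

lemma sec_add: "sec n F \<oplus>\<^bsub>amb\<^esub> sec n G = sec n (F + G)"
proof (rule sym, rule sec_eqI)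
  fix P assume P: "P \<in> points I"
  interpret loc: quotient_localization I "M P" by (rule loc_at[OF P])
  obtain N A where A: "A \<in> forms (N + n)" "A - F \<in> J" using rep_exists by blast
  obtain N' B where B: "B \<in> forms (N' + n)" "B - G \<in> J" using rep_exists by blast
  have "A * l ^ N' \<in> forms (N + n + N')" "B * l ^ N \<in> forms (N' + n + N)"
    using forms_mult A(1) B(1) l_pow_form by blast+
  then have f: "A * l ^ N' + B * l ^ N \<in> forms (N + N' + n)" by (intro forms_add) (simp_all add: ac_simps)
  have "(A * l ^ N' - F) + (B * l ^ N - G) \<in> J"
    by (intro ideal_set_add[OF J_ideal] J_cong[OF A(2) l_pow_J'] J_cong[OF B(2) l_pow_J'])
  then have "(A * l ^ N' + B * l ^ N) - (F + G) \<in> J" by (simp add: algebra_simps)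
  from sec_eq[OF P f this] show "sec n (F + G) P = (sec n F \<oplus>\<^bsub>amb\<^esub> sec n G) P"
    using sec_eq[OF P A] sec_eq[OF P B] l_pow_M[OF P] by (simp add: amb_ops(1)[OF P] loc.frac_add power_add)
qed (rule amb_ops)

lemma sec_mult: "sec m F \<otimes>\<^bsub>amb\<^esub> sec n G = sec (m + n) (F * G)"
proof (rule sym, rule sec_eqI)
  fix P assume P: "P \<in> points I"
  interpret loc: quotient_localization I "M P" by (rule loc_at[OF P])
  obtain N A where A: "A \<in> forms (N + m)" "A - F \<in> J" using rep_exists by blast
  obtain N' B where B: "B \<in> forms (N' + n)" "B - G \<in> J" using rep_exists by blast
  have f: "A * B \<in> forms (N + N' + (m + n))" using forms_mult[OF A(1) B(1)] by (simp add: ac_simps)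
  have "B * (A - F) + F * (B - G) \<in> J" by (rule ideal_set_lin[OF J_ideal A(2) B(2)])
  then have "A * B - F * G \<in> J" by (simp add: algebra_simps)
  from sec_eq[OF P f this] show "sec (m + n) (F * G) P = (sec m F \<otimes>\<^bsub>amb\<^esub> sec n G) P"
    using sec_eq[OF P A] sec_eq[OF P B] l_pow_M[OF P] by (simp add: amb_ops(2)[OF P] loc.frac_mult power_add)
qed (rule amb_ops)

lemma sec_one: "\<one>\<^bsub>amb\<^esub> = sec 0 1"
proof (rule sym, rule sec_eqI)
  show "\<one>\<^bsub>amb\<^esub> \<in> extensional (points I)" by (simp add: amb_eq ring_product_def)
  fix P assume P: "P \<in> points I"
  interpret loc: quotient_localization I "M P" by (rule loc_at[OF P])
  have "sec 0 1 P = fr P 1 (l ^ 0)" by (rule sec_eq[OF P]) (auto simp: one_forms ideal_set_zero[OF J_ideal])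
  then show "sec 0 1 P = \<one>\<^bsub>amb\<^esub> P" using P by (simp add: amb_eq ring_product_def loc.frac_one)
qed

lemma sec_zero: "\<zero>\<^bsub>amb\<^esub> = sec n 0"
proof (rule sym, rule sec_eqI)
  show "\<zero>\<^bsub>amb\<^esub> \<in> extensional (points I)" by (simp add: amb_eq ring_product_def)
  fix P assume P: "P \<in> points I"
  interpret loc: quotient_localization I "M P" by (rule loc_at[OF P])
  have "sec n 0 P = fr P 0 (l ^ 0)" by (rule sec_eq[OF P]) (auto simp: forms_zero ideal_set_zero[OF J_ideal])
  then show "sec n 0 P = \<zero>\<^bsub>amb\<^esub> P" using P by (simp add: amb_eq ring_product_def loc.frac_zero)
qed

lemma sec_carrier: "sec n F \<in> carrier amb"
  unfolding amb_eq ring_product_def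
proof (simp, rule PiE_I)
  fix P assume P: "P \<in> points I"
  interpret loc: quotient_localization I "M P" by (rule loc_at[OF P])
  obtain N A where A: "A \<in> forms (N + n)" "A - F \<in> J" using rep_exists by blast
  show "sec n F P \<in> carrier (localization (type_ring Quot I) (cl ` M P))"
    unfolding sec_eq[OF P A] using l_pow_M[OF P] by (auto simp: loc.carrier_L)
qed (simp add: sec_def)

lemma const_sec_mult: "const_section I c \<otimes>\<^bsub>amb\<^esub> sec n F = sec n (scl c F)"
  by (simp add: const_section_eq sec_mult scl_def)

text \<open>The constructor of the inductive dimension predicate on sections is, on the side of polynomials, the
span of one more vector.\<close>

lemma line_extension_sec:
  "ring.line_extension amb (range (const_section I)) (sec n F) (sec n ` mp.span B) = sec n ` mp.span (insert F B)"
proof -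
  interpret amb: cring amb by (rule amb_cring)
  have "ring.line_extension amb (range (const_section I)) (sec n F) (sec n ` mp.span B)
      = {sec n (scl c F + G) |c G. G \<in> mp.span B}"
    unfolding amb.line_extension_def set_add_def' r_coset_def
    by (auto simp: const_sec_mult sec_add)
  also have "\<dots> = sec n ` mp.span (insert F B)"
  proof (intro equalityI subsetI)
    fix x assume "x \<in> {sec n (scl c F + G) |c G. G \<in> mp.span B}"
    then obtain c G where x: "x = sec n (scl c F + G)" "G \<in> mp.span B" by blast
    have "(scl c F + G) - scl c F \<in> mp.span B" using x(2) by simp
    then have "scl c F + G \<in> mp.span (insert F B)" unfolding mp.span_breakdown_eq by blast
    then show "x \<in> sec n ` mp.span (insert F B)" using x(1) by blast
  next
    fix x assume "x \<in> sec n ` mp.span (insert F B)"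
    then obtain H where H: "x = sec n H" "H \<in> mp.span (insert F B)" by blast
    then obtain c where "H - scl c F \<in> mp.span B" unfolding mp.span_breakdown_eq by blast
    then show "x \<in> {sec n (scl c F + G) |c G. G \<in> mp.span B}"
      using H(1) by (auto intro!: exI[of _ c] exI[of _ "H - scl c F"])
  qed
  finally show ?thesis .
qed

lemma span_insert_meets_J:
  assumes B: "mp.span B \<inter> J = {0}" and F: "sec n F \<notin> sec n ` mp.span B"
  shows "mp.span (insert F B) \<inter> J = {0}"
proof -
  have "H = 0" if H: "H \<in> mp.span (insert F B)" "H \<in> J" for H
  proof -
    obtain c where c: "H - scl c F \<in> mp.span B" using H(1) unfolding mp.span_breakdown_eq by blast
    have "c = 0"
    proof (rule ccontr)
      assume "c \<noteq> 0"
      have "scl (inverse c) H \<in> J" by (rule mp.ideal_set_scale[OF J_ideal H(2)])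
      moreover have "F - scl (- inverse c) (H - scl c F) = scl (inverse c) H"
        using \<open>c \<noteq> 0\<close> by (simp add: mp.scale_right_diff_distrib)
      ultimately have "sec n F = sec n (scl (- inverse c) (H - scl c F))" by (simp add: sec_eq_iff)
      then show False using F mp.span_scale[OF c] by blast
    qed
    then show ?thesis using c H(2) B by auto
  qed
  then show ?thesis using mp.span_zero ideal_set_zero[OF J_ideal] by blast
qed

lemma H0_dim_span:
  assumes "finite B" "mp.independent B" "mp.span B \<inter> J = {0}"
  shows "H0_dim I (card B) (sec n ` mp.span B)"
  using assms
proof (induction B rule: finite_induct)
  interpret amb: cring amb by (rule amb_cring)
  case empty
  have "amb.dimension 0 (range (const_section I)) {\<zero>\<^bsub>amb\<^esub>}" by (rule amb.zero_dim)
  then show ?case by (simp add: H0_dim_def sec_zero[of n])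
next
  interpret amb: cring amb by (rule amb_cring)
  case (insert F B)
  have ind: "mp.independent B" "F \<notin> mp.span B"
    using insert.prems(1) insert.hyps(2) by (simp_all add: mp.independent_insert)
  have J: "mp.span B \<inter> J = {0}"
    using insert.prems(2) mp.span_mono[of B "insert F B"] mp.span_zero[of B] ideal_set_zero[OF J_ideal] by blast
  have "sec n F \<notin> sec n ` mp.span B"
  proof
    assume "sec n F \<in> sec n ` mp.span B"
    then obtain G where G: "G \<in> mp.span B" "F - G \<in> J" by (auto simp: sec_eq_iff)
    have "F - G \<in> mp.span (insert F B)"
      using G(1) mp.span_mono[of B "insert F B"] by (intro mp.span_diff) (auto intro: mp.span_base)
    then have "F - G = 0" using G(2) insert.prems(2) by blast
    then show False using G(1) ind(2) by simp
  qed
  from amb.Suc_dim[OF sec_carrier this insert.IH[OF ind(1) J, unfolded H0_dim_def]]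
  show ?case using insert.hyps by (simp add: H0_dim_def line_extension_sec)
qed

lemma dimension_carrier:
  assumes "ring.dimension amb d (range (const_section I)) E" shows "E \<subseteq> carrier amb"
proof -
  interpret amb: cring amb by (rule amb_cring)
  show ?thesis using assms
  proof (induction d "range (const_section I)" E rule: amb.dimension.induct)
    case (Suc_dim v E d)
    then show ?case unfolding amb.line_extension_def set_add_def' r_coset_def
      using sec_carrier by (auto simp: const_section_eq)
  qed simp
qed

lemma H0_dim_spanD:
  assumes "H0_dim I d E" "E \<subseteq> range (sec n)"
  shows "\<exists>B. finite B \<and> card B = d \<and> mp.independent B \<and> mp.span B \<inter> J = {0} \<and> E = sec n ` mp.span B"
proof -
  interpret amb: cring amb by (rule amb_cring)
  have "amb.dimension d (range (const_section I)) E" using assms(1) by (simp add: H0_dim_def)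
  then show ?thesis using assms(2)
  proof (induction d "range (const_section I)" E rule: amb.dimension.induct)
    case zero_dim
    show ?case using sec_zero[of n] by (intro exI[of _ "{}"]) (auto simp: ideal_set_zero[OF J_ideal] mp.independent_empty)
  next
    case (Suc_dim v E d)
    let ?K = "range (const_section I)"
    have K: "const_section I c \<in> ?K" for c by blast
    have ext: "x \<in> amb.line_extension ?K v E" if "x \<in> E" "x \<in> carrier amb" for x
    proof -
      have "const_section I 0 \<otimes>\<^bsub>amb\<^esub> v \<oplus>\<^bsub>amb\<^esub> x = x"
        using that Suc_dim.hyps(1) by (simp add: const_section_eq cst_zero sec_zero[of 0, symmetric])
      then show ?thesis unfolding amb.line_extension_def set_add_def' r_coset_def using that(1) by blast
    qed
    have EC: "E \<subseteq> carrier amb" by (rule dimension_carrier[OF Suc_dim.hyps(3)])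
    have "E \<subseteq> range (sec n)" using ext EC Suc_dim.prems by blast
    then obtain B where B: "finite B" "card B = d" "mp.independent B" "mp.span B \<inter> J = {0}" "E = sec n ` mp.span B"
      using Suc_dim.hyps(4) by blast
    have "\<zero>\<^bsub>amb\<^esub> \<in> E" unfolding B(5) sec_zero[of n] using mp.span_zero by blast
    then have "const_section I 1 \<otimes>\<^bsub>amb\<^esub> v \<oplus>\<^bsub>amb\<^esub> \<zero>\<^bsub>amb\<^esub> \<in> amb.line_extension ?K v E"
      unfolding amb.line_extension_def set_add_def' r_coset_def by blast
    then have "v \<in> amb.line_extension ?K v E"
      using Suc_dim.hyps(1) by (simp add: const_section_eq cst_one sec_one[symmetric])
    then obtain F where F: "v = sec n F" using Suc_dim.prems by blast
    have nF: "sec n F \<notin> sec n ` mp.span B" using Suc_dim.hyps(2) F B(5) by simp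
    then have FB: "F \<notin> mp.span B" by blast
    have "F \<notin> B" using FB mp.span_base by blast
    have "mp.independent (insert F B)" using FB B(3) by (rule mp.independent_insertI)
    moreover have "mp.span (insert F B) \<inter> J = {0}" by (rule span_insert_meets_J[OF B(4) nF])
    moreover have "amb.line_extension ?K v E = sec n ` mp.span (insert F B)"
      unfolding F B(5) by (rule line_extension_sec)
    ultimately show ?case using B(1,2) \<open>F \<notin> B\<close> by (intro exI[of _ "insert F B"]) auto
  qed
qed

lemma rdim_span:
  assumes C: "mp.fin_complement J C" and "finite B" "mp.independent B" "mp.span B \<inter> J = {0}"
  shows "mp.dim (mp.span (J \<union> B) \<inter> C) = card B"
  using assms(2-)
proof (induction B rule: finite_induct)
  case empty
  have "mp.span J = J" using mp.ideal_set_subspace[OF J_ideal] mp.span_eq_iff by blast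
  then show ?case using mp.rdim_zero[OF C] by (simp del: mp.span_eq_iff)
next
  case (insert F B)
  have ind: "mp.independent B" "F \<notin> mp.span B"
    using insert.prems(1) insert.hyps(2) by (simp_all add: mp.independent_insert)
  have J: "mp.span B \<inter> J = {0}"
    using insert.prems(2) mp.span_mono[of B "insert F B"] mp.span_zero[of B] ideal_set_zero[OF J_ideal] by blast
  have F: "F \<notin> mp.span (J \<union> B)"
  proof
    assume "F \<in> mp.span (J \<union> B)"
    then obtain j b where jb: "F = j + b" "j \<in> mp.span J" "b \<in> mp.span B" unfolding mp.span_Un by blast
    have "mp.span J = J" using mp.ideal_set_subspace[OF J_ideal] mp.span_eq_iff by blast
    then have "F - b \<in> J" using jb(1,2) by (simp del: mp.span_eq_iff)
    moreover have "F - b \<in> mp.span (insert F B)"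
      using jb(3) mp.span_mono[of B "insert F B"] by (intro mp.span_diff) (auto intro: mp.span_base)
    ultimately have "F - b = 0" using insert.prems(2) by blast
    then show False using jb(3) ind(2) by simp
  qed
  have "mp.dim (mp.span (insert F (mp.span (J \<union> B))) \<inter> C) = Suc (mp.dim (mp.span (J \<union> B) \<inter> C))"
    by (rule mp.rdim_insert[OF C _ _ F]) (auto intro: mp.span_base)
  moreover have "mp.span (insert F (mp.span (J \<union> B))) = mp.span (J \<union> insert F B)"
    by (simp add: mp.span_insert mp.span_span)
  ultimately show ?case using insert.IH[OF ind(1) J] insert.hyps by simp
qed

text \<open>Translates the dimension of a space of sections into the dimension of a subspace of the complement \<open>C\<close>
of \<open>J\<close>, where the usual linear algebra applies.\<close>

lemma H0_dim_iff:
  assumes C: "mp.fin_complement J C" and U: "mp.subspace U" "J \<subseteq> U"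
  shows "H0_dim I d (sec n ` U) \<longleftrightarrow> mp.dim (U \<inter> C) = d"
proof -
  have sub: "mp.subspace (U \<inter> C)" by (rule mp.complement_int_subspace[OF C U(1)])
  obtain b where b: "b \<subseteq> U \<inter> C" "mp.independent b" "U \<inter> C \<subseteq> mp.span b" "card b = mp.dim (U \<inter> C)"
    by (rule mp.basis_exists)
  obtain B0 where B0: "finite B0" "C = mp.span B0" using C by (auto simp: mp.fin_complement_def)
  have fb: "finite b" using mp.independent_span_bound[OF B0(1) b(2)] b(1) B0(2) by blast
  have spb: "mp.span b = U \<inter> C" using b(1,3) mp.span_minimal[OF _ sub] by blast
  have CJ: "C \<inter> J = {0}" using C by (auto simp: mp.fin_complement_def)
  have "sec n ` U = sec n ` (U \<inter> C)"
  proof (intro equalityI image_subsetI)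
    fix F assume F: "F \<in> U"
    obtain c where c: "c \<in> C" "F - c \<in> J" using C by (auto simp: mp.fin_complement_def)
    have "F - (F - c) \<in> U" using F c(2) U mp.subspace_diff by blast
    then have "c \<in> U \<inter> C" using c(1) by simp
    then show "sec n F \<in> sec n ` (U \<inter> C)" using c(2) sec_eq_iff by blast
  qed auto
  then have "sec n ` U = sec n ` mp.span b" using spb by simp
  moreover have "mp.span b \<inter> J = {0}" using spb CJ U mp.subspace_0[OF sub] ideal_set_zero[OF J_ideal] by auto
  ultimately have 1: "H0_dim I (mp.dim (U \<inter> C)) (sec n ` U)" using H0_dim_span[OF fb b(2)] b(4) by simp
  have "mp.dim (U \<inter> C) = d" if d: "H0_dim I d (sec n ` U)"
  proof -
    obtain B where B: "finite B" "card B = d" "mp.independent B" "mp.span B \<inter> J = {0}" "sec n ` U = sec n ` mp.span B"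
      using H0_dim_spanD[OF d image_mono[OF subset_UNIV]] by (elim exE conjE) (rule that)
    have "U = mp.span (J \<union> B)"
    proof (intro equalityI subsetI)
      fix F assume "F \<in> U"
      then have "sec n F \<in> sec n ` mp.span B" using B(5) by blast
      then obtain G where G: "G \<in> mp.span B" "F - G \<in> J" by (auto simp: sec_eq_iff)
      have "(F - G) + G \<in> mp.span (J \<union> B)"
        using G mp.span_mono[of B "J \<union> B"] by (intro mp.span_add) (auto intro: mp.span_base)
      then show "F \<in> mp.span (J \<union> B)" by simp
    next
      have "B \<subseteq> U"
      proof
        fix F assume "F \<in> B"
        then have "sec n F \<in> sec n ` U" using B(5) mp.span_base by blast
        then obtain G where G: "G \<in> U" "F - G \<in> J" by (auto simp: sec_eq_iff)
        then have "(F - G) + G \<in> U" using U mp.subspace_add by blast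
        then show "F \<in> U" by simp
      qed
      fix F assume "F \<in> mp.span (J \<union> B)"
      then show "F \<in> U" using mp.span_minimal[of "J \<union> B" U] U \<open>B \<subseteq> U\<close> by blast
    qed
    then show ?thesis using rdim_span[OF C B(1,3,4)] B(2) by simp
  qed
  then show ?thesis using 1 by blast
qed

lemma complement_of_degree:
  assumes "has_degree I d"
  shows "\<exists>C. mp.fin_complement J C \<and> mp.dim C = d"
proof -
  have H: "H0 I 0 = sec 0 ` UNIV" using H0_eq[of 0] by simp
  have "H0_dim I d (sec 0 ` UNIV)" using assms by (simp add: has_degree_def H)
  from H0_dim_spanD[OF this order_refl] obtain B where B: "finite B" "card B = d" "mp.independent B" "mp.span B \<inter> J = {0}" "range (sec 0) = sec 0 ` mp.span B"
    by (elim exE conjE) (rule that)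
  have "\<exists>c\<in>mp.span B. F - c \<in> J" for F
  proof -
    have "sec 0 F \<in> sec 0 ` mp.span B" using B(5) by blast
    then show ?thesis by (auto simp: sec_eq_iff)
  qed
  then have "mp.fin_complement J (mp.span B)" unfolding mp.fin_complement_def
    using B mp.ideal_set_subspace[OF J_ideal] by blast
  moreover have "mp.dim (mp.span B) = d" using mp.dim_span_eq_card_independent[OF B(3)] B(2) by simp
  ultimately show ?thesis by blast
qed

lemma sec_forms: "sec n ` forms n = sec n ` W n"
proof (intro equalityI image_subsetI)
  fix F assume "F \<in> W n"
  then obtain A where "A \<in> forms n" "A - F \<in> J" by (auto simp: W_def)
  moreover from this have "sec n F = sec n A" using J_sym by (simp add: sec_eq_iff)
  ultimately show "sec n F \<in> sec n ` forms n" by blast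
qed (auto intro: forms_W)

lemma fails_by_one_iff:
  assumes C: "mp.fin_complement J C"
  shows "fails_by_one_on_quadrics I \<longleftrightarrow> Suc (mp.dim (W 2 \<inter> C)) = mp.dim C"
proof -
  have "restrict_form I ` forms 2 = sec 2 ` forms 2" using restrict_form_eq by (intro image_cong) auto
  then have "restrict_form I ` forms 2 = sec 2 ` W 2" by (simp add: sec_forms)
  moreover have "H0 I 2 = sec 2 ` UNIV" using H0_eq[of 2] by simp
  ultimately show ?thesis unfolding fails_by_one_on_quadrics_def
    using H0_dim_iff[OF C W_subspace J_subset_W, of _ 2 2] H0_dim_iff[OF C mp.subspace_UNIV, of _ 2] by auto
qed

end

section \<open>Self-association as a functional\<close>

context affine_chart
begin

lemma H0_0: "H0 I 0 = range (sec 0)" and H0_1: "H0 I 1 = range (sec 1)"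
  using H0_eq[of 0] H0_eq[of 1] by simp_all

text \<open>A generator of the dualizing module of \<open>A = S / J\<close> for which the linear forms are isotropic, as a
functional on polynomials.\<close>

definition dual_form :: "(('n, 'k) mpoly \<Rightarrow> 'k) \<Rightarrow> bool" where
  "dual_form \<Phi> \<longleftrightarrow> mp.functional \<Phi> \<and> mp.perp \<Phi> UNIV = J \<and> (\<forall>F\<in>forms 2. \<Phi> F = 0)"

lemma dual_carrier_iff:
  "\<phi> \<in> carrier (dualizing_module I) \<longleftrightarrow> \<phi> \<in> extensional (range (sec 0)) \<and>
     (\<forall>F G. \<phi> (sec 0 (F + G)) = \<phi> (sec 0 F) + \<phi> (sec 0 G)) \<and> (\<forall>c F. \<phi> (sec 0 (scl c F)) = c * \<phi> (sec 0 F))"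
  by (auto simp: dualizing_module_def structure_algebra_def Let_def H0_0 sec_add const_sec_mult)

lemma dual_ops:
  "(\<phi> \<oplus>\<^bsub>dualizing_module I\<^esub> \<psi>) (sec 0 F) = \<phi> (sec 0 F) + \<psi> (sec 0 F)"
  "(a \<odot>\<^bsub>dualizing_module I\<^esub> \<phi>) (sec 0 F) = \<phi> (a \<otimes>\<^bsub>amb\<^esub> sec 0 F)"
  "\<phi> \<oplus>\<^bsub>dualizing_module I\<^esub> \<psi> \<in> extensional (range (sec 0))"
  "a \<odot>\<^bsub>dualizing_module I\<^esub> \<phi> \<in> extensional (range (sec 0))"
  by (auto simp: dualizing_module_def structure_algebra_def Let_def H0_0)

lemma K_carrier_iff:
  "\<psi> \<in> carrier (K_twist_minus_1 I) \<longleftrightarrow> \<psi> \<in> range (sec 1) \<rightarrow>\<^sub>E carrier (dualizing_module I) \<and>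
     (\<forall>F G. \<psi> (sec 1 (F + G)) = \<psi> (sec 1 F) \<oplus>\<^bsub>dualizing_module I\<^esub> \<psi> (sec 1 G)) \<and>
     (\<forall>A F. \<psi> (sec 1 (A * F)) = sec 0 A \<odot>\<^bsub>dualizing_module I\<^esub> \<psi> (sec 1 F))"
  by (auto simp: K_twist_minus_1_def Hom_module_def module_hom_def twist_module_def structure_algebra_def
      H0_0 H0_1 sec_add sec_mult)

lemma K_ops:
  "(\<psi> \<oplus>\<^bsub>K_twist_minus_1 I\<^esub> \<chi>) (sec 1 F) = \<psi> (sec 1 F) \<oplus>\<^bsub>dualizing_module I\<^esub> \<chi> (sec 1 F)"
  "(a \<odot>\<^bsub>K_twist_minus_1 I\<^esub> \<psi>) (sec 1 F) = a \<odot>\<^bsub>dualizing_module I\<^esub> \<psi> (sec 1 F)"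
  "\<psi> \<oplus>\<^bsub>K_twist_minus_1 I\<^esub> \<chi> \<in> extensional (range (sec 1))"
  "a \<odot>\<^bsub>K_twist_minus_1 I\<^esub> \<psi> \<in> extensional (range (sec 1))"
  by (auto simp: K_twist_minus_1_def Hom_module_def twist_module_def H0_1)

lemma iso_iff:
  "h \<in> module_iso (structure_algebra I) (twist_module I 1) (K_twist_minus_1 I) \<longleftrightarrow>
     h \<in> range (sec 1) \<rightarrow>\<^sub>E carrier (K_twist_minus_1 I) \<and>
     (\<forall>F G. h (sec 1 (F + G)) = h (sec 1 F) \<oplus>\<^bsub>K_twist_minus_1 I\<^esub> h (sec 1 G)) \<and>
     (\<forall>A F. h (sec 1 (A * F)) = sec 0 A \<odot>\<^bsub>K_twist_minus_1 I\<^esub> h (sec 1 F)) \<and>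
     bij_betw h (range (sec 1)) (carrier (K_twist_minus_1 I))"
  by (auto simp: module_iso_def module_hom_def twist_module_def structure_algebra_def
      H0_0 H0_1 sec_add sec_mult)

lemma trace_eq: "trace I \<phi> = \<phi> (sec 0 1)"
  by (simp add: trace_def structure_algebra_def sec_one)

lemma linear_sections_eq: "linear_sections I = sec 1 ` forms 1"
  unfolding linear_sections_def by (rule image_cong) (auto simp: restrict_form_eq)

lemma perp_iff: "\<psi> \<in> linear_sections_perp I \<longleftrightarrow> \<psi> \<in> carrier (K_twist_minus_1 I) \<and>
    (\<forall>F\<in>forms 1. \<psi> (sec 1 F) (sec 0 1) = 0)"
  by (auto simp: linear_sections_perp_def linear_sections_eq trace_eq)

lemma forms_2_induct:
  assumes "F \<in> forms 2" "\<And>A B. A \<in> forms 1 \<Longrightarrow> B \<in> forms 1 \<Longrightarrow> A * B \<in> K" "0 \<in> K"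
    "\<And>A B. A \<in> K \<Longrightarrow> B \<in> K \<Longrightarrow> A + B \<in> K"
  shows "F \<in> (K :: ('n, 'k) mpoly set)"
proof -
  have "F \<in> forms (Suc 1)" using assms(1) by (simp add: numeral_2_eq_2)
  then show ?thesis by (rule forms_Suc_induct) (use assms(3,4) assms(2)[OF vr_forms] in blast)+
qed

text \<open>The isomorphism \<open>h\<close> is linear over \<open>A\<close> in all arguments, so \<open>h(F)(G)(H)\<close> only depends on the product
\<open>F G H\<close>; its value is \<open>\<Phi>(F G H)\<close>. Injectivity of \<open>h\<close> is nondegeneracy of \<open>\<Phi>\<close>.\<close>

lemma dual_form_if_self_associated:
  assumes "self_associated I"
  shows "\<exists>\<Phi>. dual_form \<Phi>"
proof -
  obtain h where iso: "h \<in> module_iso (structure_algebra I) (twist_module I 1) (K_twist_minus_1 I)"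
    and perp: "h ` linear_sections I = linear_sections_perp I"
    using assms by (auto simp: self_associated_def)
  define \<beta> where "\<beta> F G H = h (sec 1 F) (sec 1 G) (sec 0 H)" for F G H
  have hK: "h (sec 1 F) \<in> carrier (K_twist_minus_1 I)" for F using iso by (auto simp: iso_iff)
  have hD: "h (sec 1 F) (sec 1 G) \<in> carrier (dualizing_module I)" for F G
    using hK[of F] by (auto simp: K_carrier_iff)
  have m1: "\<beta> (A * F) G H = \<beta> F G (A * H)" for A F G H
    using iso by (simp add: iso_iff \<beta>_def K_ops dual_ops sec_mult del: One_nat_def)
  have m2: "\<beta> F (A * G) H = \<beta> F G (A * H)" for A F G H
    using hK[of F] by (simp add: K_carrier_iff \<beta>_def dual_ops sec_mult del: One_nat_def)
  define \<Phi> where "\<Phi> H = \<beta> 1 1 H" for H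
  have \<beta>: "\<beta> F G H = \<Phi> (F * G * H)" for F G H
    using m1[of F 1 G H] m2[of 1 G 1 "F * H"] by (simp add: \<Phi>_def ac_simps)
  have lin: "mp.functional \<Phi>" unfolding mp.functional_def
    using hD[of 1 1] by (simp add: dual_carrier_iff \<Phi>_def \<beta>_def)
  have inj: "inj_on h (range (sec 1))" using iso by (auto simp: iso_iff bij_betw_def)
  have "mp.perp \<Phi> UNIV = J"
  proof (intro equalityI subsetI)
    fix F assume "F \<in> mp.perp \<Phi> UNIV"
    then have F: "\<beta> F G H = \<beta> 0 G H" for G H
      using mp.functional_zero[OF lin] by (simp add: \<beta> mp.perp_def mult.assoc)
    have "h (sec 1 F) = h (sec 1 0)"
    proof (rule extensionalityI[of _ "range (sec 1)"])
      show "h (sec 1 F) \<in> extensional (range (sec 1))" "h (sec 1 0) \<in> extensional (range (sec 1))"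
        using hK by (auto simp: K_carrier_iff PiE_def)
      fix x assume "x \<in> range (sec 1)"
      then obtain G where G: "x = sec 1 G" by blast
      show "h (sec 1 F) x = h (sec 1 0) x" unfolding G
      proof (rule extensionalityI[of _ "range (sec 0)"])
        show "h (sec 1 F) (sec 1 G) \<in> extensional (range (sec 0))" "h (sec 1 0) (sec 1 G) \<in> extensional (range (sec 0))"
          using hD by (auto simp: dual_carrier_iff)
      qed (use F in \<open>auto simp: \<beta>_def\<close>)
    qed
    then have "sec 1 F = sec 1 0" using inj by (auto dest: inj_onD)
    then show "F \<in> J" by (simp add: sec_eq_iff)
  next
    fix F assume F: "F \<in> J"
    then have z: "sec 1 F = sec 1 0" by (simp add: sec_eq_iff)
    have "\<beta> F 1 H = \<beta> 0 1 H" for H unfolding \<beta>_def z ..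
    then show "F \<in> mp.perp \<Phi> UNIV" using mp.functional_zero[OF lin] by (simp add: \<beta> mp.perp_def)
  qed
  moreover have "\<forall>F\<in>forms 2. \<Phi> F = 0"
  proof
    fix F :: "('n, 'k) mpoly" assume "F \<in> forms 2"
    then have "F \<in> {F. \<Phi> F = 0}"
    proof (rule forms_2_induct)
      fix A B :: "('n, 'k) mpoly" assume A: "A \<in> forms 1" and B: "B \<in> forms 1"
      have "h (sec 1 A) \<in> linear_sections_perp I" using A perp by (auto simp: linear_sections_eq)
      then have "\<beta> A B 1 = 0" using B by (simp add: perp_iff \<beta>_def)
      then show "A * B \<in> {F. \<Phi> F = 0}" by (simp add: \<beta>)
    qed (use lin in \<open>auto simp: mp.functional_zero mp.functional_add\<close>)
    then show "\<Phi> F = 0" by simp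
  qed
  ultimately show ?thesis using lin unfolding dual_form_def by blast
qed

text \<open>The isomorphism sends \<open>F\<close> to the map \<open>G \<mapsto> (H \<mapsto> \<Phi>(F G H))\<close>. It is onto because \<open>\<Phi>\<close> represents every
functional on \<open>A\<close>, and it carries the linear forms onto their annihilator by the dimension count.\<close>

lemma self_associated_if_dual_form:
  assumes \<Phi>: "dual_form \<Phi>" and gs: "gorenstein_scheme I" and C: "mp.fin_complement J C"
    and dim: "mp.dim C = 2 * mp.dim (W 1 \<inter> C)"
  shows "self_associated I"
proof -
  have lin: "mp.functional \<Phi>" and pJ: "mp.perp \<Phi> UNIV = J" and quad: "\<And>F. F \<in> forms 2 \<Longrightarrow> \<Phi> F = 0"
    using \<Phi> by (auto simp: dual_form_def)
  note cod = mp.fin_complement_imp_codim[OF C]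
  have \<Phi>J: "\<Phi> F = \<Phi> G" if "F - G \<in> J" for F G
    using mp.functional_perp_UNIV[of "F - G" \<Phi>] that lin pJ by (simp add: mp.functional_diff)
  \<comment> \<open>As \<open>W 1\<close> has half the dimension of \<open>A\<close>, being isotropic makes it its own orthogonal.\<close>
  have "W 1 \<subseteq> mp.perp \<Phi> (W 1)"
  proof
    fix F assume "F \<in> W 1"
    have "\<Phi> (F * G) = 0" if "G \<in> W 1" for G
    proof -
      have "F * G \<in> W (1 + 1)" by (rule W_mult[OF \<open>F \<in> W 1\<close> that])
      then obtain A where "A \<in> forms 2" "A - F * G \<in> J" by (auto simp: W_def numeral_2_eq_2)
      then show ?thesis using \<Phi>J[of A "F * G"] quad[of A] by simp
    qed
    then show "F \<in> mp.perp \<Phi> (W 1)" by (simp add: mp.perp_def)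
  qed
  moreover have "mp.dim (W 1 \<inter> C) + mp.dim (mp.perp \<Phi> (W 1) \<inter> C) = mp.dim C"
    using mp.perp_dim[OF lin _ W_subspace, of C 1] C pJ J_subset_W by simp
  ultimately have W1: "W 1 = mp.perp \<Phi> (W 1)"
    using mp.rdim_eq[OF C W_subspace mp.perp_subspace[OF lin] J_subset_W] dim by simp
  define \<Psi> where "\<Psi> F G H = \<Phi> (F * G * H)" for F G H
  have wd: "\<Psi> F G H = \<Psi> F' G' H'" if "sec 1 F = sec 1 F'" "sec 1 G = sec 1 G'" "sec 0 H = sec 0 H'" for F F' G G' H H'
  proof -
    have m: "F - F' \<in> J" "G - G' \<in> J" "H - H' \<in> J" using that by (simp_all add: sec_eq_iff)
    have "(G * H) * (F - F') + (F' * H) * (G - G') + (F' * G') * (H - H') \<in> J"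
      using m by (intro ideal_set_add[OF J_ideal] ideal_set_mult[OF J_ideal])
    then have "F * G * H - F' * G' * H' \<in> J" by (simp add: algebra_simps)
    then show ?thesis unfolding \<Psi>_def by (rule \<Phi>J)
  qed
  define lift where "lift n x = (SOME F. sec n F = x)" for n x
  have lift: "sec n (lift n (sec n F)) = sec n F" for n F
    unfolding lift_def by (rule someI) (rule refl)
  define h where "h = (\<lambda>x\<in>range (sec 1). \<lambda>y\<in>range (sec 1). \<lambda>z\<in>range (sec 0). \<Psi> (lift 1 x) (lift 1 y) (lift 0 z))"
  have h: "h (sec 1 F) (sec 1 G) (sec 0 H) = \<Phi> (F * G * H)" for F G H
    using wd[OF lift lift lift, of F G H] by (simp add: h_def \<Psi>_def)
  have hD: "h (sec 1 F) (sec 1 G) \<in> carrier (dualizing_module I)" for F G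
    unfolding dual_carrier_iff using lin
    by (auto simp: h distrib_left mp.mult_scale mp.functional_add mp.functional_scale simp del: One_nat_def) (simp add: h_def)
  have hext: "h (sec 1 F) \<in> extensional (range (sec 1))" "h (sec 1 F) (sec 1 G) \<in> extensional (range (sec 0))" for F G
    by (simp_all add: h_def)
  have hK: "h (sec 1 F) \<in> carrier (K_twist_minus_1 I)" for F
    unfolding K_carrier_iff
  proof (intro conjI allI)
    show "h (sec 1 F) \<in> range (sec 1) \<rightarrow>\<^sub>E carrier (dualizing_module I)" using hD hext by (auto simp: PiE_def)
    fix G G'
    show "h (sec 1 F) (sec 1 (G + G')) = h (sec 1 F) (sec 1 G) \<oplus>\<^bsub>dualizing_module I\<^esub> h (sec 1 F) (sec 1 G')"
      by (rule extensionalityI[OF hext(2) dual_ops(3)])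
         (use lin in \<open>auto simp: h dual_ops distrib_left distrib_right mp.functional_add simp del: One_nat_def\<close>)
  next
    fix A G
    show "h (sec 1 F) (sec 1 (A * G)) = sec 0 A \<odot>\<^bsub>dualizing_module I\<^esub> h (sec 1 F) (sec 1 G)"
      by (rule extensionalityI[OF hext(2) dual_ops(4)]) (auto simp: h dual_ops sec_mult ac_simps simp del: One_nat_def)
  qed
  have K_eqI: "\<psi> = \<chi>" if "\<psi> \<in> carrier (K_twist_minus_1 I)" "\<chi> \<in> carrier (K_twist_minus_1 I)"
    "\<And>H. \<psi> (sec 1 1) (sec 0 H) = \<chi> (sec 1 1) (sec 0 H)" for \<psi> \<chi>
  proof (rule extensionalityI[of _ "range (sec 1)"])
    show "\<psi> \<in> extensional (range (sec 1))" "\<chi> \<in> extensional (range (sec 1))"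
      using that by (auto simp: K_carrier_iff PiE_def)
    have one: "\<xi> (sec 1 G) (sec 0 H) = \<xi> (sec 1 1) (sec 0 (G * H))" if "\<xi> \<in> carrier (K_twist_minus_1 I)" for \<xi> G H
    proof -
      have "\<xi> (sec 1 (G * 1)) = sec 0 G \<odot>\<^bsub>dualizing_module I\<^esub> \<xi> (sec 1 1)"
        using that unfolding K_carrier_iff by blast
      then show ?thesis by (simp add: dual_ops sec_mult)
    qed
    fix x assume "x \<in> range (sec 1)"
    then obtain G where G: "x = sec 1 G" by blast
    show "\<psi> x = \<chi> x" unfolding G
    proof (rule extensionalityI[of _ "range (sec 0)"])
      show "\<psi> (sec 1 G) \<in> extensional (range (sec 0))" "\<chi> (sec 1 G) \<in> extensional (range (sec 0))"
        using that by (auto simp: K_carrier_iff PiE_def dual_carrier_iff)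
      fix z assume "z \<in> range (sec 0)"
      then obtain H where "z = sec 0 H" by blast
      then show "\<psi> (sec 1 G) z = \<chi> (sec 1 G) z"
        using one[OF that(1), of G H] one[OF that(2), of G H] that(3)[of "G * H"] by (simp del: One_nat_def)
    qed
  qed
  have surj: "\<exists>F. \<psi> = h (sec 1 F)" if \<psi>: "\<psi> \<in> carrier (K_twist_minus_1 I)" for \<psi>
  proof -
    have D: "\<psi> (sec 1 1) \<in> carrier (dualizing_module I)" using \<psi> by (auto simp: K_carrier_iff)
    have fe: "mp.functional (\<lambda>H. \<psi> (sec 1 1) (sec 0 H))" using D by (simp add: dual_carrier_iff mp.functional_def)
    have "\<exists>g. \<forall>H. \<psi> (sec 1 1) (sec 0 H) = \<Phi> (g * H)"
    proof (rule mp.functional_represented[OF lin _ fe])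
      show "mp.fin_codim (mp.perp \<Phi> UNIV)" using cod pJ by simp
      fix H assume "H \<in> mp.perp \<Phi> UNIV"
      then have "sec 0 H = sec 0 0" by (simp add: pJ sec_eq_iff)
      then show "\<psi> (sec 1 1) (sec 0 H) = 0" using mp.functional_zero[OF fe] by simp
    qed
    then obtain g where "\<And>H. \<psi> (sec 1 1) (sec 0 H) = \<Phi> (g * H)" by blast
    then have "\<psi> = h (sec 1 g)" by (intro K_eqI \<psi> hK) (simp add: h del: One_nat_def)
    then show ?thesis by blast
  qed
  have inj: "inj_on h (range (sec 1))"
  proof (rule inj_onI)
    fix x y assume "x \<in> range (sec 1)" "y \<in> range (sec 1)" and eq: "h x = h y"
    then obtain F G where FG: "x = sec 1 F" "y = sec 1 G" by blast
    have "\<Phi> ((F - G) * H) = 0" for H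
      using h[of F 1 H] h[of G 1 H] eq FG lin by (simp add: left_diff_distrib mp.functional_diff)
    then have "F - G \<in> J" unfolding pJ[symmetric] by (simp add: mp.perp_def)
    then show "x = y" using FG by (simp add: sec_eq_iff)
  qed
  have "h \<in> module_iso (structure_algebra I) (twist_module I 1) (K_twist_minus_1 I)"
    unfolding iso_iff
  proof (intro conjI allI)
    show "h \<in> range (sec 1) \<rightarrow>\<^sub>E carrier (K_twist_minus_1 I)" using hK by (auto simp: h_def)
    show "bij_betw h (range (sec 1)) (carrier (K_twist_minus_1 I))"
      unfolding bij_betw_def using inj hK surj by blast
    fix F G
    have hK_ext: "h (sec 1 F) \<in> extensional (range (sec 1))" for F by (rule hext)
    show "h (sec 1 (F + G)) = h (sec 1 F) \<oplus>\<^bsub>K_twist_minus_1 I\<^esub> h (sec 1 G)"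
    proof (rule extensionalityI[OF hext(1) K_ops(3)])
      fix x assume "x \<in> range (sec 1)"
      then obtain E where E: "x = sec 1 E" by blast
      show "h (sec 1 (F + G)) x = (h (sec 1 F) \<oplus>\<^bsub>K_twist_minus_1 I\<^esub> h (sec 1 G)) x"
        unfolding E K_ops
        by (rule extensionalityI[OF hext(2) dual_ops(3)])
           (use lin in \<open>auto simp: h dual_ops distrib_right mp.functional_add simp del: One_nat_def\<close>)
    qed
  next
    fix A F
    show "h (sec 1 (A * F)) = sec 0 A \<odot>\<^bsub>K_twist_minus_1 I\<^esub> h (sec 1 F)"
    proof (rule extensionalityI[OF hext(1) K_ops(4)])
      fix x assume "x \<in> range (sec 1)"
      then obtain E where E: "x = sec 1 E" by blast
      show "h (sec 1 (A * F)) x = (sec 0 A \<odot>\<^bsub>K_twist_minus_1 I\<^esub> h (sec 1 F)) x"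
        unfolding E K_ops
        by (rule extensionalityI[OF hext(2) dual_ops(4)]) (auto simp: h dual_ops sec_mult ac_simps simp del: One_nat_def)
    qed
  qed
  moreover have "h ` linear_sections I = linear_sections_perp I"
  proof (intro equalityI subsetI)
    fix \<psi> assume "\<psi> \<in> h ` linear_sections I"
    then obtain F where F: "F \<in> forms 1" "\<psi> = h (sec 1 F)" by (auto simp: linear_sections_eq)
    have "\<Phi> (F * G) = 0" if "G \<in> forms 1" for G
      using quad forms_mult[OF F(1) that] by (simp add: numeral_2_eq_2)
    then show "\<psi> \<in> linear_sections_perp I" using hK F(2) by (simp add: perp_iff h del: One_nat_def)
  next
    fix \<psi> assume \<psi>: "\<psi> \<in> linear_sections_perp I"
    then obtain F where F: "\<psi> = h (sec 1 F)" using surj by (auto simp: perp_iff)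
    have "\<Phi> (F * G) = 0" if G: "G \<in> W 1" for G
    proof -
      obtain A where A: "A \<in> forms 1" "A - G \<in> J" using G by (auto simp: W_def)
      have "\<Phi> (F * A) = 0" using \<psi> A(1) F by (simp add: perp_iff h del: One_nat_def)
      moreover have "F * A - F * G \<in> J" using ideal_set_mult[OF J_ideal A(2), of F] by (simp add: right_diff_distrib)
      ultimately show ?thesis using \<Phi>J[of "F * A" "F * G"] by simp
    qed
    then have "F \<in> W 1" using W1 by (auto simp: mp.perp_def)
    then have "sec 1 F \<in> sec 1 ` forms 1" by (simp add: sec_forms)
    then show "\<psi> \<in> h ` linear_sections I" using F by (simp add: linear_sections_eq)
  qed
  ultimately show ?thesis using gs unfolding self_associated_def by blast
qed

end

section \<open>Gorenstein local rings from functionals\<close>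

lemma (in comm_algebra) fin_codim_mono:
  assumes "fin_codim N" "N \<subseteq> N'" "subspace N'" shows "fin_codim N'"
proof -
  obtain B where B: "finite B" "span (N \<union> B) = UNIV" using assms(1) by (auto simp: fin_codim_def)
  have "span (N \<union> B) \<subseteq> span (N' \<union> B)" using assms(2) by (intro span_mono) auto
  then show ?thesis using B assms(3) unfolding fin_codim_def by blast
qed

lemma (in comm_algebra) functional_mult: "functional \<Phi> \<Longrightarrow> functional (\<lambda>x. \<Phi> (E * x))"
  by (auto simp: functional_def distrib_left mult_scale)

lemma (in comm_algebra) perp_mult: "x \<in> perp (\<lambda>x. \<Phi> (E * x)) UNIV \<longleftrightarrow> E * x \<in> perp \<Phi> UNIV"
  by (simp add: perp_def mult.assoc)

lemma (in comm_algebra_closed) gorenstein_localI: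
  assumes Q: "local_cring Q" "noetherian_ring Q" and xs: "regular_sequence Q xs"
    and \<theta>: "\<theta> \<in> ring_hom type_ring Q"
    and surj: "\<And>y. y \<in> carrier Q \<Longrightarrow> \<exists>a. y \<ominus>\<^bsub>Q\<^esub> \<theta> a \<in> genideal Q (set xs)"
    and \<Phi>: "functional \<Phi>" and N: "fin_codim (perp \<Phi> UNIV)"
    and ker: "\<And>a. \<theta> a \<in> genideal Q (set xs) \<longleftrightarrow> a \<in> perp \<Phi> UNIV"
  shows "gorenstein_local Q"
proof -
  have Qc: "cring Q" using Q(1) by (simp add: local_cring_def)
  interpret Q: cring Q by (rule Qc)
  let ?K = "genideal Q (set xs)"
  have K: "ideal ?K Q" using xs by (intro Q.genideal_ideal) (simp add: regular_sequence_def)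
  interpret K: ideal ?K Q by (rule K)
  let ?R = "Q Quot ?K" and ?c = "(+>\<^bsub>Q\<^esub>) ?K"
  have Rc: "cring ?R" by (rule K.quotient_is_cring[OF Qc])
  have c: "?c \<in> ring_hom Q ?R" by (rule K.rcos_ring_hom)
  have \<theta>': "(\<lambda>a. ?c (\<theta> a)) \<in> ring_hom type_ring ?R"
    using ring_hom_trans[OF \<theta> c] by (simp add: comp_def)
  have zero: "?c q = \<zero>\<^bsub>?R\<^esub> \<longleftrightarrow> q \<in> ?K" if "q \<in> carrier Q" for q
    using that K.rcos_const_imp_mem[of q] K.a_rcos_const[of q] by (auto simp: FactRing_def)
  have \<theta>c: "\<theta> a \<in> carrier Q" for a by (rule type_ring_hom(4)[OF \<theta> Qc])
  have surj': "(\<lambda>a. ?c (\<theta> a)) ` UNIV = carrier ?R"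
  proof
    show "(\<lambda>a. ?c (\<theta> a)) ` UNIV \<subseteq> carrier ?R" using type_ring_hom(4)[OF \<theta>' Rc] by auto
    show "carrier ?R \<subseteq> (\<lambda>a. ?c (\<theta> a)) ` UNIV"
    proof
      fix z assume "z \<in> carrier ?R"
      then obtain y where y: "y \<in> carrier Q" "z = ?c y" by (auto simp: FactRing_def A_RCOSETS_def')
      obtain a where "y \<ominus>\<^bsub>Q\<^esub> \<theta> a \<in> ?K" using surj[OF y(1)] by blast
      then have "?c y = ?c (\<theta> a)" using Q.quotient_eq_iff_same_a_r_cos[OF K y(1) \<theta>c] by simp
      then show "z \<in> (\<lambda>a. ?c (\<theta> a)) ` UNIV" using y(2) by blast
    qed
  qed
  have ker': "?c (\<theta> a) = \<zero>\<^bsub>?R\<^esub> \<longleftrightarrow> a \<in> perp \<Phi> UNIV" for a using zero[OF \<theta>c] ker by simp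
  have "injective_module ?R (as_module ?R (carrier ?R))"
    by (rule self_injective_if_functional[OF \<theta>' Rc surj' \<Phi> N ker'])
  moreover have "maximalideal P ?R" if "primeideal P ?R" for P
    by (rule fin_codim_prime_maximal[OF \<theta>' Rc surj' perp_UNIV_ideal[OF \<Phi>] N _ that]) (simp add: ker')
  ultimately show ?thesis unfolding gorenstein_local_def Let_def using Q xs by blast
qed

lemma local_cring_if_prime_kernel:
  assumes \<theta>: "\<theta> \<in> ring_hom type_ring Q" and Q: "cring Q" and surj: "\<theta> ` UNIV = carrier Q"
    and p: "ideal_set p" "1 \<notin> p" and ker: "\<And>a. \<theta> a = \<zero>\<^bsub>Q\<^esub> \<Longrightarrow> a \<in> p"
    and unit: "\<And>a. a \<notin> p \<Longrightarrow> \<exists>b. \<theta> (a * b) = \<one>\<^bsub>Q\<^esub>"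
  shows "local_cring Q"
proof (rule local_cringI[OF Q])
  interpret Q: cring Q by (rule Q)
  note h = type_ring_hom[OF \<theta> Q]
  have mem: "\<theta> a \<in> \<theta> ` p \<longleftrightarrow> a \<in> p" for a
  proof
    assume "\<theta> a \<in> \<theta> ` p"
    then obtain b where b: "b \<in> p" "\<theta> a = \<theta> b" by blast
    have "\<theta> (a - b) \<oplus>\<^bsub>Q\<^esub> \<theta> b = \<theta> b" using h(1)[of "a - b" b] b(2) by simp
    then have "\<theta> (a - b) = \<zero>\<^bsub>Q\<^esub>" using h(4)[of "a - b"] h(4)[of b] by (simp add: Q.add.r_cancel_one')
    then have "a - b \<in> p" by (rule ker)
    then show "a \<in> p" using ideal_set_add_mem_iff[OF p(1)] b(1) by blast
  qed auto
  show "ideal (\<theta> ` p) Q" by (rule ideal_image[OF \<theta> Q surj p(1)])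
  have "\<theta> 1 \<notin> \<theta> ` p" using mem p(2) by blast
  then show "\<theta> ` p \<noteq> carrier Q" using h(4)[of 1] by metis
  fix x assume "x \<in> carrier Q" "x \<notin> \<theta> ` p"
  then obtain a where a: "x = \<theta> a" "a \<notin> p" unfolding surj[symmetric] by blast
  obtain b where "\<theta> (a * b) = \<one>\<^bsub>Q\<^esub>" using unit[OF a(2)] by blast
  then show "\<exists>y\<in>carrier Q. x \<otimes>\<^bsub>Q\<^esub> y = \<one>\<^bsub>Q\<^esub>" using a(1) h(2,4) by (intro bexI[of _ "\<theta> b"]) auto
qed

text \<open>Locally at \<open>p\<close>, the quotient by \<open>x\<close> is the factor at \<open>p\<close> of the Artinian ring with functional \<open>\<Phi>\<close>. Multiplying
the argument of \<open>\<Phi>\<close> by \<open>E\<close> cuts out this factor.\<close>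

lemma (in comm_algebra_closed) gorenstein_localization:
  assumes I: "ideal_set I" and Noeth: "noetherian_above I"
    and p: "ideal_set p" "I \<subseteq> p" "1 \<notin> p" "\<And>a b. a * b \<in> p \<Longrightarrow> a \<in> p \<or> b \<in> p"
    and x: "x \<in> p" "\<And>a. x * a \<in> I \<Longrightarrow> a \<in> I"
    and \<Phi>: "functional \<Phi>" "perp \<Phi> UNIV = {a. \<exists>g. a - g * x \<in> I}" "fin_codim (perp \<Phi> UNIV)"
  shows "gorenstein_local (localization (type_ring Quot I) ((\<lambda>a. I +>\<^bsub>type_ring\<^esub> a) ` (- p)))"
proof -
  interpret loc: quotient_localization I "- p"
    by unfold_locales (use I p in auto)
  let ?N = "{a. \<exists>g. a - g * x \<in> I}"
  note fin = \<Phi>(3)[unfolded \<Phi>(2)]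
  have NI: "ideal_set ?N" by (rule ideal_set_plus_principal[OF I])
  have Np: "?N \<subseteq> p"
  proof
    fix a assume "a \<in> ?N"
    then obtain g where g: "a - g * x \<in> I" by blast
    have "(a - g * x) + g * x \<in> p" using g p(2) x(1) by (intro ideal_set_add[OF p(1)] ideal_set_mult[OF p(1)]) auto
    then show "a \<in> p" by simp
  qed
  have IN: "I \<subseteq> ?N" by (auto intro!: exI[of _ 0])
  obtain E where E: "E \<notin> p" "\<And>y. y \<notin> p \<Longrightarrow> \<exists>v. E - E * y * v \<in> ?N"
    using prime_stable_multiple[OF NI fin p(1,3) Np p(4)] by blast
  interpret L: cring loc.L by (rule loc.L_cring)
  note prime = loc.L_prime_ideal[OF p(1,2) refl]
  let ?x = "loc.frac x 1"
  have one: "1 \<in> - p" using p(3) by simp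
  have xc: "?x \<in> carrier loc.L" using one by (auto simp: loc.carrier_L)
  note gm = genideal_singleton_mem[OF loc.L_cring xc]
  have K: "ideal (genideal loc.L {?x}) loc.L" using xc by (intro L.genideal_ideal) simp
  have ker0: "loc.frac a 1 \<in> genideal loc.L {?x} \<longleftrightarrow> E * a \<in> ?N" for a
  proof
    assume "loc.frac a 1 \<in> genideal loc.L {?x}"
    then obtain z where z: "z \<in> carrier loc.L" "loc.frac a 1 = ?x \<otimes>\<^bsub>loc.L\<^esub> z" using gm by blast
    then obtain b s where b: "z = loc.frac b s" "s \<in> - p" by (auto simp: loc.carrier_L)
    have "loc.frac a 1 = loc.frac (x * b) s" using z(2) b one by (simp add: loc.frac_mult)
    then obtain u where u: "u \<in> - p" "u * (a * s - x * b * 1) \<in> I" using loc.frac_eq_iff[OF one b(2)] by blast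
    have "(u * s) * a - (u * b) * x \<in> I" using u(2) by (simp add: algebra_simps)
    then have us: "(u * s) * a \<in> ?N" by blast
    have "u * s \<notin> p" using u(1) b(2) p(4) by blast
    then obtain v where v: "E - E * (u * s) * v \<in> ?N" using E(2) by blast
    have "a * (E - E * (u * s) * v) + (E * v) * ((u * s) * a) \<in> ?N" by (rule ideal_set_lin[OF NI v us])
    then show "E * a \<in> ?N" by (simp add: algebra_simps)
  next
    assume "E * a \<in> ?N"
    then obtain g where g: "E * a - g * x \<in> I" by blast
    have "loc.frac a 1 = loc.frac (x * g) E"
      using g E(1) one by (intro loc.frac_eqI) (auto simp: mult.commute)
    also have "\<dots> = ?x \<otimes>\<^bsub>loc.L\<^esub> loc.frac g E" using one E(1) by (simp add: loc.frac_mult)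
    finally show "loc.frac a 1 \<in> genideal loc.L {?x}"
      using gm E(1) by (auto simp: loc.carrier_L)
  qed
  have "gorenstein_local loc.L"
  proof (rule gorenstein_localI[where xs = "[?x]" and \<theta> = "\<lambda>a. loc.frac a 1" and \<Phi> = "\<lambda>a. \<Phi> (E * a)"])
    show "local_cring loc.L" by (rule local_cringI[OF loc.L_cring prime])
    show "noetherian_ring loc.L" by (rule loc.L_noetherian[OF Noeth])
    show "(\<lambda>a. loc.frac a 1) \<in> ring_hom type_ring loc.L" by (rule loc.frac_hom)
    show "functional (\<lambda>a. \<Phi> (E * a))" by (rule functional_mult[OF \<Phi>(1)])
    have "perp \<Phi> UNIV \<subseteq> perp (\<lambda>a. \<Phi> (E * a)) UNIV"
      using perp_UNIV_ideal[OF \<Phi>(1)] by (auto simp: perp_mult intro: ideal_set_mult)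
    then show "fin_codim (perp (\<lambda>a. \<Phi> (E * a)) UNIV)"
      using fin_codim_mono[OF \<Phi>(3)] perp_subspace[OF functional_mult[OF \<Phi>(1)]] by blast
    show "loc.frac a 1 \<in> genideal loc.L (set [?x]) \<longleftrightarrow> a \<in> perp (\<lambda>a. \<Phi> (E * a)) UNIV" for a
      using ker0[of a] by (simp add: perp_mult \<Phi>(2))
    show "regular_sequence loc.L [?x]" unfolding regular_sequence_def
    proof (intro conjI allI ballI impI)
      show "set [?x] \<subseteq> carrier loc.L" using xc by simp
      have "loc.frac 1 1 \<notin> genideal loc.L {?x}" unfolding ker0 using E(1) Np by auto
      then show "genideal loc.L (set [?x]) \<noteq> carrier loc.L" using one by (auto simp: loc.carrier_L)
      fix i a assume i: "i < length [?x]" and a: "a \<in> carrier loc.L"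
        and m: "[?x] ! i \<otimes>\<^bsub>loc.L\<^esub> a \<in> genideal loc.L (set (take i [?x]))"
      obtain b s where b: "a = loc.frac b s" "s \<in> - p" using a by (auto simp: loc.carrier_L)
      have "loc.frac (x * b) s = loc.frac 0 1"
        using m i b one by (simp add: genideal_empty[OF L.ring_axioms] loc.frac_mult loc.frac_zero)
      then obtain u where u: "u \<in> - p" "u * (x * b * 1 - 0 * s) \<in> I" using loc.frac_eq_iff[OF b(2) one] by blast
      then have "x * (u * b) \<in> I" by (simp add: ac_simps)
      then have "u * b \<in> I" by (rule x(2))
      then have "u * (b * 1 - 0 * s) \<in> I" by simp
      then have "loc.frac b s = loc.frac 0 1" using loc.frac_eq_iff[OF b(2) one] u(1) by blast
      then show "a \<in> genideal loc.L (set (take i [?x]))"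
        using i b(1) by (simp add: genideal_empty[OF L.ring_axioms] loc.frac_zero)
    qed
    fix y assume "y \<in> carrier loc.L"
    then obtain a s where y: "y = loc.frac a s" "s \<in> - p" by (auto simp: loc.carrier_L)
    then obtain v where v: "E - E * s * v \<in> ?N" using E(2) by blast
    have "a * (E - E * s * v) \<in> ?N" by (rule ideal_set_mult[OF NI v])
    then have "E * (a - a * v * s) \<in> ?N" by (simp add: algebra_simps)
    then have k: "loc.frac (a - a * v * s) 1 \<in> genideal loc.L {?x}" by (simp only: ker0)
    have "loc.frac 1 s \<in> carrier loc.L" using y(2) by (auto simp: loc.carrier_L)
    from ideal.I_l_closed[OF K k this]
    have k': "loc.frac (a - a * v * s) s \<in> genideal loc.L {?x}" using y(2) one by (simp add: loc.frac_mult)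
    have yc: "y \<in> carrier loc.L" and vc: "loc.frac (a * v) 1 \<in> carrier loc.L"
      and kc: "loc.frac (a - a * v * s) s \<in> carrier loc.L" using y one by (auto simp: loc.carrier_L)
    have "loc.frac (a - a * v * s) s \<oplus>\<^bsub>loc.L\<^esub> loc.frac (a * v) 1 = y" using y one by (simp add: loc.frac_add)
    then have "y \<ominus>\<^bsub>loc.L\<^esub> loc.frac (a * v) 1 = loc.frac (a - a * v * s) s"
      using vc kc by (auto simp: L.minus_eq L.a_assoc L.r_neg)
    then show "\<exists>a. y \<ominus>\<^bsub>loc.L\<^esub> loc.frac a 1 \<in> genideal loc.L (set [?x])"
      using k' by (intro exI[of _ "a * v"]) simp
  qed
  then show ?thesis .
qed

locale affine_chart_closed = affine_chart I l
  for I :: "('n::finite, 'k::alg_closed_field) mpoly set" and l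
begin

text \<open>The point \<open>P\<close> as a prime ideal of the affine chart.\<close>

definition pt_affine :: "('n, 'k) coord set \<Rightarrow> ('n, 'k) mpoly set" where
  "pt_affine P = {F. \<exists>N. \<exists>A\<in>forms N. A - F \<in> J \<and> A \<in> pt P}"

lemma pt_affine_iff:
  assumes P: "P \<in> points I" and A: "A \<in> forms N" "A - F \<in> J"
  shows "F \<in> pt_affine P \<longleftrightarrow> A \<in> pt P"
proof
  assume "F \<in> pt_affine P"
  then obtain N' B where B: "B \<in> forms N'" "B - F \<in> J" "B \<in> pt P" by (auto simp: pt_affine_def)
  have "A * l ^ N' \<in> forms (N + N')" "B * l ^ N \<in> forms (N' + N)" using forms_mult A B l_pow_form by blast+
  then have f: "A * l ^ N' - B * l ^ N \<in> forms (N + N')" by (intro forms_diff) (simp_all add: ac_simps)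
  have "(A * l ^ N' - F) - (B * l ^ N - F) \<in> J"
    using ideal_set_diff[OF J_ideal J_cong[OF A(2) l_pow_J'] J_cong[OF B(2) l_pow_J']] .
  then have "A * l ^ N' - B * l ^ N \<in> I" using form_in_J[OF f] by simp
  then have "A * l ^ N' - B * l ^ N \<in> pt P" using pointD(2)[OF P] by blast
  moreover have "B * l ^ N \<in> pt P" using B(3) ideal_set_mult2[OF pointD(1)[OF P]] by blast
  ultimately have "A * l ^ N' \<in> pt P" using ideal_set_add_mem_iff[OF pointD(1)[OF P]] by blast
  then show "A \<in> pt P" using pointD(4)[OF P] l_pow_pt[OF P] by blast
qed (use A in \<open>auto simp: pt_affine_def\<close>)

lemma pt_affine_prime:
  assumes P: "P \<in> points I"
  shows "ideal_set (pt_affine P)" "J \<subseteq> pt_affine P" "1 \<notin> pt_affine P"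
    "\<And>F G. F * G \<in> pt_affine P \<Longrightarrow> F \<in> pt_affine P \<or> G \<in> pt_affine P"
proof -
  note pI = pointD(1)[OF P]
  have rep: "\<exists>N A. A \<in> forms N \<and> A - F \<in> J" for F using rep_exists[of 0 F] by simp
  have prod: "A * B - F * G \<in> J" if "A - F \<in> J" "B - G \<in> J" for A B F G
  proof -
    have "B * (A - F) + F * (B - G) \<in> J" by (rule ideal_set_lin[OF J_ideal that])
    then show ?thesis by (simp add: algebra_simps)
  qed
  show "J \<subseteq> pt_affine P"
  proof
    fix F assume "F \<in> J"
    then have "0 - F \<in> J" using ideal_set_uminus[OF J_ideal] by simp
    then show "F \<in> pt_affine P" using pt_affine_iff[OF P forms_zero[of 0]] ideal_set_zero[OF pI] by simp
  qed
  then have z: "0 \<in> pt_affine P" using ideal_set_zero[OF J_ideal] by blast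
  show "ideal_set (pt_affine P)" unfolding ideal_set_def
  proof (intro conjI ballI allI z)
    fix F G assume FG: "F \<in> pt_affine P" "G \<in> pt_affine P"
    obtain N A where A: "A \<in> forms N" "A - F \<in> J" using rep by blast
    obtain N' B where B: "B \<in> forms N'" "B - G \<in> J" using rep by blast
    have m: "A \<in> pt P" "B \<in> pt P" using pt_affine_iff[OF P A] pt_affine_iff[OF P B] FG by auto
    have f: "A * l ^ N' \<in> forms (N + N')" "B * l ^ N \<in> forms (N' + N)" using forms_mult A B l_pow_form by blast+
    then have f': "A * l ^ N' + B * l ^ N \<in> forms (N + N')" by (intro forms_add) (simp_all add: ac_simps)
    have "(A * l ^ N' - F) + (B * l ^ N - G) \<in> J"
      by (intro ideal_set_add[OF J_ideal] J_cong[OF A(2) l_pow_J'] J_cong[OF B(2) l_pow_J'])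
    then have "(A * l ^ N' + B * l ^ N) - (F + G) \<in> J" by (simp add: algebra_simps)
    moreover have "A * l ^ N' + B * l ^ N \<in> pt P" using m by (intro ideal_set_add[OF pI] ideal_set_mult2[OF pI])
    ultimately show "F + G \<in> pt_affine P" using pt_affine_iff[OF P f'] by blast
  next
    fix F G assume FG: "F \<in> pt_affine P"
    obtain N A where A: "A \<in> forms N" "A - F \<in> J" using rep by blast
    obtain N' B where B: "B \<in> forms N'" "B - G \<in> J" using rep by blast
    have "A \<in> pt P" using pt_affine_iff[OF P A] FG by auto
    then have "B * A \<in> pt P" by (rule ideal_set_mult[OF pI])
    then show "G * F \<in> pt_affine P" using pt_affine_iff[OF P forms_mult[OF B(1) A(1)] prod[OF B(2) A(2)]] by blast
  qed
  have "1 - 1 \<in> J" using ideal_set_zero[OF J_ideal] by simp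
  then show "1 \<notin> pt_affine P" using pt_affine_iff[OF P one_forms] pointD(3)[OF P] by blast
  fix F G assume FG: "F * G \<in> pt_affine P"
  obtain N A where A: "A \<in> forms N" "A - F \<in> J" using rep by blast
  obtain N' B where B: "B \<in> forms N'" "B - G \<in> J" using rep by blast
  have "A * B \<in> pt P" using pt_affine_iff[OF P forms_mult[OF A(1) B(1)] prod[OF A(2) B(2)]] FG by blast
  then show "F \<in> pt_affine P \<or> G \<in> pt_affine P"
    using pointD(4)[OF P] pt_affine_iff[OF P A] pt_affine_iff[OF P B] by blast
qed

text \<open>Each local ring is a factor of \<open>A\<close>, hence again an image of the polynomial ring. The empty sequence is
its regular sequence.\<close>

lemma gorenstein_scheme_if_functional:
  assumes \<Phi>: "mp.functional \<Phi>" "mp.perp \<Phi> UNIV = J" and fin: "mp.fin_codim J"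
  shows "gorenstein_scheme I"
  unfolding gorenstein_scheme_def
proof
  fix P assume P: "P \<in> points I"
  interpret loc: quotient_localization I "M P" by (rule loc_at[OF P])
  interpret L: cring loc.L by (rule loc.L_cring)
  note pa = pt_affine_prime[OF P]
  obtain E where E: "E \<notin> pt_affine P" "\<And>y. y \<notin> pt_affine P \<Longrightarrow> \<exists>v. E - E * y * v \<in> J"
    using mp.prime_stable_multiple[OF J_ideal fin pa(1,3,2,4)] by blast
  define \<theta> where "\<theta> F = sec 0 F P" for F
  let ?Q = "local_ring_at (coord_ring I) (coord_grading I) P"
  let ?T = "twist_stalk (coord_ring I) (coord_grading I) 0 P"
  have Q: "?Q = loc.L\<lparr>carrier := ?T\<rparr>" by (simp add: local_ring_at_def homog_loc_eq)
  have \<theta>_rep: "\<theta> F = fr P A (l ^ N)" if "A \<in> forms N" "A - F \<in> J" for F A N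
    unfolding \<theta>_def using sec_eq[OF P, of A N 0 F] that by simp
  have \<theta>_add: "\<theta> (F + G) = \<theta> F \<oplus>\<^bsub>loc.L\<^esub> \<theta> G" for F G
    using amb_ops(1)[OF P, of "sec 0 F" "sec 0 G"] by (simp add: \<theta>_def sec_add)
  have \<theta>_mult: "\<theta> (F * G) = \<theta> F \<otimes>\<^bsub>loc.L\<^esub> \<theta> G" for F G
    using amb_ops(2)[OF P, of "sec 0 F" "sec 0 G"] by (simp add: \<theta>_def sec_mult)
  have \<theta>_one: "\<theta> 1 = \<one>\<^bsub>loc.L\<^esub>" using \<theta>_rep[OF one_forms, of 1] ideal_set_zero[OF J_ideal] by (simp add: loc.frac_one)
  have \<theta>_carrier: "\<theta> F \<in> carrier loc.L" for F
  proof -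
    obtain N A where A: "A \<in> forms N" "A - F \<in> J" using rep_exists[of 0 F] by auto
    show ?thesis unfolding \<theta>_rep[OF A] loc.carrier_L using l_pow_M[OF P] by blast
  qed
  have \<theta>_hom: "\<theta> \<in> ring_hom type_ring loc.L"
    by (rule ring_hom_memI) (auto simp: \<theta>_add \<theta>_mult \<theta>_one \<theta>_carrier)
  have \<theta>_zero: "\<theta> F = \<zero>\<^bsub>loc.L\<^esub> \<longleftrightarrow> E * F \<in> J" for F
  proof -
    obtain N A where A: "A \<in> forms N" "A - F \<in> J" using rep_exists[of 0 F] by auto
    obtain N' B where B: "B \<in> forms N'" "B - E \<in> J" using rep_exists[of 0 E] by auto
    have "F * (B - E) + B * (A - F) \<in> J" by (rule ideal_set_lin[OF J_ideal B(2) A(2)])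
    then have BA: "B * A - E * F \<in> J" by (simp add: algebra_simps)
    have BP: "B \<in> M P" using pt_affine_iff[OF P B] E(1) B(1) by (auto simp: M_def)
    have "\<theta> F = \<zero>\<^bsub>loc.L\<^esub> \<longleftrightarrow> (\<exists>u\<in>M P. u * (A * 1 - 0 * l ^ N) \<in> I)"
      unfolding \<theta>_rep[OF A] loc.frac_zero by (rule loc.frac_eq_iff[OF l_pow_M[OF P] loc.one_M])
    also have "\<dots> \<longleftrightarrow> (\<exists>u\<in>M P. u * A \<in> I)" by simp
    also have "\<dots> \<longleftrightarrow> E * F \<in> J"
    proof
      assume "\<exists>u\<in>M P. u * A \<in> I"
      then obtain u n where u: "u \<in> forms n" "u \<notin> pt P" "u * A \<in> I" by (auto simp: M_def)
      have "u \<notin> pt_affine P" using pt_affine_iff[OF P u(1), of u] u(2) ideal_set_zero[OF J_ideal] by simp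
      then obtain v where v: "E - E * u * v \<in> J" using E(2) by blast
      have uA: "u * A \<in> J" using u(3) I_subset_J by blast
      have "(E * v) * (u * A) - (E * v * u) * (A - F) \<in> J"
        by (rule ideal_set_diff[OF J_ideal ideal_set_mult[OF J_ideal uA] ideal_set_mult[OF J_ideal A(2)]])
      then have "(E * v) * (u * A) - (E * v * u) * (A - F) + F * (E - E * u * v) \<in> J"
        by (rule ideal_set_add[OF J_ideal]) (rule ideal_set_mult[OF J_ideal v])
      then show "E * F \<in> J" by (simp add: algebra_simps)
    next
      assume "E * F \<in> J"
      then have "B * A \<in> J" using ideal_set_add[OF J_ideal BA, of "E * F"] by simp
      then have "B * A \<in> I" using form_in_J[OF forms_mult[OF B(1) A(1)]] by blast
      then show "\<exists>u\<in>M P. u * A \<in> I" using BP by blast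
    qed
    finally show ?thesis .
  qed
  have \<theta>_eq: "\<theta> F = \<theta> G" if "E * (F - G) \<in> J" for F G
  proof -
    have "\<theta> ((F - G) + G) = \<zero>\<^bsub>loc.L\<^esub> \<oplus>\<^bsub>loc.L\<^esub> \<theta> G" using that by (simp only: \<theta>_add \<theta>_zero[symmetric])
    then show ?thesis using \<theta>_carrier by simp
  qed
  have img: "\<theta> ` UNIV = ?T"
  proof (intro equalityI subsetI)
    fix x assume "x \<in> \<theta> ` UNIV"
    then obtain F where F: "x = \<theta> F" by blast
    obtain N A where A: "A \<in> forms N" "A - F \<in> J" using rep_exists[of 0 F] by auto
    have "int N - int N = 0" by simp
    then show "x \<in> ?T" unfolding twist_stalk_eq[OF P] F \<theta>_rep[OF A] using A(1) l_pow_form l_pow_pt[OF P] by blast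
  next
    fix x assume "x \<in> ?T"
    then obtain a f d where x: "x = fr P a f" "a \<in> forms d" "f \<in> forms d" "f \<notin> pt P"
      unfolding twist_stalk_eq[OF P] by auto
    have JJ: "g - g \<in> J" for g using ideal_set_zero[OF J_ideal] by simp
    have "f \<notin> pt_affine P" using pt_affine_iff[OF P x(3) JJ] x(4) by blast
    then obtain v where v: "E - E * f * v \<in> J" using E(2) by blast
    have fM: "f \<in> M P" using x(3,4) by (auto simp: M_def)
    have "a * (E - E * f * v) \<in> J" by (rule ideal_set_mult[OF J_ideal v])
    then have "E * (f * (a * v) - a) \<in> J" using ideal_set_uminus[OF J_ideal] by (fastforce simp: algebra_simps)
    then have "\<theta> (f * (a * v)) = \<theta> a" by (rule \<theta>_eq)
    then have eq: "\<theta> f \<otimes>\<^bsub>loc.L\<^esub> \<theta> (a * v) = \<theta> a" by (simp add: \<theta>_mult)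
    have "fr P f (l ^ d) \<otimes>\<^bsub>loc.L\<^esub> x = fr P a (l ^ d)"
      unfolding x(1) loc.frac_mult[OF l_pow_M[OF P] fM]
      by (rule loc.frac_eqI) (auto simp: l_pow_M[OF P] fM loc.mult_M algebra_simps ideal_set_zero[OF I_ideal])
    then have eq': "\<theta> f \<otimes>\<^bsub>loc.L\<^esub> x = \<theta> a" using \<theta>_rep[OF x(3) JJ] \<theta>_rep[OF x(2) JJ] by simp
    have inv: "\<theta> f \<otimes>\<^bsub>loc.L\<^esub> fr P (l ^ d) f = \<one>\<^bsub>loc.L\<^esub>"
      unfolding \<theta>_rep[OF x(3) JJ] loc.frac_mult[OF l_pow_M[OF P] fM] loc.frac_one
      by (rule loc.frac_eqI) (auto simp: l_pow_M[OF P] fM loc.mult_M loc.one_M algebra_simps ideal_set_zero[OF I_ideal])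
    have c: "fr P (l ^ d) f \<in> carrier loc.L" "x \<in> carrier loc.L" using fM x(1) by (auto simp: loc.carrier_L)
    have canc: "y = fr P (l ^ d) f \<otimes>\<^bsub>loc.L\<^esub> (\<theta> f \<otimes>\<^bsub>loc.L\<^esub> y)" if "y \<in> carrier loc.L" for y
      using inv c \<theta>_carrier[of f] that by (simp add: L.m_assoc[symmetric] L.m_comm[of "fr P (l ^ d) f"])
    have "x = \<theta> (a * v)" using canc[OF c(2)] canc[OF \<theta>_carrier[of "a * v"]] eq eq' by simp
    then show "x \<in> \<theta> ` UNIV" by blast
  qed
  have Qc: "cring ?Q"
  proof -
    interpret T: cring "type_ring :: ('n, 'k) mpoly ring" by (rule type_ring_cring)
    interpret h: ring_hom_ring type_ring loc.L \<theta>
      by (rule ring_hom_ringI2[OF T.ring_axioms L.ring_axioms \<theta>_hom])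
    have "subring (\<theta> ` UNIV) loc.L" using h.img_is_subring[OF T.carrier_is_subring] by simp
    then have "subcring ?T loc.L" unfolding img by (rule L.subcringI')
    then show ?thesis unfolding Q using L.subcring_iff[of ?T] subcring.axioms
      by (simp add: img[symmetric] \<theta>_carrier image_subset_iff)
  qed
  have hom: "\<theta> \<in> ring_hom type_ring ?Q"
    unfolding Q by (rule ring_hom_memI) (use img in \<open>auto simp: \<theta>_add \<theta>_mult \<theta>_one\<close>)
  have surj: "\<theta> ` UNIV = carrier ?Q" unfolding Q img by simp
  have zQ: "\<zero>\<^bsub>?Q\<^esub> = \<zero>\<^bsub>loc.L\<^esub>" "\<one>\<^bsub>?Q\<^esub> = \<one>\<^bsub>loc.L\<^esub>" unfolding Q by simp_all
  interpret Qr: cring ?Q by (rule Qc)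
  have z1: "\<zero>\<^bsub>?Q\<^esub> \<noteq> \<one>\<^bsub>?Q\<^esub>"
    unfolding zQ using \<theta>_zero[of 1] \<theta>_one E(1) pa(2) by auto
  show "gorenstein_local ?Q"
  proof (rule mpc.gorenstein_localI[where xs = "[]" and \<theta> = \<theta> and \<Phi> = "\<lambda>F. \<Phi> (E * F)"])
    show "local_cring ?Q"
    proof (rule local_cring_if_prime_kernel[OF hom Qc surj pa(1,3)])
      fix F assume "\<theta> F = \<zero>\<^bsub>?Q\<^esub>"
      then have "E * F \<in> pt_affine P" using \<theta>_zero zQ pa(2) by auto
      then show "F \<in> pt_affine P" using pa(4) E(1) by blast
    next
      fix F assume "F \<notin> pt_affine P"
      then obtain v where v: "E - E * F * v \<in> J" using E(2) by blast
      have "E * (F * v - 1) \<in> J" using ideal_set_uminus[OF J_ideal v] by (simp add: algebra_simps)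
      then have "\<theta> (F * v) = \<theta> 1" by (rule \<theta>_eq)
      then show "\<exists>b. \<theta> (F * b) = \<one>\<^bsub>?Q\<^esub>" using \<theta>_one zQ by auto
    qed
    show "noetherian_ring ?Q"
    proof (rule noetherian_ring_if_above[OF hom Qc mp.fin_codim_noetherian_above[OF fin]])
      show "\<theta> F = \<zero>\<^bsub>?Q\<^esub>" if "F \<in> J" for F using that \<theta>_zero zQ ideal_set_mult[OF J_ideal] by simp
      fix y assume y: "y \<in> carrier ?Q"
      then obtain a where "y = \<theta> a" unfolding surj[symmetric] by blast
      then show "\<exists>a. \<exists>v\<in>carrier ?Q. \<exists>w\<in>carrier ?Q. y = \<theta> a \<otimes>\<^bsub>?Q\<^esub> v \<and> \<theta> a = y \<otimes>\<^bsub>?Q\<^esub> w"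
        using y by (intro exI[of _ a] bexI[of _ "\<one>\<^bsub>?Q\<^esub>"]) auto
    qed
    show "regular_sequence ?Q []" unfolding regular_sequence_def
      using z1 Qr.one_closed by (auto simp: genideal_empty[OF Qr.ring_axioms])
    show "\<theta> \<in> ring_hom type_ring ?Q" by (rule hom)
    show "mp.functional (\<lambda>F. \<Phi> (E * F))" by (rule mp.functional_mult[OF \<Phi>(1)])
    have "J \<subseteq> mp.perp (\<lambda>F. \<Phi> (E * F)) UNIV"
      using \<Phi>(2) by (auto simp: mp.perp_mult intro: ideal_set_mult[OF J_ideal])
    then show "mp.fin_codim (mp.perp (\<lambda>F. \<Phi> (E * F)) UNIV)"
      using mp.fin_codim_mono[OF fin] mp.perp_subspace[OF mp.functional_mult[OF \<Phi>(1)]] by blast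
    show "\<theta> F \<in> genideal ?Q (set []) \<longleftrightarrow> F \<in> mp.perp (\<lambda>F. \<Phi> (E * F)) UNIV" for F
      using \<theta>_zero[of F] zQ(1) by (simp add: genideal_empty[OF Qr.ring_axioms] mp.perp_mult \<Phi>(2))
    fix y assume y: "y \<in> carrier ?Q"
    then obtain a where "y = \<theta> a" unfolding surj[symmetric] by blast
    then have "y \<ominus>\<^bsub>?Q\<^esub> \<theta> a = \<zero>\<^bsub>?Q\<^esub>" using y by (simp add: Qr.r_right_minus_eq)
    then show "\<exists>a. y \<ominus>\<^bsub>?Q\<^esub> \<theta> a \<in> genideal ?Q (set [])"
      by (auto simp: genideal_empty[OF Qr.ring_axioms])
  qed
qed

end

section \<open>Noetherianity and maximal ideals of the coordinate ring\<close>

text \<open>The coordinate ring is a submodule of the finite free module \<open>A[l]\<close> over \<open>k[l]\<close>, which is Noetherian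
by looking at leading coefficients: for an ideal \<open>U\<close>, those of its elements of degree at most \<open>n\<close> form a
subspace \<open>T n\<close> of \<open>A\<close>. These grow with \<open>n\<close> and become stationary at some \<open>N\<close>. Elements of degree up to \<open>N\<close>
whose leading coefficients span the \<open>T n\<close> generate \<open>U\<close>.\<close>

lemma (in affine_chart) noetherian_I:
  assumes fin: "mp.fin_codim J"
  shows "noetherian_above I"
  unfolding noetherian_above_def
proof (intro allI impI)
  fix U :: "('n, 'k) mpoly set" assume U: "ideal_set U" "I \<subseteq> U"
  obtain C where C: "mp.fin_complement J C" using mp.fin_codim_imp_complement[OF fin] by blast
  obtain B0 where B0: "finite B0" "C = mp.span B0" using C by (auto simp: mp.fin_complement_def)
  define deg where "deg n = {F :: ('n, 'k) mpoly. \<forall>m>n. hcomp m F = 0}" for n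
  have deg_sub: "mp.subspace (deg n)" for n
    by (rule mp.subspaceI) (auto simp: deg_def hcomp_zero hcomp_add hcomp_scl)
  define T where "T n = {b. \<exists>F\<in>U. F \<in> deg n \<and> hcomp n F - b \<in> J}" for n
  have T_sub: "mp.subspace (T n)" for n
  proof (rule mp.subspaceI)
    show "0 \<in> T n" using U J_ideal by (auto simp: T_def deg_def hcomp_zero ideal_set_zero intro!: bexI[of _ 0])
    fix b b' assume "b \<in> T n" "b' \<in> T n"
    then obtain F F' where F: "F \<in> U" "F \<in> deg n" "hcomp n F - b \<in> J" "F' \<in> U" "F' \<in> deg n" "hcomp n F' - b' \<in> J"
      by (auto simp: T_def)
    have "hcomp n (F + F') - (b + b') \<in> J"
      using ideal_set_add[OF J_ideal F(3,6)] by (simp add: hcomp_add algebra_simps)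
    moreover have "F + F' \<in> U" "F + F' \<in> deg n"
      using ideal_set_add[OF U(1) F(1,4)] mp.subspace_add[OF deg_sub F(2,5)] by auto
    ultimately show "b + b' \<in> T n" by (auto simp: T_def)
  next
    fix c b assume "b \<in> T n"
    then obtain F where F: "F \<in> U" "F \<in> deg n" "hcomp n F - b \<in> J" by (auto simp: T_def)
    have "hcomp n (scl c F) - scl c b \<in> J"
      using mp.ideal_set_scale[OF J_ideal F(3), of c] by (simp add: hcomp_scl mp.scale_right_diff_distrib)
    moreover have "scl c F \<in> U" "scl c F \<in> deg n"
      using mp.ideal_set_scale[OF U(1) F(1)] mp.subspace_scale[OF deg_sub F(2)] by auto
    ultimately show "scl c b \<in> T n" by (auto simp: T_def)
  qed
  have JT: "J \<subseteq> T n" for n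
    using U J_ideal by (auto simp: T_def deg_def hcomp_zero ideal_set_zero ideal_set_uminus intro!: bexI[of _ 0])
  have T_mono1: "T n \<subseteq> T (Suc n)" for n
  proof
    fix b assume "b \<in> T n"
    then obtain F where F: "F \<in> U" "F \<in> deg n" "hcomp n F - b \<in> J" by (auto simp: T_def)
    have "hcomp (Suc n) (l * F) - b \<in> J"
      using J_cong[OF F(3), of "l * hcomp n F"] l_pow_J[of 1 "hcomp n F"] by (simp add: hcomp_form_mult[OF l_form])
    moreover have "l * F \<in> deg (Suc n)" using F(2) by (auto simp: deg_def hcomp_form_mult[OF l_form])
    ultimately show "b \<in> T (Suc n)" using ideal_set_mult[OF U(1) F(1)] by (auto simp: T_def)
  qed
  have T_mono: "m \<le> n \<Longrightarrow> T m \<subseteq> T n" for m n by (rule lift_Suc_mono_le[of T]) (use T_mono1 in auto)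
  have bound: "mp.dim (T n \<inter> C) \<le> mp.dim C" for n using mp.rdim_mono[OF C, of "T n" UNIV] by simp
  have "\<exists>N. \<forall>n. mp.dim (T n \<inter> C) \<le> mp.dim (T N \<inter> C)"
    using ex_has_greatest_nat[of "\<lambda>_. True" 0 "\<lambda>n. mp.dim (T n \<inter> C)" "Suc (mp.dim C)"] bound
    by (auto simp: less_Suc_eq_le)
  then obtain N where N: "\<And>n. mp.dim (T n \<inter> C) \<le> mp.dim (T N \<inter> C)" by blast
  have stab: "T n = T N" if "N \<le> n" for n
    using mp.rdim_eq[OF C T_sub T_sub JT T_mono[OF that] N] by simp
  have "\<exists>G. finite G \<and> G \<subseteq> U \<inter> deg n \<and> (\<forall>b\<in>T n. \<exists>F\<in>mp.span G. hcomp n F - b \<in> J)" for n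
  proof -
    obtain b where b: "b \<subseteq> T n \<inter> C" "mp.independent b" "T n \<inter> C \<subseteq> mp.span b" "card b = mp.dim (T n \<inter> C)"
      by (rule mp.basis_exists)
    have fb: "finite b" using mp.independent_span_bound[OF B0(1) b(2)] b(1) B0(2) by blast
    have "\<forall>x\<in>b. \<exists>F. F \<in> U \<and> F \<in> deg n \<and> hcomp n F - x \<in> J" using b(1) by (auto simp: T_def)
    then obtain f where f: "\<forall>x\<in>b. f x \<in> U \<and> f x \<in> deg n \<and> hcomp n (f x) - x \<in> J"
      unfolding bchoice_iff by blast
    let ?S = "{x. \<exists>F\<in>mp.span (f ` b). hcomp n F - x \<in> J}"
    have "mp.subspace ?S"
    proof (rule mp.subspaceI)
      show "0 \<in> ?S" using J_ideal by (auto intro!: bexI[of _ 0] mp.span_zero simp: hcomp_zero ideal_set_zero)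
      fix x y assume "x \<in> ?S" "y \<in> ?S"
      then obtain F G where FG: "F \<in> mp.span (f ` b)" "hcomp n F - x \<in> J" "G \<in> mp.span (f ` b)" "hcomp n G - y \<in> J" by blast
      have "hcomp n (F + G) - (x + y) \<in> J"
        using ideal_set_add[OF J_ideal FG(2,4)] by (simp add: hcomp_add algebra_simps)
      then show "x + y \<in> ?S" using mp.span_add[OF FG(1,3)] by blast
    next
      fix c x assume "x \<in> ?S"
      then obtain F where F: "F \<in> mp.span (f ` b)" "hcomp n F - x \<in> J" by blast
      have "hcomp n (scl c F) - scl c x \<in> J"
        using mp.ideal_set_scale[OF J_ideal F(2), of c] by (simp add: hcomp_scl mp.scale_right_diff_distrib)
      then show "scl c x \<in> ?S" using mp.span_scale[OF F(1)] by blast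
    qed
    moreover have "b \<subseteq> ?S" using f mp.span_base[of _ "f ` b"] by blast
    ultimately have spS: "mp.span b \<subseteq> ?S" by (intro mp.span_minimal)
    have "\<exists>F\<in>mp.span (f ` b). hcomp n F - y \<in> J" if y: "y \<in> T n" for y
    proof -
      obtain c where c: "c \<in> C" "y - c \<in> J" using C by (auto simp: mp.fin_complement_def)
      have "y - (y - c) \<in> T n" using mp.subspace_diff[OF T_sub y] c(2) JT by blast
      then have "c \<in> T n \<inter> C" using c(1) by simp
      then have "c \<in> ?S" using b(3) spS by blast
      then obtain F where F: "F \<in> mp.span (f ` b)" "hcomp n F - c \<in> J" by blast
      have "hcomp n F - y \<in> J" using J_cong[OF J_sym[OF c(2)] F(2)] .
      then show ?thesis using F(1) by blast
    qed
    then show ?thesis using fb f by (intro exI[of _ "f ` b"]) auto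
  qed
  then have "\<forall>n. \<exists>G. finite G \<and> G \<subseteq> U \<inter> deg n \<and> (\<forall>b\<in>T n. \<exists>F\<in>mp.span G. hcomp n F - b \<in> J)" by blast
  then obtain G where G: "\<forall>n. finite (G n) \<and> G n \<subseteq> U \<inter> deg n \<and> (\<forall>b\<in>T n. \<exists>F\<in>mp.span (G n). hcomp n F - b \<in> J)"
    unfolding choice_iff by blast
  have "U \<subseteq> K" if K: "ideal_set K" "I \<subseteq> K" "(\<Union>n\<le>N. G n) \<subseteq> K" for K
  proof -
    have spK: "mp.span (G n) \<subseteq> K" if "n \<le> N" for n
      using K(3) that by (intro mp.span_minimal mp.ideal_set_subspace K(1)) auto
    have spU: "mp.span (G n) \<subseteq> U" for n
      using G by (intro mp.span_minimal mp.ideal_set_subspace U(1)) auto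
    have spd: "mp.span (G n) \<subseteq> deg n" for n
      using G by (intro mp.span_minimal deg_sub) auto
    have "F \<in> K" if "F \<in> U" "\<forall>m\<ge>n. hcomp m F = 0" for F n
      using that
    proof (induction n arbitrary: F)
      case 0
      then have "F = 0" using hom_ideal_memI[of "{0}" F] by (auto simp: ideal_set_def)
      then show ?case using ideal_set_zero[OF K(1)] by simp
    next
      case (Suc n)
      have Fd: "F \<in> deg n" using Suc.prems(2) by (auto simp: deg_def)
      have FT: "hcomp n F \<in> T n" using Suc.prems(1) Fd ideal_set_zero[OF J_ideal] by (auto simp: T_def)
      have "\<exists>H\<in>U. H \<in> K \<and> H \<in> deg n \<and> hcomp n H - hcomp n F \<in> J"
      proof (cases "n \<le> N")
        case True
        obtain H where "H \<in> mp.span (G n)" "hcomp n H - hcomp n F \<in> J" using G FT by blast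
        then show ?thesis using spK[OF True] spU spd by blast
      next
        case False
        then have "hcomp n F \<in> T N" using FT stab[of n] by simp
        then obtain H where H: "H \<in> mp.span (G N)" "hcomp N H - hcomp n F \<in> J" using G by blast
        let ?H = "l ^ (n - N) * H"
        have "hcomp n ?H = l ^ (n - N) * hcomp N H"
          using False by (simp add: hcomp_form_mult[OF l_pow_form])
        then have "hcomp n ?H - hcomp n F \<in> J" using J_cong[OF H(2) l_pow_J] by simp
        moreover have "?H \<in> deg n"
          unfolding deg_def
        proof (intro CollectI allI impI)
          fix m assume "m > n"
          then have "m - (n - N) > N" using False by simp
          then have "hcomp (m - (n - N)) H = 0" using H(1) spd[of N] unfolding deg_def by blast
          then show "hcomp m ?H = 0" by (simp add: hcomp_form_mult[OF l_pow_form])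
        qed
        moreover have "?H \<in> U" "?H \<in> K"
          using H(1) spU[of N] spK[of N] by (auto intro: ideal_set_mult[OF U(1)] ideal_set_mult[OF K(1)])
        ultimately show ?thesis by blast
      qed
      then obtain H where H: "H \<in> U" "H \<in> K" "H \<in> deg n" "hcomp n H - hcomp n F \<in> J" by blast
      have hI: "hcomp n (H - F) \<in> I" using form_in_J[OF hcomp_forms, of n "H - F"] H(4) by (simp add: hcomp_diff)
      define F' where "F' = F - H + hcomp n (H - F)"
      have "F' \<in> U" unfolding F'_def using Suc.prems(1) H(1) hI U
        by (intro ideal_set_add[OF U(1)] ideal_set_diff[OF U(1)]) auto
      moreover have "\<forall>m\<ge>n. hcomp m F' = 0"
        using Fd H(3) by (auto simp: F'_def hcomp_add hcomp_diff hcomp_of_form[OF hcomp_forms] deg_def)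
      ultimately have "F' \<in> K" by (rule Suc.IH)
      moreover have "H - hcomp n (H - F) \<in> K" using H(2) hI K by (intro ideal_set_diff[OF K(1)]) auto
      ultimately have "F' + (H - hcomp n (H - F)) \<in> K" by (rule ideal_set_add[OF K(1)])
      then show ?case by (simp add: F'_def)
    qed
    moreover have "\<exists>n. \<forall>m\<ge>n. hcomp m F = 0" for F :: "('n, 'k) mpoly"
      using hcomp_decomp[of F] by (metis Suc_le_lessD)
    ultimately show ?thesis by blast
  qed
  moreover have "finite (\<Union>n\<le>N. G n)" using G by auto
  moreover have "(\<Union>n\<le>N. G n) \<subseteq> U" using G by auto
  ultimately show "\<exists>G. finite G \<and> G \<subseteq> U \<and> (\<forall>K. ideal_set K \<longrightarrow> I \<subseteq> K \<longrightarrow> G \<subseteq> K \<longrightarrow> U \<subseteq> K)" by blast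
qed

lemma prod_mset_cong_mod:
  assumes "ideal_set K" "\<And>c. f c - g c \<in> K"
  shows "(\<Prod>c\<in>#A. f c) - (\<Prod>c\<in>#A. g c) \<in> (K :: 'a::comm_ring_1 set)"
proof (induction A)
  case (add c A)
  have "f c * ((\<Prod>c\<in>#A. f c) - (\<Prod>c\<in>#A. g c)) + (\<Prod>c\<in>#A. g c) * (f c - g c) \<in> K"
    by (rule ideal_set_lin[OF assms(1) add assms(2)])
  then show ?case by (simp add: algebra_simps)
qed (simp add: ideal_set_zero[OF assms(1)])

lemma prod_mset_forms: "(\<And>c. f c \<in> forms 1) \<Longrightarrow> (\<Prod>c\<in>#A. f c) \<in> forms (size A)"
proof (induction A)
  case (add c A)
  then show ?case using forms_mult[of "f c" 1] by simp
qed (simp add: one_forms)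

context affine_chart_closed
begin

text \<open>Every variable is integral over \<open>k\<close> on the chart. Homogenizing the split equation of \<open>vr i\<close> shows that
modulo a maximal ideal \<open>vr i\<close> is a multiple of \<open>l\<close>. The residue field is then generated by \<open>l\<close>, so \<open>l\<close>
is algebraic over \<open>k\<close> and therefore constant.\<close>

lemma maximal_ideals:
  assumes fin: "mp.fin_codim J"
    and m: "ideal_set m" "I \<subseteq> m" "1 \<notin> m" "\<And>F G. F * G \<in> m \<Longrightarrow> F \<in> m \<or> G \<in> m"
    and max: "\<And>F. F \<notin> m \<Longrightarrow> \<exists>G. 1 - F * G \<in> m"
  shows "l \<in> m \<or> (\<exists>c. c \<noteq> 0 \<and> l - cst c \<in> m)"
proof (cases "l \<in> m")
  case False
  have "\<exists>c. vr i - scl c l \<in> m" for i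
  proof -
    obtain A where A: "(\<Prod>c\<in>#A. vr i - scl c 1) \<in> J" using mpc.split_mod_fin_codim[OF J_ideal fin] by blast
    have "(\<Prod>c\<in>#A. vr i - scl c l) - (\<Prod>c\<in>#A. vr i - scl c 1) \<in> J"
    proof (rule prod_mset_cong_mod[OF J_ideal])
      fix c
      have "- scl c (l - 1) \<in> J" by (intro ideal_set_uminus[OF J_ideal] mp.ideal_set_scale[OF J_ideal] l_minus_one_J)
      then show "vr i - scl c l - (vr i - scl c 1) \<in> J" by (simp add: mp.scale_right_diff_distrib)
    qed
    then have "(\<Prod>c\<in>#A. vr i - scl c l) \<in> J" using ideal_set_add_mem_iff[OF J_ideal] A by blast
    moreover have "(\<Prod>c\<in>#A. vr i - scl c l) \<in> forms (size A)"
      by (intro prod_mset_forms forms_diff vr_forms forms_scl l_form)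
    ultimately have "(\<Prod>c\<in>#A. vr i - scl c l) \<in> m" using form_in_J m(2) by blast
    then show ?thesis using mpc.prime_prod_mset[OF m(3,4)] by blast
  qed
  then obtain c where c: "\<And>i. vr i - scl (c i) l \<in> m" by metis
  let ?T = "{G. \<exists>p. G - mp.poly_eval p l \<in> m}"
  have add: "G + H \<in> ?T" if GH: "G \<in> ?T" "H \<in> ?T" for G H
  proof -
    obtain p q where pq: "G - mp.poly_eval p l \<in> m" "H - mp.poly_eval q l \<in> m" using GH by blast
    have "(G + H) - mp.poly_eval (p + q) l \<in> m" using ideal_set_add[OF m(1) pq] by (simp add: mp.poly_eval_add algebra_simps)
    then show ?thesis by blast
  qed
  have zero: "0 \<in> ?T" using ideal_set_zero[OF m(1)] by (auto intro!: exI[of _ 0])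
  have "forms n \<subseteq> ?T" for n
  proof (induction n)
    case 0
    show ?case
    proof
      fix F :: "('n, 'k) mpoly" assume "F \<in> forms 0"
      then obtain a where "F = cst a" using forms_0_cst by blast
      then have "F - mp.poly_eval [:a:] l \<in> m" using ideal_set_zero[OF m(1)] by (simp add: scl_one)
      then show "F \<in> ?T" by blast
    qed
  next
    case (Suc n)
    show ?case
    proof
      fix F :: "('n, 'k) mpoly" assume "F \<in> forms (Suc n)"
      then show "F \<in> ?T"
      proof (rule forms_Suc_induct[OF _ zero add])
        fix i and G :: "('n, 'k) mpoly" assume "G \<in> forms n"
        then obtain p where p: "G - mp.poly_eval p l \<in> m" using Suc by blast
        have "vr i * (G - mp.poly_eval p l) + mp.poly_eval p l * (vr i - scl (c i) l) \<in> m"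
          by (rule ideal_set_lin[OF m(1) p c])
        moreover have "mp.poly_eval p l * scl (c i) l = mp.poly_eval (smult (c i) (pCons 0 p)) l"
          unfolding mp.poly_eval_smult mp.poly_eval_pCons mp.mult_scale by (simp add: mult.commute)
        ultimately have "vr i * G - mp.poly_eval (smult (c i) (pCons 0 p)) l \<in> m" by (simp add: algebra_simps)
        then show "vr i * G \<in> ?T" by blast
      qed
    qed
  qed
  then have all: "G \<in> ?T" for G
  proof -
    obtain D where D: "G = (\<Sum>n\<le>D. hcomp n G)" using hcomp_decomp by blast
    have "(\<Sum>n\<in>A. hcomp n G) \<in> ?T" if "finite A" for A
      using that
    proof (induction A rule: finite_induct)
      case (insert n A)
      have "hcomp n G \<in> ?T" using \<open>\<And>n. forms n \<subseteq> ?T\<close> hcomp_forms by blast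
      then show ?case using insert add by simp
    qed (simp only: sum.empty zero)
    from this[of "{..D}"] D show ?thesis by simp
  qed
  obtain G where G: "1 - l * G \<in> m" using max[OF False] by blast
  obtain p where p: "G - mp.poly_eval p l \<in> m" using all by blast
  define q where "q = 1 - pCons 0 p"
  have "(1 - l * G) + l * (G - mp.poly_eval p l) \<in> m" by (intro ideal_set_add[OF m(1) G] ideal_set_mult[OF m(1) p])
  then have q: "mp.poly_eval q l \<in> m"
    unfolding q_def mp.poly_eval_diff by (simp add: one_pCons algebra_simps)
  have "coeff q 0 = 1" by (simp add: q_def)
  then have "q \<noteq> 0" by auto
  then obtain A where A: "q = smult (lead_coeff q) (\<Prod>c\<in>#A. [:- c, 1:])" using alg_closed_imp_factorization by blast
  have "mp.poly_eval q l = scl (lead_coeff q) (\<Prod>c\<in>#A. l - scl c 1)"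
    using mp.poly_eval_smult[of "lead_coeff q" "\<Prod>c\<in>#A. [:- c, 1:]" l] A by (simp add: mp.poly_eval_prod_mset)
  then have "scl (inverse (lead_coeff q)) (mp.poly_eval q l) = (\<Prod>c\<in>#A. l - scl c 1)" using \<open>q \<noteq> 0\<close> by simp
  then have "(\<Prod>c\<in>#A. l - scl c 1) \<in> m" using mp.ideal_set_scale[OF m(1) q, of "inverse (lead_coeff q)"] by simp
  then obtain c where "l - scl c 1 \<in> m" using mpc.prime_prod_mset[OF m(3,4)] by blast
  then have "l - cst c \<in> m" by (simp add: scl_one)
  moreover have "c \<noteq> 0" using calculation False by (auto simp: cst_zero)
  ultimately show ?thesis by blast
qed simp

lemma scaled_chart:
  assumes "c \<noteq> 0" shows "affine_chart_closed I (scl c l)"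
proof -
  have "scl c l \<notin> pt P" if P: "P \<in> points I" for P
  proof
    assume "scl c l \<in> pt P"
    then have "scl (inverse c) (scl c l) \<in> pt P" by (rule mp.ideal_set_scale[OF pointD(1)[OF P]])
    then show False using l_pt[OF P] assms by simp
  qed
  then show ?thesis using forms_scl[OF l_form] fin_points by unfold_locales
qed

text \<open>If the filtration stops once it stops forever, because forms of degree \<open>n + 1\<close> are combinations of
products of a variable and a form of degree \<open>n\<close>.\<close>

lemma W_stable: assumes "W n = W (Suc n)" shows "W n = UNIV"
proof -
  have "W (n + k) = W n" for k
  proof (induction k)
    case (Suc k)
    have "W (Suc (n + k)) \<subseteq> W n"
    proof
      fix F assume "F \<in> W (Suc (n + k))"
      then obtain A where A: "A \<in> forms (Suc (n + k))" "A - F \<in> J" by (auto simp: W_def)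
      have "A \<in> W n"
      proof (rule forms_Suc_induct[OF A(1)])
        show "0 \<in> W n" by (intro forms_W forms_zero)
        show "a + b \<in> W n" if "a \<in> W n" "b \<in> W n" for a b by (rule W_add[OF that])
        fix i and G :: "('n, 'k) mpoly" assume "G \<in> forms (n + k)"
        then have "G \<in> W n" using Suc forms_W by blast
        then have "vr i * G \<in> W (1 + n)" by (rule W_mult[OF forms_W[OF vr_forms]])
        then show "vr i * G \<in> W n" using assms by simp
      qed
      then show "F \<in> W n" using W_cong[OF A(2)] by simp
    qed
    then show ?case using W_mono_add[of n "Suc k"] by auto
  qed simp
  then have "F \<in> W n" for F
  proof -
    obtain k where "F \<in> W k" using W_exhaust by blast
    then have "F \<in> W (n + k)" using W_mono[of k "n + k"] by auto
    then show ?thesis using \<open>\<And>k. W (n + k) = W n\<close> by simp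
  qed
  then show ?thesis by blast
qed

lemma W_zero_span: "W 0 = mp.span (insert 1 J)"
proof
  show "mp.span (insert 1 J) \<subseteq> W 0"
    by (intro mp.span_minimal W_subspace) (use J_subset_W forms_W[OF one_forms] in auto)
  show "W 0 \<subseteq> mp.span (insert 1 J)"
  proof
    fix F assume "F \<in> W 0"
    then obtain A where A: "A \<in> forms 0" "A - F \<in> J" by (auto simp: W_def)
    then obtain a where "A = scl a 1" using forms_0_cst scl_one by metis
    then have "F - scl a 1 \<in> mp.span J" using J_sym[OF A(2)] by (simp add: mp.span_base)
    then show "F \<in> mp.span (insert 1 J)" unfolding mp.span_breakdown_eq by blast
  qed
qed

lemma W_zero_dim:
  assumes C: "mp.fin_complement J C" and "1 \<notin> J"
  shows "mp.dim (W 0 \<inter> C) = 1"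
  using mp.rdim_insert[OF C mp.ideal_set_subspace[OF J_ideal] order_refl assms(2)] mp.rdim_zero[OF C]
  by (simp add: W_zero_span)

lemma lookup_vr: "Poly_Mapping.lookup (vr j :: ('n, 'k) mpoly) (Poly_Mapping.single i 1) = (if i = j then 1 else 0)"
proof (cases "i = j")
  case False
  have "Poly_Mapping.single j (1::nat) \<noteq> Poly_Mapping.single i 1"
  proof
    assume s: "Poly_Mapping.single j (1::nat) = Poly_Mapping.single i 1"
    have "Poly_Mapping.lookup (Poly_Mapping.single j (1::nat)) j = Poly_Mapping.lookup (Poly_Mapping.single i (1::nat)) j"
      by (simp only: s)
    then show False using False by (simp add: lookup_single when_def)
  qed
  then show ?thesis using False by (simp add: vr_def lookup_single when_def)
qed (simp add: vr_def)

lemma vr_inj: "inj (vr :: 'n \<Rightarrow> ('n, 'k) mpoly)"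
proof (rule injI)
  fix i j :: 'n assume eq: "(vr i :: ('n, 'k) mpoly) = vr j"
  show "i = j" using lookup_vr[of i i] lookup_vr[of j i] unfolding eq by (simp split: if_splits)
qed

lemma vr_independent: "mp.independent (range (vr :: 'n \<Rightarrow> ('n, 'k) mpoly))"
proof (rule mp.independent_if_scalars_zero)
  fix f :: "('n, 'k) mpoly \<Rightarrow> 'k" and x :: "('n, 'k) mpoly"
  assume s: "(\<Sum>x\<in>range vr. scl (f x) x) = 0" and "x \<in> range vr"
  then obtain i where i: "x = vr i" by blast
  have "(\<Sum>j\<in>UNIV. scl (f (vr j)) (vr j)) = 0"
    using s by (simp add: sum.reindex[OF vr_inj])
  then have "Poly_Mapping.lookup (\<Sum>j\<in>UNIV. scl (f (vr j)) (vr j)) (Poly_Mapping.single i 1) = 0" by simp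
  then have "(\<Sum>j\<in>UNIV. f (vr j) * (if i = j then 1 else 0)) = 0"
    by (simp only: lookup_sum lookup_scl lookup_vr)
  moreover have "(\<Sum>j\<in>UNIV. f (vr j) * (if i = j then 1 else 0)) = (\<Sum>j\<in>UNIV. if i = j then f (vr j) else 0)"
    by (rule sum.cong) auto
  ultimately show "f x = 0" using i by simp
qed simp

lemma vr_span: "mp.span (range vr) = (forms 1 :: ('n, 'k) mpoly set)"
proof
  show "mp.span (range vr) \<subseteq> (forms 1 :: ('n, 'k) mpoly set)"
    by (intro mp.span_minimal forms_subspace) (use vr_forms in auto)
  show "(forms 1 :: ('n, 'k) mpoly set) \<subseteq> mp.span (range vr)"
  proof
    fix F :: "('n, 'k) mpoly" assume "F \<in> forms 1"
    then have "F \<in> forms (Suc 0)" by simp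
    then show "F \<in> mp.span (range vr)"
    proof (rule forms_Suc_induct)
      fix i and G :: "('n, 'k) mpoly" assume "G \<in> forms 0"
      then have "vr i * G = scl (Poly_Mapping.lookup G 0) (vr i)"
        using forms_0_cst[of G] by (metis scl_def mult.commute)
      then show "vr i * G \<in> mp.span (range vr)" by (simp add: mp.span_scale mp.span_base)
    qed (auto intro: mp.span_zero mp.span_add)
  qed
qed

lemma W_one_dim:
  assumes C: "mp.fin_complement J C" and nd: "nondegenerate I"
  shows "mp.dim (W 1 \<inter> C) = CARD('n)"
proof -
  let ?B = "range (vr :: 'n \<Rightarrow> ('n, 'k) mpoly)"
  have "mp.span ?B \<inter> J \<subseteq> {0}"
    using nd form_in_J unfolding vr_span nondegenerate_def by blast
  then have 0: "mp.span ?B \<inter> J = {0}" using mp.span_zero ideal_set_zero[OF J_ideal] by blast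
  have "mp.span (J \<union> ?B) = W 1"
  proof
    show "mp.span (J \<union> ?B) \<subseteq> W 1"
      using J_subset_W forms_W[OF vr_forms] by (intro mp.span_minimal W_subspace) blast
    show "W 1 \<subseteq> mp.span (J \<union> ?B)"
    proof
      fix F assume "F \<in> W 1"
      then obtain A where A: "A \<in> forms 1" "A - F \<in> J" by (auto simp: W_def)
      have "A \<in> mp.span (J \<union> ?B)" using A(1) mp.span_mono[of ?B "J \<union> ?B"] unfolding vr_span by blast
      moreover have "A - F \<in> mp.span (J \<union> ?B)" using A(2) by (intro mp.span_base) blast
      ultimately have "A - (A - F) \<in> mp.span (J \<union> ?B)" by (rule mp.span_diff)
      then show "F \<in> mp.span (J \<union> ?B)" by simp
    qed
  qed
  then show ?thesis
    using rdim_span[OF C _ vr_independent 0] card_image[OF vr_inj] by simp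
qed

section \<open>The coordinate ring modulo the linear form\<close>

text \<open>The ideal of \<open>l\<close> in the coordinate ring, as an ideal of polynomials.\<close>

definition N where "N = {F. \<exists>g. F - g * l \<in> I}"

lemma N_ideal: "ideal_set N"
  unfolding N_def by (rule ideal_set_plus_principal[OF I_ideal])

lemma I_subset_N: "I \<subseteq> N" by (auto simp: N_def intro!: exI[of _ 0])

lemma l_N: "l * F \<in> N" by (auto simp: N_def ideal_set_zero[OF I_ideal] intro!: exI[of _ F])

text \<open>\<open>Wm n\<close> is \<open>W (n - 1)\<close>, with \<open>W (- 1)\<close> the zero subspace of \<open>A\<close>, that is, \<open>J\<close>.\<close>

definition Wm :: "nat \<Rightarrow> ('n, 'k) mpoly set" where
  "Wm n = (case n of 0 \<Rightarrow> J | Suc m \<Rightarrow> W m)"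

lemma Wm_simps [simp]: "Wm 0 = J" "Wm (Suc n) = W n"
  by (simp_all add: Wm_def)

text \<open>The degree \<open>n\<close> part of the coordinate ring modulo \<open>l\<close> is the quotient of \<open>W n\<close> by \<open>W (n - 1)\<close>.\<close>

lemma form_N_iff:
  assumes F: "F \<in> forms n" shows "F \<in> N \<longleftrightarrow> F \<in> Wm n"
proof
  assume "F \<in> N"
  then obtain g where g: "F - l * g \<in> I" by (auto simp: N_def mult.commute)
  then have "hcomp n (F - l * g) \<in> I" using I_hom by (simp add: hom_ideal_def)
  then have h: "F - (if 1 \<le> n then l * hcomp (n - 1) g else 0) \<in> I"
    unfolding hcomp_diff hcomp_form_mult[OF l_form] using F by (simp add: hcomp_of_form)
  show "F \<in> Wm n"
  proof (cases n)
    case 0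
    then show ?thesis using h I_subset_J by auto
  next
    case (Suc m)
    then have "F - l * hcomp m g \<in> J" using h I_subset_J by auto
    moreover have "l * hcomp m g - hcomp m g \<in> J" using l_pow_J[of 1] by simp
    ultimately have "F - hcomp m g \<in> J" by (rule J_cong[rotated])
    then have "hcomp m g - F \<in> J" by (rule J_sym)
    then show ?thesis using Suc hcomp_forms by (auto simp: W_def)
  qed
next
  assume W: "F \<in> Wm n"
  show "F \<in> N"
  proof (cases n)
    case 0
    then show ?thesis using W form_in_J[OF F] I_subset_N by auto
  next
    case (Suc m)
    then obtain A where A: "A \<in> forms m" "A - F \<in> J" using W by (auto simp: W_def)
    have "l * A - F \<in> J" using J_cong[OF A(2)] l_pow_J[of 1 A] by simp
    moreover have "l * A - F \<in> forms n" using forms_mult[OF l_form A(1)] F Suc by (intro forms_diff) auto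
    ultimately have "l * A - F \<in> N" using form_in_J I_subset_N by blast
    then show ?thesis using ideal_set_diff[OF N_ideal l_N[of A]] by fastforce
  qed
qed

lemma N_hom: assumes "F \<in> N" shows "hcomp n F \<in> N"
proof -
  obtain g where "F - l * g \<in> I" using assms by (auto simp: N_def mult.commute)
  then have "hcomp n (F - l * g) \<in> I" using I_hom by (simp add: hom_ideal_def)
  then have "hcomp n F - hcomp n (l * g) \<in> N" using I_subset_N by (auto simp: hcomp_diff)
  moreover have "hcomp n (l * g) \<in> N"
    using l_N ideal_set_zero[OF N_ideal] by (simp add: hcomp_form_mult[OF l_form])
  ultimately show ?thesis using ideal_set_add_mem_iff[OF N_ideal] by blast
qed

lemma N_iff: "F \<in> N \<longleftrightarrow> (\<forall>n. hcomp n F \<in> Wm n)"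
  using N_hom form_N_iff[OF hcomp_forms] hom_ideal_memI[OF N_ideal] by metis

text \<open>The dimensions determine all the orthogonals: that of \<open>W (3 - n)\<close> is \<open>W (n - 1)\<close>. So if a polynomial
\<open>F\<close> satisfies \<open>\<Phi>((F G)\<^sub>3) = 0\<close> for all \<open>G\<close>, then testing against forms \<open>G\<close> of degree \<open>3 - n\<close> puts its component
of degree \<open>n\<close> into \<open>W (n - 1)\<close>.\<close>

lemma irrelevant_functional:
  assumes \<Phi>: "dual_form \<Phi>" and C: "mp.fin_complement J C"
    and d1: "mp.dim C = 2 * mp.dim (W 1 \<inter> C)" and d2: "Suc (mp.dim (W 2 \<inter> C)) = mp.dim C" and one: "1 \<notin> J"
  shows "mp.functional (\<lambda>F. \<Phi> (hcomp 3 F))" "mp.perp (\<lambda>F. \<Phi> (hcomp 3 F)) UNIV = N" "mp.fin_codim N"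
proof -
  have lin: "mp.functional \<Phi>" and pJ: "mp.perp \<Phi> UNIV = J" and quad: "\<And>F. F \<in> forms 2 \<Longrightarrow> \<Phi> F = 0"
    using \<Phi> by (auto simp: dual_form_def)
  have fin: "mp.fin_codim (mp.perp \<Phi> UNIV)" using mp.fin_complement_imp_codim[OF C] pJ by simp
  have \<Phi>J: "\<Phi> F = \<Phi> G" if "F - G \<in> J" for F G
    using mp.functional_perp_UNIV[of "F - G" \<Phi>] that lin pJ by (simp add: mp.functional_diff)
  have \<Phi>W2: "\<Phi> F = 0" if "F \<in> W 2" for F
    using that quad \<Phi>J unfolding W_def by fastforce
  have pd: "mp.dim (W n \<inter> C) + mp.dim (mp.perp \<Phi> (W n) \<inter> C) = mp.dim C" for n
    using mp.perp_dim[OF lin _ W_subspace, of C n] C pJ J_subset_W by simp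
  have eqI: "W m = mp.perp \<Phi> (W n)" if "m + n = 2" "mp.dim (mp.perp \<Phi> (W n) \<inter> C) \<le> mp.dim (W m \<inter> C)" for m n
  proof (rule mp.rdim_eq[OF C W_subspace mp.perp_subspace[OF lin] J_subset_W _ that(2)])
    show "W m \<subseteq> mp.perp \<Phi> (W n)"
    proof
      fix F assume F: "F \<in> W m"
      have "\<Phi> (F * G) = 0" if "G \<in> W n" for G
        using \<Phi>W2 W_mult[OF F that] \<open>m + n = 2\<close> by simp
      then show "F \<in> mp.perp \<Phi> (W n)" by (simp add: mp.perp_def)
    qed
  qed
  have P1: "mp.perp \<Phi> (W 1) = W 1" using eqI[of 1 1] pd[of 1] d1 by simp
  have P2: "mp.perp \<Phi> (W 2) = W 0" using eqI[of 0 2] pd[of 2] d2 W_zero_dim[OF C one] by simp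
  have P0: "mp.perp \<Phi> (W 0) = W 2"
    using mp.perp_perp[OF lin fin W_subspace, of 2] P2 pJ J_subset_W by simp
  have "W 2 \<noteq> UNIV" using d2 by auto
  then have "W 2 \<noteq> W (Suc 2)" using W_stable by blast
  then have "W 2 \<subset> W 3" using W_mono[of 2 3] by (auto simp: eval_nat_numeral)
  then have "mp.dim (W 2 \<inter> C) < mp.dim (W 3 \<inter> C)" by (rule mp.rdim_strict[OF C W_subspace W_subspace J_subset_W])
  then have W3: "W 3 = UNIV"
    using d2 by (intro mp.rdim_eq[OF C W_subspace mp.subspace_UNIV J_subset_W]) auto
  have Wbig: "W n = UNIV" if "n \<ge> 3" for n using W_mono[OF that] W3 by auto
  have perpWm: "mp.perp \<Phi> (W (3 - n)) = Wm n" if n3: "n \<le> 3" for n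
  proof -
    consider "n = 0" | "n = 1" | "n = 2" | "n = 3" using n3 by linarith
    then show ?thesis
    proof cases
      case 1 then show ?thesis using W3 pJ by simp
    next
      case 2 then show ?thesis using P2 by (simp add: numeral_2_eq_2)
    next
      case 3 then show ?thesis using P1 by (simp add: numeral_2_eq_2)
    next
      case 4
      have "Wm 3 = W 2" by (simp add: eval_nat_numeral)
      then show ?thesis using 4 P0 by simp
    qed
  qed
  show lin': "mp.functional (\<lambda>F. \<Phi> (hcomp 3 F))"
    using lin by (auto simp: mp.functional_def hcomp_add hcomp_scl)
  show perp: "mp.perp (\<lambda>F. \<Phi> (hcomp 3 F)) UNIV = N"
  proof (intro equalityI subsetI)
    fix F assume F: "F \<in> mp.perp (\<lambda>F. \<Phi> (hcomp 3 F)) UNIV"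
    have "hcomp n F \<in> Wm n" for n
    proof (cases "n \<le> 3")
      case True
      have "\<Phi> (hcomp n F * G) = 0" if G: "G \<in> W (3 - n)" for G
      proof -
        obtain A where A: "A \<in> forms (3 - n)" "A - G \<in> J" using G by (auto simp: W_def)
        have "\<Phi> (hcomp 3 (A * F)) = 0" using F by (simp add: mp.perp_def mult.commute)
        then have "\<Phi> (hcomp n F * A) = 0"
          using True by (simp add: hcomp_form_mult[OF A(1)] mult.commute)
        moreover have "hcomp n F * A - hcomp n F * G \<in> J"
          using ideal_set_mult[OF J_ideal A(2), of "hcomp n F"] by (simp add: right_diff_distrib)
        ultimately show ?thesis using \<Phi>J by metis
      qed
      then show ?thesis unfolding perpWm[OF True, symmetric] by (simp add: mp.perp_def)
    next
      case False
      then obtain m where "n = Suc m" "m \<ge> 3" by (cases n) auto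
      then show ?thesis using Wbig by simp
    qed
    then show "F \<in> N" by (simp add: N_iff)
  next
    fix F assume F: "F \<in> N"
    have "\<Phi> (hcomp 3 (F * G)) = 0" for G
    proof -
      have "F * G \<in> N" by (rule ideal_set_mult2[OF N_ideal F])
      then have "hcomp 3 (F * G) \<in> Wm 3" by (simp add: N_iff)
      then show ?thesis using \<Phi>W2 by (simp add: eval_nat_numeral)
    qed
    then show "F \<in> mp.perp (\<lambda>F. \<Phi> (hcomp 3 F)) UNIV" by (simp add: mp.perp_def)
  qed
  let ?B = "(\<lambda>m. Poly_Mapping.single m (1::'k)) ` {m :: 'n \<Rightarrow>\<^sub>0 nat. mdeg m \<le> 3}"
  have "F \<in> mp.span (N \<union> ?B)" for F
  proof -
    have "Poly_Mapping.single m c \<in> mp.span (N \<union> ?B)" for m and c :: 'k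
    proof (cases "mdeg m \<le> 3")
      case True
      then have "Poly_Mapping.single m 1 \<in> mp.span (N \<union> ?B)" by (intro mp.span_base) blast
      then have "scl c (Poly_Mapping.single m 1) \<in> mp.span (N \<union> ?B)" by (rule mp.span_scale)
      then show ?thesis by (simp add: scl_def cst_def mult_single)
    next
      case False
      have f: "Poly_Mapping.single m c \<in> forms (mdeg m)" by (auto simp: forms_iff lookup_single when_def)
      obtain k where "mdeg m = Suc k" "k \<ge> 3" using False by (cases "mdeg m") auto
      then have "Poly_Mapping.single m c \<in> N" using form_N_iff[OF f] Wbig by simp
      then show ?thesis by (intro mp.span_base) blast
    qed
    then have "(\<Sum>m\<in>Poly_Mapping.keys F. Poly_Mapping.single m (Poly_Mapping.lookup F m)) \<in> mp.span (N \<union> ?B)"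
      by (intro mp.span_sum) auto
    then show ?thesis by (simp add: sum_monomials)
  qed
  moreover have "finite ?B" by (intro finite_imageI finite_mdeg_le)
  ultimately show "mp.fin_codim N" unfolding mp.fin_codim_def
    using mp.ideal_set_subspace[OF N_ideal] by blast
qed

text \<open>At a maximal ideal the regular sequence is \<open>l\<close> or \<open>l - c\<close>. In the second case the chart of \<open>l / c\<close> is
used, whose functional is obtained from the same self-association.\<close>

theorem gorenstein_if_self_associated:
  assumes deg: "has_degree I d" and nd: "nondegenerate I" and d: "d = 2 * CARD('n)"
    and sa: "self_associated I" and fb: "fails_by_one_on_quadrics I"
  shows "gorenstein_ring (coord_ring I)"
proof -
  obtain C where C: "mp.fin_complement J C" "mp.dim C = d" using complement_of_degree[OF deg] by blast
  have fin: "mp.fin_codim J" by (rule mp.fin_complement_imp_codim[OF C(1)])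
  note noeth = noetherian_I[OF fin]
  have d1: "mp.dim C = 2 * mp.dim (W 1 \<inter> C)" using W_one_dim[OF C(1) nd] C(2) d by simp
  have d2: "Suc (mp.dim (W 2 \<inter> C)) = mp.dim C" using fb fails_by_one_iff[OF C(1)] by simp
  have one: "1 \<notin> J"
  proof
    assume "1 \<in> J"
    then have "J = UNIV" using ideal_set_mult[OF J_ideal, of 1] by auto
    then show False using mp.rdim_zero[OF C(1)] C(2) d by simp
  qed
  have Rc: "cring (coord_ring I)" unfolding coord_ring_eq by (rule triv.R_cring)
  interpret R: cring "coord_ring I" by (rule Rc)
  have "gorenstein_local (localization (coord_ring I) (carrier (coord_ring I) - Q))"
    if Q: "maximalideal Q (coord_ring I)" for Q
  proof -
    interpret Q: maximalideal Q "coord_ring I" by (rule Q)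
    interpret Qp: primeideal Q "coord_ring I" by (rule R.maximalideal_prime[OF Q])
    define m where "m = {F. cl F \<in> Q}"
    note pre = cl_preimage_ideal[OF Q.ideal_axioms, folded m_def]
    have m1: "1 \<notin> m"
    proof
      assume "1 \<in> m"
      then have "\<one>\<^bsub>coord_ring I\<^esub> \<in> Q" unfolding coord_ring_eq by (simp add: triv.cl_one m_def)
      then show False using Q.one_imp_carrier Q.I_notcarr by blast
    qed
    have mp: "F \<in> m \<or> G \<in> m" if "F * G \<in> m" for F G
      using Qp.I_prime[of "cl F" "cl G"] that triv.carrier_R
      by (auto simp: m_def coord_ring_eq triv.cl_mult)
    have mmax: "\<exists>G. 1 - F * G \<in> m" if F: "F \<notin> m" for F
    proof -
      let ?K = "{a. \<exists>x. a - x * F \<in> m}"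
      have K: "ideal_set ?K" by (rule ideal_set_plus_principal[OF pre(1)])
      have mK: "m \<subseteq> ?K" by (auto intro!: exI[of _ 0])
      have IK: "I \<subseteq> ?K" using pre(2) mK by blast
      have FK: "F \<in> ?K" using ideal_set_zero[OF pre(1)] by (auto intro!: exI[of _ 1])
      have "cl ` ?K = Q \<or> cl ` ?K = carrier (coord_ring I)"
      proof (rule Q.I_maximal[OF cl_image_ideal[OF K]])
        show "Q \<subseteq> cl ` ?K" using pre(3) mK by blast
        show "cl ` ?K \<subseteq> carrier (coord_ring I)" using triv.carrier_R by (auto simp: coord_ring_eq)
      qed
      moreover have "cl ` ?K \<noteq> Q" using FK F by (auto simp: m_def)
      ultimately have "cl 1 \<in> cl ` ?K" using triv.carrier_R by (auto simp: coord_ring_eq)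
      then have "1 \<in> ?K" using cl_mem_image_iff[OF K IK] by blast
      then show ?thesis by (auto simp: mult.commute)
    qed
    have loc_eq: "carrier (coord_ring I) - Q = cl ` (- m)"
      using triv.carrier_R by (auto simp: coord_ring_eq m_def)
    note gl = mpc.gorenstein_localization[OF I_ideal noeth pre(1,2) m1 mp]
    have "gorenstein_local (localization (type_ring Quot I) (cl ` (- m)))"
      using maximal_ideals[OF fin pre(1,2) m1 mp mmax]
    proof
      assume lm: "l \<in> m"
      obtain \<Phi> where \<Phi>: "dual_form \<Phi>" using dual_form_if_self_associated[OF sa] by blast
      note irr = irrelevant_functional[OF \<Phi> C(1) d1 d2 one]
      show ?thesis
        by (rule gl[OF _ lm l_regular irr(1)]) (use irr(2,3) in \<open>simp_all add: N_def\<close>)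
    next
      assume "\<exists>c. c \<noteq> 0 \<and> l - cst c \<in> m"
      then obtain c where c: "c \<noteq> 0" "l - cst c \<in> m" by blast
      let ?l = "scl (inverse c) l"
      interpret ch: affine_chart_closed I ?l by (rule scaled_chart) (use c(1) in simp)
      obtain C' where C': "mp.fin_complement ch.J C'" using ch.complement_of_degree[OF deg] by blast
      obtain \<Phi> where "ch.dual_form \<Phi>" using ch.dual_form_if_self_associated[OF sa] by blast
      then have \<Phi>: "mp.functional \<Phi>" "mp.perp \<Phi> UNIV = ch.J" by (auto simp: ch.dual_form_def)
      have "scl (inverse c) (l - cst c) \<in> m" by (rule mp.ideal_set_scale[OF pre(1) c(2)])
      then have lm: "?l - 1 \<in> m"
        using c(1) by (simp add: mp.scale_right_diff_distrib scl_one[symmetric])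
      have reg: "a \<in> I" if "(?l - 1) * a \<in> I" for a
      proof (rule hom_ideal_memI[OF I_ideal])
        have h: "hcomp (Suc n) a - ?l * hcomp n a \<in> I" for n
        proof -
          have "hcomp (Suc n) (?l * a - a) \<in> I" using that I_hom by (simp add: hom_ideal_def algebra_simps)
          then have "?l * hcomp n a - hcomp (Suc n) a \<in> I"
            by (simp add: hcomp_diff hcomp_form_mult[OF ch.l_form])
          then show ?thesis using ideal_set_uminus[OF I_ideal] by fastforce
        qed
        have "hcomp 0 (?l * a - a) \<in> I" using that I_hom by (simp add: hom_ideal_def algebra_simps)
        then have "- hcomp 0 a \<in> I" by (simp add: hcomp_diff hcomp_form_mult[OF ch.l_form])
        then have h0: "hcomp 0 a \<in> I" using ideal_set_uminus[OF I_ideal] by fastforce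
        show "hcomp n a \<in> I" for n
        proof (induction n)
          case (Suc n)
          then have "?l * hcomp n a \<in> I" by (rule ideal_set_mult[OF I_ideal])
          then show ?case using h[of n] ideal_set_add_mem_iff[OF I_ideal] by blast
        qed (rule h0)
      qed
      show ?thesis
        by (rule gl[OF _ lm reg \<Phi>(1)])
           (use mp.fin_complement_imp_codim[OF C'] \<Phi>(2) in \<open>simp_all add: ch.J_def\<close>)
    qed
    then show ?thesis unfolding loc_eq by (simp add: coord_ring_eq)
  qed
  moreover have "noetherian_ring (coord_ring I)" unfolding coord_ring_eq by (rule triv.R_noetherian[OF noeth])
  ultimately show ?thesis unfolding gorenstein_ring_def using Rc by blast
qed

end

section \<open>The socle of a Gorenstein coordinate ring\<close>

context affine_chart_closed
begin

definition irrelevant :: "('n, 'k) mpoly set" where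
  "irrelevant = {F. hcomp 0 F = 0}"

lemma irrelevant_ideal: "ideal_set irrelevant"
  by (auto simp: irrelevant_def ideal_set_def hcomp_zero hcomp_add hcomp_mult)

lemma const_part: "\<exists>c. F - cst c \<in> irrelevant"
proof -
  obtain c where c: "hcomp 0 F = cst c" using forms_0_cst[OF hcomp_forms[of 0 F]] by blast
  then have "hcomp 0 (F - cst c) = 0" by (simp add: hcomp_diff hcomp_of_form[OF cst_forms])
  then show ?thesis by (auto simp: irrelevant_def)
qed

lemma one_irr: "1 \<notin> irrelevant"
  by (simp add: irrelevant_def hcomp_of_form[OF one_forms])

lemma irrelevant_prime: assumes "F * G \<in> irrelevant" shows "F \<in> irrelevant \<or> G \<in> irrelevant"
proof -
  obtain a b where ab: "hcomp 0 F = cst a" "hcomp 0 G = cst b"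
    using forms_0_cst[OF hcomp_forms[of 0]] by metis
  have "cst (a * b) = (0 :: ('n, 'k) mpoly)" using assms ab by (simp add: irrelevant_def hcomp_mult cst_mult)
  then have "a * b = 0" unfolding cst_def by (metis lookup_single_eq lookup_zero)
  then show ?thesis using ab by (auto simp: irrelevant_def cst_zero)
qed

lemma irrelevant_subset: assumes K: "ideal_set K" "\<And>i. vr i \<in> K" shows "irrelevant \<subseteq> K"
proof
  fix F assume "F \<in> irrelevant"
  show "F \<in> K"
  proof (rule hom_ideal_memI[OF K(1)])
    fix n
    show "hcomp n F \<in> K"
    proof (cases n)
      case 0
      then show ?thesis using \<open>F \<in> irrelevant\<close> ideal_set_zero[OF K(1)] by (simp add: irrelevant_def)
    next
      case (Suc m)
      have "hcomp (Suc m) F \<in> forms (Suc m)" by (rule hcomp_forms)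
      then have "hcomp (Suc m) F \<in> K"
        by (rule forms_Suc_induct) (auto intro: ideal_set_zero[OF K(1)] ideal_set_add[OF K(1)] ideal_set_mult2[OF K(1)] K(2))
      then show ?thesis using Suc by simp
    qed
  qed
qed

text \<open>The localization at the irrelevant ideal has the same socle modulo \<open>l\<close> as the graded ring, because an
element outside the irrelevant ideal acts on the socle as its constant term.\<close>

lemma socle_one_dim:
  assumes gor: "gorenstein_ring (coord_ring I)" and one: "1 \<notin> I"
    and b: "b \<notin> N" "\<And>i. vr i * b \<in> N" and b': "\<And>i. vr i * b' \<in> N"
  shows "\<exists>c. b' - scl c b \<in> N"
proof -
  have Iirr: "I \<subseteq> irrelevant"
  proof
    fix F assume F: "F \<in> I"
    have h: "hcomp 0 F \<in> I" using F I_hom by (simp add: hom_ideal_def)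
    obtain c where c: "hcomp 0 F = cst c" using forms_0_cst[OF hcomp_forms[of 0 F]] by blast
    have "c = 0"
    proof (rule ccontr)
      assume "c \<noteq> 0"
      have "cst (inverse c) * cst c \<in> I" using h c by (simp add: ideal_set_mult[OF I_ideal])
      then show False using \<open>c \<noteq> 0\<close> one by (simp add: cst_mult[symmetric] cst_one)
    qed
    then show "F \<in> irrelevant" using c by (simp add: irrelevant_def cst_zero)
  qed
  interpret loc: quotient_localization I "- irrelevant"
    by unfold_locales (use I_ideal one_irr irrelevant_prime in auto)
  interpret L: cring loc.L by (rule loc.L_cring)
  have Rc: "cring (coord_ring I)" unfolding coord_ring_eq by (rule triv.R_cring)
  have mem: "cl F \<in> cl ` irrelevant \<longleftrightarrow> F \<in> irrelevant" for F by (rule cl_mem_image_iff[OF irrelevant_ideal Iirr])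
  have max: "maximalideal (cl ` irrelevant) (coord_ring I)"
  proof (rule maximalidealI)
    show "ideal (cl ` irrelevant) (coord_ring I)" by (rule cl_image_ideal[OF irrelevant_ideal])
    have "cl 1 \<in> carrier (coord_ring I)" using triv.carrier_R by (auto simp: coord_ring_eq)
    then show "carrier (coord_ring I) \<noteq> cl ` irrelevant" using mem[of 1] one_irr by metis
    fix K assume K: "ideal K (coord_ring I)" "cl ` irrelevant \<subseteq> K" "K \<subseteq> carrier (coord_ring I)"
    interpret K: ideal K "coord_ring I" by (rule K(1))
    note pre = cl_preimage_ideal[OF K(1)]
    have "K = carrier (coord_ring I)" if "K \<noteq> cl ` irrelevant"
    proof -
      have "\<exists>y. y \<in> K \<and> y \<notin> cl ` irrelevant" using that K(2) by auto
      then obtain y where y: "y \<in> K" "y \<notin> cl ` irrelevant" by blast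
      then obtain F where F: "y = cl F" using K(3) triv.carrier_R by (auto simp: coord_ring_eq)
      obtain c where c: "F - cst c \<in> irrelevant" using const_part by blast
      have "c \<noteq> 0" using c y(2) F by (auto simp: cst_zero)
      have "F \<in> {F. cl F \<in> K}" using y(1) F by simp
      moreover have "F - cst c \<in> {F. cl F \<in> K}" using c K(2) by blast
      ultimately have "F - (F - cst c) \<in> {F. cl F \<in> K}" by (rule ideal_set_diff[OF pre(1)])
      then have "cst (inverse c) * cst c \<in> {F. cl F \<in> K}" using ideal_set_mult[OF pre(1)] by simp
      then have "cl 1 \<in> K" using \<open>c \<noteq> 0\<close> by (simp add: cst_mult[symmetric] cst_one)
      then have "\<one>\<^bsub>coord_ring I\<^esub> \<in> K" by (simp add: coord_ring_eq triv.cl_one)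
      then show ?thesis by (rule K.one_imp_carrier)
    qed
    then show "K = cl ` irrelevant \<or> K = carrier (coord_ring I)" by blast
  qed
  have "carrier (coord_ring I) - cl ` irrelevant = cl ` (- irrelevant)"
    using triv.carrier_R mem by (auto simp: coord_ring_eq)
  then have "gorenstein_local loc.L"
    using gor max unfolding gorenstein_ring_def by (auto simp: coord_ring_eq)
  then obtain xs where xs: "regular_sequence loc.L xs"
    "injective_module (loc.L Quot (genideal loc.L (set xs)))
       (as_module (loc.L Quot (genideal loc.L (set xs))) (carrier (loc.L Quot (genideal loc.L (set xs)))))"
    unfolding gorenstein_local_def Let_def by blast
  have o: "1 \<in> - irrelevant" using one_irr by simp
  let ?t = "loc.frac l 1"
  have tc: "?t \<in> carrier loc.L" using o by (auto simp: loc.carrier_L)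
  note gm = genideal_singleton_mem[OF loc.L_cring tc]
  note prime = loc.L_prime_ideal[OF irrelevant_ideal Iirr refl]
  have unit_const: "\<exists>c. c \<noteq> 0 \<and> u - cst c \<in> irrelevant" if "u \<notin> irrelevant" for u
  proof -
    obtain c where c: "u - cst c \<in> irrelevant" using const_part by blast
    moreover have "c \<noteq> 0" using c \<open>u \<notin> irrelevant\<close> by (auto simp: cst_zero)
    ultimately show ?thesis by blast
  qed
  have irrN: "F * g \<in> N" if "F \<in> irrelevant" "\<And>i. vr i * g \<in> N" for F g
    using irrelevant_subset[OF ideal_set_colon[OF N_ideal], of g] that by auto
  have frac_t: "loc.frac a s \<in> genideal loc.L {?t} \<longleftrightarrow> (\<exists>u\<in>- irrelevant. u * a \<in> N)" if s: "s \<in> - irrelevant" for a s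
  proof
    assume "loc.frac a s \<in> genideal loc.L {?t}"
    then obtain z where z: "z \<in> carrier loc.L" "loc.frac a s = ?t \<otimes>\<^bsub>loc.L\<^esub> z" using gm by blast
    then obtain e t where e: "z = loc.frac e t" "t \<in> - irrelevant" by (auto simp: loc.carrier_L)
    have "loc.frac a s = loc.frac (l * e) t" using z(2) e o by (simp add: loc.frac_mult)
    then obtain u where u: "u \<in> - irrelevant" "u * (a * t - l * e * s) \<in> I" using loc.frac_eq_iff[OF s e(2)] by blast
    then have "(u * t) * a - (u * e * s) * l \<in> I" by (simp add: algebra_simps)
    then have "(u * t) * a \<in> N" by (auto simp: N_def)
    moreover have "u * t \<in> - irrelevant" using u(1) e(2) by (rule loc.mult_M)
    ultimately show "\<exists>u\<in>- irrelevant. u * a \<in> N" by blast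
  next
    assume "\<exists>u\<in>- irrelevant. u * a \<in> N"
    then obtain u g where u: "u \<in> - irrelevant" "u * a - g * l \<in> I" by (auto simp: N_def)
    have us: "u * s \<in> - irrelevant" using u(1) s by (rule loc.mult_M)
    have "s * (u * a - g * l) \<in> I" by (rule ideal_set_mult[OF I_ideal u(2)])
    then have "loc.frac a s = loc.frac (l * g) (u * s)"
      using us s by (intro loc.frac_eqI) (simp_all add: algebra_simps)
    also have "\<dots> = ?t \<otimes>\<^bsub>loc.L\<^esub> loc.frac g (u * s)" using o us by (simp add: loc.frac_mult)
    finally show "loc.frac a s \<in> genideal loc.L {?t}" using gm us by (auto simp: loc.carrier_L)
  qed
  have red: "g \<in> N" if u: "u \<in> - irrelevant" "u * g \<in> N" and g: "\<And>i. vr i * g \<in> N" for u g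
  proof -
    obtain c where c: "c \<noteq> 0" "u - cst c \<in> irrelevant" using unit_const u(1) by blast
    have "u * g - (u - cst c) * g \<in> N" using u(2) irrN[OF c(2) g] by (rule ideal_set_diff[OF N_ideal])
    then have "cst c * g \<in> N" by (simp add: algebra_simps)
    then have "cst (inverse c) * (cst c * g) \<in> N" by (rule ideal_set_mult[OF N_ideal])
    then show ?thesis using c(1) by (simp add: mult.assoc[symmetric] cst_mult[symmetric] cst_one)
  qed
  have Nmult: "z \<otimes>\<^bsub>loc.L\<^esub> loc.frac g 1 \<in> genideal loc.L {?t}"
    if g: "\<And>i. vr i * g \<in> N" and z: "z \<in> {loc.frac a s |a s. a \<in> irrelevant \<and> s \<in> - irrelevant}" for g z
  proof -
    obtain a s where a: "z = loc.frac a s" "a \<in> irrelevant" "s \<in> - irrelevant" using z by blast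
    have "z \<otimes>\<^bsub>loc.L\<^esub> loc.frac g 1 = loc.frac (a * g) s" using a o by (simp add: loc.frac_mult)
    moreover have "1 * (a * g) \<in> N" using irrN[OF a(2) g] by simp
    ultimately show ?thesis using frac_t[OF a(3)] o by metis
  qed
  have "\<exists>g\<in>carrier loc.L. loc.frac b' 1 \<ominus>\<^bsub>loc.L\<^esub> g \<otimes>\<^bsub>loc.L\<^esub> loc.frac b 1 \<in> genideal loc.L {?t}"
  proof (rule gorenstein_socle_cyclic[OF loc.L_cring prime _ _ xs])
    have "l \<in> irrelevant" by (simp add: irrelevant_def hcomp_of_form[OF l_form])
    then show "?t \<in> {loc.frac a s |a s. a \<in> irrelevant \<and> s \<in> - irrelevant}" using o by blast
    show "a = \<zero>\<^bsub>loc.L\<^esub>" if a: "a \<in> carrier loc.L" "?t \<otimes>\<^bsub>loc.L\<^esub> a = \<zero>\<^bsub>loc.L\<^esub>" for a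
    proof -
      obtain e s where e: "a = loc.frac e s" "s \<in> - irrelevant" using a(1) by (auto simp: loc.carrier_L)
      have "loc.frac (l * e) s = loc.frac 0 1" using a(2) e o by (simp add: loc.frac_mult loc.frac_zero)
      then obtain u where u: "u \<in> - irrelevant" "u * (l * e * 1 - 0 * s) \<in> I" using loc.frac_eq_iff[OF e(2) o] by blast
      then have "l * (u * e) \<in> I" by (simp add: ac_simps)
      then have "u * e \<in> I" by (rule l_regular)
      then have "u * (e * 1 - 0 * s) \<in> I" by simp
      then show ?thesis using loc.frac_eq_iff[OF e(2) o] u(1) e(1) loc.frac_zero by metis
    qed
    show "loc.frac b 1 \<in> carrier loc.L" "loc.frac b' 1 \<in> carrier loc.L" using o by (auto simp: loc.carrier_L)
    show "loc.frac b 1 \<notin> genideal loc.L {?t}" using frac_t[OF o, of b] red[OF _ _ b(2)] b(1) by blast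
  qed (use Nmult b(2) b' in blast)+
  then obtain g s where g: "s \<in> - irrelevant"
    "loc.frac b' 1 \<ominus>\<^bsub>loc.L\<^esub> loc.frac g s \<otimes>\<^bsub>loc.L\<^esub> loc.frac b 1 \<in> genideal loc.L {?t}"
    unfolding loc.carrier_L by blast
  have neg: "\<ominus>\<^bsub>loc.L\<^esub> loc.frac (g * b) s = loc.frac (- (g * b)) s"
  proof (rule L.minus_equality)
    have "loc.frac 0 (s * s) = loc.frac 0 1"
      by (rule loc.frac_eqI[OF loc.mult_M[OF g(1) g(1)] o]) (simp add: ideal_set_zero[OF I_ideal])
    then show "loc.frac (- (g * b)) s \<oplus>\<^bsub>loc.L\<^esub> loc.frac (g * b) s = \<zero>\<^bsub>loc.L\<^esub>"
      using g(1) by (simp add: loc.frac_zero loc.frac_add)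
  qed (use g(1) in \<open>auto simp: loc.carrier_L\<close>)
  have "loc.frac b' 1 \<ominus>\<^bsub>loc.L\<^esub> loc.frac g s \<otimes>\<^bsub>loc.L\<^esub> loc.frac b 1 = loc.frac (b' * s - g * b) s"
    unfolding L.minus_eq using g(1) o by (simp add: loc.frac_mult neg loc.frac_add)
  then obtain u where u: "u \<in> - irrelevant" "u * (b' * s - g * b) \<in> N" using g frac_t[OF g(1)] by auto
  have us: "u * s \<in> - irrelevant" using u(1) g(1) by (rule loc.mult_M)
  obtain c where c: "c \<noteq> 0" "u * s - cst c \<in> irrelevant" using unit_const us by blast
  obtain d where d: "u * g - cst d \<in> irrelevant" using const_part by blast
  have "(u * s - cst c) * b' - (u * g - cst d) * b \<in> N"
    by (rule ideal_set_diff[OF N_ideal irrN[OF c(2) b'] irrN[OF d b(2)]])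
  then have "u * (b' * s - g * b) - ((u * s - cst c) * b' - (u * g - cst d) * b) \<in> N"
    by (rule ideal_set_diff[OF N_ideal u(2)])
  then have "cst c * b' - cst d * b \<in> N" by (simp add: algebra_simps)
  then have "cst (inverse c) * (cst c * b' - cst d * b) \<in> N" by (rule ideal_set_mult[OF N_ideal])
  moreover have "cst (inverse c) * (cst c * b' - cst d * b) = b' - scl (inverse c * d) b"
    using c(1) by (simp add: right_diff_distrib mult.assoc[symmetric] cst_mult[symmetric] cst_one scl_def)
  ultimately show ?thesis by auto
qed

text \<open>Here \<open>s'\<close> is \<open>s - 1\<close>, where \<open>s\<close> is the first index with \<open>W s = A\<close>; the functional has kernel \<open>W s'\<close>. Its
value at \<open>F\<close> is the coefficient of the top-degree socle generator \<open>b0\<close>.\<close>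

theorem dual_form_if_gorenstein:
  assumes gor: "gorenstein_ring (coord_ring I)" and C: "mp.fin_complement J C"
    and d1: "mp.dim C = 2 * mp.dim (W 1 \<inter> C)" and r: "mp.dim (W 1 \<inter> C) \<ge> 2"
  shows "\<exists>\<Phi>. dual_form \<Phi>" "Suc (mp.dim (W 2 \<inter> C)) = mp.dim C"
proof -
  have one: "1 \<notin> J"
  proof
    assume "1 \<in> J"
    then have "J = UNIV" using ideal_set_mult[OF J_ideal, of 1] by auto
    then show False using mp.rdim_zero[OF C] d1 r by simp
  qed
  then have oneI: "1 \<notin> I" using I_subset_J by blast
  note socle = socle_one_dim[OF gor oneI]
  have "\<exists>n. W n = UNIV"
  proof (rule ccontr)
    assume no: "\<not> ?thesis"
    have step: "mp.dim (W n \<inter> C) < mp.dim (W (Suc n) \<inter> C)" for n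
    proof (rule mp.rdim_strict[OF C W_subspace W_subspace J_subset_W])
      have "W n \<noteq> UNIV" using no by simp
      then have "W n \<noteq> W (Suc n)" using W_stable[of n] by argo
      then show "W n \<subset> W (Suc n)" using W_mono[of n "Suc n"] by auto
    qed
    have "n \<le> mp.dim (W n \<inter> C)" for n
    proof (induction n)
      case (Suc n)
      then show ?case using step[of n] by linarith
    qed simp
    from this[of "Suc (mp.dim C)"] show False
      using mp.rdim_mono[OF C, of "W (Suc (mp.dim C))" UNIV] by simp
  qed
  then obtain n0 where n0: "W n0 = UNIV" ..
  define s where "s = (LEAST n. W n = UNIV)"
  have s: "W s = UNIV" "n < s \<Longrightarrow> W n \<noteq> UNIV" for n
    unfolding s_def by (rule LeastI[of "\<lambda>n. W n = UNIV", OF n0]) (rule not_less_Least)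
  have Wbig: "W n = UNIV" if "n \<ge> s" for n using W_mono[OF that] s(1) by auto
  have "s \<noteq> 0"
  proof
    assume "s = 0"
    then show False using s(1) W_zero_dim[OF C one] d1 r by simp
  qed
  then obtain s' where s': "s = Suc s'" by (cases s) auto
  have Ws': "W s' \<noteq> UNIV" using s(2) s' by simp
  have "\<exists>b0\<in>forms s. b0 \<notin> W s'"
  proof (rule ccontr)
    assume n: "\<not> ?thesis"
    have "F \<in> W s'" for F
    proof -
      obtain A where A: "A \<in> forms s" "A - F \<in> J" using s(1) by (auto simp: W_def)
      then show ?thesis using n W_cong[OF A(2)] by blast
    qed
    then show False using Ws' by blast
  qed
  then obtain b0 where b0: "b0 \<in> forms s" "b0 \<notin> W s'" by blast
  have top_socle: "vr i * A \<in> N" if "A \<in> forms s" for A i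
  proof -
    have "vr i * A \<in> forms (Suc s)" using forms_mult[OF vr_forms that] by simp
    then show ?thesis using form_N_iff Wbig[of s] by simp
  qed
  have b0N: "b0 \<notin> N" using form_N_iff[OF b0(1)] b0(2) s' by simp
  \<comment> \<open>The socle is one-dimensional and contains all of \<open>A\<close> modulo \<open>W s'\<close>, the top degree.\<close>
  have "\<exists>c. F - scl c b0 \<in> W s'" for F
  proof -
    obtain A where A: "A \<in> forms s" "A - F \<in> J" using s(1) by (auto simp: W_def)
    obtain c where "A - scl c b0 \<in> N" using socle[OF b0N top_socle[OF b0(1)] top_socle[OF A(1)]] by blast
    moreover have "A - scl c b0 \<in> forms s" using A(1) b0(1) by (intro forms_diff forms_scl)
    ultimately have "A - scl c b0 \<in> W s'" using form_N_iff s' by simp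
    moreover have "(A - scl c b0) - (F - scl c b0) \<in> J" using A(2) by simp
    ultimately show ?thesis using W_cong by blast
  qed
  then obtain \<Phi> where \<Phi>: "\<And>F. F - scl (\<Phi> F) b0 \<in> W s'" by metis
  have uniq: "\<Phi> F = c" if "F - scl c b0 \<in> W s'" for F c
  proof (rule ccontr)
    assume "\<Phi> F \<noteq> c"
    have "(F - scl c b0) - (F - scl (\<Phi> F) b0) \<in> W s'" by (rule W_diff[OF that \<Phi>])
    then have "scl (\<Phi> F - c) b0 \<in> W s'" by (simp add: mp.scale_left_diff_distrib)
    then have "scl (inverse (\<Phi> F - c)) (scl (\<Phi> F - c) b0) \<in> W s'" by (rule W_scl)
    then show False using \<open>\<Phi> F \<noteq> c\<close> b0(2) by simp
  qed
  have lin: "mp.functional \<Phi>" unfolding mp.functional_def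
  proof (intro conjI allI)
    fix F G
    have "(F - scl (\<Phi> F) b0) + (G - scl (\<Phi> G) b0) \<in> W s'" by (rule W_add[OF \<Phi> \<Phi>])
    then show "\<Phi> (F + G) = \<Phi> F + \<Phi> G" by (intro uniq) (simp add: mp.scale_left_distrib algebra_simps)
  next
    fix c F
    have "scl c (F - scl (\<Phi> F) b0) \<in> W s'" by (rule W_scl[OF \<Phi>])
    then show "\<Phi> (scl c F) = c * \<Phi> F" by (intro uniq) (simp add: mp.scale_right_diff_distrib)
  qed
  have ker: "\<Phi> F = 0 \<longleftrightarrow> F \<in> W s'" for F
    using uniq[of F 0] \<Phi>[of F] by auto
  \<comment> \<open>Below the top degree there is no socle, so an element can be multiplied up degree by degree.\<close>
  have reach: "\<exists>w\<in>W k. \<Phi> (w * F) \<noteq> 0" if "n + k = s" "F \<in> W n" "F \<notin> Wm n" for n k F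
    using that
  proof (induction k arbitrary: n F)
    case 0
    then have "\<Phi> (1 * F) \<noteq> 0" using s' ker by simp
    then show ?case using forms_W[OF one_forms] by blast
  next
    case (Suc k)
    obtain A where A: "A \<in> forms n" "A - F \<in> J" using Suc.prems(2) by (auto simp: W_def)
    have WmJ: "J \<subseteq> Wm n" and Wm_sub: "mp.subspace (Wm n)"
      using J_subset_W mp.ideal_set_subspace[OF J_ideal] W_subspace by (cases n; simp)+
    have "A \<notin> Wm n"
    proof
      assume "A \<in> Wm n"
      then have "A - (A - F) \<in> Wm n" using A(2) WmJ Wm_sub mp.subspace_diff by blast
      then show False using Suc.prems(3) by simp
    qed
    then have AN: "A \<notin> N" using form_N_iff[OF A(1)] by simp
    have "\<exists>i. vr i * A \<notin> N"
    proof (rule ccontr)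
      assume "\<not> ?thesis"
      then have "\<exists>c. b0 - scl c A \<in> N" using socle[OF AN _ top_socle[OF b0(1)]] by blast
      then obtain c where c: "b0 - scl c A \<in> N" by blast
      have "hcomp s (b0 - scl c A) = b0"
        using Suc.prems(1) by (simp add: hcomp_diff hcomp_scl hcomp_of_form[OF A(1)] hcomp_of_form[OF b0(1)])
      then show False using N_hom[OF c, of s] b0N by simp
    qed
    then obtain i where i: "vr i * A \<notin> N" by blast
    have f: "vr i * A \<in> forms (Suc n)" using forms_mult[OF vr_forms A(1)] by simp
    have "vr i * A \<notin> Wm (Suc n)" using i form_N_iff[OF f] by simp
    moreover have "vr i * A \<in> W (Suc n)" by (rule forms_W[OF f])
    ultimately obtain w where w: "w \<in> W k" "\<Phi> (w * (vr i * A)) \<noteq> 0"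
      using Suc.IH[of "Suc n" "vr i * A"] Suc.prems(1) by auto
    have "w * vr i \<in> W (k + 1)" by (rule W_mult[OF w(1) forms_W[OF vr_forms]])
    moreover have "\<Phi> (w * vr i * F) \<noteq> 0"
    proof
      assume "\<Phi> (w * vr i * F) = 0"
      moreover have "w * vr i * (A - F) \<in> J" by (rule ideal_set_mult[OF J_ideal A(2)])
      then have "\<Phi> (w * vr i * (A - F)) = 0" using ker J_subset_W by blast
      ultimately have "\<Phi> (w * vr i * A) = 0" using lin by (simp add: right_diff_distrib mp.functional_diff)
      then show False using w(2) by (simp add: mult.assoc)
    qed
    ultimately show ?case by (intro bexI[of _ "w * vr i"]) auto
  qed
  have exact: "\<exists>n\<le>s. F \<in> W n \<and> F \<notin> Wm n" if "F \<notin> J" for F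
  proof -
    define n where "n = (LEAST n. F \<in> W n)"
    have Fs: "F \<in> W s" using s(1) by simp
    have n: "F \<in> W n" "n \<le> s" unfolding n_def by (rule LeastI[of "\<lambda>n. F \<in> W n", OF Fs], rule Least_le[of "\<lambda>n. F \<in> W n", OF Fs])
    have "F \<notin> Wm n"
    proof (cases n)
      case (Suc m)
      then have "F \<notin> W m" using not_less_Least[of m "\<lambda>n. F \<in> W n"] by (simp add: n_def)
      then show ?thesis using Suc by simp
    qed (use that in simp)
    then show ?thesis using n by blast
  qed
  have pJ: "mp.perp \<Phi> UNIV = J"
  proof (intro equalityI subsetI)
    fix F assume F: "F \<in> mp.perp \<Phi> UNIV"
    show "F \<in> J"
    proof (rule ccontr)
      assume "F \<notin> J"
      then obtain n where n: "n \<le> s" "F \<in> W n" "F \<notin> Wm n" using exact by blast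
      then obtain w where "\<Phi> (w * F) \<noteq> 0" using reach[of n "s - n" F] by auto
      then show False using F by (auto simp: mp.perp_def mult.commute)
    qed
  next
    fix F assume "F \<in> J"
    then have "\<Phi> (F * G) = 0" for G using ker J_subset_W ideal_set_mult2[OF J_ideal] by blast
    then show "F \<in> mp.perp \<Phi> UNIV" by (simp add: mp.perp_def)
  qed
  have perpW: "mp.perp \<Phi> (W 1) = Wm s'"
  proof (intro equalityI subsetI)
    fix F assume F: "F \<in> mp.perp \<Phi> (W 1)"
    show "F \<in> Wm s'"
    proof (rule ccontr)
      assume nF: "F \<notin> Wm s'"
      have "J \<subseteq> Wm s'" using J_subset_W by (cases s') auto
      then have "F \<notin> J" using nF by blast
      then obtain n where n: "n \<le> s" "F \<in> W n" "F \<notin> Wm n" using exact by blast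
      have "n \<ge> s'"
      proof (rule ccontr)
        assume "\<not> s' \<le> n"
        then obtain m where m: "s' = Suc m" "n \<le> m" by (cases s') auto
        then show False using nF n(2) W_mono[OF m(2)] by auto
      qed
      then have "s - n \<le> 1" using s' by simp
      moreover obtain w where w: "w \<in> W (s - n)" "\<Phi> (w * F) \<noteq> 0" using reach[of n "s - n" F] n by auto
      ultimately have "w \<in> W 1" using W_mono by blast
      then show False using F w(2) by (auto simp: mp.perp_def mult.commute)
    qed
  next
    fix F assume F: "F \<in> Wm s'"
    have "\<Phi> (F * G) = 0" if G: "G \<in> W 1" for G
    proof (cases s')
      case 0
      then have "F * G \<in> J" using F ideal_set_mult2[OF J_ideal] by simp
      then show ?thesis using ker J_subset_W by blast
    next
      case (Suc m)
      then have "F * G \<in> W (m + 1)" using F G by (intro W_mult) simp_all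
      then show ?thesis using ker Suc by simp
    qed
    then show "F \<in> mp.perp \<Phi> (W 1)" by (simp add: mp.perp_def)
  qed
  have "mp.dim (W 1 \<inter> C) + mp.dim (mp.perp \<Phi> (W 1) \<inter> C) = mp.dim C"
    using mp.perp_dim[OF lin _ W_subspace, of C 1] C pJ J_subset_W by simp
  then have dWm: "mp.dim (Wm s' \<inter> C) = mp.dim (W 1 \<inter> C)" using perpW d1 by simp
  have "s' = 2"
  proof -
    have "s' \<noteq> 0"
    proof
      assume "s' = 0"
      then show False using dWm mp.rdim_zero[OF C] r by simp
    qed
    moreover have "s' \<noteq> 1"
    proof
      assume "s' = 1"
      then show False using dWm W_zero_dim[OF C one] r by simp
    qed
    moreover have "\<not> s' \<ge> 3"
    proof
      assume "s' \<ge> 3"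
      then obtain m where m: "s' = Suc m" "m \<ge> 2" by (cases s') auto
      have "W 1 = W m" using dWm m W_mono[of 1 m] by (intro mp.rdim_eq[OF C W_subspace W_subspace J_subset_W]) auto
      moreover have "W 1 \<subseteq> W 2" "W 2 \<subseteq> W m" using m(2) by (intro W_mono; simp)+
      ultimately have "W 1 = W (Suc 1)" by (simp add: numeral_2_eq_2)
      then have "W 1 = UNIV" by (rule W_stable)
      then have "mp.dim C = mp.dim (W 1 \<inter> C)" by simp
      then show False using d1 r by simp
    qed
    ultimately show ?thesis by linarith
  qed
  have "\<Phi> F = 0" if "F \<in> forms 2" for F using ker forms_W[OF that] \<open>s' = 2\<close> by simp
  then show "\<exists>\<Phi>. dual_form \<Phi>" unfolding dual_form_def using lin pJ by blast
  have "mp.span (insert b0 (W 2)) = UNIV"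
  proof -
    have "F \<in> mp.span (insert b0 (W 2))" for F
    proof -
      have "F - scl (\<Phi> F) b0 \<in> mp.span (W 2)" using \<Phi>[of F] \<open>s' = 2\<close> by (simp add: mp.span_base)
      then show ?thesis unfolding mp.span_breakdown_eq by blast
    qed
    then show ?thesis by blast
  qed
  moreover have "b0 \<notin> W 2" using b0(2) \<open>s' = 2\<close> by simp
  ultimately show "Suc (mp.dim (W 2 \<inter> C)) = mp.dim C"
    using mp.rdim_insert[OF C W_subspace J_subset_W, of b0 2] by simp
qed

end

section \<open>Gorenstein coordinate rings and self-association\<close>

theorem theorem7p3:
  fixes I :: "(('n::finite \<Rightarrow>\<^sub>0 nat) \<Rightarrow>\<^sub>0 'k::alg_closed_field) set" and r :: nat
  assumes "r \<ge> 1" and "CARD('n) = r + 1"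
    and "finite_scheme I" and "has_degree I (2 * r + 2)"
    and "nondegenerate I"
  shows "gorenstein_ring (coord_ring I) \<longleftrightarrow> self_associated I \<and> fails_by_one_on_quadrics I"
proof -
  have cs: "closed_scheme I" using assms(3) by (simp add: finite_scheme_def closed_scheme_def)
  have fp: "finite (points I)" using assms(3) by (simp add: finite_scheme_def)
  obtain l where l: "l \<in> forms 1" "\<forall>P\<in>points I. l \<notin> closed_scheme.pt I P"
    using linear_form_avoiding_points[OF cs fp order_refl] by blast
  interpret affine_chart_closed I l
    using cs l fp by (simp add: affine_chart_closed_def affine_chart_def affine_chart_axioms_def)
  show ?thesis
  proof
    assume gor: "gorenstein_ring (coord_ring I)"
    obtain C where C: "mp.fin_complement J C" "mp.dim C = 2 * r + 2" using complement_of_degree[OF assms(4)] by blast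
    have d: "mp.dim C = 2 * mp.dim (W 1 \<inter> C)" "mp.dim (W 1 \<inter> C) \<ge> 2"
      using W_one_dim[OF C(1) assms(5)] C(2) assms(1,2) by simp_all
    obtain \<Phi> where \<Phi>: "dual_form \<Phi>" using dual_form_if_gorenstein(1)[OF gor C(1) d] by blast
    have "gorenstein_scheme I"
      using gorenstein_scheme_if_functional[OF _ _ mp.fin_complement_imp_codim[OF C(1)]] \<Phi>
      by (auto simp: dual_form_def)
    then have "self_associated I" by (rule self_associated_if_dual_form[OF \<Phi> _ C(1) d(1)])
    moreover have "fails_by_one_on_quadrics I"
      using fails_by_one_iff[OF C(1)] dual_form_if_gorenstein(2)[OF gor C(1) d] by simp
    ultimately show "self_associated I \<and> fails_by_one_on_quadrics I" ..
  next
    assume "self_associated I \<and> fails_by_one_on_quadrics I"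
    then show "gorenstein_ring (coord_ring I)"
      using gorenstein_if_self_associated[OF assms(4,5)] assms(2) by simp
  qed
qed

end
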